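(* Let $0<s<n/2$ and write $s=m+\gamma$ with $m\in\{0,1,2,\dots\}$ and $\gamma\in[0,1)$. Let $f:\mathbb{R}^n\times[0,+\infty)\to[0,+\infty)$ be continuous and let $v\in\mathcal L_s$ be a nonnegative strong solution of $(-\Delta)^sv=f(x,v)$ in $\mathbb{R}^n$. Assume that $f(\cdot,v(\cdot))\in L^p(\mathbb{R}^n)$ for some $1<p<\frac n{2s}$, and that either (a) $f(x,t)$ is nondecreasing in $t>0$ for each $x$ and $\inf_{x\in\mathbb{R}^n}f(x,t)>0$ for every $t>0$, or (b) $\lim_{|x|\to\infty}v(x)=0$. Then $v$ is a nonnegative solution of $$v(x)=c_{n,s}\int_{\mathbb{R}^n}\frac{f(y,v(y))}{|x-y|^{n-2s}}\,dy,\qquad x\in\mathbb{R}^n,$$ where $c_{n,s}=\frac{\Gamma(\frac n2-s)}{\pi^{n/2}2^{2s}\Gamma(s)}$.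
   Context: $(-\Delta)^\gamma$ ($0<\gamma<1$) is the fractional Laplacian with Fourier symbol $|\xi|^{2\gamma}$, which for sufficiently regular functions is given pointwise (up to a positive normalizing constant) by $\mathrm{P.V.}\int_{\mathbb{R}^n}\frac{v(x)-v(y)}{|x-y|^{n+2\gamma}}dy$; $(-\Delta)^0$ is the identity. $\mathcal L_s=\{v:\mathbb{R}^n\to\mathbb{R}:\int_{\mathbb{R}^n}\frac{|v(x)|}{1+|x|^{n+2\gamma}}dx<\infty\}$. A function $v\in\mathcal L_s$ is a strong solution of $(-\Delta)^sv=F$ if $v\in C^{2m+\lfloor2\gamma\rfloor,\,2\gamma-\lfloor2\gamma\rfloor+\varepsilon}_{loc}(\mathbb{R}^n)$ for some $\varepsilon>0$ and $(-\Delta)^sv=(-\Delta)^m(-\Delta)^\gamma v$ is pointwise well defined, continuous on $\mathbb{R}^n$, and equals $F$. *)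

theory Defs
  imports "HOL-Analysis.Analysis"
begin

type_synonym 'n fn = "real^'n \<Rightarrow> real"

definition partial :: "'n::finite \<Rightarrow> 'n fn \<Rightarrow> 'n fn" where
  "partial i u x = deriv (\<lambda>t. u (x + t *\<^sub>R axis i 1)) 0"

definition has_partial :: "'n::finite \<Rightarrow> 'n fn \<Rightarrow> real^'n \<Rightarrow> bool" where
  "has_partial i u x \<longleftrightarrow> (\<lambda>t. u (x + t *\<^sub>R axis i 1)) differentiable (at 0)"

fun pderivs :: "'n::finite list \<Rightarrow> 'n fn \<Rightarrow> 'n fn" where
  "pderivs [] u = u"
| "pderivs (i # is) u = partial i (pderivs is u)"

definition Ck :: "nat \<Rightarrow> 'n::finite fn \<Rightarrow> bool" where
  "Ck k u \<longleftrightarrow> (\<forall>is. length is < k \<longrightarrow> (\<forall>i x. has_partial i (pderivs is u) x))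
              \<and> (\<forall>is. length is \<le> k \<longrightarrow> continuous_on UNIV (pderivs is u))"

definition loc_holder :: "real \<Rightarrow> 'n::finite fn \<Rightarrow> bool" where
  "loc_holder \<alpha> g \<longleftrightarrow> (\<forall>K. compact K \<longrightarrow>
      (\<exists>C. \<forall>x\<in>K. \<forall>y\<in>K. \<bar>g x - g y\<bar> \<le> C * dist x y powr \<alpha>))"

definition Ck_alpha_loc :: "nat \<Rightarrow> real \<Rightarrow> 'n::finite fn \<Rightarrow> bool" where
  "Ck_alpha_loc k \<alpha> u \<longleftrightarrow> Ck k u \<and> (\<forall>is. length is = k \<longrightarrow> loc_holder \<alpha> (pderivs is u))"

definition neg_lap :: "'n::finite fn \<Rightarrow> 'n fn" where
  "neg_lap u x = - (\<Sum>i\<in>UNIV. partial i (partial i u) x)"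

definition lap_defined :: "'n::finite fn \<Rightarrow> bool" where
  "lap_defined u \<longleftrightarrow> (\<forall>i x. has_partial i u x \<and> has_partial i (partial i u) x)"

definition neg_lap_pow_defined :: "nat \<Rightarrow> 'n::finite fn \<Rightarrow> bool" where
  "neg_lap_pow_defined m u \<longleftrightarrow> (\<forall>k<m. lap_defined ((neg_lap ^^ k) u))"

definition neg_lap_pow :: "nat \<Rightarrow> 'n::finite fn \<Rightarrow> 'n fn" where
  "neg_lap_pow m u = (neg_lap ^^ m) u"

text \<open>Normalising constant C_{n,gamma} making the symbol equal to |xi|^{2 gamma}.\<close>
definition frac_const :: "nat \<Rightarrow> real \<Rightarrow> real" where
  "frac_const n \<gamma> = \<gamma> * 4 powr \<gamma> * Gamma (real n / 2 + \<gamma>) / (pi powr (real n / 2) * Gamma (1 - \<gamma>))"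

definition pv_trunc :: "real \<Rightarrow> 'n::finite fn \<Rightarrow> real^'n \<Rightarrow> real \<Rightarrow> real" where
  "pv_trunc \<gamma> w x \<epsilon> = (LINT y|lborel. indicator {y. \<epsilon> \<le> dist x y} y *
        ((w x - w y) / dist x y powr (real CARD('n) + 2 * \<gamma>)))"

definition frac_lap_defined_at :: "real \<Rightarrow> 'n::finite fn \<Rightarrow> real^'n \<Rightarrow> bool" where
  "frac_lap_defined_at \<gamma> w x \<longleftrightarrow> \<gamma> = 0 \<or>
     ((\<forall>\<epsilon>>0. integrable lborel (\<lambda>y. indicator {y. \<epsilon> \<le> dist x y} y *
        ((w x - w y) / dist x y powr (real CARD('n) + 2 * \<gamma>))))
      \<and> (\<exists>L. (pv_trunc \<gamma> w x \<longlongrightarrow> L) (at_right 0)))"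

definition frac_lap :: "real \<Rightarrow> 'n::finite fn \<Rightarrow> 'n fn" where
  "frac_lap \<gamma> w x = (if \<gamma> = 0 then w x
     else frac_const CARD('n) \<gamma> * Lim (at_right 0) (pv_trunc \<gamma> w x))"

definition L_s :: "real \<Rightarrow> 'n::finite fn set" where
  "L_s \<gamma> = {v. v \<in> borel_measurable lborel \<and>
      integrable lborel (\<lambda>x. \<bar>v x\<bar> / (1 + norm x powr (real CARD('n) + 2 * \<gamma>)))}"

definition strong_solution :: "real \<Rightarrow> 'n::finite fn \<Rightarrow> 'n fn \<Rightarrow> bool" where
  "strong_solution s v F \<longleftrightarrow>
     (let m = nat \<lfloor>s\<rfloor>; \<gamma> = s - of_int \<lfloor>s\<rfloor> in
       v \<in> L_s \<gamma> \<and>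
       (\<exists>\<epsilon>>0. Ck_alpha_loc (2 * m + nat \<lfloor>2 * \<gamma>\<rfloor>) (2 * \<gamma> - of_int \<lfloor>2 * \<gamma>\<rfloor> + \<epsilon>) v) \<and>
       (\<forall>x. frac_lap_defined_at \<gamma> v x) \<and>
       neg_lap_pow_defined m (frac_lap \<gamma> v) \<and>
       continuous_on UNIV (neg_lap_pow m (frac_lap \<gamma> v)) \<and>
       (\<forall>x. neg_lap_pow m (frac_lap \<gamma> v) x = F x))"

definition riesz_const :: "nat \<Rightarrow> real \<Rightarrow> real" where
  "riesz_const n s = Gamma (real n / 2 - s) / (pi powr (real n / 2) * 2 powr (2 * s) * Gamma s)"

end

theory Submission imports Defs "HOL-Probability.Distributions"
begin

text \<open>
  Let \<open>P(t)\<close> be the heat extension of \<open>v\<close> and \<open>F = f(\<cdot>, v)\<close>. Testing the equation against heat kernels,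
  with cut-offs to justify moving the operators onto the kernel, turns \<open>(-\<Delta>)\<^sup>s\<close> into a fractional
  derivative in time: the heat extension of \<open>F\<close> is, up to one time derivative, a Weyl fractional
  derivative of order \<open>s\<close> of \<open>P\<close> at every point. Since \<open>F \<in> L\<^sup>p\<close> with \<open>p < n / 2s\<close>, its heat extension
  decays faster than \<open>t\<^sup>-\<^sup>s\<close>, so the Weyl integral of order \<open>s\<close> converges and inverts this relation.
  Letting \<open>t \<rightarrow> 0\<close> and integrating the heat kernel in time, \<open>v\<close> is the Riesz potential of \<open>F\<close> plus
  the limit \<open>c(x) \<ge> 0\<close> of \<open>P(t)\<close> as \<open>t \<rightarrow> \<infinity>\<close>.

  If \<open>v\<close> vanishes at infinity then clearly \<open>c = 0\<close>. Otherwise the Harnack inequality for the heat kernel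
  shows that a positive value of \<open>c\<close> bounds \<open>c\<close>, hence \<open>v\<close>, below by a positive constant, and then
  monotonicity bounds \<open>F\<close> below by a positive constant, contradicting \<open>F \<in> L\<^sup>p\<close>.
\<close>

section \<open>Lebesgue integrals\<close>

text \<open>Two obstacles shape the argument. Membership in a weighted L^1 class bounds neither
  \<open>v\<close> nor its derivatives pointwise at infinity, so the operators cannot be moved from
  \<open>v\<close> to the heat kernel directly. Therefore \<open>v\<close> is first averaged against
  a compactly supported \<rho>: the averages and their second differences grow at most like (1 +
  |x|)^b (\<open>tconv_growth\<close>), which justifies the exchanges of integrals, and bumps of all
  radii finally remove the average (\<open>bump_test_zero\<close>). The other obstacle is
  convergence in time. With b = n + 2 \<gamma>, the k-th time derivative of the heat extension is
  only known to decay like t^(\<gamma> - k) (\<open>hconv_decay\<close>). For m = 0 the Weyl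
  integral with weight r^(-\<gamma>) of the derivative of order m + 1 is then borderline at
  infinity; order m + 2 is safe, which is why one more time derivative is carried along. It is
  undone by integrating in time, and the constant of integration is the limit c(x). The values of c
  at any two points are compared only up to the factor 2^(n/2), which already gives a uniform lower
  bound.\<close>

lemma nn_integral_translate:
  fixes a :: "'a::euclidean_space"
  assumes [measurable]: "f \<in> borel_measurable borel"
  shows "(\<integral>\<^sup>+x. f (a + x) \<partial>lborel) = (\<integral>\<^sup>+x. f x \<partial>lborel)"
  by (subst lborel_distr_plus[symmetric, of a], subst nn_integral_distr) auto

lemma lborel_distr_reflect:
  fixes a :: "'a::euclidean_space"
  shows "distr lborel borel (\<lambda>x. a - x) = lborel"
  by (subst lborel_affine[of "-1" a]) (auto simp: density_1)

lemma nn_integral_reflect: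
  fixes a :: "'a::euclidean_space"
  assumes [measurable]: "f \<in> borel_measurable borel"
  shows "(\<integral>\<^sup>+x. f (a - x) \<partial>lborel) = (\<integral>\<^sup>+x. f x \<partial>lborel)"
  by (subst lborel_distr_reflect[symmetric, of a], subst nn_integral_distr) auto

lemma integrable_translate:
  fixes a :: "'a::euclidean_space" and f :: "'a \<Rightarrow> real"
  shows "integrable lborel (\<lambda>x. f (a + x)) \<longleftrightarrow> integrable lborel f"
proof -
  have *: "integrable lborel (\<lambda>x. g (c + x))" if "integrable lborel g" for g :: "'a \<Rightarrow> real" and c
    using that by (subst (asm) lborel_distr_plus[symmetric, of c], subst (asm) integrable_distr_eq)
      (auto dest: borel_measurable_integrable)
  show ?thesis using *[of f a] *[of "\<lambda>x. f (a + x)" "-a"] by auto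
qed

lemma integrable_reflect:
  fixes a :: "'a::euclidean_space" and f :: "'a \<Rightarrow> real"
  shows "integrable lborel (\<lambda>x. f (a - x)) \<longleftrightarrow> integrable lborel f"
proof -
  have *: "integrable lborel (\<lambda>x. g (c - x))" if "integrable lborel g" for g :: "'a \<Rightarrow> real" and c
    using that by (subst (asm) lborel_distr_reflect[symmetric, of c], subst (asm) integrable_distr_eq)
      (auto dest: borel_measurable_integrable)
  show ?thesis using *[of f a] *[of "\<lambda>x. f (a - x)" "a"] by auto
qed

text \<open>No integrability is assumed: if \<open>f\<close> is not integrable then neither is its
  translate, and both integrals have the default value 0.\<close>

lemma integral_translate:
  fixes a :: "'a::euclidean_space" and f :: "'a \<Rightarrow> real"
  shows "(LINT x|lborel. f (a + x)) = (LINT x|lborel. f x)"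
proof (cases "integrable lborel f")
  case True
  then show ?thesis
    by (subst (2) lborel_distr_plus[symmetric, of a], subst integral_distr)
       (auto dest: borel_measurable_integrable)
next
  case False
  then show ?thesis
    using integrable_translate[of f a] by (simp add: not_integrable_integral_eq)
qed

lemma integral_reflect:
  fixes a :: "'a::euclidean_space" and f :: "'a \<Rightarrow> real"
  shows "(LINT x|lborel. f (a - x)) = (LINT x|lborel. f x)"
proof (cases "integrable lborel f")
  case True
  then show ?thesis
    by (subst (2) lborel_distr_reflect[symmetric, of a], subst integral_distr)
       (auto dest: borel_measurable_integrable)
next
  case False
  then show ?thesis
    using integrable_reflect[of f a] by (simp add: not_integrable_integral_eq)
qed

lemma integrable_bound_real:
  fixes f g :: "'a \<Rightarrow> real"
  assumes "integrable M g" "f \<in> borel_measurable M" "\<And>x. \<bar>f x\<bar> \<le> g x"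
  shows "integrable M f"
  by (rule Bochner_Integration.integrable_bound[OF assms(1,2)])
     (auto intro: order_trans[OF assms(3) abs_ge_self])

lemma nn_integral_le_imp_integrable:
  fixes f :: "'a \<Rightarrow> real"
  assumes "f \<in> borel_measurable M" "(\<integral>\<^sup>+x. ennreal \<bar>f x\<bar> \<partial>M) \<le> ennreal B"
  shows "integrable M f"
  using assms by (intro integrableI_bounded) (auto simp: order_le_less_trans[OF _ ennreal_less_top])

lemma nn_integral_le_imp_abs_integral_le:
  fixes f :: "'a \<Rightarrow> real"
  assumes "f \<in> borel_measurable M" "(\<integral>\<^sup>+x. ennreal \<bar>f x\<bar> \<partial>M) \<le> ennreal B" "0 \<le> B"
  shows "\<bar>LINT x|M. f x\<bar> \<le> B"
proof -
  have i: "integrable M f" using assms nn_integral_le_imp_integrable by blast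
  have "ennreal \<bar>LINT x|M. f x\<bar> \<le> (\<integral>\<^sup>+x. ennreal \<bar>f x\<bar> \<partial>M)"
    using integral_norm_bound_ennreal[OF i] by simp
  with assms(2,3) show ?thesis by (metis ennreal_le_iff order_trans)
qed

section \<open>Exchange of integrals and integrals depending on a parameter\<close>

lemma fubini_swap:
  fixes f :: "'a::euclidean_space \<Rightarrow> 'b::euclidean_space \<Rightarrow> real"
  assumes m[measurable]: "(\<lambda>(x, y). f x y) \<in> borel_measurable (borel \<Otimes>\<^sub>M borel)"
    and fin: "(\<integral>\<^sup>+x. \<integral>\<^sup>+y. ennreal \<bar>f x y\<bar> \<partial>lborel \<partial>lborel) < \<infinity>"
  shows "(LINT x|lborel. LINT y|lborel. f x y) = (LINT y|lborel. LINT x|lborel. f x y)"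
    and "integrable lborel (\<lambda>x. LINT y|lborel. f x y)"
    and "integrable lborel (\<lambda>y. LINT x|lborel. f x y)"
proof -
  have m'[measurable]: "(\<lambda>(x, y). f x y) \<in> borel_measurable (lborel \<Otimes>\<^sub>M lborel)"
    by (simp add: m lborel_prod borel_prod[symmetric])
  have i: "integrable (lborel \<Otimes>\<^sub>M lborel) (\<lambda>(x, y). f x y)"
  proof (rule integrableI_bounded)
    have "(\<integral>\<^sup>+ p. ennreal (norm (case p of (x, y) \<Rightarrow> f x y)) \<partial>(lborel \<Otimes>\<^sub>M lborel)) =
          (\<integral>\<^sup>+x. \<integral>\<^sup>+y. ennreal \<bar>f x y\<bar> \<partial>lborel \<partial>lborel)"
      by (subst lborel.nn_integral_fst[symmetric]) auto
    with fin show "(\<integral>\<^sup>+ p. ennreal (norm (case p of (x, y) \<Rightarrow> f x y)) \<partial>(lborel \<Otimes>\<^sub>M lborel)) < \<infinity>"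
      by simp
  qed measurable
  show "(LINT x|lborel. LINT y|lborel. f x y) = (LINT y|lborel. LINT x|lborel. f x y)"
    using lborel_pair.Fubini_integral[OF i] by simp
  show "integrable lborel (\<lambda>x. LINT y|lborel. f x y)"
    using lborel_pair.integrable_fst[OF i] by simp
  show "integrable lborel (\<lambda>y. LINT x|lborel. f x y)"
    using lborel_pair.integrable_snd[OF i] by simp
qed

text \<open>The form in which Fubini is mostly applied below: the inner integral of the absolute
  value is estimated in \<open>ennreal\<close>, where it makes sense before anything is known to be
  integrable, and only the bound \<open>B\<close> has to be integrable.\<close>

lemma fubini_swap_bound:
  fixes f :: "'a::euclidean_space \<Rightarrow> 'b::euclidean_space \<Rightarrow> real"
  assumes m[measurable]: "(\<lambda>(x, y). f x y) \<in> borel_measurable (borel \<Otimes>\<^sub>M borel)"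
    and le: "\<And>x. (\<integral>\<^sup>+y. ennreal \<bar>f x y\<bar> \<partial>lborel) \<le> ennreal (B x)"
    and B: "integrable lborel B" "\<And>x. 0 \<le> B x"
  shows "(LINT x|lborel. LINT y|lborel. f x y) = (LINT y|lborel. LINT x|lborel. f x y)"
    and "integrable lborel (\<lambda>x. LINT y|lborel. f x y)"
    and "integrable lborel (\<lambda>y. LINT x|lborel. f x y)"
proof -
  have "(\<integral>\<^sup>+x. \<integral>\<^sup>+y. ennreal \<bar>f x y\<bar> \<partial>lborel \<partial>lborel) \<le> (\<integral>\<^sup>+x. ennreal (B x) \<partial>lborel)"
    by (intro nn_integral_mono le)
  also have "\<dots> < \<infinity>" using B by (simp add: nn_integral_eq_integral)
  finally have fin: "(\<integral>\<^sup>+x. \<integral>\<^sup>+y. ennreal \<bar>f x y\<bar> \<partial>lborel \<partial>lborel) < \<infinity>" .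
  note * = fubini_swap[OF m fin]
  show "(LINT x|lborel. LINT y|lborel. f x y) = (LINT y|lborel. LINT x|lborel. f x y)" by (rule *)
  show "integrable lborel (\<lambda>x. LINT y|lborel. f x y)" by (rule *)
  show "integrable lborel (\<lambda>y. LINT x|lborel. f x y)" by (rule *)
qed

lemma fubini_swap_product_bound:
  fixes f :: "'a::euclidean_space \<Rightarrow> 'b::euclidean_space \<Rightarrow> real"
  assumes m[measurable]: "(\<lambda>(x, y). f x y) \<in> borel_measurable (borel \<Otimes>\<^sub>M borel)"
    and le: "\<And>x y. \<bar>f x y\<bar> \<le> A x * B y"
    and A: "integrable lborel A" "\<And>x. 0 \<le> A x" and B: "integrable lborel B" "\<And>x. 0 \<le> B x"
  shows "(LINT x|lborel. LINT y|lborel. f x y) = (LINT y|lborel. LINT x|lborel. f x y)"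
    and "integrable lborel (\<lambda>x. LINT y|lborel. f x y)"
    and "integrable lborel (\<lambda>y. LINT x|lborel. f x y)"
proof -
  have [measurable]: "B \<in> borel_measurable borel" using B(1) by auto
  have "(\<integral>\<^sup>+y. ennreal \<bar>f x y\<bar> \<partial>lborel) \<le> ennreal (A x * (LINT y|lborel. B y))" for x
  proof -
    have "(\<integral>\<^sup>+y. ennreal \<bar>f x y\<bar> \<partial>lborel) \<le> (\<integral>\<^sup>+y. ennreal (A x * B y) \<partial>lborel)"
      by (intro nn_integral_mono ennreal_leI le)
    also have "\<dots> = ennreal (A x * (LINT y|lborel. B y))"
      using A B by (subst nn_integral_eq_integral) auto
    finally show ?thesis .
  qed
  moreover have "integrable lborel (\<lambda>x. A x * (LINT y|lborel. B y))" using A by simp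
  moreover have "0 \<le> A x * (LINT y|lborel. B y)" for x
    using A B by (intro mult_nonneg_nonneg integral_nonneg_AE) auto
  ultimately have *: "(LINT x|lborel. LINT y|lborel. f x y) = (LINT y|lborel. LINT x|lborel. f x y)"
     "integrable lborel (\<lambda>x. LINT y|lborel. f x y)"
     "integrable lborel (\<lambda>y. LINT x|lborel. f x y)"
    by (rule fubini_swap_bound[OF m])+
  show "(LINT x|lborel. LINT y|lborel. f x y) = (LINT y|lborel. LINT x|lborel. f x y)"
    "integrable lborel (\<lambda>x. LINT y|lborel. f x y)"
    "integrable lborel (\<lambda>y. LINT x|lborel. f x y)"
    by (rule *)+
qed

text \<open>By the mean value inequality the bound \<open>w\<close> on the derivative also bounds
  the difference quotients, so dominated convergence applies along every sequence tending to 0. The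
  derivative \<open>f' t0\<close> is measurable as a limit of measurable quotients.\<close>

lemma integral_has_real_derivative:
  fixes f f' :: "real \<Rightarrow> 'a \<Rightarrow> real"
  assumes d: "0 < d"
    and int: "\<And>t. t \<in> ball t0 d \<Longrightarrow> integrable M (f t)"
    and der: "\<And>t y. t \<in> ball t0 d \<Longrightarrow> ((\<lambda>t. f t y) has_real_derivative f' t y) (at t)"
    and bound: "\<And>t y. t \<in> ball t0 d \<Longrightarrow> \<bar>f' t y\<bar> \<le> w y"
    and w: "integrable M w"
  shows "((\<lambda>t. LINT y|M. f t y) has_real_derivative (LINT y|M. f' t0 y)) (at t0)"
proof -
  have quot: "\<bar>(f (t0 + h) y - f t0 y) / h\<bar> \<le> w y" if "\<bar>h\<bar> < d" "h \<noteq> 0" for h y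
  proof -
    have "norm (f (t0 + h) y - f t0 y) \<le> w y * norm (t0 + h - t0)"
      by (rule field_differentiable_bound[of "ball t0 d" _ "\<lambda>t. f' t y"])
         (use der bound d that in \<open>auto intro: DERIV_subset has_field_derivative_at_within simp: dist_real_def\<close>)
    then show ?thesis using that by (simp add: abs_divide divide_le_eq)
  qed
  have "((\<lambda>h. LINT y|M. (f (t0 + h) y - f t0 y) / h) \<longlongrightarrow> (LINT y|M. f' t0 y)) (at 0)"
    unfolding tendsto_at_iff_sequentially comp_def
  proof (intro allI impI)
    fix X :: "nat \<Rightarrow> real" assume X: "\<forall>i. X i \<in> UNIV - {0}" "X \<longlonglongrightarrow> 0"
    have "eventually (\<lambda>i. \<bar>X i\<bar> < d) sequentially"
      using tendstoD[OF X(2) d] by (simp add: dist_real_def)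
    \<comment> \<open>The sequence is shifted by \<open>K\<close> because integrability and the
      bound are available only inside the ball of radius \<open>d\<close>.\<close>
    then obtain K where K: "\<And>i. i \<ge> K \<Longrightarrow> \<bar>X i\<bar> < d" by (auto simp: eventually_sequentially)
    have lim: "(\<lambda>i. (f (t0 + X i) y - f t0 y) / X i) \<longlonglongrightarrow> f' t0 y" for y
    proof -
      have "((\<lambda>h. (f (t0 + h) y - f t0 y) / h) \<longlongrightarrow> f' t0 y) (at 0)"
        using der[of t0 y] d by (simp add: DERIV_def)
      then show ?thesis unfolding tendsto_at_iff_sequentially comp_def using X by blast
    qed
    have meas: "(\<lambda>y. (f (t0 + X (i + K)) y - f t0 y) / X (i + K)) \<in> borel_measurable M" for i
      using int[of "t0 + X (i+K)"] int[of t0] K[of "i + K"] d by (auto simp: dist_real_def)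
    have "(\<lambda>i. LINT y|M. (f (t0 + X (i+K)) y - f t0 y) / X (i+K)) \<longlonglongrightarrow> (LINT y|M. f' t0 y)"
    proof (rule integral_dominated_convergence[where w=w])
      show "f' t0 \<in> borel_measurable M"
        by (rule borel_measurable_LIMSEQ_real[OF _ meas]) (rule LIMSEQ_ignore_initial_segment[OF lim])
      show "AE y in M. (\<lambda>i. (f (t0 + X (i+K)) y - f t0 y) / X (i+K)) \<longlonglongrightarrow> f' t0 y"
        using lim LIMSEQ_ignore_initial_segment by blast
      show "AE y in M. norm ((f (t0 + X (i+K)) y - f t0 y) / X (i+K)) \<le> w y" for i
        using quot[of "X (i+K)"] K[of "i+K"] X by (intro AE_I2) auto
    qed (use w meas in auto)
    then show "(\<lambda>i. LINT y|M. (f (t0 + X i) y - f t0 y) / X i) \<longlonglongrightarrow> (LINT y|M. f' t0 y)"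
      by (rule LIMSEQ_offset)
  qed
  moreover have "eventually (\<lambda>h. (LINT y|M. (f (t0 + h) y - f t0 y) / h) =
     ((LINT y|M. f (t0 + h) y) - (LINT y|M. f t0 y)) / h) (at 0)"
    unfolding eventually_at
    using d int by (intro exI[of _ d]) (auto simp: dist_real_def diff_divide_distrib)
  ultimately show ?thesis unfolding DERIV_def by (rule Lim_transform_eventually)
qed

lemma integral_isCont:
  fixes f :: "'b::metric_space \<Rightarrow> 'a \<Rightarrow> real"
  assumes d: "0 < d"
    and meas: "\<And>x. x \<in> ball x0 d \<Longrightarrow> f x \<in> borel_measurable M"
    and cont: "\<And>y. isCont (\<lambda>x. f x y) x0"
    and bound: "\<And>x y. x \<in> ball x0 d \<Longrightarrow> \<bar>f x y\<bar> \<le> w y"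
    and w: "integrable M w"
  shows "isCont (\<lambda>x. LINT y|M. f x y) x0"
  unfolding continuous_at_sequentially comp_def
proof (intro allI impI)
  fix X assume X: "X \<longlonglongrightarrow> x0"
  have "eventually (\<lambda>i. dist (X i) x0 < d) sequentially"
    using tendstoD[OF X d] by simp
  then obtain K where K: "\<And>i. i \<ge> K \<Longrightarrow> X i \<in> ball x0 d"
    by (auto simp: eventually_sequentially dist_commute)
  have "(\<lambda>i. LINT y|M. f (X (i+K)) y) \<longlonglongrightarrow> (LINT y|M. f x0 y)"
  proof (rule integral_dominated_convergence[where w=w])
    have "(\<lambda>i. f (X i) y) \<longlonglongrightarrow> f x0 y" for y
      using cont[of y] X unfolding continuous_at_sequentially comp_def by blast
    then show "AE y in M. (\<lambda>i. f (X (i+K)) y) \<longlonglongrightarrow> f x0 y"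
      using LIMSEQ_ignore_initial_segment by blast
    show "AE y in M. norm (f (X (i+K)) y) \<le> w y" for i
      using bound[OF K[of "i+K"]] by (intro AE_I2) auto
  qed (use w meas K d in auto)
  then show "(\<lambda>i. LINT y|M. f (X i) y) \<longlonglongrightarrow> (LINT y|M. f x0 y)"
    by (rule LIMSEQ_offset)
qed

section \<open>Power and Gaussian integrals\<close>

lemma nn_integral_powr_exp:
  assumes a: "0 < a" and c: "(0::real) < c"
  shows "(\<integral>\<^sup>+t. ennreal (indicator {0<..} t * (t powr (a - 1) * exp (- (c * t)))) \<partial>lborel)
         = ennreal (Gamma a * c powr (- a))"
proof -
  have AE0: "AE t in lborel. t \<noteq> (0::real)" by (rule AE_lborel_singleton)
  have "ennreal (Gamma a) = (\<integral>\<^sup>+t. ennreal (indicator {0<..} t * (t powr (a - 1) * exp (- t))) \<partial>lborel)"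
    unfolding Gamma_conv_nn_integral_real[OF a]
    by (intro nn_integral_cong_AE, use AE0 in eventually_elim)
       (auto simp: indicator_def exp_minus field_simps)
  also have "\<dots> = ennreal c * (\<integral>\<^sup>+t. ennreal (indicator {0<..} (0 + c * t) * ((0 + c * t) powr (a - 1) * exp (- (0 + c * t)))) \<partial>lborel)"
    by (subst nn_integral_real_affine[of _ c 0]) (use c in auto)
  also have "\<dots> = ennreal c * (\<integral>\<^sup>+t. ennreal (c powr (a - 1)) * ennreal (indicator {0<..} t * (t powr (a - 1) * exp (- (c * t)))) \<partial>lborel)"
    by (intro arg_cong2[where f=times] refl nn_integral_cong)
       (use c in \<open>auto simp: indicator_def powr_mult ennreal_mult' [symmetric] zero_less_mult_iff mult_ac\<close>)
  also have "\<dots> = ennreal c * (ennreal (c powr (a - 1)) * (\<integral>\<^sup>+t. ennreal (indicator {0<..} t * (t powr (a - 1) * exp (- (c * t)))) \<partial>lborel))"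
    by (subst nn_integral_cmult) auto
  also have "\<dots> = ennreal (c powr a) * (\<integral>\<^sup>+t. ennreal (indicator {0<..} t * (t powr (a - 1) * exp (- (c * t)))) \<partial>lborel)"
    using c by (simp add: mult.assoc[symmetric] ennreal_mult'[symmetric] powr_diff)
  finally have eq: "ennreal (Gamma a) = ennreal (c powr a) * (\<integral>\<^sup>+t. ennreal (indicator {0<..} t * (t powr (a - 1) * exp (- (c * t)))) \<partial>lborel)"
    (is "_ = _ * ?I") .
  have "ennreal (Gamma a * c powr (- a)) = ennreal (c powr (-a)) * ennreal (Gamma a)"
    using a by (subst ennreal_mult'[symmetric]) (auto simp: mult.commute)
  also have "\<dots> = ennreal (c powr (-a) * c powr a) * ?I"
    unfolding eq by (simp add: mult.assoc[symmetric] ennreal_mult')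
  also have "c powr (-a) * c powr a = 1" using c by (simp add: powr_minus)
  finally show ?thesis by simp
qed

lemma integral_powr_exp:
  assumes a: "0 < a" and c: "(0::real) < c"
  shows "integrable lborel (\<lambda>t. indicator {0<..} t * (t powr (a - 1) * exp (- (c * t))))"
    and "(LINT t|lborel. indicator {0<..} t * (t powr (a - 1) * exp (- (c * t)))) = Gamma a * c powr (- a)"
proof -
  have "0 \<le> Gamma a * c powr (- a)" using a by simp
  then show "integrable lborel (\<lambda>t. indicator {0<..} t * (t powr (a - 1) * exp (- (c * t))))"
    "(LINT t|lborel. indicator {0<..} t * (t powr (a - 1) * exp (- (c * t)))) = Gamma a * c powr (- a)"
    using nn_integral_eq_integrable[THEN iffD1, OF _ _ _ nn_integral_powr_exp[OF assms]]
    by auto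
qed

text \<open>The substitution of 1/t for t leads back to the Gamma integral. With
  \<open>c / t\<close> in the exponent the integrand is that of a Gaussian heat kernel at a fixed
  point, as a function of time.\<close>

lemma integral_powr_exp_inverse:
  assumes a: "0 < a" and c: "(0::real) < c"
  shows "integrable lborel (\<lambda>t. indicator {0<..} t * (t powr (- 1 - a) * exp (- (c / t))))"
    and "(LINT t|lborel. indicator {0<..} t * (t powr (- 1 - a) * exp (- (c / t)))) = Gamma a * c powr (- a)"
proof -
  let ?f = "\<lambda>t::real. t powr (a - 1) * exp (- (c * t))"
  let ?g = "\<lambda>t::real. inverse t" and ?g' = "\<lambda>t::real. - (inverse t ^ 2)"
  have im: "?g ` {0<..} = {0<..}"
    by (auto simp: image_iff) (metis inverse_inverse_eq positive_imp_inverse_positive greaterThan_iff)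
  have der: "(?g has_real_derivative ?g' t) (at t within {0<..})" if "t \<in> {0<..}" for t
    using that by (auto intro!: derivative_eq_intros simp: power2_eq_square)
  have f: "set_integrable lborel {0<..} ?f" "(LBINT t:{0<..}. ?f t) = Gamma a * c powr (- a)"
    using integral_powr_exp[OF assms] by (simp_all add: set_integrable_def set_lebesgue_integral_def)
  have "?f absolutely_integrable_on {0<..}" "integral {0<..} ?f = Gamma a * c powr (- a)"
    using f set_borel_integral_eq_integral[OF f(1)] absolutely_integrable_on_def
    by (auto simp: set_integrable_def integrable_completion)
  then have "(\<lambda>t. \<bar>?g' t\<bar> *\<^sub>R ?f (?g t)) absolutely_integrable_on {0<..} \<and>
    integral {0<..} (\<lambda>t. \<bar>?g' t\<bar> *\<^sub>R ?f (?g t)) = Gamma a * c powr (- a)"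
    using has_absolute_integral_change_of_variables_real[of "{0<..}" ?g ?g' ?f "Gamma a * c powr (- a)", OF _ der]
    by (simp add: im inj_on_def)
  moreover have eq: "\<bar>?g' t\<bar> *\<^sub>R ?f (?g t) = t powr (- 1 - a) * exp (- (c / t))" if "t \<in> {0<..}" for t
  proof -
    have "inverse t ^ 2 * inverse t powr (a - 1) = t powr (-1 - a)" using that
      by (simp add: powr_minus[symmetric] inverse_eq_divide powr_divide power2_eq_square powr_diff powr_add powr_minus field_simps)
    then show ?thesis by (simp add: divide_inverse mult.assoc[symmetric])
  qed
  moreover have "(\<lambda>t. \<bar>?g' t\<bar> *\<^sub>R ?f (?g t)) absolutely_integrable_on {0<..} \<longleftrightarrow> (\<lambda>t. t powr (- 1 - a) * exp (- (c / t))) absolutely_integrable_on {0<..}"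
    by (rule set_integrable_cong) (use eq in auto)
  moreover have "integral {0<..} (\<lambda>t. \<bar>?g' t\<bar> *\<^sub>R ?f (?g t)) = integral {0<..} (\<lambda>t. t powr (- 1 - a) * exp (- (c / t)))"
    by (rule Henstock_Kurzweil_Integration.integral_cong) (use eq in auto)
  ultimately have *: "(\<lambda>t. t powr (- 1 - a) * exp (- (c / t))) absolutely_integrable_on {0<..}"
    "integral {0<..} (\<lambda>t. t powr (- 1 - a) * exp (- (c / t))) = Gamma a * c powr (- a)"
    by metis+
  have "set_integrable lborel {0<..} (\<lambda>t. t powr (- 1 - a) * exp (- (c / t)))"
    using *(1) unfolding set_integrable_def by (subst (asm) integrable_completion) auto
  then show "integrable lborel (\<lambda>t. indicator {0<..} t * (t powr (- 1 - a) * exp (- (c / t))))"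
    "(LINT t|lborel. indicator {0<..} t * (t powr (- 1 - a) * exp (- (c / t)))) = Gamma a * c powr (- a)"
    using *(2) set_borel_integral_eq_integral[of "{0<..}" "\<lambda>t. t powr (- 1 - a) * exp (- (c / t))"]
    by (simp_all add: set_integrable_def set_lebesgue_integral_def)
qed

lemma nn_integral_gaussian_real:
  assumes c: "(0::real) < c"
  shows "(\<integral>\<^sup>+x. ennreal (exp (- (c * x\<^sup>2))) \<partial>lborel) = ennreal (sqrt (pi / c))"
proof -
  define s where "s = sqrt (1 / (2 * c))"
  have s: "0 < s" "s\<^sup>2 = 1 / (2 * c)" using c by (auto simp: s_def)
  have "normal_density 0 s x = exp (- (c * x\<^sup>2)) / sqrt (pi / c)" for x
    using c by (simp add: normal_density_def s(2) mult.commute)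
  then have "(\<lambda>x. exp (- (c * x\<^sup>2))) = (\<lambda>x. sqrt (pi / c) * normal_density 0 s x)"
    using c by (auto simp: fun_eq_iff)
  then have "(\<integral>\<^sup>+x. ennreal (exp (- (c * x\<^sup>2))) \<partial>lborel) = (\<integral>\<^sup>+x. ennreal (sqrt (pi / c)) * ennreal (normal_density 0 s x) \<partial>lborel)"
    by (metis (no_types, lifting) c divide_nonneg_pos ennreal_mult' less_eq_real_def pi_ge_zero real_sqrt_ge_zero)
  also have "\<dots> = ennreal (sqrt (pi / c)) * (\<integral>\<^sup>+x. ennreal (normal_density 0 s x) \<partial>lborel)"
    by (subst nn_integral_cmult) auto
  also have "(\<integral>\<^sup>+x. ennreal (normal_density 0 s x) \<partial>lborel) = 1"
    using s by (subst nn_integral_eq_integral) (auto intro: integrable_normal_density simp: integral_normal_density)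
  finally show ?thesis by simp
qed

lemma nn_integral_gaussian:
  assumes c: "(0::real) < c"
  shows "(\<integral>\<^sup>+x. ennreal (exp (- (c * (norm (x::real^'n))\<^sup>2))) \<partial>lborel) = ennreal ((pi / c) powr (real CARD('n) / 2))"
proof -
  have "exp (- (c * (norm x)\<^sup>2)) = (\<Prod>b\<in>Basis. exp (- (c * (x \<bullet> b)\<^sup>2)))" for x :: "real^'n"
    by (subst power2_norm_eq_inner, subst euclidean_inner)
       (simp add: exp_sum[symmetric] sum_negf sum_distrib_left power2_eq_square)
  then have "(\<integral>\<^sup>+x. ennreal (exp (- (c * (norm (x::real^'n))\<^sup>2))) \<partial>lborel) = (\<integral>\<^sup>+(x::real^'n). (\<Prod>b\<in>Basis. ennreal (exp (- (c * (x \<bullet> b)\<^sup>2)))) \<partial>lborel)"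
    by (simp add: prod_ennreal)
  also have "\<dots> = (\<Prod>b\<in>(Basis::(real^'n) set). (\<integral>\<^sup>+x. ennreal (exp (- (c * x\<^sup>2))) \<partial>lborel))"
    by (rule nn_integral_lborel_prod) auto
  also have "\<dots> = ennreal (sqrt (pi / c)) ^ CARD('n)"
    by (simp add: nn_integral_gaussian_real[OF c])
  also have "\<dots> = ennreal (sqrt (pi / c) ^ CARD('n))"
    using c by (simp add: ennreal_power)
  also have "sqrt (pi / c) ^ CARD('n) = (pi / c) powr (real CARD('n) / 2)"
    using c by (simp add: powr_half_sqrt[symmetric] powr_realpow[symmetric] powr_powr)
  finally show ?thesis .
qed

text \<open>The Gamma integral writes (1 + |z|^2)^(-b/2) as a superposition of Gaussians. After
  Tonelli the integral over \<open>z\<close> is explicit, and a Gamma integral with parameter (b -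
  n)/2 > 0 is left.\<close>

lemma integrable_weight:
  assumes b: "real CARD('n) < b"
  shows "integrable lborel (\<lambda>z::real^'n. (1 + norm z) powr (- b))"
proof (rule integrableI_bounded)
  have b0: "b > 0" using b by (smt (verit) of_nat_0_le_iff)
  have pt: "(1 + norm z) powr (- b) \<le> (1 + (norm z)\<^sup>2) powr (- (b / 2))" for z :: "real^'n"
  proof -
    have "(1 + norm z) powr (-b) = ((1 + norm z)\<^sup>2) powr (- (b/2))"
      by (simp add: powr_def ln_realpow add_pos_nonneg)
    also have "\<dots> \<le> (1 + (norm z)\<^sup>2) powr (- (b / 2))"
      using b0 by (intro powr_mono2') (auto simp: power2_sum add_pos_nonneg)
    finally show ?thesis .
  qed
  let ?h = "\<lambda>(z::real^'n) t::real. indicator {0<..} t * (t powr (b/2 - 1) * exp (- ((1 + (norm z)\<^sup>2) * t)))"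
  have "(\<integral>\<^sup>+(z::real^'n). ennreal (Gamma (b/2) * (1 + (norm z)\<^sup>2) powr (- (b / 2))) \<partial>lborel)
      = (\<integral>\<^sup>+(z::real^'n). \<integral>\<^sup>+t. ennreal (?h z t) \<partial>lborel \<partial>lborel)"
    using b0 by (intro nn_integral_cong nn_integral_powr_exp[symmetric]) (auto simp: add_pos_nonneg)
  also have "\<dots> = (\<integral>\<^sup>+t. \<integral>\<^sup>+(z::real^'n). ennreal (?h z t) \<partial>lborel \<partial>lborel)"
    by (rule lborel_pair.Fubini') measurable
  also have "\<dots> = (\<integral>\<^sup>+t. ennreal (pi powr (real CARD('n) / 2)) * ennreal (indicator {0<..} t * (t powr ((b - real CARD('n)) / 2 - 1) * exp (- (1 * t)))) \<partial>lborel)"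
  proof (intro nn_integral_cong)
    fix t :: real
    show "(\<integral>\<^sup>+(z::real^'n). ennreal (?h z t) \<partial>lborel) = ennreal (pi powr (real CARD('n) / 2)) * ennreal (indicator {0<..} t * (t powr ((b - real CARD('n)) / 2 - 1) * exp (- (1 * t))))"
    proof (cases "t > 0")
      case True
      have "(\<integral>\<^sup>+(z::real^'n). ennreal (?h z t) \<partial>lborel) = (\<integral>\<^sup>+(z::real^'n). ennreal (t powr (b/2 - 1) * exp (- t)) * ennreal (exp (- (t * (norm z)\<^sup>2))) \<partial>lborel)"
        using True by (intro nn_integral_cong) (auto simp: ennreal_mult'[symmetric] algebra_simps exp_add[symmetric] mult_exp_exp)
      also have "\<dots> = ennreal (t powr (b/2 - 1) * exp (- t)) * ennreal ((pi / t) powr (real CARD('n) / 2))"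
        using nn_integral_gaussian[OF True, where 'n='n] by (subst nn_integral_cmult) auto
      also have "\<dots> = ennreal (pi powr (real CARD('n) / 2) * (t powr ((b / 2 - 1) + (- (real CARD('n) / 2))) * exp (- t)))"
        using True by (subst powr_add) (simp add: ennreal_mult'[symmetric] powr_divide powr_minus_divide)
      also have "(b / 2 - 1) + (- (real CARD('n) / 2)) = (b - real CARD('n)) / 2 - 1"
        by (simp add: field_simps)
      finally show ?thesis using True by (simp add: ennreal_mult')
    qed simp
  qed
  also have "\<dots> = ennreal (pi powr (real CARD('n) / 2)) * ennreal (Gamma ((b - real CARD('n)) / 2) * 1 powr (- ((b - real CARD('n)) / 2)))"
    using b by (subst nn_integral_cmult, simp) (subst nn_integral_powr_exp, auto)
  also have "\<dots> < \<infinity>" by (simp add: ennreal_mult_less_top)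
  finally have fin: "(\<integral>\<^sup>+(z::real^'n). ennreal (Gamma (b/2) * (1 + (norm z)\<^sup>2) powr (- (b / 2))) \<partial>lborel) < \<infinity>" .
  have "(\<integral>\<^sup>+(z::real^'n). ennreal (norm ((1 + norm z) powr (- b))) \<partial>lborel) \<le>
    (\<integral>\<^sup>+(z::real^'n). ennreal (1 / Gamma (b/2)) * ennreal (Gamma (b/2) * (1 + (norm z)\<^sup>2) powr (- (b / 2))) \<partial>lborel)"
  proof (intro nn_integral_mono)
    fix z :: "real^'n"
    have "ennreal (1 / Gamma (b/2)) * ennreal (Gamma (b/2) * (1 + (norm z)\<^sup>2) powr (- (b / 2))) = ennreal ((1 + (norm z)\<^sup>2) powr (- (b / 2)))"
      using b0 Gamma_real_pos[of "b/2"] by (subst ennreal_mult'[symmetric]) (auto simp del: Gamma_real_pos)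
    then show "ennreal (norm ((1 + norm z) powr (- b))) \<le> ennreal (1 / Gamma (b/2)) * ennreal (Gamma (b/2) * (1 + (norm z)\<^sup>2) powr (- (b / 2)))"
      using pt[of z] by (simp add: ennreal_leI)
  qed
  also have "\<dots> = ennreal (1 / Gamma (b/2)) * (\<integral>\<^sup>+(z::real^'n). ennreal (Gamma (b/2) * (1 + (norm z)\<^sup>2) powr (- (b / 2))) \<partial>lborel)"
    by (subst nn_integral_cmult) auto
  also have "\<dots> < \<infinity>" using fin by (simp add: ennreal_mult_less_top)
  finally show "(\<integral>\<^sup>+(z::real^'n). ennreal (norm ((1 + norm z) powr (- b))) \<partial>lborel) < \<infinity>" .
qed simp

text \<open>Again a superposition of Gaussians: on the unit ball, the time integral of t^(-1-q/2)
  exp(-|z|^2/t) exp(-t) dominates a multiple of |z|^(-q), already through the times between |z|^2/2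
  and |z|^2. Its integral over all \<open>z\<close> is a Gamma integral with parameter (n - q)/2 >
  0; the factor exp(-t) makes that converge for large t.\<close>

lemma integrable_powr_cball:
  assumes q: "q < real CARD('n)"
  shows "integrable lborel (\<lambda>z::real^'n. indicator (cball 0 1) z * norm z powr (- q))"
proof (rule integrableI_bounded)
  let ?h = "\<lambda>(z::real^'n) t::real. indicator {0<..} t * (t powr (- 1 - q/2) * exp (- ((norm z)\<^sup>2 / t)) * exp (- t))"
  \<comment> \<open>For r/2 \<le> t \<le> r \<le> 1 the two exponentials are at least exp(-2) and
    exp(-1). The factor 1/2 is the length of [r/2, r] divided by r. The minimum covers both signs of
    1 + q/2, since the power of t is smallest at t = r or at t = r/2 accordingly.\<close>
  define c where "c = exp (-3) / 2 * min 1 (2 powr (1 + q/2))"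
  have c: "c > 0" by (simp add: c_def)
  have low: "ennreal (c * norm z powr (- q)) \<le> (\<integral>\<^sup>+t. ennreal (?h z t) \<partial>lborel)" if z: "norm z \<le> 1" "z \<noteq> 0" for z :: "real^'n"
  proof -
    define r where "r = (norm z)\<^sup>2"
    have r: "0 < r" "r \<le> 1" using z by (auto simp: r_def power_le_one)
    have pt: "ennreal (2 * c * r powr (- 1 - q/2)) * indicator {r/2..r} t \<le> ennreal (?h z t)" for t
    proof (cases "t \<in> {r/2..r}")
      case True
      have t: "0 < t" "t \<le> 1" "r / t \<le> 2" using True r by (auto simp: field_simps)
      have "min 1 (2 powr (1 + q/2)) * r powr (- 1 - q/2) \<le> t powr (- 1 - q/2)"
      proof (cases "1 + q/2 \<ge> 0")
        case True
        have "r powr (-1 - q/2) \<le> t powr (-1 - q/2)"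
          using True \<open>t \<in> {r/2..r}\<close> t by (intro powr_mono2') auto
        moreover have "min 1 (2 powr (1 + q/2)) * r powr (- 1 - q/2) \<le> 1 * r powr (- 1 - q/2)"
          by (intro mult_right_mono) auto
        ultimately show ?thesis by simp
      next
        case False
        have "(r/2) powr (-1 - q/2) \<le> t powr (-1 - q/2)"
          using False \<open>t \<in> {r/2..r}\<close> r by (intro powr_mono2) auto
        moreover have "(r/2) powr (-1 - q/2) = 2 powr (1 + q/2) * r powr (-1 - q/2)"
        proof -
          have "2 powr (1 + q/2) * 2 powr (-1 - q/2) = (1::real)"
            by (simp add: powr_add[symmetric])
          then show ?thesis using r by (simp add: powr_divide field_simps)
        qed
        moreover have "min 1 (2 powr (1 + q/2)) * r powr (- 1 - q/2) \<le> 2 powr (1 + q/2) * r powr (- 1 - q/2)"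
          by (intro mult_right_mono) auto
        ultimately show ?thesis by linarith
      qed
      moreover have "exp (-3) \<le> exp (- (r / t)) * exp (- t)"
        using t by (simp add: mult_exp_exp)
      ultimately have "exp (-3) * (min 1 (2 powr (1 + q/2)) * r powr (- 1 - q/2)) \<le> (exp (- (r / t)) * exp (- t)) * t powr (-1 - q/2)"
        by (intro mult_mono) auto
      then have "2 * c * r powr (- 1 - q/2) \<le> ?h z t"
        using t by (simp add: c_def r_def mult_ac)
      then show ?thesis using True by (simp only: indicator_simps mult_1_right ennreal_leI)
    qed simp
    have "c * norm z powr (-q) = (2 * c * r powr (- 1 - q/2)) * (r/2)"
    proof -
      have "r powr (-1 - q/2) * r = r powr (- (q/2))"
        using r powr_add[of r "-1 - q/2" 1] by simp
      also have "\<dots> = norm z powr (-q)"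
        using z by (simp add: r_def powr_def ln_realpow)
      finally show ?thesis by simp
    qed
    then have "ennreal (c * norm z powr (- q)) = ennreal (2 * c * r powr (- 1 - q/2)) * emeasure lborel {r/2..r}"
      using r c by (simp add: ennreal_mult'[symmetric])
    also have "\<dots> = (\<integral>\<^sup>+t. ennreal (2 * c * r powr (- 1 - q/2)) * indicator {r/2..r} t \<partial>lborel)"
      by (subst nn_integral_cmult_indicator) auto
    also have "\<dots> \<le> (\<integral>\<^sup>+t. ennreal (?h z t) \<partial>lborel)"
      by (intro nn_integral_mono pt)
    finally show ?thesis .
  qed
  have "(\<integral>\<^sup>+(z::real^'n). \<integral>\<^sup>+t. ennreal (?h z t) \<partial>lborel \<partial>lborel) = (\<integral>\<^sup>+t. \<integral>\<^sup>+(z::real^'n). ennreal (?h z t) \<partial>lborel \<partial>lborel)"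
    by (rule lborel_pair.Fubini') measurable
  also have "\<dots> = (\<integral>\<^sup>+t. ennreal (pi powr (real CARD('n) / 2)) * ennreal (indicator {0<..} t * (t powr ((real CARD('n) - q) / 2 - 1) * exp (- (1 * t)))) \<partial>lborel)"
  proof (intro nn_integral_cong)
    fix t :: real
    show "(\<integral>\<^sup>+(z::real^'n). ennreal (?h z t) \<partial>lborel) = ennreal (pi powr (real CARD('n) / 2)) * ennreal (indicator {0<..} t * (t powr ((real CARD('n) - q) / 2 - 1) * exp (- (1 * t))))"
    proof (cases "t > 0")
      case True
      have "(\<integral>\<^sup>+(z::real^'n). ennreal (?h z t) \<partial>lborel) = (\<integral>\<^sup>+(z::real^'n). ennreal (t powr (-1 - q/2) * exp (- t)) * ennreal (exp (- (1 / t * (norm z)\<^sup>2))) \<partial>lborel)"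
        using True by (intro nn_integral_cong) (auto simp: ennreal_mult'[symmetric] mult_ac)
      also have "\<dots> = ennreal (t powr (-1 - q/2) * exp (- t)) * ennreal ((pi / (1/t)) powr (real CARD('n) / 2))"
        using nn_integral_gaussian[of "1/t", where 'n='n] True by (subst nn_integral_cmult) auto
      also have "\<dots> = ennreal (pi powr (real CARD('n) / 2) * (t powr (real CARD('n) / 2 + (-1 - q/2)) * exp (- t)))"
        using True by (subst powr_add) (auto simp: ennreal_mult'[symmetric] powr_mult mult_ac)
      also have "real CARD('n) / 2 + (-1 - q/2) = (real CARD('n) - q) / 2 - 1"
        by (simp add: field_simps)
      finally show ?thesis using True by (simp add: ennreal_mult')
    qed simp
  qed
  also have "\<dots> = ennreal (pi powr (real CARD('n) / 2)) * ennreal (Gamma ((real CARD('n) - q) / 2) * 1 powr (- ((real CARD('n) - q) / 2)))"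
    using q by (subst nn_integral_cmult, simp) (subst nn_integral_powr_exp, auto)
  also have "\<dots> < \<infinity>" by (simp add: ennreal_mult_less_top)
  finally have fin: "(\<integral>\<^sup>+(z::real^'n). \<integral>\<^sup>+t. ennreal (?h z t) \<partial>lborel \<partial>lborel) < \<infinity>" .
  have "(\<integral>\<^sup>+(z::real^'n). ennreal (norm (indicator (cball 0 1) z * norm z powr (- q))) \<partial>lborel) \<le>
    (\<integral>\<^sup>+(z::real^'n). ennreal (1/c) * (\<integral>\<^sup>+t. ennreal (?h z t) \<partial>lborel) \<partial>lborel)"
  proof (intro nn_integral_mono)
    fix z :: "real^'n"
    show "ennreal (norm (indicator (cball 0 1) z * norm z powr (- q))) \<le> ennreal (1/c) * (\<integral>\<^sup>+t. ennreal (?h z t) \<partial>lborel)"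
    proof (cases "norm z \<le> 1 \<and> z \<noteq> 0")
      case True
      have "ennreal (norm (indicator (cball 0 1) z * norm z powr (- q))) = ennreal (1/c) * ennreal (c * norm z powr (- q))"
        using c True by (simp add: ennreal_mult'[symmetric] mult.assoc[symmetric])
      also have "\<dots> \<le> ennreal (1/c) * (\<integral>\<^sup>+t. ennreal (?h z t) \<partial>lborel)"
        using low[of z] True by (intro mult_left_mono) auto
      finally show ?thesis .
    qed auto
  qed
  also have "\<dots> = ennreal (1/c) * (\<integral>\<^sup>+(z::real^'n). \<integral>\<^sup>+t. ennreal (?h z t) \<partial>lborel \<partial>lborel)"
    by (subst nn_integral_cmult) auto
  also have "\<dots> < \<infinity>" using fin by (simp add: ennreal_mult_less_top)
  finally show "(\<integral>\<^sup>+(z::real^'n). ennreal (norm (indicator (cball 0 1) z * norm z powr (- q))) \<partial>lborel) < \<infinity>" .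
qed (intro borel_measurable_times borel_measurable_indicator; simp add: borel_closed)

text \<open>Writing (t + x)^(-c) as a Gamma integral of exp(-(t + x) s) and exchanging makes both
  integrals Gamma integrals; \<open>a < c\<close> is the positivity of the parameter c - a of the
  last one. Essentially all time integrals below are dominated by this one.\<close>

lemma integrable_powr_halfline:
  assumes a: "0 < a" "a < c" and t: "(0::real) < t"
  shows "integrable lborel (\<lambda>x. indicator {0<..} x * (x powr (a - 1) * (t + x) powr (- c)))"
proof (rule integrableI_bounded)
  let ?h = "\<lambda>x s::real. indicator {0<..} x * indicator {0<..} s * (x powr (a - 1) * s powr (c - 1) * exp (- ((t + x) * s)))"
  have "(\<integral>\<^sup>+x. ennreal (Gamma c) * ennreal (indicator {0<..} x * (x powr (a - 1) * (t + x) powr (- c))) \<partial>lborel)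
     = (\<integral>\<^sup>+x. \<integral>\<^sup>+s. ennreal (?h x s) \<partial>lborel \<partial>lborel)"
  proof (intro nn_integral_cong)
    fix x :: real
    show "ennreal (Gamma c) * ennreal (indicator {0<..} x * (x powr (a - 1) * (t + x) powr (- c))) = (\<integral>\<^sup>+s. ennreal (?h x s) \<partial>lborel)"
    proof (cases "x > 0")
      case True
      have "(\<integral>\<^sup>+s. ennreal (?h x s) \<partial>lborel) = (\<integral>\<^sup>+s. ennreal (x powr (a - 1)) * ennreal (indicator {0<..} s * (s powr (c - 1) * exp (- ((t + x) * s)))) \<partial>lborel)"
        using True by (intro nn_integral_cong) (auto simp: ennreal_mult'[symmetric] mult_ac)
      also have "\<dots> = ennreal (x powr (a - 1)) * ennreal (Gamma c * (t + x) powr (- c))"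
        using True a t by (subst nn_integral_cmult, simp) (subst nn_integral_powr_exp, auto)
      finally show ?thesis using True a by (simp add: ennreal_mult'[symmetric] mult_ac)
    qed simp
  qed
  also have "\<dots> = (\<integral>\<^sup>+s. \<integral>\<^sup>+x. ennreal (?h x s) \<partial>lborel \<partial>lborel)"
    by (rule lborel_pair.Fubini') measurable
  also have "\<dots> = (\<integral>\<^sup>+s. ennreal (Gamma a) * ennreal (indicator {0<..} s * (s powr ((c - a) - 1) * exp (- (t * s)))) \<partial>lborel)"
  proof (intro nn_integral_cong)
    fix s :: real
    show "(\<integral>\<^sup>+x. ennreal (?h x s) \<partial>lborel) = ennreal (Gamma a) * ennreal (indicator {0<..} s * (s powr ((c - a) - 1) * exp (- (t * s))))"
    proof (cases "s > 0")
      case True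
      have "(\<integral>\<^sup>+x. ennreal (?h x s) \<partial>lborel) = (\<integral>\<^sup>+x. ennreal (s powr (c - 1) * exp (- (t * s))) * ennreal (indicator {0<..} x * (x powr (a - 1) * exp (- (s * x)))) \<partial>lborel)"
        using True by (intro nn_integral_cong) (auto simp: ennreal_mult'[symmetric] algebra_simps mult_exp_exp exp_add[symmetric])
      also have "\<dots> = ennreal (s powr (c - 1) * exp (- (t * s))) * ennreal (Gamma a * s powr (- a))"
        using True a by (subst nn_integral_cmult, simp) (subst nn_integral_powr_exp, auto)
      also have "\<dots> = ennreal (Gamma a * (s powr ((c - 1) + (- a)) * exp (- (t * s))))"
        using a by (subst powr_add) (simp add: ennreal_mult'[symmetric] mult_ac)
      finally show ?thesis using True a by (simp add: ennreal_mult'[symmetric] algebra_simps)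
    qed simp
  qed
  also have "\<dots> = ennreal (Gamma a) * ennreal (Gamma (c - a) * t powr (- (c - a)))"
    using a t by (subst nn_integral_cmult, simp) (subst nn_integral_powr_exp, auto)
  also have "\<dots> < \<infinity>" by (simp add: ennreal_mult_less_top)
  finally have fin: "ennreal (Gamma c) * (\<integral>\<^sup>+x. ennreal (indicator {0<..} x * (x powr (a - 1) * (t + x) powr (- c))) \<partial>lborel) < \<infinity>"
    by (subst (asm) nn_integral_cmult) auto
  then have "(\<integral>\<^sup>+x. ennreal (indicator {0<..} x * (x powr (a - 1) * (t + x) powr (- c))) \<partial>lborel) < \<infinity>"
    using a Gamma_real_pos[of c] by (auto simp: ennreal_mult_less_top simp del: Gamma_real_pos)
  then show "(\<integral>\<^sup>+x. ennreal (norm (indicator {0<..} x * (x powr (a - 1) * (t + x) powr (- c)))) \<partial>lborel) < \<infinity>"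
    by simp
qed simp

section \<open>The heat kernel\<close>

definition heat :: "real \<Rightarrow> real^'n \<Rightarrow> real" where
  "heat t z = (4 * pi * t) powr (- (real CARD('n) / 2)) * exp (- ((norm z)\<^sup>2 / (4 * t)))"

text \<open>The recursion is that of rescaled Laguerre polynomials, chosen so that
  \<open>hk k t = (- d/dt)\<^sup>k (heat t)\<close>.\<close>

fun lag :: "real \<Rightarrow> nat \<Rightarrow> real poly" where
  "lag \<nu> 0 = 1"
| "lag \<nu> (Suc k) = smult (real k + \<nu>) (lag \<nu> k) + pCons 0 (pderiv (lag \<nu> k) - lag \<nu> k)"

definition hk :: "nat \<Rightarrow> real \<Rightarrow> real^'n \<Rightarrow> real" where
  "hk k t z = poly (lag (real CARD('n) / 2) k) ((norm z)\<^sup>2 / (4 * t)) * inverse (t ^ k) * heat t z"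

lemma hk_0: "hk 0 = heat"
  by (simp add: hk_def fun_eq_iff)

lemma heat_nonneg [simp]: "0 \<le> heat t z"
  by (simp add: heat_def)

lemma hk_minus [simp]: "hk k t (- z) = hk k t z"
  by (simp add: hk_def heat_def)

lemma hk_minus_commute: "hk k t (x - y) = hk k t (y - x)"
  using hk_minus[of k t "x - y"] by simp

lemma heat_minus [simp]: "heat t (- z) = heat t z"
  by (simp add: heat_def)

lemma borel_measurable_heat [measurable]:
  assumes [measurable]: "f \<in> borel_measurable M" "g \<in> borel_measurable M"
  shows "(\<lambda>x. heat (f x) (g x :: real^'n)) \<in> borel_measurable M"
  unfolding heat_def by measurable

lemma borel_measurable_hk [measurable]:
  assumes [measurable]: "f \<in> borel_measurable M" "g \<in> borel_measurable M"
  shows "(\<lambda>x. hk k (f x) (g x :: real^'n)) \<in> borel_measurable M"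
proof -
  have [measurable]: "poly p \<in> borel_measurable borel" for p :: "real poly"
    by (intro borel_measurable_continuous_onI continuous_intros)
  show ?thesis unfolding hk_def by measurable
qed

lemma isCont_heat: "isCont (heat t) z"
  unfolding heat_def divide_inverse by (intro continuous_intros)

lemma isCont_hk: "isCont (hk k t) z"
proof -
  have "isCont (\<lambda>z::real^'b. (norm z)\<^sup>2 / (4 * t)) z" for z
    unfolding divide_inverse by (intro continuous_intros)
  then have "isCont (\<lambda>z::real^'b. poly p ((norm z)\<^sup>2 / (4 * t))) z" for z and p :: "real poly"
    by (rule isCont_o2) (intro continuous_intros)
  then show ?thesis unfolding hk_def by (intro continuous_mult isCont_heat continuous_const)
qed

lemma heat_has_derivative:
  assumes t: "0 < t"
  shows "((\<lambda>t. heat t (z::real^'n)) has_real_derivative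
    ((norm z)\<^sup>2 / (4 * t) - real CARD('n) / 2) / t * heat t z) (at t)"
proof -
  have d: "((\<lambda>t. (4 * pi * t) powr c) has_real_derivative c / t * (4 * pi * t) powr c) (at t)" for c
  proof -
    have "((\<lambda>t. (4 * pi * t) powr c) has_real_derivative c * (4 * pi * t) powr (c - 1) * (4 * pi)) (at t)"
      using t by (auto intro!: derivative_eq_intros)
    moreover have "c * (4 * pi * t) powr (c - 1) * (4 * pi) = c / t * (4 * pi * t) powr c"
      using t by (simp add: powr_diff)
    ultimately show ?thesis by simp
  qed
  have "((\<lambda>t. (4 * pi * t) powr (- (real CARD('n) / 2))) has_real_derivative
     - (real CARD('n) / 2) / t * (4 * pi * t) powr (- (real CARD('n) / 2))) (at t)"
    by (rule d)
  moreover have "((\<lambda>t. exp (- ((norm z)\<^sup>2 / (4 * t)))) has_real_derivative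
     (norm z)\<^sup>2 / (4 * t) / t * exp (- ((norm z)\<^sup>2 / (4 * t)))) (at t)"
    using t by (auto intro!: derivative_eq_intros simp: field_simps power2_eq_square)
  ultimately have "((\<lambda>t. (4 * pi * t) powr (- (real CARD('n) / 2)) * exp (- ((norm z)\<^sup>2 / (4 * t)))) has_real_derivative
     - (real CARD('n) / 2) / t * (4 * pi * t) powr (- (real CARD('n) / 2)) * exp (- ((norm z)\<^sup>2 / (4 * t)))
     + (norm z)\<^sup>2 / (4 * t) / t * exp (- ((norm z)\<^sup>2 / (4 * t))) * (4 * pi * t) powr (- (real CARD('n) / 2))) (at t)"
    by (rule DERIV_mult)
  then show ?thesis unfolding heat_def
    by (rule DERIV_cong) (use t in \<open>simp add: field_simps\<close>)
qed

lemma hk_has_derivative: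
  assumes t: "0 < t"
  shows "((\<lambda>t. hk k t (z::real^'n)) has_real_derivative - hk (Suc k) t z) (at t)"
proof -
  let ?\<nu> = "real CARD('n) / 2"
  define L where "L = lag ?\<nu> k"
  define r where "r = (norm z)\<^sup>2 / (4 * t)"
  have d1: "((\<lambda>t. poly L ((norm z)\<^sup>2 / (4 * t))) has_real_derivative - (poly (pderiv L) r * r / t)) (at t)"
    unfolding r_def using t
    by (auto intro!: derivative_eq_intros DERIV_chain'[OF _ poly_DERIV] simp: field_simps power2_eq_square)
  have d2: "((\<lambda>t. inverse (t ^ k)) has_real_derivative - (real k / t * inverse (t ^ k))) (at t)"
    using t by (auto intro!: derivative_eq_intros) (cases k; auto simp: field_simps)
  have "((\<lambda>t. poly L ((norm z)\<^sup>2 / (4 * t)) * inverse (t ^ k) * heat t z) has_real_derivative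
     (poly L r * inverse (t^k)) * ((r - ?\<nu>) / t * heat t z) +
     (poly L r * - (real k / t * inverse (t ^ k)) + - (poly (pderiv L) r * r / t) * inverse (t ^ k)) * heat t z) (at t)"
    using DERIV_mult'[OF DERIV_mult'[OF d1 d2] heat_has_derivative[OF t, of z]]
    by (simp add: r_def)
  moreover have "(\<lambda>t. hk k t z) = (\<lambda>t. poly L ((norm z)\<^sup>2 / (4 * t)) * inverse (t ^ k) * heat t z)"
    by (simp add: hk_def L_def fun_eq_iff)
  moreover have "- hk (Suc k) t z = (poly L r * inverse (t^k)) * ((r - ?\<nu>) / t * heat t z) +
     (poly L r * - (real k / t * inverse (t ^ k)) + - (poly (pderiv L) r * r / t) * inverse (t ^ k)) * heat t z"
  proof -
    \<comment> \<open>Once the analytic factors are named, the claim is a polynomial identity,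
      namely the recursion of \<open>lag\<close>.\<close>
    define i where "i = inverse t"
    define q where "q = inverse (t ^ k)"
    define \<nu> where "\<nu> = ?\<nu>"
    define A where "A = poly L r"
    define A' where "A' = poly (pderiv L) r"
    define h where "h = heat t z"
    have "hk (Suc k) t z = ((real k + \<nu>) * A + r * (A' - A)) * (i * q) * h"
      by (simp add: hk_def L_def[symmetric] r_def[symmetric] A_def A'_def i_def q_def h_def \<nu>_def)
    moreover have "\<And>x. x / t = x * i" by (simp add: i_def divide_inverse)
    ultimately show ?thesis
      unfolding A_def[symmetric] A'_def[symmetric] q_def[symmetric] h_def[symmetric] \<nu>_def[symmetric]
      by (simp only:) (simp add: algebra_simps)
  qed
  ultimately show ?thesis by simp
qed

section \<open>Size of the heat kernel and of its time derivatives\<close>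

lemma poly_exp_bound:
  fixes p :: "real poly"
  shows "0 < c \<Longrightarrow> \<exists>C>0. \<forall>r\<ge>0. \<bar>poly p r\<bar> \<le> C * exp (c * r)"
proof (induction p arbitrary: c)
  case 0
  show ?case by (auto intro!: exI[of _ 1])
next
  case (pCons a p)
  \<comment> \<open>The induction hypothesis is used with half the rate: one half of the exponential
    absorbs the new factor \<open>r\<close>, the other bounds the rest of the polynomial.\<close>
  from pCons.IH[of "c/2"] pCons.prems obtain C where C: "C > 0" "\<And>r. r \<ge> 0 \<Longrightarrow> \<bar>poly p r\<bar> \<le> C * exp (c/2 * r)" by auto
  have "\<bar>poly (pCons a p) r\<bar> \<le> (\<bar>a\<bar> + 2 / c * C) * exp (c * r)" if r: "r \<ge> 0" for r
  proof -
    have "r \<le> 2 / c * exp (c/2 * r)"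
      using exp_ge_add_one_self[of "c/2 * r"] pCons.prems r by (simp add: field_simps)
    then have "r * \<bar>poly p r\<bar> \<le> (2 / c * exp (c/2 * r)) * (C * exp (c/2 * r))"
      using C r pCons.prems by (intro mult_mono) auto
    also have "\<dots> = 2 / c * C * exp (c * r)" by (simp add: mult_exp_exp)
    finally have 1: "r * \<bar>poly p r\<bar> \<le> 2 / c * C * exp (c * r)" .
    have 2: "\<bar>a\<bar> \<le> \<bar>a\<bar> * exp (c * r)" using pCons.prems r mult_left_mono[of 1 "exp (c * r)" "\<bar>a\<bar>"] by simp
    have "\<bar>poly (pCons a p) r\<bar> \<le> \<bar>a\<bar> + r * \<bar>poly p r\<bar>"
      using r abs_triangle_ineq[of a "r * poly p r"] by (simp add: abs_mult)
    also have "\<dots> \<le> (\<bar>a\<bar> + 2 / c * C) * exp (c * r)" using 1 2 by (simp add: distrib_right)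
    finally show ?thesis .
  qed
  moreover have "\<bar>a\<bar> + 2 / c * C > 0" using C pCons.prems by (intro add_nonneg_pos) auto
  ultimately show ?case by blast
qed

lemma powr_scale: "0 < l \<Longrightarrow> 0 < x \<Longrightarrow> l powr c * (l * x) powr (- c) = (x::real) powr (- c)"
  by (simp add: powr_mult powr_minus field_simps)

text \<open>Doubling the time halves the Gaussian exponent r = |z|^2/(4t); the surplus factor
  exp(-r/2) absorbs the polynomial in r.\<close>

lemma hk_bound:
  "\<exists>C>0. \<forall>t>0. \<forall>z::real^'n. \<bar>hk k t z\<bar> \<le> C * inverse (t ^ k) * heat (2 * t) z"
proof -
  obtain C where C: "C > 0" "\<And>r. r \<ge> 0 \<Longrightarrow> \<bar>poly (lag (real CARD('n) / 2) k) r\<bar> \<le> C * exp (1/2 * r)"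
    using poly_exp_bound[of "1/2" "lag (real CARD('n) / 2) k"] by auto
  have "\<bar>hk k t z\<bar> \<le> (C * 2 powr (real CARD('n) / 2)) * inverse (t ^ k) * heat (2 * t) z" if t: "t > 0" for t and z :: "real^'n"
  proof -
    define r where "r = (norm z)\<^sup>2 / (4 * t)"
    have r: "r \<ge> 0" using t by (simp add: r_def)
    have "heat t z = exp (-(1/2 * r)) * (2 powr (real CARD('n) / 2) * heat (2 * t) z)"
    proof -
      have "2 powr (real CARD('n) / 2) * (4 * pi * (2 * t)) powr (- (real CARD('n) / 2)) = (4 * pi * t) powr (- (real CARD('n) / 2))"
        using powr_scale[of 2 "4 * pi * t" "real CARD('n) / 2"] t by (simp add: mult_ac)
      moreover have "exp (- r) = exp (-(1/2 * r)) * exp (- ((norm z)\<^sup>2 / (4 * (2 * t))))"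
        using t by (simp add: r_def mult_exp_exp field_simps)
      ultimately show ?thesis by (simp add: heat_def r_def mult.assoc[symmetric])
    qed
    then have "\<bar>hk k t z\<bar> = \<bar>poly (lag (real CARD('n) / 2) k) r\<bar> * exp (-(1/2 * r)) * (inverse (t ^ k) * 2 powr (real CARD('n) / 2) * heat (2 * t) z)"
      using t by (simp add: hk_def abs_mult r_def[symmetric])
    also have "\<dots> \<le> (C * exp (1/2 * r)) * exp (-(1/2 * r)) * (inverse (t ^ k) * 2 powr (real CARD('n) / 2) * heat (2 * t) z)"
      using C r t by (intro mult_right_mono) auto
    also have "\<dots> = (C * (exp (1/2 * r) * exp (-(1/2 * r)))) * (inverse (t ^ k) * 2 powr (real CARD('n) / 2) * heat (2 * t) z)"
      by (simp only: mult.assoc)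
    also have "exp (1/2 * r) * exp (-(1/2 * r)) = 1" by (simp add: mult_exp_exp)
    finally show ?thesis by (simp add: mult_ac)
  qed
  then show ?thesis using C by (intro exI[of _ "C * 2 powr (real CARD('n) / 2)"]) auto
qed

lemma powr_le_exp:
  assumes "0 \<le> a"
  shows "\<exists>C>0. \<forall>r\<ge>0. r powr a \<le> C * exp (r::real)"
proof (cases "a = 0")
  case True
  have "r powr a \<le> 1 * exp r" if "r \<ge> 0" for r :: real
    using that True by (cases "r = 0") (auto)
  then show ?thesis by (intro exI[of _ 1]) auto
next
  case False
  then have a: "a > 0" using assms by simp
  have "r powr a \<le> a powr a * exp r" if "r \<ge> 0" for r
  proof -
    have "r / a \<le> exp (r / a)" using exp_ge_add_one_self[of "r/a"] by linarith
    then have "(r / a) powr a \<le> exp (r / a) powr a" using a that by (intro powr_mono2) auto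
    also have "\<dots> = exp r" using a by (simp add: powr_def)
    finally show ?thesis using a that by (simp add: powr_divide field_simps)
  qed
  then show ?thesis using a by (intro exI[of _ "a powr a"]) auto
qed

lemma one_plus_powr_le:
  assumes "0 \<le> B" "0 \<le> (r::real)"
  shows "(1 + r) powr B \<le> 2 powr B * (1 + r powr B)"
proof (cases "r \<le> 1")
  case True
  have "(1 + r) powr B \<le> 2 powr B" using True assms by (intro powr_mono2) auto
  also have "\<dots> \<le> 2 powr B * (1 + r powr B)" by (simp add: mult_left_mono)
  finally show ?thesis .
next
  case False
  have "(1 + r) powr B \<le> (2 * r) powr B" using False assms by (intro powr_mono2) auto
  also have "\<dots> = 2 powr B * r powr B" using False by (simp add: powr_mult)
  also have "\<dots> \<le> 2 powr B * (1 + r powr B)" by (simp add: mult_left_mono)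
  finally show ?thesis .
qed

text \<open>The Gaussian absorbs |z|^B at the price of t^(B/2). The two powers of \<open>t\<close>
  come from the two terms of (1 + |z|)^B \<le> 2^B (1 + |z|^B); the first governs small times and
  the second large ones.\<close>

lemma heat_weight_bound:
  assumes B: "0 \<le> B"
  shows "\<exists>C>0. \<forall>t>0. \<forall>z::real^'n. heat t z \<le>
     C * (t powr (- (real CARD('n) / 2)) + t powr ((B - real CARD('n)) / 2)) * (1 + norm z) powr (- B)"
proof -
  obtain C where C: "C > 0" "\<And>r. r \<ge> 0 \<Longrightarrow> r powr (B/2) \<le> C * exp r"
    using powr_le_exp[of "B/2"] B by auto
  let ?n = "real CARD('n)"
  define D where "D = 2 powr B * (1 + 4 powr (B/2) * C) * (4 * pi) powr (- (?n / 2))"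
  have "heat t z \<le> D * (t powr (- (?n / 2)) + t powr ((B - ?n) / 2)) * (1 + norm z) powr (- B)" if t: "t > 0" for t and z :: "real^'n"
  proof -
    define r where "r = (norm z)\<^sup>2 / (4 * t)"
    have r: "r \<ge> 0" using t by (simp add: r_def)
    have nz: "norm z powr B * exp (-r) \<le> (4 * t) powr (B/2) * C"
    proof -
      have "norm z powr B = (4 * t) powr (B/2) * r powr (B/2)"
      proof (cases "z = 0")
        case False
        have "(4 * t) powr (B/2) * r powr (B/2) = ((norm z)\<^sup>2) powr (B/2)"
          using t r False by (subst powr_mult[symmetric]) (auto simp: r_def)
        also have "\<dots> = norm z powr B" using False by (simp add: powr_def ln_realpow)
        finally show ?thesis by simp
      qed (simp add: r_def)
      then have "norm z powr B * exp (-r) = (4 * t) powr (B/2) * (r powr (B/2) * exp (-r))" by simp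
      also have "\<dots> \<le> (4 * t) powr (B/2) * (C * exp r * exp (-r))"
        using C(2)[OF r] by (intro mult_left_mono mult_right_mono) auto
      also have "\<dots> = (4 * t) powr (B/2) * C" by (simp add: mult.assoc mult_exp_exp)
      finally show ?thesis .
    qed
    have e1: "exp (- r) \<le> 1" using r by simp
    have "exp (-r) * (1 + norm z) powr B \<le> exp (-r) * (2 powr B * (1 + norm z powr B))"
      using one_plus_powr_le[OF B, of "norm z"] by (intro mult_left_mono) auto
    also have "\<dots> = 2 powr B * (exp (-r) + norm z powr B * exp (-r))" by (simp add: algebra_simps)
    also have "\<dots> \<le> 2 powr B * (1 + (4 * t) powr (B/2) * C)"
      using nz e1 by (intro mult_left_mono add_mono) auto
    also have "\<dots> \<le> 2 powr B * ((1 + 4 powr (B/2) * C) * (1 + t powr (B/2)))"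
      using t C by (intro mult_left_mono) (auto simp: powr_mult algebra_simps)
    finally have *: "exp (-r) * (1 + norm z) powr B \<le> 2 powr B * (1 + 4 powr (B/2) * C) * (1 + t powr (B/2))" by simp
    have "heat t z * (1 + norm z) powr B = (4 * pi * t) powr (- (?n / 2)) * (exp (-r) * (1 + norm z) powr B)"
      by (simp add: heat_def r_def)
    also have "\<dots> \<le> (4 * pi * t) powr (- (?n / 2)) * (2 powr B * (1 + 4 powr (B/2) * C) * (1 + t powr (B/2)))"
      using * by (intro mult_left_mono) auto
    also have "(4 * pi * t) powr (- (?n / 2)) = (4 * pi) powr (- (?n / 2)) * t powr (- (?n/2))"
      using t by (simp add: powr_mult)
    also have "(4 * pi) powr (- (?n / 2)) * t powr (- (?n/2)) * (2 powr B * (1 + 4 powr (B/2) * C) * (1 + t powr (B/2))) =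
       D * (t powr (- (?n / 2)) + t powr (- (?n / 2)) * t powr (B/2))"
      by (simp add: D_def algebra_simps)
    also have "t powr (- (?n / 2)) * t powr (B/2) = t powr ((B - ?n) / 2)"
      using t by (simp add: powr_add[symmetric] field_simps)
    finally have "heat t z * (1 + norm z) powr B \<le> D * (t powr (- (?n / 2)) + t powr ((B - ?n) / 2))" .
    then have "heat t z * (1 + norm z) powr B * (1 + norm z) powr (-B) \<le> D * (t powr (- (?n / 2)) + t powr ((B - ?n) / 2)) * (1 + norm z) powr (-B)"
      by (intro mult_right_mono) auto
    moreover have "(1 + norm z) powr B * (1 + norm z) powr (-B) = 1"
      using norm_ge_zero[of z] powr_add[of "1 + norm z" B "-B"] by (auto simp: add_nonneg_eq_0_iff)
    ultimately show ?thesis by (simp add: mult.assoc)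
  qed
  moreover have "D > 0" using C unfolding D_def by (intro mult_pos_pos add_pos_pos) auto
  ultimately show ?thesis by blast
qed

lemma heat_le: "0 < t \<Longrightarrow> heat t (z::real^'n) \<le> (4 * pi * t) powr (- (real CARD('n) / 2))"
  by (simp add: heat_def mult_left_le)

lemma hk_weight_bound:
  assumes B: "0 \<le> B"
  shows "\<exists>C>0. \<forall>t>0. \<forall>z::real^'n. \<bar>hk k t z\<bar> \<le>
     C * inverse (t ^ k) * (t powr (- (real CARD('n) / 2)) + t powr ((B - real CARD('n)) / 2)) * (1 + norm z) powr (- B)"
proof -
  let ?n = "real CARD('n)"
  obtain C where C: "C > 0" "\<And>t z. t > 0 \<Longrightarrow> heat t (z::real^'n) \<le> C * (t powr (- (?n / 2)) + t powr ((B - ?n) / 2)) * (1 + norm z) powr (- B)"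
    using heat_weight_bound[OF B] by blast
  obtain K where K: "K > 0" "\<And>t z. t > 0 \<Longrightarrow> \<bar>hk k t (z::real^'n)\<bar> \<le> K * inverse (t ^ k) * heat (2 * t) z"
    using hk_bound by blast
  define M where "M = 2 powr (- (?n/2)) + 2 powr ((B - ?n)/2)"
  have "\<bar>hk k t z\<bar> \<le> (K * C * M) * inverse (t ^ k) * (t powr (- (?n / 2)) + t powr ((B - ?n) / 2)) * (1 + norm z) powr (- B)" if t: "t > 0" for t and z :: "real^'n"
  proof -
    have "(2*t) powr (- (?n / 2)) + (2*t) powr ((B - ?n) / 2) \<le> M * (t powr (- (?n / 2)) + t powr ((B - ?n) / 2))"
      using t by (simp add: M_def powr_mult algebra_simps)
    then have "heat (2 * t) z \<le> C * (M * (t powr (- (?n / 2)) + t powr ((B - ?n) / 2))) * (1 + norm z) powr (- B)"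
      using C(2)[of "2*t" z] t C(1) by (meson mult_left_mono mult_right_mono order_trans less_imp_le mult_pos_pos powr_ge_zero zero_less_numeral)
    then have "K * inverse (t ^ k) * heat (2 * t) z \<le> K * inverse (t ^ k) * (C * (M * (t powr (- (?n / 2)) + t powr ((B - ?n) / 2))) * (1 + norm z) powr (- B))"
      using K t by (intro mult_left_mono) auto
    with K(2)[OF t, of z] show ?thesis by (simp add: mult_ac)
  qed
  moreover have "M > 0" unfolding M_def by (intro add_pos_pos) auto
  ultimately show ?thesis using K C by (intro exI[of _ "K * C * M"]) auto
qed

text \<open>On a compact interval of positive times every power of \<open>t\<close> is bounded.
  Uniformity in \<open>t\<close> is what domination under the integral sign requires.\<close>

lemma hk_weight_bound_local:
  assumes B: "0 \<le> B" and t: "0 < t0"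
  shows "\<exists>C>0. \<forall>t\<in>{t0..t1}. \<forall>z::real^'n. \<bar>hk k t z\<bar> \<le> C * (1 + norm z) powr (- B)"
proof -
  let ?n = "real CARD('n)"
  obtain C where C: "C > 0" "\<And>t z. t > 0 \<Longrightarrow> \<bar>hk k t (z::real^'n)\<bar> \<le> C * inverse (t ^ k) * (t powr (- (?n / 2)) + t powr ((B - ?n) / 2)) * (1 + norm z) powr (- B)"
    using hk_weight_bound[OF B] by blast
  have "continuous_on {t0..t1} (\<lambda>t. inverse (t ^ k) * (t powr (- (?n / 2)) + t powr ((B - ?n) / 2)))"
    using t by (intro continuous_intros) auto
  then have "bounded ((\<lambda>t. inverse (t ^ k) * (t powr (- (?n / 2)) + t powr ((B - ?n) / 2))) ` {t0..t1})"
    by (intro compact_imp_bounded compact_continuous_image) auto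
  then obtain M where M: "M > 0" "\<And>t. t \<in> {t0..t1} \<Longrightarrow> inverse (t ^ k) * (t powr (- (?n / 2)) + t powr ((B - ?n) / 2)) \<le> M"
    unfolding bounded_pos by (metis (no_types, lifting) abs_le_D1 imageI real_norm_def)
  have "\<bar>hk k t z\<bar> \<le> (C * M) * (1 + norm z) powr (- B)" if "t \<in> {t0..t1}" for t and z :: "real^'n"
  proof -
    have "\<bar>hk k t z\<bar> \<le> C * (inverse (t ^ k) * (t powr (- (?n / 2)) + t powr ((B - ?n) / 2))) * (1 + norm z) powr (- B)"
      using C(2)[of t z] that t by (simp add: mult_ac)
    also have "\<dots> \<le> C * M * (1 + norm z) powr (- B)"
      using M(2)[OF that] C(1) by (intro mult_right_mono mult_left_mono) auto
    finally show ?thesis .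
  qed
  then show ?thesis using C M by (intro exI[of _ "C * M"]) auto
qed

lemma hk_bounded_local:
  assumes t: "0 < t0"
  shows "\<exists>C>0. \<forall>t\<in>{t0..t1}. \<forall>z::real^'n. \<bar>hk k t z\<bar> \<le> C"
proof -
  obtain C where C: "C > 0" "\<And>t z. t \<in> {t0..t1} \<Longrightarrow> \<bar>hk k t (z::real^'n)\<bar> \<le> C * (1 + norm z) powr (- 0)"
    using hk_weight_bound_local[OF order_refl t, where 'n='n and ?t1.0=t1 and k=k] by blast
  moreover have "(1 + norm z) powr (- 0) = 1" for z :: "real^'n"
    using norm_ge_zero[of z] by (simp add: add_nonneg_eq_0_iff)
  ultimately show ?thesis by (metis mult.right_neutral)
qed

section \<open>Total mass, semigroup property and subordination\<close>

lemma nn_integral_heat: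
  assumes t: "0 < t"
  shows "(\<integral>\<^sup>+(z::real^'n). ennreal (heat t z) \<partial>lborel) = 1"
proof -
  have "(\<integral>\<^sup>+(z::real^'n). ennreal (heat t z) \<partial>lborel) = (\<integral>\<^sup>+(z::real^'n). ennreal ((4 * pi * t) powr (- (real CARD('n) / 2))) * ennreal (exp (- (1 / (4 * t) * (norm z)\<^sup>2))) \<partial>lborel)"
    by (simp add: heat_def ennreal_mult')
  also have "\<dots> = ennreal ((4 * pi * t) powr (- (real CARD('n) / 2))) * ennreal ((pi / (1 / (4 * t))) powr (real CARD('n) / 2))"
    using nn_integral_gaussian[of "1/(4*t)", where 'n='n] t by (subst nn_integral_cmult) auto
  also have "\<dots> = ennreal ((4 * pi * t) powr (- (real CARD('n) / 2)) * (4 * pi * t) powr (real CARD('n) / 2))"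
    using t by (simp add: ennreal_mult' mult_ac)
  also have "\<dots> = 1" using t by (simp add: powr_add[symmetric])
  finally show ?thesis .
qed

lemma integral_heat:
  assumes t: "0 < t"
  shows "integrable lborel (heat t :: real^'n \<Rightarrow> real)" "(LINT z|lborel. heat t (z::real^'n)) = 1"
proof -
  have "heat t \<in> borel_measurable (lborel :: (real^'n) measure)" by measurable
  then show "integrable lborel (heat t :: real^'n \<Rightarrow> real)" "(LINT z|lborel. heat t (z::real^'n)) = 1"
    using nn_integral_eq_integrable[of "heat t" "lborel :: (real^'n) measure" 1] nn_integral_heat[OF t, where 'n='n] by auto
qed

text \<open>Completing the square in \<open>z\<close>: the product is a heat kernel in
  \<open>z\<close> centred at \<open>a\<close>, at time 1/(4c) = ts/(t + s), times a Gaussian in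
  \<open>x\<close> that belongs to time t + s. The former has mass 1.\<close>

lemma heat_semigroup:
  assumes t: "0 < t" and s: "0 < s"
  shows "(LINT z|lborel. heat t (x - z) * heat s z) = heat (t + s) (x::real^'n)"
proof -
  define c where "c = (t + s) / (4 * t * s)"
  define a where "a = (s / (t + s)) *\<^sub>R x"
  have ts: "t + s > 0" using t s by simp
  let ?n2 = "- (real CARD('n) / 2)"
  have sq: "(norm (x - z))\<^sup>2 / (4 * t) + (norm z)\<^sup>2 / (4 * s) = (norm x)\<^sup>2 / (4 * (t + s)) + (norm (- a + z))\<^sup>2 * c" for z
  proof -
    have 1: "(norm (x - z))\<^sup>2 = (norm x)\<^sup>2 - 2 * (x \<bullet> z) + (norm z)\<^sup>2"
      by (simp add: power2_norm_eq_inner inner_simps inner_commute)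
    have 2: "(norm (- a + z))\<^sup>2 = (s / (t + s))\<^sup>2 * (norm x)\<^sup>2 - 2 * (s / (t + s)) * (x \<bullet> z) + (norm z)\<^sup>2"
    proof -
      have "(norm (- a + z))\<^sup>2 = (norm a)\<^sup>2 - 2 * (a \<bullet> z) + (norm z)\<^sup>2"
        by (simp add: power2_norm_eq_inner inner_simps inner_commute)
      moreover have "(norm a)\<^sup>2 = (s / (t + s))\<^sup>2 * (norm x)\<^sup>2" by (simp add: a_def power_mult_distrib power_divide)
      moreover have "a \<bullet> z = (s / (t + s)) * (x \<bullet> z)" by (simp add: a_def)
      ultimately show ?thesis by simp
    qed
    \<comment> \<open>In these terms the identity rests on three relations: c = A + B, c l = A and c
      l^2 = A - E.\<close>
    define A where "A = 1 / (4 * t)"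
    define B where "B = 1 / (4 * s)"
    define E where "E = 1 / (4 * (t + s))"
    define l where "l = s / (t + s)"
    have aux: "w / (4 * t * s) * (s / w) = 1 / (4 * t)" "1 / (4 * t) - 1 / (4 * w) = (w - t) / (4 * t * w)"
      if "w > 0" for w
      using t s that by (simp_all add: field_simps)
    have c: "c = A + B" using t s by (simp add: c_def A_def B_def field_simps)
    have cl: "c * l = A" unfolding c_def A_def l_def by (rule aux(1)[OF ts])
    have "A * l = (t + s - t) / (4 * t * (t + s))" by (simp add: A_def l_def)
    also have "\<dots> = A - E" unfolding A_def E_def by (rule aux(2)[OF ts, symmetric])
    finally have cll: "c * l\<^sup>2 = A - E" using cl by (simp add: power2_eq_square mult.assoc[symmetric])
    have "(norm (- a + z))\<^sup>2 * c = (c * l\<^sup>2) * (norm x)\<^sup>2 - 2 * (c * l) * (x \<bullet> z) + c * (norm z)\<^sup>2"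
      unfolding 2 l_def by (simp add: algebra_simps)
    then have "(norm (- a + z))\<^sup>2 * c = (A - E) * (norm x)\<^sup>2 - 2 * A * (x \<bullet> z) + (A + B) * (norm z)\<^sup>2"
      unfolding cl cll by (simp add: c)
    moreover have "(norm (x - z))\<^sup>2 / (4 * t) = A * ((norm x)\<^sup>2 - 2 * (x \<bullet> z) + (norm z)\<^sup>2)"
      "(norm z)\<^sup>2 / (4 * s) = B * (norm z)\<^sup>2" "(norm x)\<^sup>2 / (4 * (t + s)) = E * (norm x)\<^sup>2"
      unfolding 1 by (simp_all add: A_def B_def E_def)
    ultimately show ?thesis by (simp add: algebra_simps)
  qed
  have "heat t (x - z) * heat s z = (4 * pi * t) powr ?n2 * (4 * pi * s) powr ?n2 / (4 * pi * (1 / (4 * c))) powr ?n2 * exp (- ((norm x)\<^sup>2 / (4 * (t + s)))) * heat (1 / (4 * c)) (- a + z)" for z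
  proof -
    have e: "(norm (- a + z))\<^sup>2 / (4 * (1 / (4 * c))) = (norm (- a + z))\<^sup>2 * c" by simp
    have nz: "(4 * pi * (1 / (4 * c))) powr ?n2 \<noteq> 0" using t s by (simp add: c_def)
    have "heat t (x - z) * heat s z = (4 * pi * t) powr ?n2 * (4 * pi * s) powr ?n2 * exp (- ((norm (x - z))\<^sup>2 / (4 * t) + (norm z)\<^sup>2 / (4 * s)))"
      by (simp add: heat_def exp_add[symmetric] mult_exp_exp)
    also have "\<dots> = (4 * pi * t) powr ?n2 * (4 * pi * s) powr ?n2 * (exp (- ((norm x)\<^sup>2 / (4 * (t + s)))) * exp (- ((norm (- a + z))\<^sup>2 * c)))"
      unfolding sq by (simp add: mult_exp_exp)
    moreover have "heat (1 / (4 * c)) (- a + z) = (4 * pi * (1 / (4 * c))) powr ?n2 * exp (- ((norm (- a + z))\<^sup>2 * c))"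
      by (simp only: heat_def e)
    ultimately show ?thesis using nz by (simp del: powr_eq_0_iff)
  qed
  then have "(LINT z|lborel. heat t (x - z) * heat s z) = (4 * pi * t) powr ?n2 * (4 * pi * s) powr ?n2 / (4 * pi * (1 / (4 * c))) powr ?n2 * exp (- ((norm x)\<^sup>2 / (4 * (t + s)))) * (LINT z|lborel. heat (1 / (4 * c)) (- a + z))"
    by simp
  also have "(LINT z|lborel. heat (1 / (4 * c)) (- a + z)) = 1"
    using integral_translate[of "heat (1 / (4*c))" "-a"] integral_heat(2)[of "1 / (4 * c)", where 'n='n] t s by (simp add: c_def)
  also have "(4 * pi * t) powr ?n2 * (4 * pi * s) powr ?n2 / (4 * pi * (1 / (4 * c))) powr ?n2 = (4 * pi * (t + s)) powr ?n2"
  proof -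
    have "(4 * pi * t) powr ?n2 * (4 * pi * s) powr ?n2 / (4 * pi * (1 / (4 * c))) powr ?n2 = (4 * pi * t * (4 * pi * s) / (4 * pi * (1 / (4 * c)))) powr ?n2"
    proof -
      have "4 * pi * (1 / (4 * c)) > 0" using t s by (simp add: c_def)
      moreover have "4 * pi * t > 0" "4 * pi * s > 0" using t s by simp_all
      moreover have "x powr e * y powr e / w powr e = (x * y / w) powr e" if "x > 0" "y > 0" "w > 0" for x y w e :: real
        using that by (simp add: powr_divide powr_mult)
      ultimately show ?thesis by blast
    qed
    also have "4 * pi * t * (4 * pi * s) / (4 * pi * (1 / (4 * c))) = 16 * pi * t * s * c" by simp
    also have "\<dots> = 4 * pi * (t + s)" using t s by (simp add: c_def)
    finally show ?thesis .
  qed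
  finally show ?thesis by (simp add: heat_def)
qed

text \<open>By differentiating the identity for \<open>k\<close> in \<open>t\<close> and comparing
  derivatives; \<open>t\<close> is arbitrary in the induction because the derivative involves nearby
  times.\<close>

lemma hk_semigroup:
  assumes t: "0 < t" and s: "0 < s"
  shows "(LINT z|lborel. hk k t (x - z) * heat s z) = hk k (t + s) (x::real^'n)"
  using t
proof (induction k arbitrary: t)
  case 0
  then show ?case using heat_semigroup[OF _ s] by (simp add: hk_0)
next
  case (Suc k)
  obtain C where C: "\<And>t' z. t' \<in> {t/2..2*t} \<Longrightarrow> \<bar>hk (Suc k) t' (z::real^'n)\<bar> \<le> C"
    using hk_bounded_local[of "t/2", where ?t1.0="2*t" and k="Suc k" and 'n='n] Suc.prems by (meson half_gt_zero)
  have b: "t' \<in> {t/2..2*t}" "t' > 0" if "t' \<in> ball t (t/2)" for t'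
    using that Suc.prems unfolding mem_ball dist_real_def atLeastAtMost_iff by arith+
  have "((\<lambda>t. LINT z|lborel. hk k t (x - z) * heat s z) has_real_derivative (LINT z|lborel. - hk (Suc k) t (x - z) * heat s z)) (at t)"
  proof (rule integral_has_real_derivative[where d="t/2" and w="\<lambda>z. C * heat s z"])
    fix t' z assume t': "t' \<in> ball t (t/2)"
    show "((\<lambda>t. hk k t (x - z) * heat s z) has_real_derivative - hk (Suc k) t' (x - z) * heat s z) (at t')"
      by (intro DERIV_cmult_right hk_has_derivative b(2)[OF t'])
    show "\<bar>- hk (Suc k) t' (x - z) * heat s z\<bar> \<le> C * heat s z"
      using C[OF b(1)[OF t'], of "x - z"] by (simp add: abs_mult mult_right_mono)
  next
    fix t' assume t': "t' \<in> ball t (t/2)"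
    obtain C' where C': "\<And>z. \<bar>hk k t' (z::real^'n)\<bar> \<le> C'"
      using hk_bounded_local[of t', where ?t1.0=t' and k=k and 'n='n] b(2)[OF t'] by auto
    show "integrable lborel (\<lambda>z. hk k t' (x - z) * heat s z)"
    proof (rule integrable_bound_real)
      show "integrable lborel (\<lambda>z::real^'n. C' * heat s z)" using integral_heat[OF s] by auto
      show "\<bar>hk k t' (x - z) * heat s z\<bar> \<le> C' * heat s z" for z
        using C'[of "x - z"] by (simp add: abs_mult mult_right_mono)
    qed measurable
  qed (use Suc.prems integral_heat[OF s] in auto)
  moreover have "((\<lambda>t. LINT z|lborel. hk k t (x - z) * heat s z) has_real_derivative - hk (Suc k) (t + s) x) (at t)"
  proof (rule has_field_derivative_transform_within[where d=t and f="\<lambda>t. hk k (t + s) x"])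
    show "((\<lambda>t. hk k (t + s) x) has_real_derivative - hk (Suc k) (t + s) x) (at t)"
      using hk_has_derivative[of "t + s" k x] Suc.prems s unfolding DERIV_shift by simp
    show "hk k (t' + s) x = (LINT z|lborel. hk k t' (x - z) * heat s z)" if "dist t' t < t" for t'
    proof -
      have "t' > 0" using that unfolding dist_real_def by arith
      then show ?thesis using Suc.IH[of t'] by simp
    qed
  qed (use Suc.prems in auto)
  ultimately have "(LINT z|lborel. - hk (Suc k) t (x - z) * heat s z) = - hk (Suc k) (t + s) x"
    by (rule DERIV_unique)
  then show ?case by simp
qed

text \<open>Used with both signs of \<open>a\<close>: for a = \<gamma> the result is the kernel of
  the fractional Laplacian, for a = -s the Riesz kernel. This is the origin of the constants
  \<open>frac_const\<close> and \<open>riesz_const\<close>.\<close>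

lemma heat_subordination:
  assumes a: "real CARD('n) / 2 + a > 0" and z: "z \<noteq> (0::real^'n)"
  shows "integrable lborel (\<lambda>t. indicator {0<..} t * (t powr (- 1 - a) * heat t z))"
    and "(LINT t|lborel. indicator {0<..} t * (t powr (- 1 - a) * heat t z)) =
      4 powr a * Gamma (real CARD('n) / 2 + a) / pi powr (real CARD('n) / 2) * norm z powr (- (real CARD('n) + 2 * a))"
proof -
  let ?n = "real CARD('n)"
  have eq: "indicator {0<..} t * (t powr (- 1 - a) * heat t z) = (4 * pi) powr (- (?n / 2)) * (indicator {0<..} t * (t powr (- 1 - (?n / 2 + a)) * exp (- ((norm z)\<^sup>2 / 4 / t))))" for t
  proof (cases "t > 0")
    case True
    have "t powr (- 1 - (?n/2 + a)) = t powr (-1 - a) * t powr (- (?n/2))"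
      by (simp add: powr_add[symmetric] algebra_simps)
    then show ?thesis using True by (simp add: heat_def powr_mult mult_ac)
  qed simp
  have c: "(norm z)\<^sup>2 / 4 > 0" using z by simp
  show "integrable lborel (\<lambda>t. indicator {0<..} t * (t powr (- 1 - a) * heat t z))"
    unfolding eq using integral_powr_exp_inverse(1)[OF a c] by (intro integrable_mult_right) auto
  have "(LINT t|lborel. indicator {0<..} t * (t powr (- 1 - a) * heat t z)) = (4 * pi) powr (- (?n / 2)) * (Gamma (?n/2 + a) * ((norm z)\<^sup>2 / 4) powr (- (?n/2 + a)))"
    unfolding eq using integral_powr_exp_inverse(2)[OF a c] by simp
  also have "((norm z)\<^sup>2 / 4) powr (- (?n/2 + a)) = norm z powr (- (?n + 2 * a)) * 4 powr (?n/2 + a)"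
  proof -
    have "((norm z)\<^sup>2 / 4) powr (- (?n/2 + a)) = ((norm z)\<^sup>2) powr (- (?n/2 + a)) * 4 powr (?n/2 + a)"
      using z by (simp add: powr_divide powr_minus field_simps)
    also have "((norm z)\<^sup>2) powr (- (?n/2 + a)) = norm z powr (- (?n + 2 * a))"
      using z by (simp add: powr_def ln_realpow algebra_simps)
    finally show ?thesis .
  qed
  also have "(4 * pi) powr (- (?n / 2)) * (Gamma (?n/2 + a) * (norm z powr (- (?n + 2 * a)) * 4 powr (?n/2 + a)))
     = (4 powr (- (?n/2)) * 4 powr (?n/2 + a)) * Gamma (?n/2 + a) * pi powr (- (?n/2)) * norm z powr (- (?n + 2 * a))"
    by (simp add: powr_mult mult_ac)
  also have "4 powr (- (?n/2)) * 4 powr (?n/2 + a) = (4::real) powr a"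
    by (simp add: powr_add[symmetric])
  finally show "(LINT t|lborel. indicator {0<..} t * (t powr (- 1 - a) * heat t z)) =
      4 powr a * Gamma (?n / 2 + a) / pi powr (?n / 2) * norm z powr (- (?n + 2 * a))"
    by (simp add: powr_minus_divide)
qed

section \<open>Partial derivatives\<close>

lemma has_partialD:
  "has_partial i u x \<Longrightarrow> ((\<lambda>t. u (x + t *\<^sub>R axis i 1)) has_real_derivative partial i u x) (at 0)"
  unfolding has_partial_def partial_def by (simp add: DERIV_deriv_iff_real_differentiable)

lemma partialI:
  assumes "((\<lambda>t. u (x + t *\<^sub>R axis i 1)) has_real_derivative D) (at 0)"
  shows "has_partial i u x" "partial i u x = D"
  using assms unfolding has_partial_def partial_def
  by (auto simp: DERIV_imp_deriv real_differentiable_def)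

lemma has_partial_line:
  assumes "\<And>x. has_partial i u x"
  shows "((\<lambda>t. u (x + t *\<^sub>R axis i 1)) has_real_derivative partial i u (x + t *\<^sub>R axis i 1)) (at t)"
proof -
  have "((\<lambda>h. u ((x + t *\<^sub>R axis i 1) + h *\<^sub>R axis i 1)) has_real_derivative partial i u (x + t *\<^sub>R axis i 1)) (at 0)"
    by (rule has_partialD[OF assms])
  then have "((\<lambda>h. (\<lambda>s. u (x + s *\<^sub>R axis i 1)) (h + t)) has_real_derivative partial i u (x + t *\<^sub>R axis i 1)) (at 0)"
    by (simp add: algebra_simps)
  then show ?thesis using DERIV_shift[of "\<lambda>s. u (x + s *\<^sub>R axis i 1)" _ 0 t] by simp
qed

lemma pderivs_append: "pderivs (is @ js) u = pderivs is (pderivs js u)"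
  by (induction "is") auto

lemma Ck_0 [simp]: "Ck 0 u \<longleftrightarrow> continuous_on UNIV u"
  by (auto simp: Ck_def)

text \<open>The lists in the definition of \<open>Ck\<close> are split at their last entry, which is
  the derivative taken first. The resulting recursion carries the inductions below.\<close>

lemma Ck_Suc:
  "Ck (Suc k) u \<longleftrightarrow> continuous_on UNIV u \<and> (\<forall>i x. has_partial i u x) \<and> (\<forall>i. Ck k (partial i u))"
proof (intro iffI conjI allI)
  assume A: "Ck (Suc k) u"
  show "continuous_on UNIV u" using A unfolding Ck_def by (metis le0 list.size(3) pderivs.simps(1))
  show "has_partial i u x" for i x
    using A unfolding Ck_def by (metis zero_less_Suc list.size(3) pderivs.simps(1))
  have eq: "pderivs is (partial j u) = pderivs (is @ [j]) u" for "is" j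
    by (simp add: pderivs_append)
  have "has_partial i (pderivs (is @ [j]) u) x" if "length is < k" for "is" i j x
    using A that unfolding Ck_def by (metis Suc_less_eq length_append_singleton)
  moreover have "continuous_on UNIV (pderivs (is @ [j]) u)" if "length is \<le> k" for "is" j
    using A that unfolding Ck_def by (metis Suc_le_mono length_append_singleton)
  ultimately show "Ck k (partial j u)" for j
    unfolding Ck_def eq by blast
next
  assume B: "continuous_on UNIV u \<and> (\<forall>i x. has_partial i u x) \<and> (\<forall>i. Ck k (partial i u))"
  have 1: "has_partial i (pderivs is u) x" if "length is < Suc k" for "is" i x
  proof (cases "is" rule: rev_cases)
    case Nil then show ?thesis using B by simp
  next
    case (snoc js j)
    then show ?thesis using B that unfolding Ck_def by (simp add: pderivs_append)
  qed
  have 2: "continuous_on UNIV (pderivs is u)" if "length is \<le> Suc k" for "is"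
  proof (cases "is" rule: rev_cases)
    case Nil then show ?thesis using B by simp
  next
    case (snoc js j)
    then show ?thesis using B that unfolding Ck_def by (simp add: pderivs_append)
  qed
  show "Ck (Suc k) u" unfolding Ck_def using 1 2 by blast
qed

lemma Ck_mono: "Ck k u \<Longrightarrow> j \<le> k \<Longrightarrow> Ck j u"
  unfolding Ck_def by auto

lemma Ck_continuous: "Ck k u \<Longrightarrow> continuous_on UNIV u"
  using Ck_mono[of k u 0] by simp

lemma Ck_pderivs: "Ck (k + length is) u \<Longrightarrow> Ck k (pderivs is u)"
proof (induction "is" arbitrary: k)
  case (Cons i "is")
  then have "Ck (Suc k) (pderivs is u)" by simp
  then show ?case by (simp add: Ck_Suc)
qed simp

section \<open>Rules for partial derivatives and for \<open>Ck\<close>\<close>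

lemma partial_const:
  fixes i :: "'n::finite"
  shows "has_partial i (\<lambda>x. c) x" "partial i (\<lambda>x. c) = (\<lambda>x. 0)"
proof -
  have *: "((\<lambda>t. (\<lambda>x::real^'n. c) (x + t *\<^sub>R axis i 1)) has_real_derivative 0) (at 0)" for x
    by simp
  show "has_partial i (\<lambda>x. c) x" by (rule partialI(1)[OF *])
  show "partial i (\<lambda>x. c) = (\<lambda>x. 0)" using partialI(2)[OF *] by auto
qed

lemma partial_add:
  assumes "has_partial i u x" "has_partial i w x"
  shows "has_partial i (\<lambda>x. u x + w x) x" "partial i (\<lambda>x. u x + w x) x = partial i u x + partial i w x"
  using partialI[OF DERIV_add[OF has_partialD[OF assms(1)] has_partialD[OF assms(2)]]] by auto

lemma partial_mult:
  assumes "has_partial i u x" "has_partial i w x"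
  shows "has_partial i (\<lambda>x. u x * w x) x" "partial i (\<lambda>x. u x * w x) x = u x * partial i w x + partial i u x * w x"
proof -
  have "((\<lambda>t. u (x + t *\<^sub>R axis i 1) * w (x + t *\<^sub>R axis i 1)) has_real_derivative u x * partial i w x + partial i u x * w x) (at 0)"
    using DERIV_mult'[OF has_partialD[OF assms(1)] has_partialD[OF assms(2)]] by simp
  from partialI[OF this] show "has_partial i (\<lambda>x. u x * w x) x" "partial i (\<lambda>x. u x * w x) x = u x * partial i w x + partial i u x * w x"
    by auto
qed

lemma partial_cmult:
  assumes "has_partial i u x"
  shows "has_partial i (\<lambda>x. c * u x) x" "partial i (\<lambda>x. c * u x) x = c * partial i u x"
  using partialI[OF DERIV_cmult[OF has_partialD[OF assms]]] by auto

lemma partial_component: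
  "has_partial i (\<lambda>x. x $ j) x" "partial i (\<lambda>x. x $ j) = (\<lambda>x. if i = j then 1 else 0)"
proof -
  have *: "((\<lambda>t. (\<lambda>x. x $ j) (x + t *\<^sub>R axis i 1)) has_real_derivative (if i = j then 1 else 0)) (at 0)" for x :: "real^'a"
    by (auto intro!: derivative_eq_intros simp: axis_def)
  show "has_partial i (\<lambda>x. x $ j) x" by (rule partialI(1)[OF *])
  show "partial i (\<lambda>x. x $ j) = (\<lambda>x. if i = j then 1 else 0)" using partialI(2)[OF *] by auto
qed

lemma Ck_const [simp]: "Ck k (\<lambda>x. c)"
  by (induction k arbitrary: c) (auto simp: Ck_Suc partial_const)

lemma Ck_component: "Ck k (\<lambda>x. x $ j)"
proof (cases k)
  case (Suc l)
  have "Ck l (\<lambda>x. if i = j then 1 else 0)" for i by (cases "i = j") auto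
  then show ?thesis unfolding Suc Ck_Suc by (auto simp: partial_component intro!: continuous_intros)
qed (auto intro!: continuous_intros)

lemma Ck_add: "Ck k u \<Longrightarrow> Ck k w \<Longrightarrow> Ck k (\<lambda>x. u x + w x)"
proof (induction k arbitrary: u w)
  case (Suc k)
  then have p: "\<And>i x. has_partial i u x" "\<And>i x. has_partial i w x" and "continuous_on UNIV u" "continuous_on UNIV w"
    by (auto simp: Ck_Suc)
  moreover have "partial i (\<lambda>x. u x + w x) = (\<lambda>x. partial i u x + partial i w x)" for i
    using partial_add(2)[OF p] by auto
  ultimately show ?case using Suc by (auto simp: Ck_Suc intro!: continuous_intros partial_add)
qed (auto intro!: continuous_intros)

lemma Ck_mult: "Ck k u \<Longrightarrow> Ck k w \<Longrightarrow> Ck k (\<lambda>x. u x * w x)"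
proof (induction k arbitrary: u w)
  case (Suc k)
  then have p: "\<And>i x. has_partial i u x" "\<And>i x. has_partial i w x" and "continuous_on UNIV u" "continuous_on UNIV w"
    by (auto simp: Ck_Suc)
  moreover have "partial i (\<lambda>x. u x * w x) = (\<lambda>x. u x * partial i w x + partial i u x * w x)" for i
    using partial_mult(2)[OF p] by auto
  moreover have "Ck k u" "Ck k w" using Suc.prems Ck_mono by (auto intro: Ck_mono[of "Suc k"])
  ultimately show ?case using Suc by (auto simp: Ck_Suc intro!: continuous_intros partial_mult Ck_add)
qed (auto intro!: continuous_intros)

lemma Ck_cmult: "Ck k u \<Longrightarrow> Ck k (\<lambda>x. c * u x)"
  by (rule Ck_mult) auto

lemma Ck_minus: "Ck k u \<Longrightarrow> Ck k (\<lambda>x. - u x)"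
  using Ck_cmult[of k u "-1"] by simp

lemma Ck_sum: "finite S \<Longrightarrow> (\<And>j. j \<in> S \<Longrightarrow> Ck k (u j)) \<Longrightarrow> Ck k (\<lambda>x. \<Sum>j\<in>S. u j x)"
  by (induction S rule: finite_induct) (auto intro!: Ck_add)

lemma Ck_neg_lap: "Ck (Suc (Suc k)) u \<Longrightarrow> Ck k (neg_lap u)"
  unfolding neg_lap_def[abs_def] by (intro Ck_minus Ck_sum) (auto simp: Ck_Suc)

lemma Ck_neg_lap_pow: "Ck (2 * j + k) u \<Longrightarrow> Ck k ((neg_lap ^^ j) u)"
proof (induction j arbitrary: k)
  case (Suc j)
  then have "Ck (Suc (Suc k)) ((neg_lap ^^ j) u)" by simp
  then show ?case by (simp add: Ck_neg_lap)
qed simp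

lemma partial_translate: "partial i (\<lambda>x. u (x + a)) = (\<lambda>x. partial i u (x + a))"
  by (simp add: partial_def fun_eq_iff algebra_simps)

lemma has_partial_translate: "has_partial i (\<lambda>x. u (x + a)) x \<longleftrightarrow> has_partial i u (x + a)"
  by (simp add: has_partial_def algebra_simps)

lemma Ck_translate: "Ck k u \<Longrightarrow> Ck k (\<lambda>x. u (x + a))"
proof (induction k arbitrary: u)
  case 0
  then show ?case by (simp add: continuous_on_compose2[of UNIV u UNIV "\<lambda>x. x + a"] continuous_on_add)
next
  case (Suc k)
  then have 1: "Ck k (\<lambda>x. partial i u (x + a))" "continuous_on UNIV u" "has_partial i u x" for i x
    by (auto simp: Ck_Suc)
  have "continuous_on UNIV (\<lambda>x. u (x + a))"
    by (rule continuous_on_compose2[OF 1(2)]) (auto intro!: continuous_intros)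
  then show ?case using 1(1,3) unfolding Ck_Suc has_partial_translate partial_translate[of _ u a] by blast
qed

lemma neg_lap_translate: "neg_lap (\<lambda>x. u (x + a)) = (\<lambda>x. neg_lap u (x + a))"
proof -
  have "partial i (partial i (\<lambda>x. u (x + a))) = (\<lambda>x. partial i (partial i u) (x + a))" for i
    using partial_translate[of i u a] partial_translate[of i "partial i u" a] by simp
  then show ?thesis by (simp add: neg_lap_def fun_eq_iff)
qed

lemma neg_lap_pow_translate: "(neg_lap ^^ m) (\<lambda>x. u (x + a)) = (\<lambda>x. (neg_lap ^^ m) u (x + a))"
proof (induction m)
  case (Suc m)
  then show ?case using neg_lap_translate[of "(neg_lap ^^ m) u" a] by simp
qed simp

section \<open>Radial functions and the heat equation\<close>

lemma norm_axis_line: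
  "(norm (z + t *\<^sub>R axis i 1 :: real^'n))\<^sup>2 = (norm z)\<^sup>2 + 2 * (z $ i) * t + t\<^sup>2"
proof -
  have "(norm (z + t *\<^sub>R axis i 1 :: real^'n))\<^sup>2 = (norm z)\<^sup>2 + 2 * (z \<bullet> (t *\<^sub>R axis i 1)) + (norm (t *\<^sub>R (axis i 1 :: real^'n)))\<^sup>2"
    by (simp only: power2_norm_eq_inner inner_add_left inner_add_right inner_commute)
  then show ?thesis by (simp add: inner_axis norm_axis_1 power_mult_distrib)
qed

lemma partial_radial:
  assumes "(g has_real_derivative g') (at ((norm z)\<^sup>2))"
  shows "has_partial i (\<lambda>z::real^'n. g ((norm z)\<^sup>2)) z" "partial i (\<lambda>z::real^'n. g ((norm z)\<^sup>2)) z = 2 * (z $ i) * g'"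
proof -
  have 1: "((\<lambda>t. (norm z)\<^sup>2 + 2 * (z $ i) * t + t\<^sup>2) has_real_derivative 2 * (z $ i)) (at 0)"
    by (auto intro!: derivative_eq_intros)
  have "((\<lambda>t. g ((norm z)\<^sup>2 + 2 * (z $ i) * t + t\<^sup>2)) has_real_derivative g' * (2 * (z $ i))) (at 0)"
    by (rule DERIV_chain2[OF _ 1]) (use assms in simp)
  then have "((\<lambda>t. g ((norm (z + t *\<^sub>R axis i 1))\<^sup>2)) has_real_derivative 2 * (z $ i) * g') (at 0)"
    by (simp add: norm_axis_line mult_ac)
  from partialI[OF this] show "has_partial i (\<lambda>z::real^'n. g ((norm z)\<^sup>2)) z" "partial i (\<lambda>z::real^'n. g ((norm z)\<^sup>2)) z = 2 * (z $ i) * g'"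
    by auto
qed

lemma neg_lap_radial:
  assumes g: "\<And>r. (g has_real_derivative g' r) (at r)" and g': "\<And>r. (g' has_real_derivative g'' r) (at r)"
  shows "neg_lap (\<lambda>z::real^'n. g ((norm z)\<^sup>2)) z = - (4 * (norm z)\<^sup>2 * g'' ((norm z)\<^sup>2) + 2 * real CARD('n) * g' ((norm z)\<^sup>2))"
proof -
  have 1: "partial i (\<lambda>z::real^'n. g ((norm z)\<^sup>2)) = (\<lambda>z. (2 * (z $ i)) * g' ((norm z)\<^sup>2))" for i
    using partial_radial(2)[OF g] by auto
  have "partial i (\<lambda>z::real^'n. (2 * (z $ i)) * g' ((norm z)\<^sup>2)) z = (2 * (z $ i)) * (2 * (z $ i) * g'' ((norm z)\<^sup>2)) + 2 * g' ((norm z)\<^sup>2)" for i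
    using partial_mult(2)[of i "\<lambda>z. 2 * z $ i" z "\<lambda>z. g' ((norm z)\<^sup>2)", OF partial_cmult(1)[OF partial_component(1)] partial_radial(1)[OF g']]
      partial_radial(2)[OF g', of i z] partial_cmult(2)[OF partial_component(1), of i 2 i z] by (simp add: partial_component)
  then have "neg_lap (\<lambda>z::real^'n. g ((norm z)\<^sup>2)) z = - (\<Sum>i\<in>UNIV. (4 * g'' ((norm z)\<^sup>2)) * (z $ i)\<^sup>2 + 2 * g' ((norm z)\<^sup>2))"
    unfolding neg_lap_def 1 by (simp add: power2_eq_square mult_ac)
  also have "\<dots> = - ((4 * g'' ((norm z)\<^sup>2)) * (\<Sum>i\<in>UNIV. (z $ i)\<^sup>2) + real CARD('n) * (2 * g' ((norm z)\<^sup>2)))"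
    by (simp only: sum.distrib sum_distrib_left[symmetric] sum_constant)
  also have "(\<Sum>i\<in>UNIV. (z $ i)\<^sup>2) = (norm z)\<^sup>2"
    by (simp add: norm_vec_def L2_set_def sum_nonneg)
  finally show ?thesis by (simp add: mult_ac)
qed

text \<open>Up to a factor 2 z_i a partial derivative stays in this family, with \<open>q\<close>
  replaced by \<open>pderiv q - smult c q\<close>; hence an induction on \<open>k\<close> for all
  \<open>q\<close> at once.\<close>

lemma Ck_poly_gauss: "Ck k (\<lambda>z::real^'n. poly q ((norm z)\<^sup>2) * exp (- (c * (norm z)\<^sup>2)))"
proof (induction k arbitrary: q)
  case 0
  show ?case by (auto intro!: continuous_intros)
next
  case (Suc k)
  have d: "((\<lambda>r. poly q r * exp (- (c * r))) has_real_derivative poly (pderiv q - smult c q) r * exp (- (c * r))) (at r)" for r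
    by (auto intro!: derivative_eq_intros poly_DERIV simp: algebra_simps)
  have "partial i (\<lambda>z::real^'n. poly q ((norm z)\<^sup>2) * exp (- (c * (norm z)\<^sup>2))) = (\<lambda>z. (2 * (z $ i)) * (poly (pderiv q - smult c q) ((norm z)\<^sup>2) * exp (- (c * (norm z)\<^sup>2))))" for i
    using partial_radial(2)[OF d] by auto
  moreover have "Ck k (\<lambda>z::real^'n. (2 * (z $ i)) * (poly (pderiv q - smult c q) ((norm z)\<^sup>2) * exp (- (c * (norm z)\<^sup>2))))" for i
    by (intro Ck_mult[OF Ck_cmult[OF Ck_component] Suc])
  moreover have "has_partial i (\<lambda>z::real^'n. poly q ((norm z)\<^sup>2) * exp (- (c * (norm z)\<^sup>2))) z" for i z
    by (rule partial_radial(1)[OF d])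
  ultimately show ?case unfolding Ck_Suc by (auto intro!: continuous_intros)
qed

lemma Ck_hk: "Ck j (hk k t :: real^'n \<Rightarrow> real)"
proof -
  let ?L = "lag (real CARD('n) / 2) k"
  have "hk k t = (\<lambda>z::real^'n. (inverse (t ^ k) * (4 * pi * t) powr (- (real CARD('n) / 2))) *
      (poly (pcompose ?L [:0, 1 / (4 * t):]) ((norm z)\<^sup>2) * exp (- (1 / (4 * t) * (norm z)\<^sup>2))))"
    by (simp add: hk_def heat_def poly_pcompose fun_eq_iff)
  then show ?thesis by (simp only: Ck_cmult[OF Ck_poly_gauss])
qed

text \<open>The Laguerre equation, which is the heat equation in the variable r = |z|^2/(4t). In the
  induction, the equation for \<open>k\<close> first simplifies the derivative of
  \<open>lag \<nu> (Suc k)\<close> to (k + 1)(L' - L); with this, the equation for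
  \<open>Suc k\<close> is k + 1 times the one for \<open>k\<close>.\<close>

lemma lag_ode:
  fixes \<nu> r :: real
  shows "r * poly (pderiv (pderiv (lag \<nu> k))) r + (\<nu> - r) * poly (pderiv (lag \<nu> k)) r + real k * poly (lag \<nu> k) r = 0"
    (is "?ode k r")
proof (induction k arbitrary: r)
  case (Suc k)
  let ?L = "lag \<nu> k"
  have "pderiv (lag \<nu> (Suc k)) = smult (real k + \<nu>) (pderiv ?L) + (pderiv ?L - ?L) + pCons 0 (pderiv (pderiv ?L) - pderiv ?L)"
    by (simp add: pderiv_smult pderiv_add pderiv_diff pderiv_pCons)
  note * = this
  have D1: "poly (pderiv (lag \<nu> (Suc k))) x = (real k + 1) * (poly (pderiv ?L) x - poly ?L x)" for x
  proof -
    have "poly (pderiv (lag \<nu> (Suc k))) x = (real k + \<nu>) * poly (pderiv ?L) x + (poly (pderiv ?L) x - poly ?L x) + x * (poly (pderiv (pderiv ?L)) x - poly (pderiv ?L) x)"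
      if "pderiv (lag \<nu> (Suc k)) = smult (real k + \<nu>) (pderiv ?L) + (pderiv ?L - ?L) + pCons 0 (pderiv (pderiv ?L) - pderiv ?L)"
      by (simp only: that) simp
    from this[OF *] show ?thesis using Suc[of x] by (simp add: algebra_simps del: lag.simps)
  qed
  have "pderiv (lag \<nu> (Suc k)) = smult (real k + 1) (pderiv ?L - ?L)"
    by (rule poly_ext) (simp only: D1 poly_smult poly_diff)
  then have D2: "poly (pderiv (pderiv (lag \<nu> (Suc k)))) r = (real k + 1) * (poly (pderiv (pderiv ?L)) r - poly (pderiv ?L) r)"
    by (simp only: pderiv_smult pderiv_diff poly_smult poly_diff)
  define A where "A = poly ?L r"
  define A' where "A' = poly (pderiv ?L) r"
  define A'' where "A'' = poly (pderiv (pderiv ?L)) r"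
  have o: "r * A'' + (\<nu> - r) * A' + real k * A = 0" using Suc[of r] by (simp add: A_def A'_def A''_def)
  have "r * ((real k + 1) * (A'' - A')) + (\<nu> - r) * ((real k + 1) * (A' - A)) + (real k + 1) * ((real k + \<nu>) * A + r * (A' - A)) = (real k + 1) * (r * A'' + (\<nu> - r) * A' + real k * A)"
    by (simp add: algebra_simps)
  then show ?case unfolding D1 D2 using o by (simp add: A_def A'_def A''_def add.commute)
qed simp

text \<open>The heat equation: the negative Laplacian raises the index just as the negative time
  derivative does (\<open>hk_has_derivative\<close>). Each of the m Laplacians of the equation is
  thereby converted into a time derivative.\<close>

lemma neg_lap_hk:
  assumes t: "0 < t"
  shows "neg_lap (hk k t) = (hk (Suc k) t :: real^'n \<Rightarrow> real)"
proof
  fix z :: "real^'n"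
  let ?\<nu> = "real CARD('n) / 2"
  define L where "L = lag ?\<nu> k"
  define c where "c = 1 / (4 * t)"
  define K where "K = inverse (t ^ k) * (4 * pi * t) powr (- ?\<nu>)"
  define g where "g r = K * (poly L (c * r) * exp (- (c * r)))" for r
  define g1 where "g1 r = K * c * ((poly (pderiv L) (c * r) - poly L (c * r)) * exp (- (c * r)))" for r
  define g2 where "g2 r = K * c * c * ((poly (pderiv (pderiv L)) (c * r) - 2 * poly (pderiv L) (c * r) + poly L (c * r)) * exp (- (c * r)))" for r
  have p: "((\<lambda>r. poly q (c * r)) has_real_derivative c * poly (pderiv q) (c * r)) (at r)" for q r
    by (rule DERIV_chain2[OF poly_DERIV, THEN DERIV_cong]) (auto intro!: derivative_eq_intros)
  have d1: "(g has_real_derivative g1 r) (at r)" for r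
    unfolding g_def[abs_def] g1_def by (auto intro!: derivative_eq_intros p simp: algebra_simps)
  have d2: "(g1 has_real_derivative g2 r) (at r)" for r
    unfolding g1_def[abs_def] g2_def by (auto intro!: derivative_eq_intros p simp: algebra_simps)
  have hk: "hk k t = (\<lambda>z::real^'n. g ((norm z)\<^sup>2))"
    by (simp add: hk_def heat_def g_def K_def c_def L_def fun_eq_iff)
  define r where "r = (norm z)\<^sup>2"
  define x where "x = c * r"
  have "neg_lap (hk k t) z = - (4 * r * g2 r + 4 * ?\<nu> * g1 r)"
    unfolding hk using neg_lap_radial[OF d1 d2, of z] by (simp add: r_def)
  also have "\<dots> = - (4 * c * K * exp (- x)) * (x * poly (pderiv (pderiv L)) x - 2 * x * poly (pderiv L) x + x * poly L x + ?\<nu> * poly (pderiv L) x - ?\<nu> * poly L x)"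
    unfolding g1_def g2_def x_def by (simp add: algebra_simps)
  also have "\<dots> = 4 * c * K * exp (- x) * (real k * poly L x + x * poly (pderiv L) x - x * poly L x + ?\<nu> * poly L x)"
  proof -
    have "x * A'' - 2 * x * A' + x * A + \<nu> * A' - \<nu> * A = - (real k * A + x * A' - x * A + \<nu> * A)"
      if "x * A'' + (\<nu> - x) * A' + real k * A = 0" for A A' A'' \<nu> :: real
      using that by (simp add: algebra_simps)
    from this[OF lag_ode[of x ?\<nu> k, folded L_def]] show ?thesis by (simp only: minus_mult_minus)
  qed
  also have "\<dots> = ((real k + ?\<nu>) * poly L x + x * (poly (pderiv L) x - poly L x)) * (inverse t * inverse (t ^ k)) * ((4 * pi * t) powr (- ?\<nu>) * exp (- x))"
  proof -
    have c: "4 * c = inverse t" by (simp add: c_def inverse_eq_divide)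
    have "a * (q * p) * E * (real k * A + x * A' - x * A + \<nu> * A) = ((real k + \<nu>) * A + x * (A' - A)) * (a * q) * (p * E)" for a q p E A A' \<nu> :: real
      by (simp add: algebra_simps)
    then show ?thesis unfolding c K_def by this
  qed
  also have "\<dots> = hk (Suc k) t z"
    by (simp add: hk_def heat_def L_def[symmetric] x_def c_def r_def)
  finally show "neg_lap (hk k t) z = hk (Suc k) t z" .
qed

lemma neg_lap_pow_hk:
  assumes t: "0 < t"
  shows "(neg_lap ^^ m) (hk k t) = (hk (m + k) t :: real^'n \<Rightarrow> real)"
  by (induction m) (auto simp: neg_lap_hk[OF t])

subsection \<open>Compactly supported functions and integration by parts\<close>

definition csupp :: "'n::finite fn \<Rightarrow> bool" where
  "csupp \<phi> \<longleftrightarrow> (\<exists>R. \<forall>x. R < norm x \<longrightarrow> \<phi> x = 0)"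

lemma csupp_partial:
  fixes \<phi> :: "real^'n \<Rightarrow> real"
  shows "csupp \<phi> \<Longrightarrow> csupp (partial i \<phi>)"
proof -
  assume "csupp \<phi>"
  then obtain R where R: "\<And>x. R < norm x \<Longrightarrow> \<phi> x = 0" unfolding csupp_def by blast
  have "partial i \<phi> x = 0" if x: "R < norm x" for x :: "real^'n"
  proof (rule partialI(2), rule has_field_derivative_transform_within[where d="norm x - R" and f="\<lambda>t. 0"])
    fix t :: real assume "dist t 0 < norm x - R"
    then have "R < norm (x + t *\<^sub>R axis i 1)"
      using norm_triangle_ineq2[of x "- (t *\<^sub>R axis i 1)"] by (simp add: norm_axis_1)
    then show "0 = \<phi> (x + t *\<^sub>R axis i 1)" using R by simp
  qed (use x in auto)
  then show ?thesis unfolding csupp_def by blast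
qed

lemma csupp_neg_lap: "csupp \<phi> \<Longrightarrow> csupp (neg_lap \<phi>)"
proof -
  assume "csupp \<phi>"
  then have "csupp (partial i (partial i \<phi>))" for i by (intro csupp_partial)
  then obtain R where R: "\<And>i x. R i < norm x \<Longrightarrow> partial i (partial i \<phi>) x = 0" unfolding csupp_def by metis
  have "neg_lap \<phi> x = 0" if "Max (range R) < norm x" for x
  proof -
    have "R i < norm x" for i using that Max_ge[of "range R" "R i"] by (simp add: order_le_less_trans)
    then show ?thesis using R by (simp add: neg_lap_def)
  qed
  then show ?thesis unfolding csupp_def by blast
qed

lemma csupp_neg_lap_pow: "csupp \<phi> \<Longrightarrow> csupp ((neg_lap ^^ m) \<phi>)"
  by (induction m) (auto simp: csupp_neg_lap)

lemma csupp_mult: "csupp \<phi> \<Longrightarrow> csupp (\<lambda>x. u x * \<phi> x)"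
  unfolding csupp_def by (metis mult_zero_right)

lemma csupp_translate: "csupp \<phi> \<Longrightarrow> csupp (\<lambda>x. \<phi> (x + a))"
proof -
  assume "csupp \<phi>"
  then obtain R where R: "\<And>x. R < norm x \<Longrightarrow> \<phi> x = 0" unfolding csupp_def by blast
  have "\<phi> (x + a) = 0" if "R + norm a < norm x" for x
    using that norm_triangle_ineq2[of x "-a"] by (intro R) simp
  then show ?thesis unfolding csupp_def by blast
qed

lemma csupp_bounded:
  assumes "continuous_on UNIV \<phi>" "csupp \<phi>"
  obtains R M where "R > 0" "M > 0" "\<And>x. R < norm x \<Longrightarrow> \<phi> x = 0" "\<And>x. \<bar>\<phi> x\<bar> \<le> M"
    "\<And>x. \<bar>\<phi> x\<bar> \<le> M * indicator (cball 0 R) x"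
proof -
  obtain R0 where R0: "\<And>x. R0 < norm x \<Longrightarrow> \<phi> x = 0" using assms unfolding csupp_def by blast
  define R where "R = max R0 1"
  have "bounded (\<phi> ` cball 0 R)"
    by (intro compact_imp_bounded compact_continuous_image continuous_on_subset[OF assms(1)]) auto
  then obtain M where M: "M > 0" "\<And>x. x \<in> cball 0 R \<Longrightarrow> \<bar>\<phi> x\<bar> \<le> M" unfolding bounded_pos by auto
  have out: "\<phi> x = 0" if "R < norm x" for x using that R0 by (auto simp: R_def)
  have "\<bar>\<phi> x\<bar> \<le> M * indicator (cball 0 R) x" for x
    using M out by (cases "x \<in> cball 0 R") auto
  moreover have "\<bar>\<phi> x\<bar> \<le> M" for x
    using M out by (cases "x \<in> cball 0 R") auto
  moreover have "R > 0" by (auto simp: R_def)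
  ultimately show thesis using that M(1) out by blast
qed

lemma integrable_indicator_cball: "integrable lborel (\<lambda>x. M * indicator (cball a R) x :: real)"
  for a :: "'a::euclidean_space"
proof -
  have "integrable lborel (indicator (cball a R) :: 'a \<Rightarrow> real)"
    using emeasure_lborel_cball_finite[of a R] by (intro integrable_real_indicator) (auto simp: borel_closed)
  then show ?thesis by (rule integrable_mult_right)
qed

lemma integrable_csupp:
  assumes "continuous_on UNIV \<phi>" "csupp \<phi>"
  shows "integrable lborel \<phi>"
proof -
  obtain R M where "R > 0" "M > 0" and M: "\<And>x. \<bar>\<phi> x\<bar> \<le> M * indicator (cball 0 R) x"
    using csupp_bounded[OF assms] by metis
  show ?thesis
    by (rule integrable_bound_real[OF integrable_indicator_cball _ M])
       (use assms(1) borel_measurable_continuous_onI in auto)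
qed

text \<open>The integral of \<open>w\<close> does not change when \<open>w\<close> is translated
  along the axis; the claim is the derivative of this fact under the integral sign.\<close>

lemma integral_partial_zero:
  assumes w: "Ck (Suc 0) w" "csupp w"
  shows "(LINT x|lborel. partial i w x) = 0"
proof -
  have p: "\<And>x. has_partial i w x" and c: "continuous_on UNIV w" "continuous_on UNIV (partial i w)"
    using w by (auto simp: Ck_Suc)
  obtain R M where R: "R > 0" and M: "M > 0" "\<And>x. \<bar>partial i w x\<bar> \<le> M * indicator (cball 0 R) x"
    using csupp_bounded[OF c(2) csupp_partial[OF w(2)]] by metis
  have "((\<lambda>t. LINT x|lborel. w (x + t *\<^sub>R axis i 1)) has_real_derivative (LINT x|lborel. partial i w (x + 0 *\<^sub>R axis i 1))) (at 0)"
  proof (rule integral_has_real_derivative[where d=1 and w="\<lambda>x. M * indicator (cball 0 (R + 1)) x"])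
    show "((\<lambda>t. w (x + t *\<^sub>R axis i 1)) has_real_derivative partial i w (x + t *\<^sub>R axis i 1)) (at t)" for t x
      by (rule has_partial_line[OF p])
    show "integrable lborel (\<lambda>x. w (x + t *\<^sub>R axis i 1))" for t
      using integrable_translate[of w "t *\<^sub>R axis i 1"] integrable_csupp[OF c(1) w(2)] by (simp add: add.commute)
    show "\<bar>partial i w (x + t *\<^sub>R axis i 1)\<bar> \<le> M * indicator (cball 0 (R + 1)) x" if "t \<in> ball 0 1" for t x
    proof (cases "norm x \<le> R + 1")
      case True
      have "\<bar>partial i w (x + t *\<^sub>R axis i 1)\<bar> \<le> M * 1"
        by (rule order_trans[OF M(2)]) (use M(1) in \<open>auto intro!: mult_left_mono simp: indicator_def\<close>)
      then show ?thesis using True by simp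
    next
      case False
      then have "R < norm (x + t *\<^sub>R axis i 1)"
        using norm_triangle_ineq2[of x "- (t *\<^sub>R axis i 1)"] that by (simp add: norm_axis_1)
      then have "partial i w (x + t *\<^sub>R axis i 1) = 0" using M(2)[of "x + t *\<^sub>R axis i 1"] by simp
      then show ?thesis using M(1) by simp
    qed
    show "integrable lborel (\<lambda>x::real^'a. M * indicator (cball 0 (R + 1)) x)"
      by (rule integrable_indicator_cball)
  qed simp
  moreover have "(LINT x|lborel. w (x + t *\<^sub>R axis i 1)) = (LINT x|lborel. w x)" for t
    using integral_translate[of w "t *\<^sub>R axis i 1"] by (simp add: add.commute)
  ultimately have "((\<lambda>t. LINT x|lborel. w x) has_real_derivative (LINT x|lborel. partial i w x)) (at 0)"
    by simp
  then show ?thesis using DERIV_unique DERIV_const by blast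
qed

lemma integral_by_parts:
  assumes u: "Ck (Suc 0) u" and \<phi>: "Ck (Suc 0) \<phi>" "csupp \<phi>"
  shows "(LINT x|lborel. partial i u x * \<phi> x) = - (LINT x|lborel. u x * partial i \<phi> x)"
proof -
  have p: "\<And>x. has_partial i u x" "\<And>x. has_partial i \<phi> x"
    and c: "continuous_on UNIV u" "continuous_on UNIV \<phi>" "continuous_on UNIV (partial i u)" "continuous_on UNIV (partial i \<phi>)"
    using assms by (auto simp: Ck_Suc)
  have "(LINT x|lborel. partial i (\<lambda>x. u x * \<phi> x) x) = 0"
    by (intro integral_partial_zero Ck_mult u \<phi> csupp_mult)
  then have "(LINT x|lborel. u x * partial i \<phi> x + partial i u x * \<phi> x) = 0"
    using partial_mult(2)[OF p] by simp
  moreover have "integrable lborel (\<lambda>x. u x * partial i \<phi> x)" "integrable lborel (\<lambda>x. partial i u x * \<phi> x)"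
    using c by (auto intro!: integrable_csupp continuous_intros csupp_mult csupp_partial \<phi>)
  ultimately show ?thesis by simp
qed

lemma green:
  assumes u: "Ck 2 u" and \<phi>: "Ck 2 \<phi>" "csupp \<phi>"
  shows "(LINT x|lborel. neg_lap u x * \<phi> x) = (LINT x|lborel. u x * neg_lap \<phi> x)"
proof -
  have C: "Ck (Suc 0) u" "Ck (Suc 0) \<phi>" "\<And>i. Ck (Suc 0) (partial i u)" "\<And>i. Ck (Suc 0) (partial i \<phi>)"
    using u \<phi>(1) by (auto simp: numeral_2_eq_2 Ck_Suc)
  then have cc: "\<And>i. continuous_on UNIV (partial i (partial i u))" "\<And>i. continuous_on UNIV (partial i (partial i \<phi>))"
    "continuous_on UNIV u" "continuous_on UNIV \<phi>"
    by (auto simp: Ck_Suc)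
  have "(LINT x|lborel. partial i (partial i u) x * \<phi> x) = (LINT x|lborel. u x * partial i (partial i \<phi>) x)" for i
    using integral_by_parts[OF C(3)[of i] C(2) \<phi>(2), of i] integral_by_parts[OF C(1) C(4)[of i] csupp_partial[OF \<phi>(2)], of i] by simp
  moreover have "integrable lborel (\<lambda>x. partial i (partial i u) x * \<phi> x)" "integrable lborel (\<lambda>x. u x * partial i (partial i \<phi>) x)" for i
    using cc by (auto intro!: integrable_csupp continuous_intros csupp_mult csupp_partial \<phi>)
  ultimately show ?thesis
    by (simp add: neg_lap_def sum_distrib_left sum_distrib_right)
qed

lemma green_pow:
  assumes "Ck (2 * m) u" "Ck (2 * m) \<phi>" "csupp \<phi>"
  shows "(LINT x|lborel. (neg_lap ^^ m) u x * \<phi> x) = (LINT x|lborel. u x * (neg_lap ^^ m) \<phi> x)"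
  using assms
proof (induction m arbitrary: \<phi>)
  case (Suc m)
  have "Ck 2 ((neg_lap ^^ m) u)" using Ck_neg_lap_pow[of m 2 u] Suc.prems(1) by simp
  moreover have "Ck 2 \<phi>" using Suc.prems(2) by (rule Ck_mono) simp
  ultimately have "(LINT x|lborel. (neg_lap ^^ Suc m) u x * \<phi> x) = (LINT x|lborel. (neg_lap ^^ m) u x * neg_lap \<phi> x)"
    using green[of "(neg_lap ^^ m) u" \<phi>] Suc.prems(3) by simp
  also have "\<dots> = (LINT x|lborel. u x * (neg_lap ^^ m) (neg_lap \<phi>) x)"
    using Suc.prems by (intro Suc.IH) (auto intro: Ck_mono[of "2 * Suc m"] Ck_neg_lap csupp_neg_lap)
  finally show ?case by (simp add: funpow_swap1)
qed simp

subsection \<open>Bump functions\<close>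

text \<open>A test function of finite smoothness, supported for \<open>e\<close> > 0 in the ball of
  radius sqrt(e). Its partial derivatives are coordinates times bumps of lower exponent, so
  \<open>N\<close> only has to exceed the number of derivatives that will be taken.\<close>

definition bump :: "nat \<Rightarrow> real \<Rightarrow> real^'n \<Rightarrow> real" where
  "bump N e z = max 0 (e - (norm z)\<^sup>2) ^ N"

lemma csupp_bump: "csupp (bump (Suc N) e)"
proof -
  have "bump (Suc N) e z = 0" if "\<bar>e\<bar> + 1 < norm z" for z :: "real^'a"
  proof -
    have "norm z \<le> (norm z)\<^sup>2" using that by (intro self_le_power) auto
    then show ?thesis using that by (simp add: bump_def)
  qed
  then show ?thesis unfolding csupp_def by blast
qed

lemma bump_deriv:
  "((\<lambda>r. max 0 (e - r) ^ Suc (Suc N)) has_real_derivative - (real (Suc (Suc N)) * max 0 (e - r) ^ Suc N)) (at r)"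
proof (cases r e rule: linorder_cases)
  case less
  have "((\<lambda>r. (e - r) ^ Suc (Suc N)) has_real_derivative - (real (Suc (Suc N)) * max 0 (e - r) ^ Suc N)) (at r)"
  proof -
    have "((\<lambda>r. e - r) has_real_derivative -1) (at r)" by (auto intro!: derivative_eq_intros)
    from DERIV_power[OF this, of "Suc (Suc N)"] show ?thesis using less by (simp add: algebra_simps)
  qed
  then show ?thesis
    by (rule has_field_derivative_transform_within[where d="e - r"]) (use less in \<open>auto simp: dist_real_def max_def\<close>)
next
  case greater
  have "((\<lambda>r. 0) has_real_derivative - (real (Suc (Suc N)) * max 0 (e - r) ^ Suc N)) (at r)"
    using greater by simp
  then show ?thesis
    by (rule has_field_derivative_transform_within[where d="r - e"]) (use greater in \<open>auto simp: dist_real_def max_def\<close>)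
next
  case equal
  have "((\<lambda>h::real. (max 0 (- h)) ^ Suc (Suc N) / h) \<longlongrightarrow> 0) (at 0)"
  proof (rule Lim_null_comparison)
    have "norm (max 0 (- h) ^ Suc (Suc N) / h) \<le> \<bar>h\<bar> ^ Suc N" if "h \<noteq> 0" for h :: real
    proof -
      have "\<bar>max 0 (- h) ^ Suc (Suc N)\<bar> \<le> \<bar>h\<bar> ^ Suc (Suc N)"
        unfolding power_abs by (intro power_mono) auto
      then show ?thesis using that by (simp add: divide_le_eq mult_ac)
    qed
    then show "\<forall>\<^sub>F h in at 0. norm (max 0 (- h) ^ Suc (Suc N) / h) \<le> \<bar>h\<bar> ^ Suc N"
      by (auto simp: eventually_at intro!: exI[of _ 1])
    show "((\<lambda>h::real. \<bar>h\<bar> ^ Suc N) \<longlongrightarrow> 0) (at 0)"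
      by (auto intro!: tendsto_eq_intros)
  qed
  then show ?thesis using equal by (simp add: DERIV_def)
qed

lemma continuous_bump: "continuous_on UNIV (bump N e)"
  unfolding bump_def[abs_def] by (intro continuous_intros)

lemma Ck_bump: "Ck k (bump (k + Suc N) e :: real^'n \<Rightarrow> real)"
proof (induction k)
  case 0
  then show ?case by (simp add: continuous_bump)
next
  case (Suc k)
  define c where "c = real (Suc (Suc (k + N)))"
  have d: "((\<lambda>r. max 0 (e - r) ^ (Suc k + Suc N)) has_real_derivative - (c * max 0 (e - r) ^ (k + Suc N))) (at r)" for r
    using bump_deriv[of e "k + N" r] by (simp add: c_def)
  have "partial i (bump (Suc k + Suc N) e) = (\<lambda>z::real^'n. (2 * (z $ i)) * - (c * bump (k + Suc N) e z))" for i
    using partial_radial(2)[OF d] by (auto simp: bump_def[abs_def])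
  moreover have "Ck k (\<lambda>z::real^'n. (2 * (z $ i)) * - (c * bump (k + Suc N) e z))" for i
    by (intro Ck_mult[OF Ck_cmult[OF Ck_component]] Ck_minus Ck_cmult Suc)
  moreover have "has_partial i (bump (Suc k + Suc N) e) z" for i and z :: "real^'n"
    using partial_radial(1)[OF d] by (simp add: bump_def[abs_def])
  ultimately show ?case unfolding Ck_Suc using continuous_bump by metis
qed

text \<open>If \<open>A x\<close> were nonzero, \<open>A\<close> would keep its sign on a ball
  around \<open>x\<close>, and the bump supported in that ball would have a nonzero average. This
  recovers a pointwise identity from its averaged versions.\<close>

lemma bump_test_zero:
  fixes A :: "real^'n \<Rightarrow> real"
  assumes A: "continuous_on UNIV A" and zero: "\<And>e. e > 0 \<Longrightarrow> (LINT w|lborel. bump (Suc N) e w * A (x + w)) = 0"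
  shows "A x = 0"
proof (rule ccontr)
  assume nz: "A x \<noteq> 0"
  define s where "s = sgn (A x)"
  have sA: "s * A x > 0" using nz by (simp add: s_def sgn_if)
  have "continuous_on UNIV (\<lambda>w. s * A (x + w))"
    by (intro continuous_intros continuous_on_compose2[OF A]) auto
  then have "isCont (\<lambda>w. s * A (x + w)) 0" by (simp add: continuous_on_eq_continuous_at)
  then have "\<forall>\<^sub>F w in at 0. s * A (x + w) > 0"
    using sA by (intro order_tendstoD(1)[of _ "s * A (x + 0)"]) (auto simp: isCont_def)
  then obtain d where d: "d > 0" "\<And>w. w \<noteq> 0 \<Longrightarrow> norm w < d \<Longrightarrow> s * A (x + w) > 0"
    unfolding eventually_at by (auto simp: dist_norm)
  then have pos: "s * A (x + w) > 0" if "norm w < d" for w using sA that by (cases "w = 0") auto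
  define h where "h w = bump (Suc N) (d\<^sup>2) w * (s * A (x + w))" for w
  have c: "continuous_on UNIV h" unfolding h_def[abs_def]
    by (intro continuous_intros continuous_bump continuous_on_compose2[OF A]) auto
  have out: "bump (Suc N) (d\<^sup>2) w = 0" if "norm w \<ge> d" for w :: "real^'n"
  proof -
    have "d\<^sup>2 \<le> (norm w)\<^sup>2" using that d by (intro power_mono) auto
    then show ?thesis by (simp add: bump_def)
  qed
  have nn: "h w \<ge> 0" for w
  proof (cases "norm w < d")
    case True
    then show ?thesis using pos[OF True] by (simp add: h_def bump_def)
  next
    case False
    then show ?thesis using out[of w] by (simp add: h_def)
  qed
  have hpos: "h w > 0" if "norm w < d" for w
  proof -
    have "(norm w)\<^sup>2 < d\<^sup>2" using that by (intro power_strict_mono) auto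
    then show ?thesis using pos[OF that] by (simp add: h_def bump_def)
  qed
  have cs: "csupp h" unfolding csupp_def h_def using out by (intro exI[of _ d]) auto
  have "(LINT w|lborel. h w) = s * (LINT w|lborel. bump (Suc N) (d\<^sup>2) w * A (x + w))"
  proof -
    have "h = (\<lambda>w. s * (bump (Suc N) (d\<^sup>2) w * A (x + w)))" by (simp add: h_def fun_eq_iff)
    then show ?thesis by simp
  qed
  then have "(LINT w|lborel. h w) = 0" using zero[of "d\<^sup>2"] d by simp
  then have "AE w in lborel. h w = 0"
    using integral_nonneg_eq_0_iff_AE[OF integrable_csupp[OF c cs]] nn by simp
  then have "AE w in lborel. w \<notin> ball (0::real^'n) d"
    by (rule eventually_mono) (use hpos in force)
  then have "emeasure lborel (ball (0::real^'n) d) = 0"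
    by (subst (asm) AE_iff_measurable[where N="ball 0 d"]) auto
  then show False using content_ball_pos[OF d(1), of "0::real^'n"]
    unfolding measure_def by simp
qed

subsection \<open>Differentiability\<close>

text \<open>The increment from \<open>x\<close> is reached one coordinate at a time; along each axis
  the mean value inequality is applied to \<open>g\<close> minus its linear part, whose derivative
  is small near \<open>x\<close> by continuity of the partial derivatives.\<close>

lemma Ck_1_has_derivative:
  fixes g :: "real^'n \<Rightarrow> real"
  assumes g: "Ck (Suc 0) g"
  shows "(g has_derivative (\<lambda>h. \<Sum>i\<in>UNIV. h $ i * partial i g x)) (at x)"
proof -
  have p: "\<And>i x. has_partial i g x" and c: "\<And>i. continuous_on UNIV (partial i g)"
    using g by (auto simp: Ck_Suc)
  let ?n = "real CARD('n)"
  have lin: "bounded_linear (\<lambda>h::real^'n. \<Sum>i\<in>UNIV. h $ i * partial i g x)"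
    by (intro bounded_linear_sum bounded_linear_mult_const bounded_linear_vec_nth)
  have key: "\<exists>d>0. \<forall>y. norm (y - x) < d \<longrightarrow> norm (g y - g x - (\<Sum>i\<in>UNIV. (y - x) $ i * partial i g x)) \<le> e * norm (y - x)" if e: "e > 0" for e
  proof -
    have "\<exists>d>0. \<forall>y. norm (y - x) < d \<longrightarrow> \<bar>partial i g y - partial i g x\<bar> \<le> e / ?n" for i
    proof -
      have "isCont (partial i g) x" using c by (simp add: continuous_on_eq_continuous_at)
      then obtain d where "d > 0" "\<And>y. dist y x < d \<Longrightarrow> dist (partial i g y) (partial i g x) < e / ?n"
        using e unfolding continuous_at_eps_delta by (metis divide_pos_pos of_nat_0_less_iff zero_less_card_finite)
      then show ?thesis by (intro exI[of _ d]) (auto simp: dist_norm less_imp_le)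
    qed
    then obtain d where d: "\<And>i. d i > 0" "\<And>i y. norm (y - x) < d i \<Longrightarrow> \<bar>partial i g y - partial i g x\<bar> \<le> e / ?n" by metis
    define D where "D = Min (range d)"
    have D: "D > 0" "\<And>i y. norm (y - x) < D \<Longrightarrow> \<bar>partial i g y - partial i g x\<bar> \<le> e / ?n"
      unfolding D_def using d by (auto simp: Min_gr_iff)
    \<comment> \<open>\<open>hS h S\<close> keeps the coordinates of \<open>h\<close> in
      \<open>S\<close>, so adding one index to \<open>S\<close> moves along one axis. All
      intermediate points stay within distance |h| of \<open>x\<close>.\<close>
    define hS where "hS h S = (\<chi> i. if i \<in> S then h $ i else 0)" for h :: "real^'n" and S
    have hS_le: "norm (hS h S) \<le> norm h" for h S
      by (rule norm_le_componentwise_cart) (simp add: hS_def)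
    have tele: "\<bar>g (x + hS h S) - g x - (\<Sum>i\<in>S. h $ i * partial i g x)\<bar> \<le> (\<Sum>i\<in>S. \<bar>h $ i\<bar> * (e / ?n))" if h: "norm h < D" for h S
      using finite[of S]
    proof (induction S rule: finite_induct)
      case empty
      have "hS h {} = 0" by (simp add: hS_def vec_eq_iff)
      then show ?case by simp
    next
      case (insert j S)
      let ?y = "\<lambda>t. x + hS h S + t *\<^sub>R axis j 1"
      have ins: "hS h (insert j S) = hS h S + h $ j *\<^sub>R axis j 1"
        using insert by (auto simp: hS_def vec_eq_iff axis_def)
      have small: "norm (?y t - x) < D" if "\<bar>t\<bar> \<le> \<bar>h $ j\<bar>" for t
      proof -
        have "norm (hS h S + t *\<^sub>R axis j 1) \<le> norm (hS h (insert j S))"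
          using insert that by (intro norm_le_componentwise_cart) (auto simp: hS_def axis_def)
        then show ?thesis using hS_le[of h "insert j S"] h by (simp add: algebra_simps)
      qed
      have "norm ((\<lambda>t. g (?y t) - t * partial j g x) (h $ j) - (\<lambda>t. g (?y t) - t * partial j g x) 0) \<le> (e / ?n) * norm (h $ j - 0)"
      proof (rule field_differentiable_bound[of "{- \<bar>h $ j\<bar> .. \<bar>h $ j\<bar>}" _ "\<lambda>t. partial j g (?y t) - partial j g x"])
        show "((\<lambda>t. g (?y t) - t * partial j g x) has_field_derivative partial j g (?y t) - partial j g x) (at t within {- \<bar>h $ j\<bar> .. \<bar>h $ j\<bar>})" for t
          by (rule has_field_derivative_at_within) (auto intro!: derivative_eq_intros has_partial_line p)
        show "norm (partial j g (?y t) - partial j g x) \<le> e / ?n" if "t \<in> {- \<bar>h $ j\<bar> .. \<bar>h $ j\<bar>}" for t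
          using D(2)[OF small[of t]] that by (auto simp: abs_le_iff)
      qed auto
      then have "\<bar>g (x + hS h (insert j S)) - g (x + hS h S) - h $ j * partial j g x\<bar> \<le> \<bar>h $ j\<bar> * (e / ?n)"
        by (simp add: ins algebra_simps)
      then show ?case using insert by (simp add: algebra_simps)
    qed
    have "norm (g y - g x - (\<Sum>i\<in>UNIV. (y - x) $ i * partial i g x)) \<le> e * norm (y - x)" if y: "norm (y - x) < D" for y
    proof -
      have "hS (y - x) UNIV = y - x" by (simp add: hS_def vec_eq_iff)
      then have "norm (g y - g x - (\<Sum>i\<in>UNIV. (y - x) $ i * partial i g x)) \<le> (\<Sum>i\<in>UNIV. \<bar>(y - x) $ i\<bar> * (e / ?n))"
        using tele[OF y, of UNIV] by simp
      also have "\<dots> \<le> (\<Sum>i\<in>(UNIV::'n set). norm (y - x) * (e / ?n))"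
        using e by (intro sum_mono mult_right_mono component_le_norm_cart) auto
      finally show ?thesis by (simp add: mult_ac)
    qed
    then show ?thesis using D(1) by blast
  qed
  show ?thesis
    unfolding has_derivative_at_alt using lin key by blast
qed

lemma Ck_1_line_derivative:
  fixes g :: "real^'n \<Rightarrow> real"
  assumes g: "Ck (Suc 0) g"
  shows "((\<lambda>s. g (x + s *\<^sub>R z)) has_real_derivative (\<Sum>i\<in>UNIV. z $ i * partial i g (x + s *\<^sub>R z))) (at s)"
proof -
  have 1: "((\<lambda>s. x + s *\<^sub>R z) has_derivative (\<lambda>h. h *\<^sub>R z)) (at s)"
    by (auto intro!: derivative_eq_intros)
  have "((\<lambda>s. g (x + s *\<^sub>R z)) has_derivative (\<lambda>h. \<Sum>i\<in>UNIV. (h *\<^sub>R z) $ i * partial i g (x + s *\<^sub>R z))) (at s)"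
    by (rule has_derivative_compose[OF 1 Ck_1_has_derivative[OF g]])
  moreover have "(\<lambda>h. \<Sum>i\<in>UNIV. (h *\<^sub>R z) $ i * partial i g (x + s *\<^sub>R z)) = times (\<Sum>i\<in>UNIV. z $ i * partial i g (x + s *\<^sub>R z))"
    by (rule ext) (simp add: sum_distrib_left mult_ac)
  ultimately show ?thesis by (simp add: has_field_derivative_def)
qed

section \<open>Second differences\<close>

text \<open>The numerator of the fractional Laplacian after averaging over z and -z, with its sign.
  The terms of first order in z cancel, so the integral converges absolutely where the one-sided
  difference would need a principal value.\<close>

definition d2 :: "('a::ab_group_add \<Rightarrow> real) \<Rightarrow> 'a \<Rightarrow> 'a \<Rightarrow> real" where
  "d2 w x z = 2 * w x - w (x + z) - w (x - z)"

text \<open>One condition for both ranges of 2 \<gamma>: a bound on second differences expresses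
  regularity of any order \<sigma> up to 2 without mentioning derivatives. It is local in
  \<open>x\<close>, as the constant depends on \<open>R\<close>.\<close>

definition holder2 :: "real \<Rightarrow> 'n::finite fn \<Rightarrow> bool" where
  "holder2 \<sigma> w \<longleftrightarrow> (\<forall>R. \<exists>C\<ge>0. \<forall>x z. norm x \<le> R \<longrightarrow> norm z \<le> 1 \<longrightarrow> \<bar>d2 w x z\<bar> \<le> C * norm z powr \<sigma>)"

lemma holder2_mono:
  assumes "holder2 \<sigma> w" "\<tau> \<le> \<sigma>"
  shows "holder2 \<tau> w"
  unfolding holder2_def
proof
  fix R
  obtain C where C: "C \<ge> 0" "\<And>x z. norm x \<le> R \<Longrightarrow> norm z \<le> 1 \<Longrightarrow> \<bar>d2 w x z\<bar> \<le> C * norm z powr \<sigma>"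
    using assms(1) unfolding holder2_def by blast
  have "\<bar>d2 w x z\<bar> \<le> C * norm z powr \<tau>" if "norm x \<le> R" "norm z \<le> 1" for x z
  proof -
    have "norm z powr \<sigma> \<le> norm z powr \<tau>"
    proof (cases "z = 0")
      case False
      then show ?thesis using that assms(2) by (intro powr_mono') auto
    qed simp
    then show ?thesis using C(2)[OF that] C(1) by (meson mult_left_mono order_trans)
  qed
  with C(1) show "\<exists>C\<ge>0. \<forall>x z. norm x \<le> R \<longrightarrow> norm z \<le> 1 \<longrightarrow> \<bar>d2 w x z\<bar> \<le> C * norm z powr \<tau>" by blast
qed

lemma loc_holderE:
  assumes "loc_holder \<alpha> g"
  obtains C where "C \<ge> 0" "\<And>x y. norm x \<le> R \<Longrightarrow> norm y \<le> R \<Longrightarrow> \<bar>g x - g y\<bar> \<le> C * norm (x - y) powr \<alpha>"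
proof -
  obtain C where C: "\<And>x y. x \<in> cball 0 R \<Longrightarrow> y \<in> cball 0 R \<Longrightarrow> \<bar>g x - g y\<bar> \<le> C * dist x y powr \<alpha>"
    using spec[OF assms[unfolded loc_holder_def], of "cball 0 R"] compact_cball by meson
  \<comment> \<open>The constant in \<open>loc_holder\<close> carries no sign, for instance when the
    compact set is a single point; it is replaced by a nonnegative one.\<close>
  have "\<bar>g x - g y\<bar> \<le> max C 0 * norm (x - y) powr \<alpha>" if "norm x \<le> R" "norm y \<le> R" for x y
  proof -
    have "\<bar>g x - g y\<bar> \<le> C * dist x y powr \<alpha>" using C that by simp
    also have "\<dots> \<le> max C 0 * dist x y powr \<alpha>" by (intro mult_right_mono) auto
    finally show ?thesis by (simp add: dist_norm)
  qed
  then show thesis using that[of "max C 0"] by simp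
qed

lemma loc_holder_imp_holder2:
  assumes "loc_holder \<alpha> w"
  shows "holder2 \<alpha> w"
  unfolding holder2_def
proof
  fix R
  obtain C where C: "C \<ge> 0" "\<And>x y. norm x \<le> R + 1 \<Longrightarrow> norm y \<le> R + 1 \<Longrightarrow> \<bar>w x - w y\<bar> \<le> C * norm (x - y) powr \<alpha>"
    using loc_holderE[OF assms, of "R + 1"] by blast
  have "\<bar>d2 w x z\<bar> \<le> (2 * C) * norm z powr \<alpha>" if "norm x \<le> R" "norm z \<le> 1" for x z
  proof -
    have "\<bar>w x - w (x + z)\<bar> \<le> C * norm z powr \<alpha>"
      using C(2)[of x "x + z"] that norm_triangle_ineq[of x z] by simp
    moreover have "\<bar>w x - w (x - z)\<bar> \<le> C * norm z powr \<alpha>"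
      using C(2)[of x "x - z"] that norm_triangle_ineq4[of x z] by simp
    ultimately show ?thesis unfolding d2_def by linarith
  qed
  then show "\<exists>C\<ge>0. \<forall>x z. norm x \<le> R \<longrightarrow> norm z \<le> 1 \<longrightarrow> \<bar>d2 w x z\<bar> \<le> C * norm z powr \<alpha>"
    using C(1) by (intro exI[of _ "2 * C"]) auto
qed

lemma Ck_1_loc_holder:
  fixes g :: "real^'n \<Rightarrow> real"
  assumes g: "Ck (Suc 0) g"
  shows "loc_holder 1 g"
  unfolding loc_holder_def
proof (intro allI impI)
  fix K :: "(real^'n) set" assume "compact K"
  then obtain R where R: "\<And>x. x \<in> K \<Longrightarrow> norm x \<le> R" using compact_imp_bounded bounded_iff by metis
  have c: "\<And>i. continuous_on UNIV (partial i g)" using g by (auto simp: Ck_Suc)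
  have "\<exists>M. \<forall>x\<in>cball 0 R. \<bar>partial i g x\<bar> \<le> M" for i
  proof -
    have "bounded (partial i g ` cball 0 R)"
      by (intro compact_imp_bounded compact_continuous_image continuous_on_subset[OF c]) auto
    then show ?thesis unfolding bounded_iff by auto
  qed
  then obtain M where M: "\<And>i x. x \<in> cball 0 R \<Longrightarrow> \<bar>partial i g x\<bar> \<le> M i" by metis
  have "\<bar>g x - g y\<bar> \<le> (\<Sum>i\<in>UNIV. \<bar>M i\<bar>) * dist x y powr 1" if "x \<in> K" "y \<in> K" for x y
  proof -
    have "norm ((\<lambda>s. g (x + s *\<^sub>R (y - x))) 1 - (\<lambda>s. g (x + s *\<^sub>R (y - x))) 0) \<le> (\<Sum>i\<in>UNIV. \<bar>M i\<bar> * norm (y - x)) * norm (1 - 0::real)"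
    proof (rule field_differentiable_bound[of "{0..1}"])
      show "((\<lambda>s. g (x + s *\<^sub>R (y - x))) has_field_derivative (\<Sum>i\<in>UNIV. (y - x) $ i * partial i g (x + s *\<^sub>R (y - x)))) (at s within {0..1})" for s
        by (rule has_field_derivative_at_within[OF Ck_1_line_derivative[OF g]])
      show "norm (\<Sum>i\<in>UNIV. (y - x) $ i * partial i g (x + s *\<^sub>R (y - x))) \<le> (\<Sum>i\<in>UNIV. \<bar>M i\<bar> * norm (y - x))" if s: "s \<in> {0..1}" for s
      proof (rule sum_norm_le)
        fix i
        have "x + s *\<^sub>R (y - x) = (1 - s) *\<^sub>R x + s *\<^sub>R y" by (simp add: algebra_simps)
        moreover have "(1 - s) *\<^sub>R x + s *\<^sub>R y \<in> cball 0 R"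
          using s R[OF \<open>x \<in> K\<close>] R[OF \<open>y \<in> K\<close>] by (intro convexD[OF convex_cball]) auto
        ultimately have "\<bar>partial i g (x + s *\<^sub>R (y - x))\<bar> \<le> \<bar>M i\<bar>" using M[of "x + s *\<^sub>R (y - x)" i] by simp
        then have "\<bar>(y - x) $ i\<bar> * \<bar>partial i g (x + s *\<^sub>R (y - x))\<bar> \<le> norm (y - x) * \<bar>M i\<bar>"
          by (intro mult_mono component_le_norm_cart) auto
        then show "norm ((y - x) $ i * partial i g (x + s *\<^sub>R (y - x))) \<le> \<bar>M i\<bar> * norm (y - x)"
          unfolding real_norm_def abs_mult by (simp only: mult.commute)
      qed
    qed auto
    then show ?thesis by (simp add: sum_distrib_right[symmetric] dist_norm norm_minus_commute abs_minus_commute)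
  qed
  then show "\<exists>C. \<forall>x\<in>K. \<forall>y\<in>K. \<bar>g x - g y\<bar> \<le> C * dist x y powr 1" by blast
qed

text \<open>The function w(x + s z) + w(x - s z) has as s-derivative the scalar product of z with a
  difference of gradients at points 2 s |z| apart, which is of order |z|^(1+\<alpha>). The mean
  value inequality on [0, 1] then bounds \<open>d2\<close>.\<close>

lemma C1_holder2:
  fixes w :: "real^'n \<Rightarrow> real"
  assumes w: "Ck (Suc 0) w" and h: "\<And>i. loc_holder \<alpha> (partial i w)" and \<alpha>: "\<alpha> > 0"
  shows "holder2 (1 + \<alpha>) w"
  unfolding holder2_def
proof
  fix R
  have "\<exists>C\<ge>0. \<forall>x y. norm x \<le> R + 1 \<longrightarrow> norm y \<le> R + 1 \<longrightarrow> \<bar>partial i w x - partial i w y\<bar> \<le> C * norm (x - y) powr \<alpha>" for i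
    using loc_holderE[OF h[of i], of "R + 1"] by metis
  then obtain C where C: "\<And>i. C i \<ge> 0" "\<And>i x y. norm x \<le> R + 1 \<Longrightarrow> norm y \<le> R + 1 \<Longrightarrow> \<bar>partial i w x - partial i w y\<bar> \<le> C i * norm (x - y) powr \<alpha>"
    by metis
  define M where "M = (\<Sum>i\<in>UNIV. C i * 2 powr \<alpha>)"
  have "\<bar>d2 w x z\<bar> \<le> M * norm z powr (1 + \<alpha>)" if x: "norm x \<le> R" and z: "norm z \<le> 1" for x z
  proof -
    define f where "f s = w (x + s *\<^sub>R z) + w (x + s *\<^sub>R (- z))" for s
    have "norm (f 1 - f 0) \<le> (\<Sum>i\<in>UNIV. norm z * (C i * (2 powr \<alpha> * norm z powr \<alpha>))) * norm (1 - 0::real)"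
    proof (rule field_differentiable_bound[of "{0..1}"])
      show "(f has_field_derivative (\<Sum>i\<in>UNIV. z $ i * partial i w (x + s *\<^sub>R z)) + (\<Sum>i\<in>UNIV. (- z) $ i * partial i w (x + s *\<^sub>R (- z)))) (at s within {0..1})" for s
        unfolding f_def by (rule has_field_derivative_at_within[OF DERIV_add[OF Ck_1_line_derivative[OF w] Ck_1_line_derivative[OF w]]])
      show "norm ((\<Sum>i\<in>UNIV. z $ i * partial i w (x + s *\<^sub>R z)) + (\<Sum>i\<in>UNIV. (- z) $ i * partial i w (x + s *\<^sub>R (- z)))) \<le> (\<Sum>i\<in>UNIV. norm z * (C i * (2 powr \<alpha> * norm z powr \<alpha>)))" if s: "s \<in> {0..1}" for s
      proof -
        have "(\<Sum>i\<in>UNIV. z $ i * partial i w (x + s *\<^sub>R z)) + (\<Sum>i\<in>UNIV. (- z) $ i * partial i w (x + s *\<^sub>R (- z))) =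
            (\<Sum>i\<in>UNIV. z $ i * (partial i w (x + s *\<^sub>R z) - partial i w (x + s *\<^sub>R (- z))))"
          by (simp add: sum.distrib[symmetric] algebra_simps sum_subtractf sum_negf)
        moreover have "norm (\<Sum>i\<in>UNIV. z $ i * (partial i w (x + s *\<^sub>R z) - partial i w (x + s *\<^sub>R (- z)))) \<le> (\<Sum>i\<in>UNIV. norm z * (C i * (2 powr \<alpha> * norm z powr \<alpha>)))"
        proof (rule sum_norm_le)
          fix i
          have sz: "norm (s *\<^sub>R z) \<le> 1" using s z mult_mono[of s 1 "norm z" 1] by simp
          have 1: "norm (x + s *\<^sub>R z) \<le> R + 1" "norm (x + s *\<^sub>R (- z)) \<le> R + 1"
            using norm_triangle_ineq[of x "s *\<^sub>R z"] norm_triangle_ineq4[of x "s *\<^sub>R z"] sz x by auto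
          have "norm (x + s *\<^sub>R z - (x + s *\<^sub>R (- z))) = 2 * s * norm z"
          proof -
            have "(2 * s) *\<^sub>R z = s *\<^sub>R z + s *\<^sub>R z" using scaleR_left_distrib[of s s z] by (simp only: mult_2)
            then have "x + s *\<^sub>R z - (x + s *\<^sub>R (- z)) = (2 * s) *\<^sub>R z" by simp
            then have "norm (x + s *\<^sub>R z - (x + s *\<^sub>R (- z))) = \<bar>2 * s\<bar> * norm z" by (simp only: norm_scaleR)
            then show ?thesis using s by simp
          qed
          also have "\<dots> \<le> 2 * norm z" using s by (simp add: mult_left_le_one_le)
          finally have "norm (x + s *\<^sub>R z - (x + s *\<^sub>R (- z))) powr \<alpha> \<le> (2 * norm z) powr \<alpha>"
            using \<alpha> by (intro powr_mono2) auto
          then have "\<bar>partial i w (x + s *\<^sub>R z) - partial i w (x + s *\<^sub>R (- z))\<bar> \<le> C i * (2 powr \<alpha> * norm z powr \<alpha>)"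
            using C(2)[OF 1, of i] C(1)[of i] by (simp add: powr_mult) (meson mult_left_mono order_trans)
          then have "\<bar>z $ i\<bar> * \<bar>partial i w (x + s *\<^sub>R z) - partial i w (x + s *\<^sub>R (- z))\<bar> \<le> norm z * (C i * (2 powr \<alpha> * norm z powr \<alpha>))"
            by (intro mult_mono component_le_norm_cart) auto
          then show "norm (z $ i * (partial i w (x + s *\<^sub>R z) - partial i w (x + s *\<^sub>R (- z)))) \<le> norm z * (C i * (2 powr \<alpha> * norm z powr \<alpha>))"
            by (simp only: real_norm_def abs_mult)
        qed
        ultimately show ?thesis by simp
      qed
    qed auto
    also have "(\<Sum>i\<in>UNIV. norm z * (C i * (2 powr \<alpha> * norm z powr \<alpha>))) * norm (1 - 0::real) = M * (norm z * norm z powr \<alpha>)"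
      by (simp add: M_def sum_distrib_left sum_distrib_right mult_ac)
    also have "norm z * norm z powr \<alpha> = norm z powr (1 + \<alpha>)"
      by (cases "z = 0") (auto simp: powr_add)
    finally show ?thesis by (simp add: f_def d2_def algebra_simps)
  qed
  moreover have "M \<ge> 0" unfolding M_def using C(1) by (intro sum_nonneg) auto
  ultimately show "\<exists>C\<ge>0. \<forall>x z. norm x \<le> R \<longrightarrow> norm z \<le> 1 \<longrightarrow> \<bar>d2 w x z\<bar> \<le> C * norm z powr (1 + \<alpha>)" by blast
qed

lemma Ck_2_holder2:
  assumes "Ck (Suc (Suc 0)) w"
  shows "holder2 2 w"
proof -
  have "Ck (Suc 0) w" using assms by (rule Ck_mono) simp
  moreover have "loc_holder 1 (partial i w)" for i
    using assms by (intro Ck_1_loc_holder) (simp add: Ck_Suc)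
  ultimately show ?thesis using C1_holder2[of w 1] by simp
qed

text \<open>Unifies the cases of the integer part of 2 \<gamma>. The exponent 2 \<gamma> + \<eta> is
  kept at most 1 when 2 \<gamma> < 1 and at most 2 otherwise, so that derivatives of order less than
  \<open>k\<close>, about which only one or two continuous derivatives are known, satisfy the same
  bound as those of order \<open>k\<close>.\<close>

lemma Ck_alpha_holder2:
  fixes v :: "real^'n \<Rightarrow> real"
  assumes v: "Ck_alpha_loc (k + nat \<lfloor>2 * \<gamma>\<rfloor>) (2 * \<gamma> - of_int \<lfloor>2 * \<gamma>\<rfloor> + \<epsilon>) v"
    and \<gamma>: "0 < \<gamma>" "\<gamma> < 1" and \<epsilon>: "\<epsilon> > 0"
  shows "\<exists>\<eta>. 0 < \<eta> \<and> \<eta> < 1 \<and> (\<forall>is. length is \<le> k \<longrightarrow> holder2 (2 * \<gamma> + \<eta>) (pderivs is v))"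
proof (cases "2 * \<gamma> < 1")
  case True
  then have fl: "\<lfloor>2 * \<gamma>\<rfloor> = 0" using \<gamma> by linarith
  have C: "Ck k v" and H: "\<And>is. length is = k \<Longrightarrow> loc_holder (2 * \<gamma> + \<epsilon>) (pderivs is v)"
    using v unfolding Ck_alpha_loc_def fl by auto
  define \<eta> where "\<eta> = min \<epsilon> (1 - 2 * \<gamma>) / 2"
  have \<eta>: "0 < \<eta>" "\<eta> < 1" "2 * \<gamma> + \<eta> \<le> 2 * \<gamma> + \<epsilon>" "2 * \<gamma> + \<eta> \<le> 1"
    using True \<gamma> \<epsilon> by (auto simp: \<eta>_def min_def field_simps)
  have "holder2 (2 * \<gamma> + \<eta>) (pderivs is v)" if "length is \<le> k" for "is"
  proof (cases "length is = k")
    case True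
    then show ?thesis using holder2_mono[OF loc_holder_imp_holder2[OF H]] \<eta> by blast
  next
    case False
    then have "Ck (Suc 0) (pderivs is v)" using that by (intro Ck_pderivs Ck_mono[OF C]) simp
    then show ?thesis using holder2_mono[OF loc_holder_imp_holder2[OF Ck_1_loc_holder]] \<eta> by blast
  qed
  with \<eta> show ?thesis by blast
next
  case False
  then have fl: "\<lfloor>2 * \<gamma>\<rfloor> = 1" using \<gamma> by linarith
  have C: "Ck (Suc k) v" and H: "\<And>is. length is = Suc k \<Longrightarrow> loc_holder (2 * \<gamma> - 1 + \<epsilon>) (pderivs is v)"
    using v unfolding Ck_alpha_loc_def fl by auto
  define \<eta> where "\<eta> = min \<epsilon> (2 - 2 * \<gamma>) / 2"
  have \<eta>: "0 < \<eta>" "\<eta> < 1" "2 * \<gamma> + \<eta> \<le> 1 + (2 * \<gamma> - 1 + \<epsilon>)" "2 * \<gamma> + \<eta> \<le> 1 + 1"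
    using False \<gamma> \<epsilon> by (auto simp: \<eta>_def min_def field_simps)
  have "holder2 (2 * \<gamma> + \<eta>) (pderivs is v)" if l: "length is \<le> k" for "is"
  proof -
    have C1: "Ck (Suc 0) (pderivs is v)" using l by (intro Ck_pderivs Ck_mono[OF C]) simp
    show ?thesis
    proof (cases "length is = k")
      case True
      have "loc_holder (2 * \<gamma> - 1 + \<epsilon>) (partial i (pderivs is v))" for i
        using H[of "i # is"] True by simp
      then show ?thesis using holder2_mono[OF C1_holder2[OF C1]] \<eta> False \<epsilon> by force
    next
      case False
      have "Ck (Suc (Suc 0)) (pderivs is v)" using l False by (intro Ck_pderivs Ck_mono[OF C]) simp
      then show ?thesis using holder2_mono[OF Ck_2_holder2] \<eta> by simp
    qed
  qed
  with \<eta> show ?thesis by blast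
qed

section \<open>The weighted space\<close>

text \<open>The class \<open>L_s\<close> with the weight 1/(1 + |y|^b) exchanged for the comparable
  (1 + |y|)^(-b), for which \<open>peetre\<close> holds. The exponent is free because
  \<open>F\<close> is placed in the class with b = n + 1.\<close>

definition wint :: "real \<Rightarrow> 'n::finite fn \<Rightarrow> bool" where
  "wint b v \<longleftrightarrow> v \<in> borel_measurable borel \<and> integrable lborel (\<lambda>y. \<bar>v y\<bar> * (1 + norm y) powr (- b))"

definition wnorm :: "real \<Rightarrow> 'n::finite fn \<Rightarrow> real" where
  "wnorm b v = (LINT y|lborel. \<bar>v y\<bar> * (1 + norm y) powr (- b))"

lemma wnorm_nonneg: "0 \<le> wnorm b v"
  unfolding wnorm_def by (intro integral_nonneg_AE) auto

lemma L_s_wint: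
  fixes v :: "real^'n \<Rightarrow> real"
  assumes v: "v \<in> L_s \<gamma>" and \<gamma>: "0 \<le> \<gamma>"
  shows "wint (real CARD('n) + 2 * \<gamma>) v"
proof -
  let ?b = "real CARD('n) + 2 * \<gamma>"
  have i: "integrable lborel (\<lambda>x. \<bar>v x\<bar> / (1 + norm x powr ?b))" and [measurable]: "v \<in> borel_measurable borel"
    using v by (auto simp: L_s_def)
  have "integrable lborel (\<lambda>y. \<bar>v y\<bar> * (1 + norm y) powr (- ?b))"
  proof (rule integrable_bound_real)
    show "integrable lborel (\<lambda>x. 2 * (\<bar>v x\<bar> / (1 + norm x powr ?b)))" using i by (rule integrable_mult_right)
    show "\<bar>\<bar>v y\<bar> * (1 + norm y) powr (- ?b)\<bar> \<le> 2 * (\<bar>v y\<bar> / (1 + norm y powr ?b))" for y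
    proof -
      have b0: "?b \<ge> 0" using \<gamma> by simp
      have "1 powr ?b \<le> (1 + norm y) powr ?b" "norm y powr ?b \<le> (1 + norm y) powr ?b"
        using b0 by (auto intro!: powr_mono2 ge_one_powr_ge_zero)
      then have le: "1 + norm y powr ?b \<le> 2 * (1 + norm y) powr ?b" by simp
      have pos: "1 + norm y powr ?b > 0" "(1 + norm y) powr ?b > 0"
        using norm_ge_zero[of y] by (auto simp: add_pos_nonneg add_nonneg_eq_0_iff)
      have "(1 + norm y) powr (- ?b) = 1 / (1 + norm y) powr ?b" by (rule powr_minus_divide)
      also have "\<dots> \<le> 2 / (1 + norm y powr ?b)" using le pos by (simp add: divide_le_eq le_divide_eq mult.commute)
      finally have "\<bar>v y\<bar> * (1 + norm y) powr (- ?b) \<le> \<bar>v y\<bar> * (2 / (1 + norm y powr ?b))"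
        by (intro mult_left_mono) auto
      then show ?thesis by (simp add: abs_mult mult.commute)
    qed
  qed simp
  then show ?thesis unfolding wint_def by simp
qed

text \<open>Peetre's inequality, from 1 + |x + y| \<le> (1 + |x|)(1 + |y|). It recentres a decaying
  kernel from \<open>x\<close> to the origin at the cost of a factor (1 + |x|)^b.\<close>

lemma peetre:
  fixes x y :: "'a::real_normed_vector"
  assumes "0 \<le> b"
  shows "(1 + norm y) powr (- b) \<le> (1 + norm x) powr b * (1 + norm (x + y)) powr (- b)"
proof -
  have "1 + norm (x + y) \<le> (1 + norm x) * (1 + norm y)"
  proof -
    have "(1 + norm x) * (1 + norm y) = 1 + norm x + norm y + norm x * norm y" by (simp add: algebra_simps)
    then show ?thesis using norm_triangle_ineq[of x y] mult_nonneg_nonneg[OF norm_ge_zero[of x] norm_ge_zero[of y]] by linarith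
  qed
  then have "(1 + norm (x + y)) powr b \<le> ((1 + norm x) * (1 + norm y)) powr b"
    using assms by (intro powr_mono2) auto
  then have "(1 + norm (x + y)) powr b \<le> (1 + norm x) powr b * (1 + norm y) powr b"
    by (simp add: powr_mult)
  moreover have pos: "(1 + norm u) powr b > 0" for u :: 'a
    using norm_ge_zero[of u] by (auto simp: add_nonneg_eq_0_iff)
  ultimately show ?thesis using pos[of y] pos[of "x + y"]
    by (simp add: powr_minus_divide divide_le_eq le_divide_eq mult_ac)
qed

lemma peetre_diff:
  fixes x y :: "'a::real_normed_vector"
  assumes "0 \<le> b"
  shows "(1 + norm (y - x)) powr (- b) \<le> (1 + norm x) powr b * (1 + norm y) powr (- b)"
  using peetre[OF assms, of "y - x" x] by simp

text \<open>The basic estimate for all convolutions below. The \<open>ennreal\<close> form is kept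
  as a separate conclusion because it is what \<open>fubini_swap_bound\<close> asks for.\<close>

lemma wint_kernel_bound:
  fixes v :: "real^'n \<Rightarrow> real"
  assumes v: "wint b v" and b: "0 \<le> b" and K: "\<And>y. \<bar>K y\<bar> \<le> C * (1 + norm (y - x)) powr (- b)" and C: "0 \<le> C"
    and [measurable]: "K \<in> borel_measurable borel"
  shows "(\<integral>\<^sup>+y. ennreal \<bar>v y * K y\<bar> \<partial>lborel) \<le> ennreal (C * (1 + norm x) powr b * wnorm b v)"
    and "integrable lborel (\<lambda>y. v y * K y)"
    and "\<bar>LINT y|lborel. v y * K y\<bar> \<le> C * (1 + norm x) powr b * wnorm b v"
proof -
  have [measurable]: "v \<in> borel_measurable borel" and i: "integrable lborel (\<lambda>y. \<bar>v y\<bar> * (1 + norm y) powr (- b))"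
    using v by (auto simp: wint_def)
  have pt: "\<bar>v y * K y\<bar> \<le> (C * (1 + norm x) powr b) * (\<bar>v y\<bar> * (1 + norm y) powr (- b))" for y
  proof -
    have "\<bar>K y\<bar> \<le> C * ((1 + norm x) powr b * (1 + norm y) powr (- b))"
      by (rule order_trans[OF K mult_left_mono[OF peetre_diff[OF b] C]])
    then have "\<bar>v y\<bar> * \<bar>K y\<bar> \<le> \<bar>v y\<bar> * (C * ((1 + norm x) powr b * (1 + norm y) powr (- b)))"
      by (intro mult_left_mono) auto
    then show ?thesis by (simp add: abs_mult mult_ac)
  qed
  have "(\<integral>\<^sup>+y. ennreal \<bar>v y * K y\<bar> \<partial>lborel) \<le> (\<integral>\<^sup>+y. ennreal ((C * (1 + norm x) powr b) * (\<bar>v y\<bar> * (1 + norm y) powr (- b))) \<partial>lborel)"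
    by (intro nn_integral_mono ennreal_leI pt)
  also have "\<dots> = ennreal (C * (1 + norm x) powr b * wnorm b v)"
    using i C by (subst nn_integral_eq_integral) (auto simp: wnorm_def intro!: AE_I2 mult_nonneg_nonneg)
  finally show *: "(\<integral>\<^sup>+y. ennreal \<bar>v y * K y\<bar> \<partial>lborel) \<le> ennreal (C * (1 + norm x) powr b * wnorm b v)" .
  show "integrable lborel (\<lambda>y. v y * K y)"
    by (rule nn_integral_le_imp_integrable[OF _ *]) measurable
  show "\<bar>LINT y|lborel. v y * K y\<bar> \<le> C * (1 + norm x) powr b * wnorm b v"
    by (rule nn_integral_le_imp_abs_integral_le[OF _ *]) (auto simp: C wnorm_nonneg)
qed

section \<open>The fractional Laplacian as an absolutely convergent integral\<close>

lemma powr_far_bound: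
  assumes "0 \<le> b" "1 \<le> (r::real)"
  shows "r powr (- b) \<le> 2 powr b * (1 + r) powr (- b)"
proof -
  have "(2 * r) powr (- b) \<le> (1 + r) powr (- b)"
    using assms by (intro powr_mono2') auto
  then show ?thesis using assms by (simp add: powr_mult powr_minus field_simps)
qed

text \<open>For |z| \<le> 1 the Hoelder bound leaves |z|^(-(n - \<eta>)), which is integrable near
  0; for |z| > 1 the kernel is comparable to the weight of \<open>wint\<close> and the three terms
  of \<open>d2\<close> are estimated separately. The bound is explicit in \<open>x\<close> because
  it is integrated over \<open>x\<close> later on.\<close>

lemma d2_kernel_bound:
  fixes v :: "real^'n \<Rightarrow> real"
  assumes v: "wint b v" and b: "b = real CARD('n) + 2 * \<gamma>" and \<gamma>: "0 < \<gamma>" and \<eta>: "0 < \<eta>"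
    and H: "\<And>z. norm z \<le> 1 \<Longrightarrow> \<bar>d2 v x z\<bar> \<le> C * norm z powr (2 * \<gamma> + \<eta>)" and C: "0 \<le> C"
  shows "(\<integral>\<^sup>+z. ennreal \<bar>d2 v x z * norm z powr (- b)\<bar> \<partial>lborel) \<le>
     ennreal (C * (LINT z|lborel. indicator (cball 0 1) (z::real^'n) * norm z powr (- (real CARD('n) - \<eta>))) +
        2 powr b * (2 * \<bar>v x\<bar> * (LINT z|lborel. (1 + norm (z::real^'n)) powr (- b)) + 2 * ((1 + norm x) powr b * wnorm b v)))"
    and "integrable lborel (\<lambda>z. d2 v x z * norm z powr (- b))"
proof -
  have b0: "0 \<le> b" "real CARD('n) < b" using b \<gamma> by auto
  have [measurable]: "v \<in> borel_measurable borel" using v by (auto simp: wint_def)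
  have [measurable]: "cball (0::real^'n) 1 \<in> sets borel" by (simp add: borel_closed)
  let ?A = "\<lambda>z::real^'n. indicator (cball 0 1) z * norm z powr (- (real CARD('n) - \<eta>))"
  let ?W = "\<lambda>z::real^'n. (1 + norm z) powr (- b)"
  have A: "integrable lborel ?A" by (rule integrable_powr_cball) (use \<eta> in simp)
  have W: "integrable lborel ?W" by (rule integrable_weight[OF b0(2)])
  have 1: "(\<integral>\<^sup>+z. ennreal \<bar>v (x + z) * ?W z\<bar> \<partial>lborel) \<le> ennreal ((1 + norm x) powr b * wnorm b v)"
  proof -
    have "(\<integral>\<^sup>+z. ennreal \<bar>v (x + z) * ?W z\<bar> \<partial>lborel) = (\<integral>\<^sup>+z. (\<lambda>y. ennreal \<bar>v y * ?W (y - x)\<bar>) (x + z) \<partial>lborel)" by simp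
    also have "\<dots> = (\<integral>\<^sup>+y. ennreal \<bar>v y * ?W (y - x)\<bar> \<partial>lborel)" by (rule nn_integral_translate) measurable
    also have "\<dots> \<le> ennreal (1 * (1 + norm x) powr b * wnorm b v)"
      by (rule wint_kernel_bound[OF v b0(1)]) auto
    finally show ?thesis by simp
  qed
  have 2: "(\<integral>\<^sup>+z. ennreal \<bar>v (x - z) * ?W z\<bar> \<partial>lborel) \<le> ennreal ((1 + norm x) powr b * wnorm b v)"
  proof -
    have "(\<integral>\<^sup>+z. ennreal \<bar>v (x - z) * ?W z\<bar> \<partial>lborel) = (\<integral>\<^sup>+z. (\<lambda>y. ennreal \<bar>v y * ?W (y - x)\<bar>) (x - z) \<partial>lborel)" by simp
    also have "\<dots> = (\<integral>\<^sup>+y. ennreal \<bar>v y * ?W (y - x)\<bar> \<partial>lborel)" by (rule nn_integral_reflect) measurable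
    also have "\<dots> \<le> ennreal (1 * (1 + norm x) powr b * wnorm b v)"
      by (rule wint_kernel_bound[OF v b0(1)]) auto
    finally show ?thesis by simp
  qed
  have pt: "\<bar>d2 v x z * norm z powr (- b)\<bar> \<le> C * ?A z + 2 powr b * (2 * \<bar>v x\<bar> * ?W z + (\<bar>v (x + z) * ?W z\<bar> + \<bar>v (x - z) * ?W z\<bar>))" for z
  proof (cases "norm z \<le> 1")
    case True
    have "\<bar>d2 v x z * norm z powr (- b)\<bar> \<le> C * norm z powr (2 * \<gamma> + \<eta>) * norm z powr (- b)"
      using H[OF True] by (auto simp: abs_mult intro!: mult_right_mono)
    also have "\<dots> = C * norm z powr (- (real CARD('n) - \<eta>))"
      by (simp add: mult.assoc powr_add[symmetric] b)
    finally have "\<bar>d2 v x z * norm z powr (- b)\<bar> \<le> C * ?A z" using True by simp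
    moreover have "0 \<le> 2 powr b * (2 * \<bar>v x\<bar> * ?W z + (\<bar>v (x + z) * ?W z\<bar> + \<bar>v (x - z) * ?W z\<bar>))"
      by (intro mult_nonneg_nonneg add_nonneg_nonneg) auto
    ultimately show ?thesis by linarith
  next
    case False
    have "\<bar>d2 v x z\<bar> \<le> 2 * \<bar>v x\<bar> + (\<bar>v (x + z)\<bar> + \<bar>v (x - z)\<bar>)" unfolding d2_def by linarith
    then have "\<bar>d2 v x z\<bar> * norm z powr (- b) \<le> (2 * \<bar>v x\<bar> + (\<bar>v (x + z)\<bar> + \<bar>v (x - z)\<bar>)) * (2 powr b * ?W z)"
      using powr_far_bound[OF b0(1), of "norm z"] False by (intro mult_mono) auto
    then show ?thesis using False by (simp add: abs_mult algebra_simps)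
  qed
  have "(\<integral>\<^sup>+z. ennreal \<bar>d2 v x z * norm z powr (- b)\<bar> \<partial>lborel) \<le>
     (\<integral>\<^sup>+z. ennreal (C * ?A z) + ennreal (2 powr b) * (ennreal (2 * \<bar>v x\<bar> * ?W z) + (ennreal \<bar>v (x + z) * ?W z\<bar> + ennreal \<bar>v (x - z) * ?W z\<bar>)) \<partial>lborel)"
  proof (intro nn_integral_mono)
    fix z :: "real^'n"
    have "ennreal \<bar>d2 v x z * norm z powr (- b)\<bar> \<le> ennreal (C * ?A z + 2 powr b * (2 * \<bar>v x\<bar> * ?W z + (\<bar>v (x + z) * ?W z\<bar> + \<bar>v (x - z) * ?W z\<bar>)))"
      by (intro ennreal_leI pt)
    also have "\<dots> = ennreal (C * ?A z) + ennreal (2 powr b) * (ennreal (2 * \<bar>v x\<bar> * ?W z) + (ennreal \<bar>v (x + z) * ?W z\<bar> + ennreal \<bar>v (x - z) * ?W z\<bar>))"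
      using C by (simp add: ennreal_plus ennreal_mult' add_nonneg_nonneg del: ennreal_plus[symmetric])
    finally show "ennreal \<bar>d2 v x z * norm z powr (- b)\<bar> \<le> ennreal (C * ?A z) + ennreal (2 powr b) * (ennreal (2 * \<bar>v x\<bar> * ?W z) + (ennreal \<bar>v (x + z) * ?W z\<bar> + ennreal \<bar>v (x - z) * ?W z\<bar>))" .
  qed
  also have "\<dots> = (\<integral>\<^sup>+z. ennreal (C * ?A z) \<partial>lborel) + ennreal (2 powr b) * ((\<integral>\<^sup>+z. ennreal (2 * \<bar>v x\<bar> * ?W z) \<partial>lborel)
      + ((\<integral>\<^sup>+z. ennreal \<bar>v (x + z) * ?W z\<bar> \<partial>lborel) + (\<integral>\<^sup>+z. ennreal \<bar>v (x - z) * ?W z\<bar> \<partial>lborel)))"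
    by (subst nn_integral_add, measurable, subst nn_integral_cmult, measurable, subst nn_integral_add, measurable, subst nn_integral_add, measurable)
  also have "\<dots> \<le> ennreal (C * (LINT z|lborel. ?A z)) + ennreal (2 powr b) * (ennreal (2 * \<bar>v x\<bar> * (LINT z|lborel. ?W z))
      + (ennreal ((1 + norm x) powr b * wnorm b v) + ennreal ((1 + norm x) powr b * wnorm b v)))"
  proof (intro add_mono mult_left_mono 1 2)
    show "(\<integral>\<^sup>+z. ennreal (C * ?A z) \<partial>lborel) \<le> ennreal (C * (LINT z|lborel. ?A z))"
      using A C by (subst nn_integral_eq_integral) auto
    show "(\<integral>\<^sup>+z. ennreal (2 * \<bar>v x\<bar> * ?W z) \<partial>lborel) \<le> ennreal (2 * \<bar>v x\<bar> * (LINT z|lborel. ?W z))"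
      using W by (subst nn_integral_eq_integral) auto
  qed auto
  also have "\<dots> = ennreal (C * (LINT z|lborel. ?A z) + 2 powr b * (2 * \<bar>v x\<bar> * (LINT z|lborel. ?W z) + 2 * ((1 + norm x) powr b * wnorm b v)))"
  proof -
    have "0 \<le> (LINT z|lborel. ?A z)" "0 \<le> (LINT z|lborel. ?W z)" by (auto intro!: integral_nonneg_AE)
    then show ?thesis using C wnorm_nonneg[of b v]
      by (simp add: ennreal_plus[symmetric] ennreal_mult'[symmetric] del: ennreal_plus)
  qed
  finally show *: "(\<integral>\<^sup>+z. ennreal \<bar>d2 v x z * norm z powr (- b)\<bar> \<partial>lborel) \<le>
     ennreal (C * (LINT z|lborel. ?A z) + 2 powr b * (2 * \<bar>v x\<bar> * (LINT z|lborel. ?W z) + 2 * ((1 + norm x) powr b * wnorm b v)))" .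
  show "integrable lborel (\<lambda>z. d2 v x z * norm z powr (- b))"
    by (rule nn_integral_le_imp_integrable[OF _ *]) (unfold d2_def, measurable)
qed

text \<open>Adding to the truncated integral its reflection under z to -z turns the numerator into
  \<open>d2\<close>, whence the factor 1/2. The integral of \<open>d2\<close> converges absolutely,
  so dominated convergence removes the truncation.\<close>

lemma frac_lap_eq:
  fixes v :: "real^'n \<Rightarrow> real"
  assumes v: "wint b v" and b: "b = real CARD('n) + 2 * \<gamma>" and \<gamma>: "0 < \<gamma>" and \<eta>: "0 < \<eta>"
    and H: "holder2 (2 * \<gamma> + \<eta>) v" and def: "frac_lap_defined_at \<gamma> v x"
  shows "frac_lap \<gamma> v x = frac_const CARD('n) \<gamma> / 2 * (LINT z|lborel. d2 v x z * norm z powr (- b))"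
proof -
  have [measurable]: "v \<in> borel_measurable borel" using v by (auto simp: wint_def)
  obtain C where C: "C \<ge> 0" "\<And>z. norm z \<le> 1 \<Longrightarrow> \<bar>d2 v x z\<bar> \<le> C * norm z powr (2 * \<gamma> + \<eta>)"
    using H unfolding holder2_def by (metis order_refl)
  have int: "integrable lborel (\<lambda>z. d2 v x z * norm z powr (- b))"
    by (rule d2_kernel_bound(2)[OF v b \<gamma> \<eta> C(2,1)])
  define h where "h e z = indicator {z. e \<le> norm z} z * ((v x - v (x + z)) / norm z powr b)" for e and z :: "real^'n"
  have trunc: "pv_trunc \<gamma> v x e = 1/2 * (LINT z|lborel. indicator {z. e \<le> norm z} z * (d2 v x z * norm z powr (- b)))" if "e > 0" for e
  proof -
    have p1: "pv_trunc \<gamma> v x e = (LINT z|lborel. h e z)"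
      unfolding pv_trunc_def by (subst integral_translate[symmetric, of _ x]) (simp add: h_def[abs_def] b dist_norm indicator_def)
    have ih: "integrable lborel (h e)"
    proof -
      have "integrable lborel (\<lambda>y. indicator {y. e \<le> dist x y} y * ((v x - v y) / dist x y powr (real CARD('n) + 2 * \<gamma>)))"
        using def \<gamma> that unfolding frac_lap_defined_at_def by auto
      then have "integrable lborel (\<lambda>z. indicator {y. e \<le> dist x y} (x + z) * ((v x - v (x + z)) / dist x (x + z) powr (real CARD('n) + 2 * \<gamma>)))"
        by (subst integrable_translate)
      then show ?thesis by (simp add: h_def[abs_def] b dist_norm indicator_def)
    qed
    have ih': "integrable lborel (\<lambda>z. h e (- z))" using integrable_reflect[of "h e" 0] ih by simp
    have "(LINT z|lborel. h e (- z)) = (LINT z|lborel. h e z)" using integral_reflect[of "h e" 0] by simp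
    then have "2 * (LINT z|lborel. h e z) = (LINT z|lborel. h e z + h e (- z))"
      using ih ih' by simp
    also have "\<dots> = (LINT z|lborel. indicator {z. e \<le> norm z} z * (d2 v x z * norm z powr (- b)))"
    proof (rule Bochner_Integration.integral_cong[OF refl])
      fix z
      show "h e z + h e (- z) = indicator {z. e \<le> norm z} z * (d2 v x z * norm z powr (- b))"
        by (simp add: h_def d2_def indicator_def powr_minus_divide diff_divide_distrib add_divide_distrib algebra_simps)
    qed
    finally show ?thesis using p1 by simp
  qed
  have "(pv_trunc \<gamma> v x \<longlongrightarrow> 1/2 * (LINT z|lborel. d2 v x z * norm z powr (- b))) (at_right 0)"
    unfolding tendsto_at_iff_sequentially comp_def
  proof (intro allI impI)
    fix X :: "nat \<Rightarrow> real" assume X: "\<forall>i. X i \<in> {0<..} - {0}" "X \<longlonglongrightarrow> 0"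
    have "(\<lambda>i. LINT z|lborel. indicator {z. X i \<le> norm z} z * (d2 v x z * norm z powr (- b))) \<longlonglongrightarrow> (LINT z|lborel. d2 v x z * norm z powr (- b))"
    proof (rule integral_dominated_convergence[where w="\<lambda>z. \<bar>d2 v x z * norm z powr (- b)\<bar>"])
      show "AE z in lborel. (\<lambda>i. indicator {z. X i \<le> norm z} z * (d2 v x z * norm z powr (- b))) \<longlonglongrightarrow> d2 v x z * norm z powr (- b)"
      proof (intro AE_I2)
        fix z :: "real^'n"
        show "(\<lambda>i. indicator {z. X i \<le> norm z} z * (d2 v x z * norm z powr (- b))) \<longlonglongrightarrow> d2 v x z * norm z powr (- b)"
        proof (cases "z = 0")
          case False
          then have "eventually (\<lambda>i. X i < norm z) sequentially" using order_tendstoD(2)[OF X(2)] by simp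
          then have "eventually (\<lambda>i. indicator {z. X i \<le> norm z} z * (d2 v x z * norm z powr (- b)) = d2 v x z * norm z powr (- b)) sequentially"
            by eventually_elim simp
          then show ?thesis by (rule tendsto_eventually)
        qed simp
      qed
      show "integrable lborel (\<lambda>z. \<bar>d2 v x z * norm z powr (- b)\<bar>)" using int by (rule integrable_abs)
      show "(\<lambda>z. d2 v x z * norm z powr (- b)) \<in> borel_measurable lborel" unfolding d2_def by measurable
      show "(\<lambda>z. indicator {z. X i \<le> norm z} z * (d2 v x z * norm z powr (- b))) \<in> borel_measurable lborel" for i
        unfolding d2_def by measurable
      show "AE z in lborel. norm (indicator {z. X i \<le> norm z} z * (d2 v x z * norm z powr (- b))) \<le> \<bar>d2 v x z * norm z powr (- b)\<bar>" for i
        by (intro AE_I2) (auto simp: indicator_def)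
    qed
    then have "(\<lambda>i. 1/2 * (LINT z|lborel. indicator {z. X i \<le> norm z} z * (d2 v x z * norm z powr (- b)))) \<longlonglongrightarrow> 1/2 * (LINT z|lborel. d2 v x z * norm z powr (- b))"
      by (rule tendsto_mult_left)
    moreover have "pv_trunc \<gamma> v x (X i) = 1/2 * (LINT z|lborel. indicator {z. X i \<le> norm z} z * (d2 v x z * norm z powr (- b)))" for i
      by (rule trunc) (use X(1) in auto)
    ultimately show "(\<lambda>i. pv_trunc \<gamma> v x (X i)) \<longlonglongrightarrow> 1/2 * (LINT z|lborel. d2 v x z * norm z powr (- b))"
      by (simp only:)
  qed
  then have "Lim (at_right 0) (pv_trunc \<gamma> v x) = 1/2 * (LINT z|lborel. d2 v x z * norm z powr (- b))"
    by (intro tendsto_Lim) auto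
  then show ?thesis using \<gamma> by (simp add: frac_lap_def)
qed

section \<open>Regularity of the fractional Laplacian\<close>

text \<open>Kernels with \<open>k\<close> continuous derivatives that all decay at least like (1 +
  |z|)^(-d): convolution with a function in \<open>wint d\<close> may be differentiated
  \<open>k\<close> times under the integral sign.\<close>

fun symb :: "nat \<Rightarrow> real \<Rightarrow> 'n::finite fn \<Rightarrow> bool" where
  "symb 0 d \<kappa> \<longleftrightarrow> continuous_on UNIV \<kappa> \<and> (\<exists>C\<ge>0. \<forall>z. \<bar>\<kappa> z\<bar> \<le> C * (1 + norm z) powr (- d))"
| "symb (Suc k) d \<kappa> \<longleftrightarrow> symb 0 d \<kappa> \<and> (\<forall>i x. has_partial i \<kappa> x) \<and> (\<forall>i. symb k d (partial i \<kappa>))"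

lemma symb_0: "symb k d \<kappa> \<Longrightarrow> symb 0 d \<kappa>"
  by (cases k) auto

lemma symb_Suc: "symb (Suc k) d \<kappa> \<Longrightarrow> symb k d \<kappa>"
proof (induction k arbitrary: \<kappa>)
  case 0
  then show ?case using symb_0 by blast
next
  case (Suc k)
  then have "symb (Suc k) d (partial i \<kappa>)" for i unfolding symb.simps(2)[of "Suc k"] by blast
  then have "symb k d (partial i \<kappa>)" for i by (rule Suc.IH)
  then show ?case using Suc.prems unfolding symb.simps(2) by blast
qed

lemma symb_mono: "symb k d \<kappa> \<Longrightarrow> d' \<le> d \<Longrightarrow> symb k d' \<kappa>"
proof (induction k arbitrary: \<kappa>)
  case 0
  then obtain C where C: "C \<ge> 0" "\<And>z. \<bar>\<kappa> z\<bar> \<le> C * (1 + norm z) powr (- d)" by auto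
  have "\<bar>\<kappa> z\<bar> \<le> C * (1 + norm z) powr (- d')" for z
    by (rule order_trans[OF C(2)]) (use C(1) 0 in \<open>auto intro!: mult_left_mono powr_mono\<close>)
  then show ?case using 0 C(1) by auto
next
  case (Suc k)
  have *: "symb 0 d' \<kappa>" if "symb 0 d \<kappa>"
  proof -
    from that obtain C where C: "C \<ge> 0" "\<And>z. \<bar>\<kappa> z\<bar> \<le> C * (1 + norm z) powr (- d)" by auto
    have "\<bar>\<kappa> z\<bar> \<le> C * (1 + norm z) powr (- d')" for z
      by (rule order_trans[OF C(2)]) (use C(1) Suc.prems in \<open>auto intro!: mult_left_mono powr_mono\<close>)
    then show ?thesis using that C(1) by auto
  qed
  show ?case using Suc * unfolding symb.simps(2) by blast
qed

lemma symb_add: "symb k d \<kappa> \<Longrightarrow> symb k d \<mu> \<Longrightarrow> symb k d (\<lambda>z. \<kappa> z + \<mu> z)"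
proof (induction k arbitrary: \<kappa> \<mu>)
  case 0
  then obtain C D where C: "C \<ge> 0" "\<And>z. \<bar>\<kappa> z\<bar> \<le> C * (1 + norm z) powr (- d)"
    and D: "D \<ge> 0" "\<And>z. \<bar>\<mu> z\<bar> \<le> D * (1 + norm z) powr (- d)" by auto
  have "\<bar>\<kappa> z + \<mu> z\<bar> \<le> (C + D) * (1 + norm z) powr (- d)" for z
    using C(2)[of z] D(2)[of z] abs_triangle_ineq[of "\<kappa> z" "\<mu> z"] by (simp add: distrib_right)
  moreover have "C + D \<ge> 0" using C D by simp
  ultimately show ?case using 0 by (auto intro!: continuous_intros)
next
  case (Suc k)
  have *: "symb 0 d (\<lambda>z. \<kappa> z + \<mu> z)"
  proof -
    obtain C D where C: "C \<ge> 0" "\<And>z. \<bar>\<kappa> z\<bar> \<le> C * (1 + norm z) powr (- d)"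
      and D: "D \<ge> 0" "\<And>z. \<bar>\<mu> z\<bar> \<le> D * (1 + norm z) powr (- d)" using Suc.prems by auto
    have "\<bar>\<kappa> z + \<mu> z\<bar> \<le> (C + D) * (1 + norm z) powr (- d)" for z
      using C(2)[of z] D(2)[of z] abs_triangle_ineq[of "\<kappa> z" "\<mu> z"] by (simp add: distrib_right)
    moreover have "C + D \<ge> 0" using C D by simp
    ultimately show ?thesis using Suc.prems by (auto intro!: continuous_intros)
  qed
  have p: "\<And>i x. has_partial i \<kappa> x" "\<And>i x. has_partial i \<mu> x" using Suc.prems by auto
  have "partial i (\<lambda>z. \<kappa> z + \<mu> z) = (\<lambda>z. partial i \<kappa> z + partial i \<mu> z)" for i
    using partial_add(2)[OF p] by auto
  then have "symb k d (partial i (\<lambda>z. \<kappa> z + \<mu> z))" for i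
    using Suc.IH[of "partial i \<kappa>" "partial i \<mu>"] Suc.prems by simp
  then show ?case using * partial_add(1)[OF p] unfolding symb.simps(2) by blast
qed

lemma symb_cmult: "symb k d \<kappa> \<Longrightarrow> symb k d (\<lambda>z. a * \<kappa> z)"
proof (induction k arbitrary: \<kappa>)
  case 0
  then obtain C where C: "C \<ge> 0" "\<And>z. \<bar>\<kappa> z\<bar> \<le> C * (1 + norm z) powr (- d)" by auto
  have "\<bar>a * \<kappa> z\<bar> \<le> (\<bar>a\<bar> * C) * (1 + norm z) powr (- d)" for z
    using mult_left_mono[OF C(2)[of z], of "\<bar>a\<bar>"] by (simp add: abs_mult mult.assoc)
  moreover have "\<bar>a\<bar> * C \<ge> 0" using C by simp
  ultimately show ?case using 0 by (auto intro!: continuous_intros)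
next
  case (Suc k)
  have *: "symb 0 d (\<lambda>z. a * \<kappa> z)"
  proof -
    obtain C where C: "C \<ge> 0" "\<And>z. \<bar>\<kappa> z\<bar> \<le> C * (1 + norm z) powr (- d)" using Suc.prems by auto
    have "\<bar>a * \<kappa> z\<bar> \<le> (\<bar>a\<bar> * C) * (1 + norm z) powr (- d)" for z
      using mult_left_mono[OF C(2)[of z], of "\<bar>a\<bar>"] by (simp add: abs_mult mult.assoc)
    moreover have "\<bar>a\<bar> * C \<ge> 0" using C by simp
    ultimately show ?thesis using Suc.prems by (auto intro!: continuous_intros)
  qed
  have p: "\<And>i x. has_partial i \<kappa> x" using Suc.prems by auto
  have "partial i (\<lambda>z. a * \<kappa> z) = (\<lambda>z. a * partial i \<kappa> z)" for i
    using partial_cmult(2)[OF p] by auto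
  then have "symb k d (partial i (\<lambda>z. a * \<kappa> z))" for i
    using Suc.IH[of "partial i \<kappa>"] Suc.prems by simp
  then show ?case using * partial_cmult(1)[OF p] unfolding symb.simps(2) by blast
qed

lemma symb_component:
  fixes \<kappa> :: "real^'n \<Rightarrow> real"
  shows "symb k d \<kappa> \<Longrightarrow> symb k (d - 1) (\<lambda>z. z $ j * \<kappa> z)"
proof (induction k arbitrary: \<kappa>)
  case (Suc k)
  have *: "symb 0 (d - 1) (\<lambda>z. z $ j * \<kappa> z)" if s0: "symb 0 d \<kappa>" for \<kappa> :: "real^'n \<Rightarrow> real"
  proof -
    obtain C where C: "C \<ge> 0" "\<And>z. \<bar>\<kappa> z\<bar> \<le> C * (1 + norm z) powr (- d)" using s0 by auto
    have "\<bar>z $ j * \<kappa> z\<bar> \<le> C * (1 + norm z) powr (- (d - 1))" for z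
    proof -
      have "\<bar>z $ j\<bar> * \<bar>\<kappa> z\<bar> \<le> (1 + norm z) * (C * (1 + norm z) powr (- d))"
        using component_le_norm_cart[of z j] C(2)[of z] by (intro mult_mono) auto
      also have "\<dots> = C * ((1 + norm z) powr 1 * (1 + norm z) powr (- d))"
        using norm_ge_zero[of z] by (simp add: mult_ac)
      also have "\<dots> = C * (1 + norm z) powr (- (d - 1))" by (subst powr_add[symmetric]) simp
      finally show ?thesis by (simp add: abs_mult)
    qed
    then show ?thesis using s0 C(1) by (auto intro!: continuous_intros)
  qed
  have p: "\<And>i x. has_partial i \<kappa> x" using Suc.prems by auto
  have "partial i (\<lambda>z. z $ j * \<kappa> z) = (\<lambda>z. z $ j * partial i \<kappa> z + (if i = j then 1 else 0) * \<kappa> z)" for i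
    using partial_mult(2)[OF partial_component(1)[of i j] p[of i]] by (auto simp: partial_component(2))
  moreover have "symb k (d - 1) (\<lambda>z. z $ j * partial i \<kappa> z + (if i = j then 1 else 0) * \<kappa> z)" for i
    using Suc.IH[of "partial i \<kappa>"] Suc.prems symb_mono[OF symb_Suc[OF Suc.prems], of "d - 1"]
    by (intro symb_add symb_cmult) auto
  ultimately have "symb k (d - 1) (partial i (\<lambda>z. z $ j * \<kappa> z))" for i by simp
  then show ?case using *[OF symb_0[OF Suc.prems]] partial_mult(1)[OF partial_component(1) p] unfolding symb.simps(2) by blast
next
  case 0
  then obtain C where C: "C \<ge> 0" "\<And>z. \<bar>\<kappa> z\<bar> \<le> C * (1 + norm z) powr (- d)" by auto
  have "\<bar>z $ j * \<kappa> z\<bar> \<le> C * (1 + norm z) powr (- (d - 1))" for z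
  proof -
    have "\<bar>z $ j\<bar> * \<bar>\<kappa> z\<bar> \<le> (1 + norm z) * (C * (1 + norm z) powr (- d))"
      using component_le_norm_cart[of z j] C(2)[of z] by (intro mult_mono) auto
    also have "\<dots> = C * ((1 + norm z) powr 1 * (1 + norm z) powr (- d))"
      using norm_ge_zero[of z] by (simp add: mult_ac)
    also have "\<dots> = C * (1 + norm z) powr (- (d - 1))" by (subst powr_add[symmetric]) simp
    finally show ?thesis by (simp add: abs_mult)
  qed
  then show ?case using 0 C(1) by (auto intro!: continuous_intros)
qed

lemma radial_symb_0:
  assumes g: "continuous_on UNIV g" "\<And>r. r \<ge> 1 \<Longrightarrow> g r = r powr (- q)" and q: "q > 0"
  shows "symb 0 (2 * q) (\<lambda>z::real^'n. g ((norm z)\<^sup>2))"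
proof -
  have "continuous_on UNIV (\<lambda>z::real^'n. g ((norm z)\<^sup>2))"
    by (rule continuous_on_compose2[OF g(1)]) (auto intro!: continuous_intros)
  have "bounded (g ` {0..1})"
    by (intro compact_imp_bounded compact_continuous_image continuous_on_subset[OF g(1)]) auto
  then obtain M where M: "M > 0" "\<And>r. r \<in> {0..1} \<Longrightarrow> \<bar>g r\<bar> \<le> M" unfolding bounded_pos by auto
  have "\<bar>g ((norm z)\<^sup>2)\<bar> \<le> (M + 1) * 2 powr (2 * q) * (1 + norm z) powr (- (2 * q))" for z :: "real^'n"
  proof (cases "norm z \<le> 1")
    case True
    then have "\<bar>g ((norm z)\<^sup>2)\<bar> \<le> M" by (intro M(2)) (auto simp: power_le_one)
    moreover have "2 powr (- (2 * q)) \<le> (1 + norm z) powr (- (2 * q))"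
      using True q by (intro powr_mono2') (auto simp: add_pos_nonneg)
    then have "1 \<le> 2 powr (2 * q) * (1 + norm z) powr (- (2 * q))"
      by (simp add: powr_minus_divide field_simps)
    then have "M * 1 \<le> (M + 1) * (2 powr (2 * q) * (1 + norm z) powr (- (2 * q)))"
      using M(1) by (intro mult_mono) auto
    ultimately show ?thesis by (simp add: mult.assoc)
  next
    case False
    then have "1 \<le> (norm z)\<^sup>2" by (simp add: one_le_power)
    then have "g ((norm z)\<^sup>2) = ((norm z)\<^sup>2) powr (- q)" by (rule g(2))
    also have "\<dots> = norm z powr (- (2 * q))" using False by (simp add: powr_def ln_realpow)
    finally have "\<bar>g ((norm z)\<^sup>2)\<bar> \<le> 1 * (2 powr (2 * q) * (1 + norm z) powr (- (2 * q)))"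
      using powr_far_bound[of "2 * q" "norm z"] False q by simp
    also have "\<dots> \<le> (M + 1) * (2 powr (2 * q) * (1 + norm z) powr (- (2 * q)))"
      using M(1) by (intro mult_right_mono) auto
    finally show ?thesis by (simp add: mult.assoc)
  qed
  moreover have "(M + 1) * 2 powr (2 * q) \<ge> 0" using M by simp
  ultimately show ?thesis using \<open>continuous_on UNIV (\<lambda>z::real^'n. g ((norm z)\<^sup>2))\<close> unfolding symb.simps by blast
qed

text \<open>A finitely often differentiable kernel that agrees with the singular one outside the unit ball,
  obtained by integrating a truncated power repeatedly.\<close>

lemma far_kernel:
  "q > 0 \<Longrightarrow> \<exists>g. continuous_on UNIV g \<and> (\<forall>r\<ge>1. g r = r powr (- q)) \<and> symb k (2 * q) (\<lambda>z::real^'n. g ((norm z)\<^sup>2))"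
proof (induction k arbitrary: q)
  case 0
  let ?g = "\<lambda>r::real. max 1 r powr (- q)"
  have c: "continuous_on UNIV ?g" by (intro continuous_intros) auto
  have "\<And>r. r \<ge> 1 \<Longrightarrow> ?g r = r powr (- q)" by (simp add: max_def)
  then show ?case using radial_symb_0[OF c] c 0 by blast
next
  case (Suc k)
  obtain g1 where g1: "continuous_on UNIV g1" "\<And>r. r \<ge> 1 \<Longrightarrow> g1 r = r powr (- (q + 1))"
    "symb k (2 * (q + 1)) (\<lambda>z::real^'n. g1 ((norm z)\<^sup>2))"
    using Suc.IH[of "q + 1"] Suc.prems by auto
  obtain G where G: "\<And>r. (G has_real_derivative g1 r) (at r)"
    using einterval_antiderivative[of "-\<infinity>" "\<infinity>" g1] g1(1)
    by (auto simp: continuous_on_eq_continuous_at has_real_derivative_iff_has_vector_derivative)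
  \<comment> \<open>The derivative of \<open>g\<close> agrees with that of r^(-q) beyond 1, and the
    normalisation g(1) = 1 makes the functions themselves agree there.\<close>
  define g where "g r = 1 - q * (G r - G 1)" for r
  have d: "(g has_real_derivative - q * g1 r) (at r)" for r
    unfolding g_def by (auto intro!: derivative_eq_intros G)
  have c: "continuous_on UNIV g" using d by (meson DERIV_isCont continuous_at_imp_continuous_on)
  have "\<exists>C. \<forall>r\<in>{1..}. g r - r powr (- q) = C"
  proof (rule has_field_derivative_zero_constant)
    fix r :: real assume r: "r \<in> {1..}"
    have "((\<lambda>r. g r - r powr (- q)) has_real_derivative - q * g1 r - (- q) * r powr (- q - 1)) (at r)"
      using r by (auto intro!: derivative_eq_intros d)
    moreover have "- q * g1 r - (- q) * r powr (- q - 1) = 0"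
    proof -
      have "- (q + 1) = - q - 1" by simp
      then show ?thesis using g1(2)[of r] r by (simp only: atLeast_iff)
    qed
    ultimately show "((\<lambda>r. g r - r powr (- q)) has_real_derivative 0) (at r within {1..})"
      by (metis has_field_derivative_at_within)
  qed auto
  then obtain C where C: "\<And>r. r \<ge> 1 \<Longrightarrow> g r - r powr (- q) = C" by auto
  have "C = 0" using C[of 1] by (simp add: g_def)
  then have gq: "g r = r powr (- q)" if "r \<ge> 1" for r using C[OF that] by simp
  have "partial i (\<lambda>z::real^'n. g ((norm z)\<^sup>2)) = (\<lambda>z. (- 2 * q) * (z $ i * g1 ((norm z)\<^sup>2)))" for i
    using partial_radial(2)[OF d] by (auto simp: mult_ac)
  \<comment> \<open>The coordinate costs one power of decay, while \<open>g1\<close> has two powers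
    to spare.\<close>
  moreover have "symb k (2 * q) (\<lambda>z::real^'n. (- 2 * q) * (z $ i * g1 ((norm z)\<^sup>2)))" for i
    by (intro symb_cmult symb_mono[OF symb_component[OF g1(3)]]) simp
  ultimately have "symb k (2 * q) (partial i (\<lambda>z::real^'n. g ((norm z)\<^sup>2)))" for i by simp
  then have "symb (Suc k) (2 * q) (\<lambda>z::real^'n. g ((norm z)\<^sup>2))"
    using radial_symb_0[OF c gq Suc.prems] partial_radial(1)[OF d] unfolding symb.simps(2) by blast
  then show ?case using c gq by blast
qed

text \<open>All derivatives fall on the kernel, so \<open>v\<close> may be an arbitrary function of
  the weighted class.\<close>

lemma Ck_convolution:
  fixes v :: "real^'n \<Rightarrow> real"
  assumes v: "wint b v" and b: "0 \<le> b"
  shows "symb k b \<kappa> \<Longrightarrow> Ck k (\<lambda>x. LINT y|lborel. v y * \<kappa> (y - x))"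
proof (induction k arbitrary: \<kappa>)
  have [measurable]: "v \<in> borel_measurable borel" and iv: "integrable lborel (\<lambda>y. \<bar>v y\<bar> * (1 + norm y) powr (- b))"
    using v by (auto simp: wint_def)
  have dom: "\<bar>v y * \<kappa> (y - x)\<bar> \<le> (C * (2 + norm x0) powr b) * (\<bar>v y\<bar> * (1 + norm y) powr (- b))"
    if "\<And>z. \<bar>\<kappa> z\<bar> \<le> C * (1 + norm z) powr (- b)" "C \<ge> 0" "norm (x - x0) \<le> 1" for \<kappa> C x x0 y
  proof -
    have "\<bar>\<kappa> (y - x)\<bar> \<le> C * ((1 + norm x) powr b * (1 + norm y) powr (- b))"
      by (rule order_trans[OF that(1) mult_left_mono[OF peetre_diff[OF b] that(2)]])
    also have "\<dots> \<le> C * ((2 + norm x0) powr b * (1 + norm y) powr (- b))"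
    proof -
      have "norm x \<le> norm x0 + 1" using norm_triangle_ineq[of "x - x0" x0] that(3) by simp
      then show ?thesis using that(2) b by (intro mult_left_mono mult_right_mono powr_mono2) auto
    qed
    finally have "\<bar>v y\<bar> * \<bar>\<kappa> (y - x)\<bar> \<le> \<bar>v y\<bar> * (C * ((2 + norm x0) powr b * (1 + norm y) powr (- b)))"
      by (intro mult_left_mono) auto
    then show ?thesis by (simp add: abs_mult mult_ac)
  qed
  have cont: "continuous_on UNIV (\<lambda>x. LINT y|lborel. v y * \<kappa> (y - x))" if s: "symb 0 b \<kappa>" for \<kappa>
  proof -
    from s obtain C where C: "C \<ge> 0" "\<And>z. \<bar>\<kappa> z\<bar> \<le> C * (1 + norm z) powr (- b)" and c: "continuous_on UNIV \<kappa>" by auto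
    have [measurable]: "\<kappa> \<in> borel_measurable borel" using c by (rule borel_measurable_continuous_onI)
    have "isCont (\<lambda>x. LINT y|lborel. v y * \<kappa> (y - x)) x0" for x0
    proof (rule integral_isCont[where d=1 and w="\<lambda>y. (C * (2 + norm x0) powr b) * (\<bar>v y\<bar> * (1 + norm y) powr (- b))"])
      show "integrable lborel (\<lambda>y. (C * (2 + norm x0) powr b) * (\<bar>v y\<bar> * (1 + norm y) powr (- b)))"
        using iv by (rule integrable_mult_right)
      show "isCont (\<lambda>x. v y * \<kappa> (y - x)) x0" for y
      proof -
        have "continuous_on UNIV (\<lambda>x. \<kappa> (y - x))"
          by (rule continuous_on_compose2[OF c]) (auto intro!: continuous_intros)
        then show ?thesis by (intro continuous_intros) (auto simp: continuous_on_eq_continuous_at)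
      qed
      show "\<bar>v y * \<kappa> (y - x)\<bar> \<le> (C * (2 + norm x0) powr b) * (\<bar>v y\<bar> * (1 + norm y) powr (- b))" if "x \<in> ball x0 1" for x y
        using that by (intro dom[OF C(2,1)]) (simp add: dist_norm norm_minus_commute)
    qed auto
    then show ?thesis by (simp add: continuous_at_imp_continuous_on)
  qed
  {
    case 0
    then show ?case using cont by simp
  next
    case (Suc k)
    have p: "\<And>i x. has_partial i \<kappa> x" using Suc.prems by simp
    have [measurable]: "\<kappa> \<in> borel_measurable borel" using Suc.prems by (auto intro: borel_measurable_continuous_onI)
    have der: "((\<lambda>t. (\<lambda>x. LINT y|lborel. v y * \<kappa> (y - x)) (x + t *\<^sub>R axis i 1)) has_real_derivative - (LINT y|lborel. v y * partial i \<kappa> (y - x))) (at 0)" for i x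
    proof -
      from symb_0[of k b "partial i \<kappa>"] Suc.prems obtain C where C: "C \<ge> 0" "\<And>z. \<bar>partial i \<kappa> z\<bar> \<le> C * (1 + norm z) powr (- b)" by auto
      from symb_0[OF Suc.prems] obtain C' where C': "C' \<ge> 0" "\<And>z. \<bar>\<kappa> z\<bar> \<le> C' * (1 + norm z) powr (- b)" by auto
      have "((\<lambda>t. LINT y|lborel. v y * \<kappa> (y - (x + t *\<^sub>R axis i 1))) has_real_derivative (LINT y|lborel. - (v y * partial i \<kappa> (y - (x + 0 *\<^sub>R axis i 1))))) (at 0)"
      proof (rule integral_has_real_derivative[where d=1 and w="\<lambda>y. (C * (2 + norm x) powr b) * (\<bar>v y\<bar> * (1 + norm y) powr (- b))"])
        show "integrable lborel (\<lambda>y. (C * (2 + norm x) powr b) * (\<bar>v y\<bar> * (1 + norm y) powr (- b)))"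
          using iv by (rule integrable_mult_right)
        show "integrable lborel (\<lambda>y. v y * \<kappa> (y - (x + t *\<^sub>R axis i 1)))" for t
          by (rule wint_kernel_bound(2)[OF v b C'(2,1)]) measurable
        show "((\<lambda>t. v y * \<kappa> (y - (x + t *\<^sub>R axis i 1))) has_real_derivative - (v y * partial i \<kappa> (y - (x + t *\<^sub>R axis i 1)))) (at t)" for t y
        proof -
          have "((\<lambda>t. \<kappa> ((y - x) + (- t) *\<^sub>R axis i 1)) has_real_derivative partial i \<kappa> ((y - x) + (- t) *\<^sub>R axis i 1) * (-1)) (at t)"
            by (rule DERIV_chain2[OF has_partial_line[OF p]]) (auto intro!: derivative_eq_intros)
          then have "((\<lambda>t. v y * \<kappa> ((y - x) + (- t) *\<^sub>R axis i 1)) has_real_derivative v y * (partial i \<kappa> ((y - x) + (- t) *\<^sub>R axis i 1) * (-1))) (at t)"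
            by (rule DERIV_cmult)
          then show ?thesis by (simp add: algebra_simps)
        qed
        show "\<bar>- (v y * partial i \<kappa> (y - (x + t *\<^sub>R axis i 1)))\<bar> \<le> (C * (2 + norm x) powr b) * (\<bar>v y\<bar> * (1 + norm y) powr (- b))" if "t \<in> ball 0 1" for t y
          unfolding abs_minus_cancel using that by (intro dom[OF C(2,1)]) simp
      qed simp
      then show ?thesis by simp
    qed
    have "partial i (\<lambda>x. LINT y|lborel. v y * \<kappa> (y - x)) = (\<lambda>x. - (LINT y|lborel. v y * partial i \<kappa> (y - x)))" for i
      using partialI(2)[OF der] by auto
    moreover have "Ck k (\<lambda>x. - (LINT y|lborel. v y * partial i \<kappa> (y - x)))" for i
      using Suc by (intro Ck_minus) auto
    ultimately have "Ck k (partial i (\<lambda>x. LINT y|lborel. v y * \<kappa> (y - x)))" for i by simp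
    then show ?case unfolding Ck_Suc using cont[OF symb_0[OF Suc.prems]] partialI(1)[OF der] by blast
  }
qed

lemma holder2_dominated:
  fixes w :: "real^'n \<Rightarrow> real"
  assumes H: "holder2 (2 * \<gamma> + \<eta>) w" and b: "b = real CARD('n) + 2 * \<gamma>"
    and \<kappa>: "\<And>z. z \<noteq> 0 \<Longrightarrow> \<bar>\<kappa> z\<bar> \<le> K * indicator (cball 0 1) z * norm z powr (- b)" and K: "0 \<le> K"
  shows "\<exists>C. \<forall>x z. norm x \<le> R \<longrightarrow> \<bar>d2 w x z * \<kappa> z\<bar> \<le> C * (indicator (cball 0 1) z * norm z powr (- (real CARD('n) - \<eta>)))"
proof -
  obtain C where C: "C \<ge> 0" "\<And>x z. norm x \<le> R \<Longrightarrow> norm z \<le> 1 \<Longrightarrow> \<bar>d2 w x z\<bar> \<le> C * norm z powr (2 * \<gamma> + \<eta>)"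
    using H unfolding holder2_def by blast
  have "\<bar>d2 w x z * \<kappa> z\<bar> \<le> (C * K) * (indicator (cball 0 1) z * norm z powr (- (real CARD('n) - \<eta>)))" if x: "norm x \<le> R" for x z
  proof -
    consider "z = 0" | "norm z > 1" | "z \<noteq> 0" "norm z \<le> 1" by fastforce
    then show ?thesis
    proof cases
      case 1
      then show ?thesis by (simp add: d2_def)
    next
      case 2
      then have "z \<noteq> 0" by auto
      then have "\<kappa> z = 0" using \<kappa>[of z] 2 by simp
      then show ?thesis using 2 by simp
    next
      case 3
      have "\<bar>d2 w x z\<bar> * \<bar>\<kappa> z\<bar> \<le> (C * norm z powr (2 * \<gamma> + \<eta>)) * (K * norm z powr (- b))"
        using C(2)[OF x 3(2)] \<kappa>[OF 3(1)] 3 C(1) by (intro mult_mono) auto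
      also have "\<dots> = C * K * (norm z powr (2 * \<gamma> + \<eta>) * norm z powr (- b))" by (simp add: mult_ac)
      also have "norm z powr (2 * \<gamma> + \<eta>) * norm z powr (- b) = norm z powr (- (real CARD('n) - \<eta>))"
        by (simp add: powr_add[symmetric] b)
      finally show ?thesis using 3 by (simp add: abs_mult)
    qed
  qed
  then show ?thesis by blast
qed

text \<open>Here the kernel is singular at 0 and has bounded support, so the derivatives fall on
  \<open>w\<close>. The second-difference bound for every derivative up to order \<open>k\<close>
  provides a dominating function that is uniform for \<open>x\<close> in a ball.\<close>

lemma Ck_local_part:
  fixes w :: "real^'n \<Rightarrow> real"
  assumes \<eta>: "0 < \<eta>" and b: "b = real CARD('n) + 2 * \<gamma>"
    and \<kappa>: "\<And>z. z \<noteq> 0 \<Longrightarrow> \<bar>\<kappa> z\<bar> \<le> K * indicator (cball 0 1) z * norm z powr (- b)" and K: "0 \<le> K"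
    and [measurable]: "\<kappa> \<in> borel_measurable borel"
  shows "Ck k w \<Longrightarrow> (\<And>is. length is \<le> k \<Longrightarrow> holder2 (2 * \<gamma> + \<eta>) (pderivs is w)) \<Longrightarrow> Ck k (\<lambda>x. LINT z|lborel. d2 w x z * \<kappa> z)"
proof (induction k arbitrary: w)
  let ?A = "\<lambda>z::real^'n. indicator (cball 0 1) z * norm z powr (- (real CARD('n) - \<eta>))"
  have A: "integrable lborel ?A" by (rule integrable_powr_cball) (use \<eta> in simp)
  have CA: "integrable lborel (\<lambda>z. C * ?A z)" for C using A by (rule integrable_mult_right)
  have meas: "(\<lambda>z. d2 w x z * \<kappa> z) \<in> borel_measurable lborel" if "continuous_on UNIV w" for w x
  proof -
    have [measurable]: "w \<in> borel_measurable borel" using that by (rule borel_measurable_continuous_onI)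
    show ?thesis unfolding d2_def by measurable
  qed
  have cont: "continuous_on UNIV (\<lambda>x. LINT z|lborel. d2 w x z * \<kappa> z)" if c: "continuous_on UNIV w" and H: "holder2 (2 * \<gamma> + \<eta>) w" for w
  proof -
    have "isCont (\<lambda>x. LINT z|lborel. d2 w x z * \<kappa> z) x0" for x0
    proof -
      obtain C where C: "\<And>x z. norm x \<le> norm x0 + 1 \<Longrightarrow> \<bar>d2 w x z * \<kappa> z\<bar> \<le> C * ?A z"
        using holder2_dominated[OF H b \<kappa> K] by blast
      show ?thesis
      proof (rule integral_isCont[where d=1 and w="\<lambda>z. C * ?A z"])
        show "isCont (\<lambda>x. d2 w x z * \<kappa> z) x0" for z
        proof -
          have "continuous_on UNIV (\<lambda>x. w (x + z))" "continuous_on UNIV (\<lambda>x. w (x - z))"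
            by (auto intro!: continuous_on_compose2[OF c] continuous_intros)
          then have "continuous_on UNIV (\<lambda>x. d2 w x z * \<kappa> z)" unfolding d2_def using c by (intro continuous_intros)
          then show ?thesis by (simp add: continuous_on_eq_continuous_at)
        qed
        show "\<bar>d2 w x z * \<kappa> z\<bar> \<le> C * ?A z" if "x \<in> ball x0 1" for x z
        proof (rule C)
          show "norm x \<le> norm x0 + 1" using that norm_triangle_ineq[of "x - x0" x0] by (simp add: dist_norm norm_minus_commute)
        qed
      qed (use meas[OF c] CA in auto)
    qed
    then show ?thesis by (simp add: continuous_at_imp_continuous_on)
  qed
  {
    case 0
    have "holder2 (2 * \<gamma> + \<eta>) w" using "0.prems"(2)[of "[]"] by simp
    then show ?case using cont[of w] "0.prems"(1) by simp
  next
    case (Suc k)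
    have p: "\<And>i x. has_partial i w x" and cw: "continuous_on UNIV w"
      using Suc.prems(1) by (auto simp: Ck_Suc)
    have H0: "holder2 (2 * \<gamma> + \<eta>) w" using Suc.prems(2)[of "[]"] by simp
    have Hp: "holder2 (2 * \<gamma> + \<eta>) (pderivs is (partial i w))" if "length is \<le> k" for "is" i
      using Suc.prems(2)[of "is @ [i]"] that by (simp add: pderivs_append)
    have der: "((\<lambda>t. (\<lambda>x. LINT z|lborel. d2 w x z * \<kappa> z) (x + t *\<^sub>R axis i 1)) has_real_derivative (LINT z|lborel. d2 (partial i w) x z * \<kappa> z)) (at 0)" for i x
    proof -
      obtain C where C: "\<And>x' z. norm x' \<le> norm x + 1 \<Longrightarrow> \<bar>d2 (partial i w) x' z * \<kappa> z\<bar> \<le> C * ?A z"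
        using holder2_dominated[OF _ b \<kappa> K, of \<eta> "partial i w" "norm x + 1"] Hp[of "[]" i] by auto
      have "((\<lambda>t. LINT z|lborel. d2 w (x + t *\<^sub>R axis i 1) z * \<kappa> z) has_real_derivative (LINT z|lborel. d2 (partial i w) (x + 0 *\<^sub>R axis i 1) z * \<kappa> z)) (at 0)"
      proof (rule integral_has_real_derivative[where d=1 and w="\<lambda>z. C * ?A z"])
        show "integrable lborel (\<lambda>z. d2 w (x + t *\<^sub>R axis i 1) z * \<kappa> z)" for t
        proof -
          obtain C' where C': "\<And>z. \<bar>d2 w (x + t *\<^sub>R axis i 1) z * \<kappa> z\<bar> \<le> C' * ?A z"
            using holder2_dominated[OF H0 b \<kappa> K, of "norm (x + t *\<^sub>R axis i 1)"] by blast
          show ?thesis by (rule integrable_bound_real[OF CA meas[OF cw] C'])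
        qed
        show "((\<lambda>t. d2 w (x + t *\<^sub>R axis i 1) z * \<kappa> z) has_real_derivative d2 (partial i w) (x + t *\<^sub>R axis i 1) z * \<kappa> z) (at t)" for t z
        proof (rule DERIV_cmult_right)
          have 1: "((\<lambda>t. w (x + a + t *\<^sub>R axis i 1)) has_real_derivative partial i w (x + a + t *\<^sub>R axis i 1)) (at t)" for a
            by (rule has_partial_line[OF p])
          show "((\<lambda>t. d2 w (x + t *\<^sub>R axis i 1) z) has_real_derivative d2 (partial i w) (x + t *\<^sub>R axis i 1) z) (at t)"
            unfolding d2_def using DERIV_diff[OF DERIV_diff[OF DERIV_cmult[OF 1[of 0], of 2] 1[of z]] 1[of "- z"]]
            by (simp add: algebra_simps)
        qed
        show "\<bar>d2 (partial i w) (x + t *\<^sub>R axis i 1) z * \<kappa> z\<bar> \<le> C * ?A z" if "t \<in> ball 0 1" for t z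
        proof (rule C)
          show "norm (x + t *\<^sub>R axis i 1) \<le> norm x + 1" using that norm_triangle_ineq[of x "t *\<^sub>R axis i 1"] by simp
        qed
        show "integrable lborel (\<lambda>z. C * ?A z)" by (rule CA)
      qed simp
      then show ?thesis by simp
    qed
    have "partial i (\<lambda>x. LINT z|lborel. d2 w x z * \<kappa> z) = (\<lambda>x. LINT z|lborel. d2 (partial i w) x z * \<kappa> z)" for i
      using partialI(2)[OF der] by auto
    moreover have "Ck k (\<lambda>x. LINT z|lborel. d2 (partial i w) x z * \<kappa> z)" for i
      using Suc.IH[of "partial i w"] Suc.prems(1) Hp by (auto simp: Ck_Suc)
    ultimately have "Ck k (partial i (\<lambda>x. LINT z|lborel. d2 w x z * \<kappa> z))" for i by simp
    then show ?case unfolding Ck_Suc using cont[OF cw H0] partialI(1)[OF der] by blast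
  }
qed

text \<open>A strong solution comes with the existence of the iterated partial derivatives in
  \<open>neg_lap_pow\<close>, whereas integration by parts needs all derivatives up to order 2m to
  be continuous. To obtain them, |z|^(-b) is split into \<open>\<kappa>1\<close>, supported in the
  unit ball, and the regular kernel \<open>\<kappa>2\<close>. Derivatives fall on \<open>v\<close>
  in the first part and on the kernel in the second, because the growth of the derivatives of
  \<open>v\<close> at infinity is unknown.\<close>

lemma Ck_frac_lap:
  fixes v :: "real^'n \<Rightarrow> real"
  assumes v: "wint b v" and b: "b = real CARD('n) + 2 * \<gamma>" and \<gamma>: "0 < \<gamma>" and \<eta>: "0 < \<eta>"
    and def: "\<And>x. frac_lap_defined_at \<gamma> v x"
    and C: "Ck k v" and H: "\<And>is. length is \<le> k \<Longrightarrow> holder2 (2 * \<gamma> + \<eta>) (pderivs is v)"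
  shows "Ck k (frac_lap \<gamma> v)"
proof -
  have b0: "b > 0" "real CARD('n) < b" using b \<gamma> by (auto simp: add_pos_nonneg)
  have H0: "holder2 (2 * \<gamma> + \<eta>) v" using H[of "[]"] by simp
  have [measurable]: "v \<in> borel_measurable borel" using v by (auto simp: wint_def)
  obtain g where g: "continuous_on UNIV g" "\<And>r. r \<ge> 1 \<Longrightarrow> g r = r powr (- (b/2))" "symb k b (\<lambda>z::real^'n. g ((norm z)\<^sup>2))"
    using far_kernel[of "b/2" k] b0 by auto
  define \<kappa>2 where "\<kappa>2 z = g ((norm z)\<^sup>2)" for z :: "real^'n"
  define \<kappa>1 where "\<kappa>1 z = norm z powr (- b) - \<kappa>2 z" for z :: "real^'n"
  have sy: "symb k b \<kappa>2" using g(3) by (simp add: \<kappa>2_def[abs_def])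
  obtain C2 where C2: "C2 \<ge> 0" "\<And>z. \<bar>\<kappa>2 z\<bar> \<le> C2 * (1 + norm z) powr (- b)" and c2: "continuous_on UNIV \<kappa>2"
    using symb_0[OF sy] by auto
  have [measurable]: "\<kappa>2 \<in> borel_measurable borel" using c2 by (rule borel_measurable_continuous_onI)
  have [measurable]: "\<kappa>1 \<in> borel_measurable borel" unfolding \<kappa>1_def[abs_def] by measurable
  have k1: "\<bar>\<kappa>1 z\<bar> \<le> (1 + C2) * indicator (cball 0 1) z * norm z powr (- b)" if "z \<noteq> 0" for z
  proof (cases "norm z \<le> 1")
    case True
    have "\<bar>\<kappa>2 z\<bar> \<le> C2 * norm z powr (- b)"
      using True that b0 by (intro order_trans[OF C2(2)] mult_left_mono C2(1) powr_mono2') auto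
    then have "\<bar>\<kappa>1 z\<bar> \<le> (1 + C2) * norm z powr (- b)" unfolding \<kappa>1_def distrib_right using powr_ge_zero[of "norm z" "-b"] by linarith
    then show ?thesis using True by simp
  next
    case False
    then have "1 \<le> (norm z)\<^sup>2" by (simp add: one_le_power)
    then have "\<kappa>2 z = norm z powr (- b)" unfolding \<kappa>2_def using g(2)[of "(norm z)\<^sup>2"] that by (simp add: powr_def ln_realpow)
    then show ?thesis using False by (simp add: \<kappa>1_def)
  qed
  have i2: "integrable lborel \<kappa>2"
    by (rule integrable_bound_real[OF integrable_mult_right[OF integrable_weight[OF b0(2)]] _ C2(2)]) simp
  \<comment> \<open>\<open>\<kappa>2\<close> is radial, hence even, so v(x + z) and v(x - z)
    contribute the same convolution; this gives the factor -2.\<close>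
  have split: "(LINT z|lborel. d2 v x z * norm z powr (- b)) = (LINT z|lborel. d2 v x z * \<kappa>1 z) + (2 * (LINT z|lborel. \<kappa>2 z) * v x + (-2) * (LINT y|lborel. v y * \<kappa>2 (y - x)))" for x
  proof -
    have ij: "integrable lborel (\<lambda>y. v y * \<kappa>2 (y - x))"
      by (rule wint_kernel_bound(2)[OF v _ C2(2,1)]) (use b0 in auto)
    have p: "integrable lborel (\<lambda>z. v (x + z) * \<kappa>2 z)" "(LINT z|lborel. v (x + z) * \<kappa>2 z) = (LINT y|lborel. v y * \<kappa>2 (y - x))"
      using integrable_translate[of "\<lambda>y. v y * \<kappa>2 (y - x)" x] integral_translate[of "\<lambda>y. v y * \<kappa>2 (y - x)" x] ij by auto
    have m: "integrable lborel (\<lambda>z. v (x - z) * \<kappa>2 z)" "(LINT z|lborel. v (x - z) * \<kappa>2 z) = (LINT y|lborel. v y * \<kappa>2 (y - x))"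
      using integrable_reflect[of "\<lambda>y. v y * \<kappa>2 (y - x)" x] integral_reflect[of "\<lambda>y. v y * \<kappa>2 (y - x)" x] ij
      by (auto simp: \<kappa>2_def)
    obtain D where D: "\<And>z. \<bar>d2 v x z * \<kappa>1 z\<bar> \<le> D * (indicator (cball 0 1) z * norm z powr (- (real CARD('n) - \<eta>)))"
      using holder2_dominated[OF H0 b k1, of "norm x"] C2(1) by auto
    have i1: "integrable lborel (\<lambda>z. d2 v x z * \<kappa>1 z)"
      by (rule integrable_bound_real[OF integrable_mult_right[OF integrable_powr_cball] _ D]) (use \<eta> in \<open>auto simp: d2_def\<close>)
    have "(LINT z|lborel. d2 v x z * norm z powr (- b)) = (LINT z|lborel. d2 v x z * \<kappa>1 z + (2 * v x * \<kappa>2 z - v (x + z) * \<kappa>2 z - v (x - z) * \<kappa>2 z))"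
      by (rule Bochner_Integration.integral_cong[OF refl]) (simp add: \<kappa>1_def d2_def algebra_simps)
    also have "\<dots> = (LINT z|lborel. d2 v x z * \<kappa>1 z) + (2 * v x * (LINT z|lborel. \<kappa>2 z) - (LINT y|lborel. v y * \<kappa>2 (y - x)) - (LINT y|lborel. v y * \<kappa>2 (y - x)))"
      using i1 i2 p m by simp
    finally show ?thesis by simp
  qed
  have "frac_lap \<gamma> v = (\<lambda>x. frac_const CARD('n) \<gamma> / 2 * ((LINT z|lborel. d2 v x z * \<kappa>1 z) + (2 * (LINT z|lborel. \<kappa>2 z) * v x + (-2) * (LINT y|lborel. v y * \<kappa>2 (y - x)))))"
    using frac_lap_eq[OF v b \<gamma> \<eta> H0 def] split by (auto simp: fun_eq_iff)
  moreover have "Ck k (\<lambda>x. frac_const CARD('n) \<gamma> / 2 * ((LINT z|lborel. d2 v x z * \<kappa>1 z) + (2 * (LINT z|lborel. \<kappa>2 z) * v x + (-2) * (LINT y|lborel. v y * \<kappa>2 (y - x)))))"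
    using C2(1) b0 by (intro Ck_cmult Ck_add Ck_local_part[OF \<eta> b k1] C H Ck_convolution[OF v _ sy]) auto
  ultimately show ?thesis by simp
qed

section \<open>Heat extensions\<close>

text \<open>For \<open>v\<close> in the weighted class and t > 0 this is (- d/dt)^k applied to the
  heat extension of \<open>v\<close> (\<open>hconv_has_derivative\<close>), written as a single
  integral.\<close>

definition hconv :: "'n::finite fn \<Rightarrow> nat \<Rightarrow> real \<Rightarrow> real^'n \<Rightarrow> real" where
  "hconv v k t x = (LINT y|lborel. v y * hk k t (x - y))"

lemma borel_measurable_hconv:
  assumes [measurable]: "v \<in> borel_measurable borel" "f \<in> borel_measurable M" "g \<in> borel_measurable M"
  shows "(\<lambda>p. hconv v k (f p) (g p)) \<in> borel_measurable M"
  unfolding hconv_def by measurable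

lemma norm_minus_weight: "(1 + norm (x - y :: 'a::real_normed_vector)) powr c = (1 + norm (y - x)) powr c"
  by (simp add: norm_minus_commute)

lemma hconv_integrable:
  fixes v :: "real^'n \<Rightarrow> real"
  assumes v: "wint b v" and b: "0 \<le> b" and t: "0 < t"
  shows "integrable lborel (\<lambda>y. v y * hk k t (x - y))"
proof -
  obtain C where C: "C > 0" "\<And>z. \<bar>hk k t (z::real^'n)\<bar> \<le> C * (1 + norm z) powr (- b)"
    using hk_weight_bound_local[OF b t, of t k, where 'n='n] by auto
  have "\<bar>hk k t (x - y)\<bar> \<le> C * (1 + norm (y - x)) powr (- b)" for y
    using C(2)[of "x - y"] by (simp only: norm_minus_weight)
  then show ?thesis using C(1) by (intro wint_kernel_bound(2)[OF v b]) auto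
qed

lemma hconv_has_derivative:
  fixes v :: "real^'n \<Rightarrow> real"
  assumes v: "wint b v" and b: "0 \<le> b" and t: "0 < t"
  shows "((\<lambda>t. hconv v k t x) has_real_derivative - hconv v (Suc k) t x) (at t)"
proof -
  have iv: "integrable lborel (\<lambda>y. \<bar>v y\<bar> * (1 + norm y) powr (- b))" using v by (auto simp: wint_def)
  obtain C where C: "C > 0" "\<And>s z. s \<in> {t/2..2*t} \<Longrightarrow> \<bar>hk (Suc k) s (z::real^'n)\<bar> \<le> C * (1 + norm z) powr (- b)"
    using hk_weight_bound_local[OF b, of "t/2" "2*t" "Suc k", where 'n='n] t by (meson half_gt_zero)
  have s: "s \<in> {t/2..2*t}" "s > 0" if "s \<in> ball t (t/2)" for s
    using that t unfolding mem_ball dist_real_def atLeastAtMost_iff by arith+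
  have "((\<lambda>t. LINT y|lborel. v y * hk k t (x - y)) has_real_derivative (LINT y|lborel. v y * - hk (Suc k) t (x - y))) (at t)"
  proof (rule integral_has_real_derivative[where d="t/2" and w="\<lambda>y. (C * (1 + norm x) powr b) * (\<bar>v y\<bar> * (1 + norm y) powr (- b))"])
    show "integrable lborel (\<lambda>y. v y * hk k s (x - y))" if "s \<in> ball t (t/2)" for s
      by (rule hconv_integrable[OF v b s(2)[OF that]])
    show "((\<lambda>t. v y * hk k t (x - y)) has_real_derivative v y * - hk (Suc k) s (x - y)) (at s)" if "s \<in> ball t (t/2)" for s y
      by (intro DERIV_cmult hk_has_derivative s(2)[OF that])
    show "\<bar>v y * - hk (Suc k) s (x - y)\<bar> \<le> (C * (1 + norm x) powr b) * (\<bar>v y\<bar> * (1 + norm y) powr (- b))" if "s \<in> ball t (t/2)" for s y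
    proof -
      have "\<bar>hk (Suc k) s (x - y)\<bar> \<le> C * (1 + norm (y - x)) powr (- b)"
        using C(2)[OF s(1)[OF that], of "x - y"] by (simp only: norm_minus_weight)
      also have "\<dots> \<le> C * ((1 + norm x) powr b * (1 + norm y) powr (- b))"
        using C(1) by (intro mult_left_mono peetre_diff b) auto
      finally have "\<bar>v y\<bar> * \<bar>hk (Suc k) s (x - y)\<bar> \<le> \<bar>v y\<bar> * (C * ((1 + norm x) powr b * (1 + norm y) powr (- b)))"
        by (intro mult_left_mono) auto
      then show ?thesis by (simp add: abs_mult mult_ac)
    qed
    show "integrable lborel (\<lambda>y. (C * (1 + norm x) powr b) * (\<bar>v y\<bar> * (1 + norm y) powr (- b)))"
      using iv by (rule integrable_mult_right)
  qed (use t in auto)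
  then show ?thesis unfolding hconv_def by simp
qed

lemma hconv_isCont_t:
  fixes v :: "real^'n \<Rightarrow> real"
  assumes "wint b v" "0 \<le> b" "0 < t"
  shows "isCont (\<lambda>t. hconv v k t x) t"
  by (rule DERIV_isCont[OF hconv_has_derivative[OF assms]])

lemma hconv_continuous:
  fixes v :: "real^'n \<Rightarrow> real"
  assumes v: "wint b v" and b: "0 \<le> b" and t: "0 < t"
  shows "continuous_on UNIV (hconv v k t)"
proof -
  obtain C where C: "C > 0" "\<And>z. \<bar>hk k t (z::real^'n)\<bar> \<le> C * (1 + norm z) powr (- b)"
    using hk_weight_bound_local[OF b t, of t k, where 'n='n] by auto
  have "symb 0 b (hk k t :: real^'n \<Rightarrow> real)"
    using C by (auto simp: continuous_at_imp_continuous_on isCont_hk intro!: exI[of _ C])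
  then have "Ck 0 (\<lambda>x. LINT y|lborel. v y * hk k t (y - x))" by (rule Ck_convolution[OF v b])
  then show ?thesis by (simp add: hconv_def[abs_def] hk_minus_commute)
qed

text \<open>With B = b the kernel bound contributes t^((b - n)/2) = t^\<gamma>, and each time
  derivative gains a factor 1/t. Keeping \<open>t\<close> above \<open>t0\<close> lets the other
  power t^(-n/2) be absorbed.\<close>

lemma hconv_decay:
  fixes v :: "real^'n \<Rightarrow> real"
  assumes v: "wint b v" and b: "b = real CARD('n) + 2 * \<gamma>" and \<gamma>: "0 \<le> \<gamma>" and t0: "0 < t0"
  shows "\<exists>C\<ge>0. \<forall>t\<ge>t0. \<forall>x. \<bar>hconv v k t x\<bar> \<le> C * t powr (\<gamma> - real k) * (1 + norm x) powr b"
proof -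
  let ?n = "real CARD('n)"
  have b0: "0 \<le> b" using b \<gamma> by simp
  obtain C where C: "C > 0" "\<And>t z. t > 0 \<Longrightarrow> \<bar>hk k t (z::real^'n)\<bar> \<le> C * inverse (t ^ k) * (t powr (- (?n / 2)) + t powr ((b - ?n) / 2)) * (1 + norm z) powr (- b)"
    using hk_weight_bound[OF b0, where 'n='n] by blast
  define M where "M = t0 powr (- (?n / 2) - \<gamma>) + 1"
  have M: "M > 0" unfolding M_def by (simp add: add_nonneg_pos)
  have "\<bar>hconv v k t x\<bar> \<le> (C * M * wnorm b v) * t powr (\<gamma> - real k) * (1 + norm x) powr b" if t: "t \<ge> t0" for t x
  proof -
    have t': "t > 0" using t t0 by simp
    have "t powr (- (?n / 2)) = t powr (- (?n / 2) - \<gamma>) * t powr \<gamma>"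
      by (simp add: powr_add[symmetric])
    also have "\<dots> \<le> t0 powr (- (?n / 2) - \<gamma>) * t powr \<gamma>"
      using t t0 \<gamma> by (intro mult_right_mono powr_mono2') auto
    finally have "t powr (- (?n / 2)) + t powr ((b - ?n) / 2) \<le> M * t powr \<gamma>"
      by (simp add: M_def b algebra_simps)
    then have "C * inverse (t ^ k) * (t powr (- (?n / 2)) + t powr ((b - ?n) / 2)) \<le> C * inverse (t ^ k) * (M * t powr \<gamma>)"
      using C t' by (intro mult_left_mono) auto
    also have "\<dots> = (C * M) * (t powr \<gamma> * inverse (t ^ k))" by (simp add: mult_ac)
    also have "t powr \<gamma> * inverse (t ^ k) = t powr (\<gamma> - real k)"
      using t' by (simp add: powr_diff powr_realpow divide_inverse)
    finally have le: "C * inverse (t ^ k) * (t powr (- (?n / 2)) + t powr ((b - ?n) / 2)) \<le> C * M * t powr (\<gamma> - real k)" .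
    have "\<bar>hconv v k t x\<bar> \<le> (C * M * t powr (\<gamma> - real k)) * (1 + norm x) powr b * wnorm b v"
      unfolding hconv_def
    proof (rule wint_kernel_bound(3)[OF v b0])
      show "\<bar>hk k t (x - y)\<bar> \<le> (C * M * t powr (\<gamma> - real k)) * (1 + norm (y - x)) powr (- b)" for y
      proof -
        have "\<bar>hk k t (x - y)\<bar> \<le> C * inverse (t ^ k) * (t powr (- (?n / 2)) + t powr ((b - ?n) / 2)) * (1 + norm (y - x)) powr (- b)"
          using C(2)[OF t', of "x - y"] by (simp only: norm_minus_weight)
        also have "\<dots> \<le> (C * M * t powr (\<gamma> - real k)) * (1 + norm (y - x)) powr (- b)"
          by (intro mult_right_mono le) auto
        finally show ?thesis .
      qed
      show "0 \<le> C * M * t powr (\<gamma> - real k)" using C M by simp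
    qed measurable
    then show ?thesis by (simp add: mult_ac)
  qed
  moreover have "C * M * wnorm b v \<ge> 0" using C M wnorm_nonneg[of b v] by simp
  ultimately show ?thesis by blast
qed

lemma integrable_growth_times_hk:
  fixes b :: real
  assumes b: "0 \<le> b" and t: "0 < t"
  shows "integrable lborel (\<lambda>z::real^'n. (1 + norm z) powr b * \<bar>hk k t z\<bar>)"
proof -
  let ?n = "real CARD('n)"
  obtain C where C: "C > 0" "\<And>z. \<bar>hk k t (z::real^'n)\<bar> \<le> C * (1 + norm z) powr (- (b + (?n + 1)))"
    using hk_weight_bound_local[of "b + (?n + 1)" t t k, where 'n='n] b t by auto
  show ?thesis
  proof (rule integrable_bound_real)
    show "integrable lborel (\<lambda>z::real^'n. C * (1 + norm z) powr (- (?n + 1)))"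
      by (intro integrable_mult_right integrable_weight) simp
    show "\<bar>(1 + norm z) powr b * \<bar>hk k t z\<bar>\<bar> \<le> C * (1 + norm z) powr (- (?n + 1))" for z :: "real^'n"
    proof -
      have "(1 + norm z) powr b * \<bar>hk k t z\<bar> \<le> (1 + norm z) powr b * (C * (1 + norm z) powr (- (b + (?n + 1))))"
        by (intro mult_left_mono C(2)) auto
      also have "\<dots> = C * ((1 + norm z) powr b * (1 + norm z) powr (- (b + (?n + 1))))" by simp
      also have "(1 + norm z) powr b * (1 + norm z) powr (- (b + (?n + 1))) = (1 + norm z) powr (- (?n + 1))"
        by (subst powr_add[symmetric]) simp
      finally show ?thesis by simp
    qed
  qed simp
qed

lemma weight_add:
  fixes x y :: "'a::real_normed_vector"
  assumes "0 \<le> b"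
  shows "(1 + norm (x + y)) powr b \<le> (1 + norm x) powr b * (1 + norm y) powr b"
proof -
  have "(1 + norm x) * (1 + norm y) = 1 + norm x + norm y + norm x * norm y" by (simp add: algebra_simps)
  then have "1 + norm (x + y) \<le> (1 + norm x) * (1 + norm y)"
    using norm_triangle_ineq[of x y] mult_nonneg_nonneg[OF norm_ge_zero[of x] norm_ge_zero[of y]] by linarith
  then have "(1 + norm (x + y)) powr b \<le> ((1 + norm x) * (1 + norm y)) powr b"
    using assms by (intro powr_mono2) auto
  then show ?thesis by (simp add: powr_mult)
qed

lemma hconv_heat:
  fixes v :: "real^'n \<Rightarrow> real"
  assumes v: "wint b v" and b: "0 \<le> b" and t: "0 < t" and s: "0 < s"
  shows "integrable lborel (\<lambda>z. hconv v k t (x + z) * heat s z)"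
    and "(LINT z|lborel. hconv v k t (x + z) * heat s z) = hconv v k (t + s) x"
proof -
  have [measurable]: "v \<in> borel_measurable borel" using v by (auto simp: wint_def)
  obtain C where C: "C > 0" "\<And>z. \<bar>hk k t (z::real^'n)\<bar> \<le> C * (1 + norm z) powr (- b)"
    using hk_weight_bound_local[OF b t, of t k, where 'n='n] by auto
  define f where "f z y = v y * hk k t (x + z - y) * heat s z" for z y
  define B where "B z = (C * (1 + norm x) powr b * wnorm b v) * ((1 + norm z) powr b * \<bar>hk 0 s z\<bar>)" for z :: "real^'n"
  have m: "(\<lambda>(z, y). f z y) \<in> borel_measurable (borel \<Otimes>\<^sub>M borel)" unfolding f_def by measurable
  have iB: "integrable lborel B" unfolding B_def by (intro integrable_mult_right integrable_growth_times_hk b s)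
  have B0: "0 \<le> B z" for z using C wnorm_nonneg[of b v] by (simp add: B_def)
  have le: "(\<integral>\<^sup>+y. ennreal \<bar>f z y\<bar> \<partial>lborel) \<le> ennreal (B z)" for z
  proof -
    have "(\<integral>\<^sup>+y. ennreal \<bar>f z y\<bar> \<partial>lborel) = (\<integral>\<^sup>+y. ennreal \<bar>v y * hk k t (x + z - y)\<bar> * ennreal (heat s z) \<partial>lborel)"
      by (simp add: f_def abs_mult ennreal_mult')
    also have "\<dots> = (\<integral>\<^sup>+y. ennreal \<bar>v y * hk k t (x + z - y)\<bar> \<partial>lborel) * ennreal (heat s z)"
      by (rule nn_integral_multc) measurable
    also have "\<dots> \<le> ennreal (C * (1 + norm (x + z)) powr b * wnorm b v) * ennreal (heat s z)"
    proof (intro mult_right_mono wint_kernel_bound(1)[OF v b])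
      show "\<bar>hk k t (x + z - y)\<bar> \<le> C * (1 + norm (y - (x + z))) powr (- b)" for y
        using C(2)[of "x + z - y"] by (simp only: norm_minus_weight)
    qed (use C in auto)
    also have "\<dots> = ennreal (C * (1 + norm (x + z)) powr b * wnorm b v * heat s z)"
      using C wnorm_nonneg[of b v] by (simp add: ennreal_mult')
    also have "\<dots> \<le> ennreal (B z)"
    proof (rule ennreal_leI)
      have "C * (1 + norm (x + z)) powr b * wnorm b v * heat s z \<le> C * ((1 + norm x) powr b * (1 + norm z) powr b) * wnorm b v * heat s z"
        using C wnorm_nonneg[of b v] weight_add[OF b, of x z] by (intro mult_right_mono mult_left_mono) auto
      then show "C * (1 + norm (x + z)) powr b * wnorm b v * heat s z \<le> B z" by (simp add: B_def hk_0 mult_ac)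
    qed
    finally show ?thesis .
  qed
  note fub = fubini_swap_bound[OF m le iB B0]
  have inner: "(LINT y|lborel. f z y) = hconv v k t (x + z) * heat s z" for z
    by (simp add: f_def hconv_def)
  show "integrable lborel (\<lambda>z. hconv v k t (x + z) * heat s z)" using fub(2) by (simp add: inner)
  have outer: "(LINT z|lborel. f z y) = v y * hk k (t + s) (x - y)" for y
  proof -
    have "(LINT z|lborel. f z y) = v y * (LINT z|lborel. hk k t (x + z - y) * heat s z)"
      unfolding f_def by (subst integral_mult_right_zero[symmetric]) (simp add: mult.assoc)
    also have "(LINT z|lborel. hk k t (x + z - y) * heat s z) = (LINT z|lborel. hk k t ((x - y) - z) * heat s z)"
      using integral_reflect[of "\<lambda>z. hk k t (x + z - y) * heat s z" 0] by (simp add: algebra_simps)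
    also have "\<dots> = hk k (t + s) (x - y)" by (rule hk_semigroup[OF t s])
    finally show ?thesis .
  qed
  show "(LINT z|lborel. hconv v k t (x + z) * heat s z) = hconv v k (t + s) x"
    using fub(1) by (simp add: inner outer) (simp add: hconv_def)
qed

section \<open>Averages against test functions\<close>

text \<open>Averages of \<open>v\<close> over translates of a test function. A function in the
  weighted class need not have a pointwise growth bound, but its averages do.\<close>

definition tconv :: "'n::finite fn \<Rightarrow> 'n fn \<Rightarrow> 'n fn" where
  "tconv v \<sigma> x = (LINT y|lborel. v y * \<sigma> (y - x))"

lemma csupp_weight_bound:
  fixes \<sigma> :: "real^'n \<Rightarrow> real"
  assumes c: "continuous_on UNIV \<sigma>" and s: "csupp \<sigma>" and b: "0 \<le> b"
  shows "\<exists>C\<ge>0. \<forall>z. \<bar>\<sigma> z\<bar> \<le> C * (1 + norm z) powr (- b)"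
proof -
  obtain R M where R: "R > 0" and M: "M > 0" "\<And>x. R < norm x \<Longrightarrow> \<sigma> x = 0" "\<And>x. \<bar>\<sigma> x\<bar> \<le> M"
    using csupp_bounded[OF c s] by metis
  have "\<bar>\<sigma> z\<bar> \<le> (M * (1 + R) powr b) * (1 + norm z) powr (- b)" for z
  proof (cases "norm z \<le> R")
    case True
    have "(1 + R) powr (- b) \<le> (1 + norm z) powr (- b)"
      using True b by (intro powr_mono2') (auto simp: add_pos_nonneg)
    then have "(1 + R) powr b * (1 + R) powr (- b) \<le> (1 + R) powr b * (1 + norm z) powr (- b)"
      by (intro mult_left_mono) auto
    then have "1 \<le> (1 + R) powr b * (1 + norm z) powr (- b)" using R by (simp add: powr_add[symmetric])
    then have "M * 1 \<le> M * ((1 + R) powr b * (1 + norm z) powr (- b))" using M(1) by (intro mult_left_mono) auto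
    then show ?thesis using M(3)[of z] by (simp add: mult.assoc)
  next
    case False
    then show ?thesis using M by simp
  qed
  then show ?thesis using M(1) by (intro exI[of _ "M * (1 + R) powr b"]) auto
qed

lemma tconv_continuous:
  fixes v :: "real^'n \<Rightarrow> real"
  assumes v: "wint b v" and b: "0 \<le> b" and c: "continuous_on UNIV \<sigma>" and s: "csupp \<sigma>"
  shows "continuous_on UNIV (tconv v \<sigma>)"
proof -
  have "symb 0 b \<sigma>" using csupp_weight_bound[OF c s b] c by simp
  then show ?thesis using Ck_convolution[OF v b, of 0 \<sigma>] by (simp add: tconv_def[abs_def])
qed

text \<open>Young's inequality with a weight: \<open>peetre\<close> moves the weight from
  \<open>x\<close> to \<open>y\<close>, and the remaining factor \<open>h (y - x)\<close> has a
  fixed finite integral because \<sigma> has compact support.\<close>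

lemma wint_tconv:
  fixes v :: "real^'n \<Rightarrow> real"
  assumes v: "wint b v" and b: "0 \<le> b" and c: "continuous_on UNIV \<sigma>" and s: "csupp \<sigma>"
  shows "wint b (tconv v \<sigma>)"
proof -
  have [measurable]: "v \<in> borel_measurable borel" and iv: "integrable lborel (\<lambda>y. \<bar>v y\<bar> * (1 + norm y) powr (- b))"
    using v by (auto simp: wint_def)
  have [measurable]: "\<sigma> \<in> borel_measurable borel" using c by (rule borel_measurable_continuous_onI)
  have m[measurable]: "tconv v \<sigma> \<in> borel_measurable borel"
    by (rule borel_measurable_continuous_onI[OF tconv_continuous[OF assms]])
  define h where "h w = \<sigma> w * (1 + norm w) powr b" for w
  have ch: "continuous_on UNIV (\<lambda>w::real^'n. (1 + norm w) powr b)"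
    by (intro continuous_intros) (auto simp: add_nonneg_eq_0_iff)
  have ih: "integrable lborel (\<lambda>w. \<bar>h w\<bar>)"
  proof -
    have "integrable lborel (\<lambda>w. (1 + norm w) powr b * \<sigma> w)"
      by (intro integrable_csupp csupp_mult s continuous_on_mult ch c)
    then show ?thesis by (auto simp: h_def mult.commute)
  qed
  have "(\<integral>\<^sup>+x. ennreal (norm (\<bar>tconv v \<sigma> x\<bar> * (1 + norm x) powr (- b))) \<partial>lborel) \<le>
     (\<integral>\<^sup>+x. \<integral>\<^sup>+y. ennreal (\<bar>v y\<bar> * (1 + norm y) powr (- b)) * ennreal \<bar>h (y - x)\<bar> \<partial>lborel \<partial>lborel)"
  proof (rule nn_integral_mono)
    fix x
    have iy: "integrable lborel (\<lambda>y. v y * \<sigma> (y - x))"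
      using csupp_weight_bound[OF c s b] by (auto intro!: wint_kernel_bound(2)[OF v b])
    have "ennreal \<bar>tconv v \<sigma> x\<bar> \<le> (\<integral>\<^sup>+y. ennreal \<bar>v y * \<sigma> (y - x)\<bar> \<partial>lborel)"
      unfolding tconv_def using integral_norm_bound_ennreal[OF iy] by simp
    then have "ennreal (\<bar>tconv v \<sigma> x\<bar> * (1 + norm x) powr (- b)) \<le> (\<integral>\<^sup>+y. ennreal \<bar>v y * \<sigma> (y - x)\<bar> \<partial>lborel) * ennreal ((1 + norm x) powr (- b))"
      by (simp add: ennreal_mult' mult_right_mono)
    also have "\<dots> = (\<integral>\<^sup>+y. ennreal \<bar>v y * \<sigma> (y - x)\<bar> * ennreal ((1 + norm x) powr (- b)) \<partial>lborel)"
      by (rule nn_integral_multc[symmetric]) measurable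
    also have "\<dots> \<le> (\<integral>\<^sup>+y. ennreal (\<bar>v y\<bar> * (1 + norm y) powr (- b)) * ennreal \<bar>h (y - x)\<bar> \<partial>lborel)"
    proof (rule nn_integral_mono)
      fix y
      have "(1 + norm x) powr (- b) \<le> (1 + norm (y - x)) powr b * (1 + norm y) powr (- b)"
        using peetre[OF b, of x "y - x"] by simp
      then have "\<bar>v y * \<sigma> (y - x)\<bar> * (1 + norm x) powr (- b) \<le> \<bar>v y * \<sigma> (y - x)\<bar> * ((1 + norm (y - x)) powr b * (1 + norm y) powr (- b))"
        by (intro mult_left_mono) auto
      also have "\<dots> = (\<bar>v y\<bar> * (1 + norm y) powr (- b)) * \<bar>h (y - x)\<bar>" by (simp add: h_def abs_mult mult_ac)
      finally show "ennreal \<bar>v y * \<sigma> (y - x)\<bar> * ennreal ((1 + norm x) powr (- b)) \<le> ennreal (\<bar>v y\<bar> * (1 + norm y) powr (- b)) * ennreal \<bar>h (y - x)\<bar>"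
        by (simp add: ennreal_mult'[symmetric] ennreal_leI)
    qed
    finally show "ennreal (norm (\<bar>tconv v \<sigma> x\<bar> * (1 + norm x) powr (- b))) \<le> (\<integral>\<^sup>+y. ennreal (\<bar>v y\<bar> * (1 + norm y) powr (- b)) * ennreal \<bar>h (y - x)\<bar> \<partial>lborel)"
      by simp
  qed
  also have "\<dots> = (\<integral>\<^sup>+y. \<integral>\<^sup>+x. ennreal (\<bar>v y\<bar> * (1 + norm y) powr (- b)) * ennreal \<bar>h (y - x)\<bar> \<partial>lborel \<partial>lborel)"
    by (rule lborel_pair.Fubini') (unfold h_def, measurable)
  also have "\<dots> = (\<integral>\<^sup>+y. ennreal (\<bar>v y\<bar> * (1 + norm y) powr (- b)) * ennreal (LINT w|lborel. \<bar>h w\<bar>) \<partial>lborel)"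
  proof (rule nn_integral_cong)
    fix y
    have hm: "(\<lambda>x. ennreal \<bar>h x\<bar>) \<in> borel_measurable borel" unfolding h_def by measurable
    have "(\<integral>\<^sup>+x. ennreal \<bar>h (y - x)\<bar> \<partial>lborel) = (\<integral>\<^sup>+x. ennreal \<bar>h x\<bar> \<partial>lborel)"
      by (rule nn_integral_reflect[OF hm])
    also have "\<dots> = ennreal (LINT w|lborel. \<bar>h w\<bar>)" by (rule nn_integral_eq_integral[OF ih]) simp
    finally show "(\<integral>\<^sup>+x. ennreal (\<bar>v y\<bar> * (1 + norm y) powr (- b)) * ennreal \<bar>h (y - x)\<bar> \<partial>lborel) = ennreal (\<bar>v y\<bar> * (1 + norm y) powr (- b)) * ennreal (LINT w|lborel. \<bar>h w\<bar>)"
      by (subst nn_integral_cmult) (auto simp: h_def)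
  qed
  also have "\<dots> = (\<integral>\<^sup>+y. ennreal (\<bar>v y\<bar> * (1 + norm y) powr (- b)) \<partial>lborel) * ennreal (LINT w|lborel. \<bar>h w\<bar>)"
    by (rule nn_integral_multc) measurable
  also have "\<dots> < \<infinity>" using iv by (simp add: nn_integral_eq_integral ennreal_mult_less_top)
  finally have "(\<integral>\<^sup>+x. ennreal (norm (\<bar>tconv v \<sigma> x\<bar> * (1 + norm x) powr (- b))) \<partial>lborel) < \<infinity>" .
  then show ?thesis unfolding wint_def by (auto intro!: integrableI_bounded)
qed

text \<open>The common majorant for the two exchanges of integrals in \<open>hconv_average\<close>
  and \<open>hconv_tconv\<close>.\<close>

lemma hconv_average_bound:
  fixes v :: "real^'n \<Rightarrow> real"
  assumes v: "wint b v" and b: "0 \<le> b" and c: "continuous_on UNIV \<sigma>" and s: "csupp \<sigma>" and t: "0 < t"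
  shows "\<exists>B. integrable lborel B \<and> (\<forall>w. 0 \<le> B w) \<and>
    (\<forall>w. (\<integral>\<^sup>+y. ennreal \<bar>\<sigma> w * (v y * hk k t (x + w - y))\<bar> \<partial>lborel) \<le> ennreal (B w))"
proof -
  have [measurable]: "v \<in> borel_measurable borel" using v by (auto simp: wint_def)
  obtain C where C: "C > 0" "\<And>z. \<bar>hk k t (z::real^'n)\<bar> \<le> C * (1 + norm z) powr (- b)"
    using hk_weight_bound_local[OF b t, of t k, where 'n='n] by auto
  define B where "B w = \<bar>\<sigma> w\<bar> * (C * (1 + norm (x + w)) powr b * wnorm b v)" for w
  have "integrable lborel (\<lambda>w. (C * (1 + norm (x + w)) powr b * wnorm b v) * \<sigma> w)"
    by (intro integrable_csupp csupp_mult s continuous_intros c) (auto simp: add_nonneg_eq_0_iff)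
  then have "integrable lborel (\<lambda>w. \<bar>(C * (1 + norm (x + w)) powr b * wnorm b v) * \<sigma> w\<bar>)" by (rule integrable_abs)
  then have "integrable lborel B" using C wnorm_nonneg[of b v] by (simp add: B_def[abs_def] abs_mult mult_ac)
  moreover have "0 \<le> B w" for w using C wnorm_nonneg[of b v] by (simp add: B_def)
  moreover have "(\<integral>\<^sup>+y. ennreal \<bar>\<sigma> w * (v y * hk k t (x + w - y))\<bar> \<partial>lborel) \<le> ennreal (B w)" for w
  proof -
    have "(\<integral>\<^sup>+y. ennreal \<bar>\<sigma> w * (v y * hk k t (x + w - y))\<bar> \<partial>lborel) = (\<integral>\<^sup>+y. ennreal \<bar>\<sigma> w\<bar> * ennreal \<bar>v y * hk k t (x + w - y)\<bar> \<partial>lborel)"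
      by (simp add: abs_mult ennreal_mult')
    also have "\<dots> = ennreal \<bar>\<sigma> w\<bar> * (\<integral>\<^sup>+y. ennreal \<bar>v y * hk k t (x + w - y)\<bar> \<partial>lborel)"
      by (rule nn_integral_cmult) measurable
    also have "\<dots> \<le> ennreal \<bar>\<sigma> w\<bar> * ennreal (C * (1 + norm (x + w)) powr b * wnorm b v)"
    proof (intro mult_left_mono wint_kernel_bound(1)[OF v b])
      show "\<bar>hk k t (x + w - y)\<bar> \<le> C * (1 + norm (y - (x + w))) powr (- b)" for y
        using C(2)[of "x + w - y"] by (simp only: norm_minus_weight)
    qed (use C in auto)
    also have "\<dots> = ennreal (B w)" by (simp add: B_def ennreal_mult')
    finally show ?thesis .
  qed
  ultimately show ?thesis by blast
qed

lemma hconv_average: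
  fixes v :: "real^'n \<Rightarrow> real"
  assumes v: "wint b v" and b: "0 \<le> b" and c: "continuous_on UNIV \<sigma>" and s: "csupp \<sigma>" and t: "0 < t"
  shows "(LINT w|lborel. \<sigma> w * hconv v k t (x + w)) = (LINT y|lborel. v y * (LINT w|lborel. \<sigma> w * hk k t (x + w - y)))"
proof -
  have [measurable]: "v \<in> borel_measurable borel" using v by (auto simp: wint_def)
  have [measurable]: "\<sigma> \<in> borel_measurable borel" using c by (rule borel_measurable_continuous_onI)
  obtain B where B: "integrable lborel B" "\<And>w. 0 \<le> B w"
    "\<And>w. (\<integral>\<^sup>+y. ennreal \<bar>\<sigma> w * (v y * hk k t (x + w - y))\<bar> \<partial>lborel) \<le> ennreal (B w)"
    using hconv_average_bound[OF assms] by blast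
  have "(LINT w|lborel. LINT y|lborel. \<sigma> w * (v y * hk k t (x + w - y))) = (LINT y|lborel. LINT w|lborel. \<sigma> w * (v y * hk k t (x + w - y)))"
    by (rule fubini_swap_bound(1)[OF _ B(3,1,2)]) measurable
  moreover have "(LINT w|lborel. \<sigma> w * (v y * hk k t (x + w - y))) = v y * (LINT w|lborel. \<sigma> w * hk k t (x + w - y))" for y
    by (subst integral_mult_right_zero[symmetric]) (simp add: mult_ac)
  ultimately show ?thesis by (simp add: hconv_def)
qed

lemma hconv_tconv:
  fixes v :: "real^'n \<Rightarrow> real"
  assumes v: "wint b v" and b: "0 \<le> b" and c: "continuous_on UNIV \<sigma>" and s: "csupp \<sigma>" and t: "0 < t"
  shows "hconv (tconv v \<sigma>) k t x = (LINT w|lborel. \<sigma> w * hconv v k t (x + w))"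
proof -
  have [measurable]: "v \<in> borel_measurable borel" using v by (auto simp: wint_def)
  have [measurable]: "\<sigma> \<in> borel_measurable borel" using c by (rule borel_measurable_continuous_onI)
  obtain B where B: "integrable lborel B" "\<And>w. 0 \<le> B w"
    "\<And>w. (\<integral>\<^sup>+y. ennreal \<bar>\<sigma> w * (v y * hk k t (x + w - y))\<bar> \<partial>lborel) \<le> ennreal (B w)"
    using hconv_average_bound[OF assms] by blast
  have "(LINT w|lborel. LINT z|lborel. \<sigma> w * (v (w + z) * hk k t (x - z))) = (LINT z|lborel. LINT w|lborel. \<sigma> w * (v (w + z) * hk k t (x - z)))"
  proof (rule fubini_swap_bound(1)[OF _ _ B(1,2)])
    show "(\<integral>\<^sup>+z. ennreal \<bar>\<sigma> w * (v (w + z) * hk k t (x - z))\<bar> \<partial>lborel) \<le> ennreal (B w)" for w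
      using B(3)[of w] nn_integral_translate[of "\<lambda>y. ennreal \<bar>\<sigma> w * (v y * hk k t (x + w - y))\<bar>" w] by simp
  qed measurable
  note swap = this
  have inner: "(LINT z|lborel. \<sigma> w * (v (w + z) * hk k t (x - z))) = \<sigma> w * hconv v k t (x + w)" for w
    using integral_translate[of "\<lambda>y. v y * hk k t (x + w - y)" w] by (simp add: hconv_def)
  have outer: "(LINT w|lborel. \<sigma> w * (v (w + z) * hk k t (x - z))) = tconv v \<sigma> z * hk k t (x - z)" for z
  proof -
    have "(LINT w|lborel. \<sigma> w * (v (w + z) * hk k t (x - z))) = (LINT w|lborel. \<sigma> w * v (w + z)) * hk k t (x - z)"
      by (subst integral_mult_left_zero[symmetric]) (simp add: mult_ac)
    also have "(LINT w|lborel. \<sigma> w * v (w + z)) = tconv v \<sigma> z"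
      using integral_translate[of "\<lambda>y. v y * \<sigma> (y - z)" z] by (simp add: tconv_def add.commute mult.commute)
    finally show ?thesis .
  qed
  show ?thesis using swap unfolding inner outer by (simp add: hconv_def[of "tconv v \<sigma>"])
qed

text \<open>Integration by parts moves the Laplacians from \<rho> to the heat kernel, where they act
  as time derivatives. The compact support of \<rho> removes the boundary terms.\<close>

lemma hconv_tconv_neg_lap_pow:
  fixes v :: "real^'n \<Rightarrow> real"
  assumes v: "wint b v" and b: "0 \<le> b" and \<rho>: "Ck (2 * m) \<rho>" "csupp \<rho>" and t: "0 < t"
  shows "hconv (tconv v ((neg_lap ^^ m) \<rho>)) k t x = hconv (tconv v \<rho>) (m + k) t x"
proof -
  let ?\<sigma> = "(neg_lap ^^ m) \<rho>"
  have c: "continuous_on UNIV ?\<sigma>" "continuous_on UNIV \<rho>"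
    using Ck_neg_lap_pow[of m 0 \<rho>] \<rho>(1) Ck_continuous by auto
  have "(LINT w|lborel. ?\<sigma> w * hk k t (x + w - y)) = (LINT w|lborel. \<rho> w * hk (m + k) t (x + w - y))" for y
  proof -
    have "(LINT w|lborel. (neg_lap ^^ m) (\<lambda>w. hk k t (w + (x - y))) w * \<rho> w) = (LINT w|lborel. hk k t (w + (x - y)) * ?\<sigma> w)"
      by (rule green_pow[OF Ck_translate[OF Ck_hk] \<rho>])
    then show ?thesis
      unfolding neg_lap_pow_translate[of m "hk k t" "x - y"] neg_lap_pow_hk[OF t] by (simp add: mult.commute algebra_simps)
  qed
  then show ?thesis
    using hconv_tconv[OF v b c(1) csupp_neg_lap_pow[OF \<rho>(2)] t, of k x] hconv_tconv[OF v b c(2) \<rho>(2) t, of "m + k" x]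
      hconv_average[OF v b c(1) csupp_neg_lap_pow[OF \<rho>(2)] t, of k x] hconv_average[OF v b c(2) \<rho>(2) t, of "m + k" x] by simp
qed

section \<open>The equation tested against heat kernels\<close>

lemma d2_tconv:
  fixes v :: "real^'n \<Rightarrow> real"
  assumes v: "wint b v" and b: "0 \<le> b" and c: "continuous_on UNIV \<sigma>" and s: "csupp \<sigma>"
  shows "d2 (tconv v \<sigma>) x z = (LINT y|lborel. v y * d2 \<sigma> (y - x) z)"
proof -
  have [measurable]: "\<sigma> \<in> borel_measurable borel" using c by (rule borel_measurable_continuous_onI)
  have i: "integrable lborel (\<lambda>y. v y * \<sigma> (y - x))" for x
    using csupp_weight_bound[OF c s b] by (auto intro!: wint_kernel_bound(2)[OF v b])
  have e: "v y * d2 \<sigma> (y - x) z = 2 * (v y * \<sigma> (y - x)) - v y * \<sigma> (y - (x + z)) - v y * \<sigma> (y - (x - z))" for y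
    by (simp add: d2_def algebra_simps)
  show ?thesis unfolding e using i by (simp add: d2_def tconv_def)
qed

text \<open>The second difference is passed to \<sigma>, which is of class C^2 with compact support.
  Unlike \<open>holder2\<close>, the resulting bound holds for all \<open>x\<close>, with the
  explicit growth (1 + |x|)^b.\<close>

lemma tconv_growth:
  fixes v :: "real^'n \<Rightarrow> real"
  assumes v: "wint b v" and b: "0 \<le> b" and \<sigma>: "Ck (Suc (Suc 0)) \<sigma>" and s: "csupp \<sigma>"
  shows "\<exists>C\<ge>0. \<forall>x. \<bar>tconv v \<sigma> x\<bar> \<le> C * (1 + norm x) powr b \<and>
    (\<forall>z. norm z \<le> 1 \<longrightarrow> \<bar>d2 (tconv v \<sigma>) x z\<bar> \<le> C * (1 + norm x) powr b * norm z powr 2)"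
proof -
  have c: "continuous_on UNIV \<sigma>" using \<sigma> by (rule Ck_continuous)
  have [measurable]: "\<sigma> \<in> borel_measurable borel" using c by (rule borel_measurable_continuous_onI)
  obtain C1 where C1: "C1 \<ge> 0" "\<And>z. \<bar>\<sigma> z\<bar> \<le> C1 * (1 + norm z) powr (- b)"
    using csupp_weight_bound[OF c s b] by blast
  have 1: "\<bar>tconv v \<sigma> x\<bar> \<le> C1 * (1 + norm x) powr b * wnorm b v" for x
    unfolding tconv_def by (rule wint_kernel_bound(3)[OF v b C1(2,1)]) measurable
  obtain R M where R: "R > 0" and M: "\<And>x. R < norm x \<Longrightarrow> \<sigma> x = 0" using csupp_bounded[OF c s] by metis
  obtain C2 where C2: "C2 \<ge> 0" "\<And>w z. norm w \<le> R + 1 \<Longrightarrow> norm z \<le> 1 \<Longrightarrow> \<bar>d2 \<sigma> w z\<bar> \<le> C2 * norm z powr 2"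
    using Ck_2_holder2[OF \<sigma>] unfolding holder2_def by blast
  have d: "\<bar>d2 \<sigma> w z\<bar> \<le> (C2 * (2 + R) powr b * norm z powr 2) * (1 + norm w) powr (- b)" if z: "norm z \<le> 1" for w z
  proof (cases "norm w \<le> R + 1")
    case True
    have "(2 + R) powr (- b) \<le> (1 + norm w) powr (- b)"
      using True b by (intro powr_mono2') (auto simp: add_pos_nonneg)
    then have "(2 + R) powr b * (2 + R) powr (- b) \<le> (2 + R) powr b * (1 + norm w) powr (- b)"
      by (intro mult_left_mono) auto
    then have "1 \<le> (2 + R) powr b * (1 + norm w) powr (- b)" using R by (simp add: powr_add[symmetric])
    then have "C2 * norm z powr 2 * 1 \<le> C2 * norm z powr 2 * ((2 + R) powr b * (1 + norm w) powr (- b))"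
      using C2(1) by (intro mult_left_mono) auto
    then show ?thesis using C2(2)[OF True z] by (simp add: mult_ac)
  next
    case False
    then have "R < norm w" "R < norm (w + z)" "R < norm (w - z)"
      using z norm_triangle_ineq2[of w "-z"] norm_triangle_ineq2[of w z] by auto
    then show ?thesis using M C2(1) by (simp add: d2_def)
  qed
  have 2: "\<bar>d2 (tconv v \<sigma>) x z\<bar> \<le> (C2 * (2 + R) powr b * norm z powr 2) * (1 + norm x) powr b * wnorm b v" if z: "norm z \<le> 1" for x z
    unfolding d2_tconv[OF v b c s]
    by (rule wint_kernel_bound(3)[OF v b d[OF z]]) (use C2 in \<open>auto simp: d2_def\<close>)
  define C where "C = (C1 + C2 * (2 + R) powr b) * wnorm b v"
  have "\<bar>tconv v \<sigma> x\<bar> \<le> C * (1 + norm x) powr b" for x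
  proof (rule order_trans[OF 1])
    have "C1 * wnorm b v \<le> C" unfolding C_def using C2(1) wnorm_nonneg[of b v] by (intro mult_right_mono) auto
    then have "(C1 * wnorm b v) * (1 + norm x) powr b \<le> C * (1 + norm x) powr b" by (intro mult_right_mono) auto
    then show "C1 * (1 + norm x) powr b * wnorm b v \<le> C * (1 + norm x) powr b" by (simp add: mult_ac)
  qed
  moreover have "\<bar>d2 (tconv v \<sigma>) x z\<bar> \<le> C * (1 + norm x) powr b * norm z powr 2" if z: "norm z \<le> 1" for x z
  proof (rule order_trans[OF 2[OF z]])
    have "C2 * (2 + R) powr b * wnorm b v \<le> C" unfolding C_def using C1(1) wnorm_nonneg[of b v] by (intro mult_right_mono) auto
    then have "(C2 * (2 + R) powr b * wnorm b v) * ((1 + norm x) powr b * norm z powr 2) \<le> C * ((1 + norm x) powr b * norm z powr 2)"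
      by (intro mult_right_mono) auto
    then show "(C2 * (2 + R) powr b * norm z powr 2) * (1 + norm x) powr b * wnorm b v \<le> C * (1 + norm x) powr b * norm z powr 2"
      by (simp add: mult_ac)
  qed
  moreover have "C \<ge> 0" using C1 C2 wnorm_nonneg[of b v] by (simp add: C_def)
  ultimately show ?thesis by blast
qed

text \<open>Averaging commutes with the fractional Laplacian by Fubini, since both are integrals
  over translates of \<open>v\<close>.\<close>

lemma tconv_frac_lap:
  fixes v :: "real^'n \<Rightarrow> real"
  assumes v: "wint b v" and b: "b = real CARD('n) + 2 * \<gamma>" and \<gamma>: "0 < \<gamma>" and \<eta>: "0 < \<eta>"
    and H: "holder2 (2 * \<gamma> + \<eta>) v" and cv: "continuous_on UNIV v" and def: "\<And>x. frac_lap_defined_at \<gamma> v x"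
    and c: "continuous_on UNIV \<sigma>" and s: "csupp \<sigma>"
  shows "tconv (frac_lap \<gamma> v) \<sigma> x = frac_const CARD('n) \<gamma> / 2 * (LINT z|lborel. d2 (tconv v \<sigma>) x z * norm z powr (- b))"
proof -
  have [measurable]: "v \<in> borel_measurable borel" using v by (auto simp: wint_def)
  have [measurable]: "\<sigma> \<in> borel_measurable borel" using c by (rule borel_measurable_continuous_onI)
  have cs: "continuous_on UNIV (\<lambda>y. \<sigma> (y - x))" for x
    by (rule continuous_on_compose2[OF c]) (auto intro!: continuous_intros)
  have ss: "csupp (\<lambda>y. \<sigma> (y - x))" for x using csupp_translate[OF s, of "-x"] by simp
  \<comment> \<open>\<open>R\<close> bounds the support of the translated test function. Only points
    \<open>y\<close> in this ball matter, and there the Hoelder constant can be chosen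
    uniformly.\<close>
  obtain R where R: "R > 0" "\<And>y. R < norm y \<Longrightarrow> \<sigma> (y - x) = 0" using csupp_bounded[OF cs ss] by metis
  obtain C where C: "C \<ge> 0" "\<And>y z. norm y \<le> R \<Longrightarrow> norm z \<le> 1 \<Longrightarrow> \<bar>d2 v y z\<bar> \<le> C * norm z powr (2 * \<gamma> + \<eta>)"
    using H unfolding holder2_def by blast
  define A where "A = C * (LINT z|lborel. indicator (cball 0 1) (z::real^'n) * norm z powr (- (real CARD('n) - \<eta>)))"
  define W where "W = (LINT z|lborel. (1 + norm (z::real^'n)) powr (- b))"
  define Bd where "Bd y = A + 2 powr b * (2 * \<bar>v y\<bar> * W + 2 * ((1 + norm y) powr b * wnorm b v))" for y
  have W0: "0 \<le> W" unfolding W_def by (intro integral_nonneg_AE) auto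
  have A0: "0 \<le> A" unfolding A_def using C(1) by (intro mult_nonneg_nonneg integral_nonneg_AE) auto
  have Bd0: "0 \<le> Bd y" for y using A0 W0 wnorm_nonneg[of b v] by (simp add: Bd_def)
  have "integrable lborel (\<lambda>y. Bd y * \<sigma> (y - x))"
    unfolding Bd_def by (intro integrable_csupp csupp_mult ss continuous_intros cs cv) (auto simp: add_nonneg_eq_0_iff)
  then have iB: "integrable lborel (\<lambda>y. \<bar>Bd y * \<sigma> (y - x)\<bar>)" by (rule integrable_abs)
  define f where "f y z = \<sigma> (y - x) * (d2 v y z * norm z powr (- b))" for y z
  have fm: "(\<lambda>(y, z). f y z) \<in> borel_measurable (borel \<Otimes>\<^sub>M borel)" unfolding f_def d2_def by measurable
  have le: "(\<integral>\<^sup>+z. ennreal \<bar>f y z\<bar> \<partial>lborel) \<le> ennreal \<bar>Bd y * \<sigma> (y - x)\<bar>" for y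
  proof (cases "norm y \<le> R")
    case True
    have "(\<integral>\<^sup>+z. ennreal \<bar>f y z\<bar> \<partial>lborel) = (\<integral>\<^sup>+z. ennreal \<bar>\<sigma> (y - x)\<bar> * ennreal \<bar>d2 v y z * norm z powr (- b)\<bar> \<partial>lborel)"
      by (simp add: f_def abs_mult ennreal_mult')
    also have "\<dots> = ennreal \<bar>\<sigma> (y - x)\<bar> * (\<integral>\<^sup>+z. ennreal \<bar>d2 v y z * norm z powr (- b)\<bar> \<partial>lborel)"
      by (rule nn_integral_cmult) (unfold d2_def, measurable)
    also have "\<dots> \<le> ennreal \<bar>\<sigma> (y - x)\<bar> * ennreal (Bd y)"
      using d2_kernel_bound(1)[OF v b \<gamma> \<eta> C(2)[OF True] C(1)] unfolding Bd_def A_def W_def by (intro mult_left_mono) auto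
    also have "\<dots> = ennreal \<bar>Bd y * \<sigma> (y - x)\<bar>" using Bd0[of y] by (simp add: ennreal_mult'[symmetric] abs_mult mult.commute)
    finally show ?thesis .
  next
    case False
    then show ?thesis using R(2)[of y] by (simp add: f_def)
  qed
  have "(LINT y|lborel. LINT z|lborel. f y z) = (LINT z|lborel. LINT y|lborel. f y z)"
    by (rule fubini_swap_bound(1)[OF fm le iB]) simp
  moreover have "(LINT z|lborel. f y z) = \<sigma> (y - x) * (LINT z|lborel. d2 v y z * norm z powr (- b))" for y
    by (simp add: f_def)
  moreover have "(LINT y|lborel. f y z) = d2 (tconv v \<sigma>) x z * norm z powr (- b)" for z
  proof -
    have sh: "integrable lborel (\<lambda>y. v (y + a) * \<sigma> (y - x))" "(LINT y|lborel. v (y + a) * \<sigma> (y - x)) = tconv v \<sigma> (x + a)" for a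
    proof -
      have "continuous_on UNIV (\<lambda>y. v (y + a))" by (rule continuous_on_compose2[OF cv]) (auto intro!: continuous_intros)
      then show "integrable lborel (\<lambda>y. v (y + a) * \<sigma> (y - x))" by (intro integrable_csupp csupp_mult ss continuous_on_mult cs)
      show "(LINT y|lborel. v (y + a) * \<sigma> (y - x)) = tconv v \<sigma> (x + a)"
        using integral_translate[of "\<lambda>y. v y * \<sigma> (y - (x + a))" a] by (simp add: tconv_def add.commute algebra_simps)
    qed
    have "(LINT y|lborel. f y z) = (LINT y|lborel. 2 * (v (y + 0) * \<sigma> (y - x)) - v (y + z) * \<sigma> (y - x) - v (y + (- z)) * \<sigma> (y - x)) * norm z powr (- b)"
      by (subst integral_mult_left_zero[symmetric]) (simp add: f_def d2_def algebra_simps)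
    also have "(LINT y|lborel. 2 * (v (y + 0) * \<sigma> (y - x)) - v (y + z) * \<sigma> (y - x) - v (y + (- z)) * \<sigma> (y - x)) = 2 * tconv v \<sigma> (x + 0) - tconv v \<sigma> (x + z) - tconv v \<sigma> (x + - z)"
      using sh(1)[of 0] sh(1)[of z] sh(1)[of "-z"] sh(2)[of 0] sh(2)[of z] sh(2)[of "-z"] by simp
    finally show ?thesis by (simp add: d2_def)
  qed
  ultimately have *: "(LINT y|lborel. \<sigma> (y - x) * (LINT z|lborel. d2 v y z * norm z powr (- b))) = (LINT z|lborel. d2 (tconv v \<sigma>) x z * norm z powr (- b))"
    by simp
  have "tconv (frac_lap \<gamma> v) \<sigma> x = (LINT y|lborel. frac_const CARD('n) \<gamma> / 2 * (\<sigma> (y - x) * (LINT z|lborel. d2 v y z * norm z powr (- b))))"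
    unfolding tconv_def frac_lap_eq[OF v b \<gamma> \<eta> H def] by (simp add: mult_ac)
  then show ?thesis using * by simp
qed

text \<open>The heat extension commutes with the singular integral. The bounds on \<open>N\<close>
  and on its second differences grow only like (1 + |x|)^b, which the heat kernel integrates; this
  is why \<open>N\<close> will be an average of \<open>v\<close> and not \<open>v\<close>
  itself.\<close>

lemma hconv_singular_integral:
  fixes N :: "real^'n \<Rightarrow> real"
  assumes N: "wint b N" and b: "b = real CARD('n) + 2 * \<gamma>" and \<gamma>: "0 < \<gamma>" "\<gamma> < 1"
    and C: "C \<ge> 0" "\<And>x. \<bar>N x\<bar> \<le> C * (1 + norm x) powr b"
      "\<And>x z. norm z \<le> 1 \<Longrightarrow> \<bar>d2 N x z\<bar> \<le> C * (1 + norm x) powr b * norm z powr 2"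
    and t: "0 < t"
  shows "hconv (\<lambda>x. LINT z|lborel. d2 N x z * norm z powr (- b)) k t x0 = (LINT z|lborel. d2 (hconv N k t) x0 z * norm z powr (- b))"
    and "integrable lborel (\<lambda>z. d2 (hconv N k t) x0 z * norm z powr (- b))"
proof -
  have b0: "0 \<le> b" using b \<gamma> by simp
  have [measurable]: "N \<in> borel_measurable borel" using N by (auto simp: wint_def)
  \<comment> \<open>With this \<eta> the exponent 2 \<gamma> + \<eta> of
    \<open>d2_kernel_bound\<close> is 2, the order of the given bound on second differences.\<close>
  define \<eta> where "\<eta> = 2 - 2 * \<gamma>"
  have \<eta>: "0 < \<eta>" "2 * \<gamma> + \<eta> = 2" using \<gamma> by (auto simp: \<eta>_def)
  define A where "A = (LINT z|lborel. indicator (cball 0 1) (z::real^'n) * norm z powr (- (real CARD('n) - \<eta>)))"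
  define W where "W = (LINT z|lborel. (1 + norm (z::real^'n)) powr (- b))"
  have W0: "0 \<le> W" unfolding W_def by (intro integral_nonneg_AE) auto
  have A0: "0 \<le> A" unfolding A_def by (intro integral_nonneg_AE) auto
  define M where "M = C * A + 2 powr b * (2 * C * W + 2 * wnorm b N)"
  have M0: "0 \<le> M" using C(1) A0 W0 wnorm_nonneg[of b N] by (simp add: M_def)
  have bd: "(\<integral>\<^sup>+z. ennreal \<bar>d2 N x z * norm z powr (- b)\<bar> \<partial>lborel) \<le> ennreal (M * (1 + norm x) powr b)" for x
  proof -
    have "\<bar>d2 N x z\<bar> \<le> (C * (1 + norm x) powr b) * norm z powr (2 * \<gamma> + \<eta>)" if "norm z \<le> 1" for z
      using C(3)[OF that, of x] by (simp only: \<eta>(2))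
    from d2_kernel_bound(1)[OF N b \<gamma>(1) \<eta>(1) this]
    have "(\<integral>\<^sup>+z. ennreal \<bar>d2 N x z * norm z powr (- b)\<bar> \<partial>lborel) \<le> ennreal (C * (1 + norm x) powr b * A + 2 powr b * (2 * \<bar>N x\<bar> * W + 2 * ((1 + norm x) powr b * wnorm b N)))"
      using C(1) by (simp add: A_def W_def)
    also have "\<dots> \<le> ennreal (M * (1 + norm x) powr b)"
    proof (rule ennreal_leI)
      have "2 * \<bar>N x\<bar> * W \<le> 2 * (C * (1 + norm x) powr b) * W" using C(2)[of x] W0 by (intro mult_right_mono mult_left_mono) auto
      then have "2 powr b * (2 * \<bar>N x\<bar> * W + 2 * ((1 + norm x) powr b * wnorm b N)) \<le> 2 powr b * (2 * (C * (1 + norm x) powr b) * W + 2 * ((1 + norm x) powr b * wnorm b N))"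
        by (intro mult_left_mono) auto
      then show "C * (1 + norm x) powr b * A + 2 powr b * (2 * \<bar>N x\<bar> * W + 2 * ((1 + norm x) powr b * wnorm b N)) \<le> M * (1 + norm x) powr b"
        by (simp add: M_def algebra_simps)
    qed
    finally show ?thesis .
  qed
  define f where "f x z = d2 N x z * norm z powr (- b) * hk k t (x0 - x)" for x z
  define B where "B x = M * (1 + norm x0) powr b * ((1 + norm (x0 - x)) powr b * \<bar>hk k t (x0 - x)\<bar>)" for x
  have fm: "(\<lambda>(x, z). f x z) \<in> borel_measurable (borel \<Otimes>\<^sub>M borel)" unfolding f_def d2_def by measurable
  have iB: "integrable lborel B" unfolding B_def
    using integrable_reflect[of "\<lambda>z. (1 + norm z) powr b * \<bar>hk k t z\<bar>" x0] integrable_growth_times_hk[OF b0 t, of k, where 'n='n]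
    by (intro integrable_mult_right) simp
  have B0: "0 \<le> B x" for x using M0 by (simp add: B_def)
  have le: "(\<integral>\<^sup>+z. ennreal \<bar>f x z\<bar> \<partial>lborel) \<le> ennreal (B x)" for x
  proof -
    have "(\<integral>\<^sup>+z. ennreal \<bar>f x z\<bar> \<partial>lborel) = (\<integral>\<^sup>+z. ennreal \<bar>d2 N x z * norm z powr (- b)\<bar> * ennreal \<bar>hk k t (x0 - x)\<bar> \<partial>lborel)"
      by (simp add: f_def abs_mult ennreal_mult')
    also have "\<dots> = (\<integral>\<^sup>+z. ennreal \<bar>d2 N x z * norm z powr (- b)\<bar> \<partial>lborel) * ennreal \<bar>hk k t (x0 - x)\<bar>"
      by (rule nn_integral_multc) (unfold d2_def, measurable)
    also have "\<dots> \<le> ennreal (M * (1 + norm x) powr b) * ennreal \<bar>hk k t (x0 - x)\<bar>"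
      by (intro mult_right_mono bd) auto
    also have "\<dots> = ennreal (M * (1 + norm x) powr b * \<bar>hk k t (x0 - x)\<bar>)"
      using M0 by (simp add: ennreal_mult')
    also have "\<dots> \<le> ennreal (B x)"
    proof (rule ennreal_leI)
      have "(1 + norm x) powr b \<le> (1 + norm x0) powr b * (1 + norm (x0 - x)) powr b"
        using weight_add[OF b0, of x0 "x - x0"] by (simp add: norm_minus_commute)
      then have "M * (1 + norm x) powr b * \<bar>hk k t (x0 - x)\<bar> \<le> M * ((1 + norm x0) powr b * (1 + norm (x0 - x)) powr b) * \<bar>hk k t (x0 - x)\<bar>"
        using M0 by (intro mult_right_mono mult_left_mono) auto
      then show "M * (1 + norm x) powr b * \<bar>hk k t (x0 - x)\<bar> \<le> B x" by (simp add: B_def mult_ac)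
    qed
    finally show ?thesis .
  qed
  note fub = fubini_swap_bound[OF fm le iB B0]
  have inner: "(LINT x|lborel. f x z) = d2 (hconv N k t) x0 z * norm z powr (- b)" for z
  proof -
    have sh: "integrable lborel (\<lambda>x. N (x + a) * hk k t (x0 - x))" "(LINT x|lborel. N (x + a) * hk k t (x0 - x)) = hconv N k t (x0 + a)" for a
      using integrable_translate[of "\<lambda>x. N x * hk k t (x0 + a - x)" a] hconv_integrable[OF N b0 t, of k "x0 + a"]
        integral_translate[of "\<lambda>x. N x * hk k t (x0 + a - x)" a] by (simp_all add: hconv_def add.commute)
    have "(LINT x|lborel. f x z) = (LINT x|lborel. 2 * (N (x + 0) * hk k t (x0 - x)) - N (x + z) * hk k t (x0 - x) - N (x + (- z)) * hk k t (x0 - x)) * norm z powr (- b)"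
      by (subst integral_mult_left_zero[symmetric]) (simp add: f_def d2_def algebra_simps)
    also have "(LINT x|lborel. 2 * (N (x + 0) * hk k t (x0 - x)) - N (x + z) * hk k t (x0 - x) - N (x + (- z)) * hk k t (x0 - x)) = 2 * hconv N k t (x0 + 0) - hconv N k t (x0 + z) - hconv N k t (x0 + - z)"
      using sh(1)[of 0] sh(1)[of z] sh(1)[of "-z"] sh(2)[of 0] sh(2)[of z] sh(2)[of "-z"] by simp
    finally show ?thesis by (simp add: d2_def)
  qed
  have outer: "(LINT z|lborel. f x z) = (LINT z|lborel. d2 N x z * norm z powr (- b)) * hk k t (x0 - x)" for x
    by (simp add: f_def)
  show "hconv (\<lambda>x. LINT z|lborel. d2 N x z * norm z powr (- b)) k t x0 = (LINT z|lborel. d2 (hconv N k t) x0 z * norm z powr (- b))"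
    using fub(1) unfolding inner outer by (simp add: hconv_def[of "\<lambda>x. LINT z|lborel. d2 N x z * norm z powr (- b)"])
  show "integrable lborel (\<lambda>z. d2 (hconv N k t) x0 z * norm z powr (- b))"
    using fub(3) unfolding inner .
qed

text \<open>The singular kernel is a superposition of heat kernels, so the fractional Laplacian of a heat
  extension is a Marchaud derivative in the time variable.\<close>

lemma singular_integral_marchaud:
  fixes N :: "real^'n \<Rightarrow> real"
  assumes N: "wint b N" and b: "b = real CARD('n) + 2 * \<gamma>" and \<gamma>: "0 < \<gamma>" "\<gamma> < 1" and t: "0 < t"
    and int: "integrable lborel (\<lambda>z. d2 (hconv N k t) x z * norm z powr (- b))"
  shows "frac_const CARD('n) \<gamma> / 2 * (LINT z|lborel. d2 (hconv N k t) x z * norm z powr (- b)) =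
    \<gamma> / Gamma (1 - \<gamma>) * (LINT s|lborel. indicator {0<..} s * (s powr (- 1 - \<gamma>) * (hconv N k t x - hconv N k (t + s) x)))"
proof -
  have b0: "0 \<le> b" using b \<gamma> by simp
  have [measurable]: "N \<in> borel_measurable borel" using N by (auto simp: wint_def)
  have [measurable]: "hconv N k t \<in> borel_measurable borel"
    by (rule borel_measurable_continuous_onI[OF hconv_continuous[OF N b0 t]])
  \<comment> \<open>What remains of \<open>frac_const\<close> after the constant of
    \<open>heat_subordination\<close> is split off.\<close>
  define K where "K = \<gamma> / Gamma (1 - \<gamma>)"
  let ?n = "real CARD('n)"
  have sub: "frac_const CARD('n) \<gamma> * norm z powr (- b) = K * (LINT s|lborel. indicator {0<..} s * (s powr (- 1 - \<gamma>) * heat s z))"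
    and subi: "integrable lborel (\<lambda>s. indicator {0<..} s * (s powr (- 1 - \<gamma>) * heat s z))" if "z \<noteq> 0" for z :: "real^'n"
  proof -
    have pos: "real CARD('n) / 2 + \<gamma> > 0" using \<gamma> by (simp add: add_pos_pos)
    show "frac_const CARD('n) \<gamma> * norm z powr (- b) = K * (LINT s|lborel. indicator {0<..} s * (s powr (- 1 - \<gamma>) * heat s z))"
      unfolding heat_subordination(2)[OF pos that] K_def frac_const_def b by (simp add: mult_ac)
    show "integrable lborel (\<lambda>s. indicator {0<..} s * (s powr (- 1 - \<gamma>) * heat s z))"
      by (rule heat_subordination(1)[OF pos that])
  qed
  have K0: "0 \<le> K" using \<gamma> by (simp add: K_def)
  define f where "f z s = K / 2 * d2 (hconv N k t) x z * (indicator {0<..} s * (s powr (- 1 - \<gamma>) * heat s z))" for z :: "real^'n" and s :: real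
  define B where "B z = \<bar>frac_const CARD('n) \<gamma> / 2 * (d2 (hconv N k t) x z * norm z powr (- b))\<bar>" for z
  have inner: "(LINT s|lborel. f z s) = frac_const CARD('n) \<gamma> / 2 * (d2 (hconv N k t) x z * norm z powr (- b))" for z
  proof (cases "z = 0")
    case False
    have "(LINT s|lborel. f z s) = d2 (hconv N k t) x z / 2 * (K * (LINT s|lborel. indicator {0<..} s * (s powr (- 1 - \<gamma>) * heat s z)))"
      by (simp add: f_def)
    also have "\<dots> = d2 (hconv N k t) x z / 2 * (frac_const CARD('n) \<gamma> * norm z powr (- b))"
      using sub[OF False] by simp
    finally show ?thesis by simp
  qed (simp add: f_def d2_def)
  have le: "(\<integral>\<^sup>+s. ennreal \<bar>f z s\<bar> \<partial>lborel) \<le> ennreal (B z)" for z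
  proof (cases "z = 0")
    case False
    have "integrable lborel (f z)" unfolding f_def using subi[OF False] by (rule integrable_mult_right)
    then have "(\<integral>\<^sup>+s. ennreal \<bar>f z s\<bar> \<partial>lborel) = ennreal (LINT s|lborel. \<bar>f z s\<bar>)"
      by (intro nn_integral_eq_integral integrable_abs) auto
    also have "(LINT s|lborel. \<bar>f z s\<bar>) = \<bar>LINT s|lborel. f z s\<bar>"
    proof -
      \<comment> \<open>For fixed \<open>z\<close> the integrand has a constant sign in
        \<open>s\<close>, that of the second difference, so the integral of its absolute value is
        the absolute value of its integral.\<close>
      have "(\<lambda>s. \<bar>f z s\<bar>) = (\<lambda>s. sgn (d2 (hconv N k t) x z) * f z s)"
      proof
        fix s
        have "0 \<le> K / 2 * (indicator {0<..} s * (s powr (- 1 - \<gamma>) * heat s z))" using K0 by simp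
        then show "\<bar>f z s\<bar> = sgn (d2 (hconv N k t) x z) * f z s"
          by (auto simp: f_def abs_mult sgn_if mult_ac abs_of_nonneg K0)
      qed
      then have "(LINT s|lborel. \<bar>f z s\<bar>) = sgn (d2 (hconv N k t) x z) * (LINT s|lborel. f z s)" by simp
      moreover have "0 \<le> (LINT s|lborel. \<bar>f z s\<bar>)" by (intro integral_nonneg_AE) auto
      moreover have "d2 (hconv N k t) x z = 0 \<Longrightarrow> (LINT s|lborel. f z s) = 0" unfolding inner by simp
      ultimately show ?thesis by (auto simp: sgn_if split: if_splits)
    qed
    finally show ?thesis by (simp only: inner B_def order_refl)
  qed (simp add: f_def d2_def)
  have fm: "(\<lambda>(z, s). f z s) \<in> borel_measurable (borel \<Otimes>\<^sub>M borel)" unfolding f_def d2_def by measurable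
  have iB: "integrable lborel B" unfolding B_def by (intro integrable_abs integrable_mult_right int)
  have swap: "(LINT z|lborel. LINT s|lborel. f z s) = (LINT s|lborel. LINT z|lborel. f z s)"
    by (rule fubini_swap_bound(1)[OF fm le iB]) (simp add: B_def)
  \<comment> \<open>By the semigroup property the terms at x + z and x - z both integrate to the
    extension at time t + s; the resulting factor 2 cancels the 1/2.\<close>
  have outer: "(LINT z|lborel. f z s) = K * (indicator {0<..} s * (s powr (- 1 - \<gamma>) * (hconv N k t x - hconv N k (t + s) x)))" for s
  proof (cases "s > 0")
    case True
    note h = hconv_heat[OF N b0 t True, of k x]
    have h': "integrable lborel (\<lambda>z. hconv N k t (x - z) * heat s z)" "(LINT z|lborel. hconv N k t (x - z) * heat s z) = hconv N k (t + s) x"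
      using integrable_reflect[of "\<lambda>z. hconv N k t (x + z) * heat s z" 0] integral_reflect[of "\<lambda>z. hconv N k t (x + z) * heat s z" 0] h by auto
    have i1: "integrable lborel (\<lambda>z::real^'n. 2 * hconv N k t x * heat s z)" using integral_heat(1)[OF True] by (rule integrable_mult_right)
    have "(LINT z|lborel. f z s) = (LINT z|lborel. (K / 2 * s powr (- 1 - \<gamma>)) * (2 * hconv N k t x * heat s z - hconv N k t (x + z) * heat s z - hconv N k t (x - z) * heat s z))"
      using True by (intro Bochner_Integration.integral_cong refl) (simp add: f_def d2_def algebra_simps)
    also have "\<dots> = (K / 2 * s powr (- 1 - \<gamma>)) * (2 * hconv N k t x - hconv N k (t + s) x - hconv N k (t + s) x)"
      using i1 h h' integral_heat(2)[OF True, where 'n='n] by simp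
    finally show ?thesis using True by (simp add: algebra_simps)
  qed (simp add: f_def)
  show ?thesis using swap unfolding inner outer by (simp add: K_def)
qed

text \<open>The m Laplacians pass to \<rho>, which gives \<sigma>; the fractional Laplacian is then
  evaluated on the average \<open>N\<close> of \<open>v\<close> against \<sigma>, where the growth
  is controlled; after the heat extension the Laplacians leave \<sigma> again as time derivatives.
  Of the 2m + 2 derivatives of \<rho>, the last two serve \<open>tconv_growth\<close> for
  \<sigma>.\<close>

lemma hconv_equation_marchaud:
  fixes v :: "real^'n \<Rightarrow> real"
  assumes v: "wint b v" and b: "b = real CARD('n) + 2 * \<gamma>" and \<gamma>: "0 < \<gamma>" "\<gamma> < 1" and \<eta>: "0 < \<eta>"
    and H: "holder2 (2 * \<gamma> + \<eta>) v" and cv: "continuous_on UNIV v" and def: "\<And>x. frac_lap_defined_at \<gamma> v x"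
    and u: "Ck (2 * m) (frac_lap \<gamma> v)" and \<rho>: "Ck (2 * m + 2) \<rho>" "csupp \<rho>" and t: "0 < t"
  shows "hconv (tconv ((neg_lap ^^ m) (frac_lap \<gamma> v)) \<rho>) k t x =
    \<gamma> / Gamma (1 - \<gamma>) * (LINT s|lborel. indicator {0<..} s * (s powr (- 1 - \<gamma>) *
      (hconv (tconv v \<rho>) (m + k) t x - hconv (tconv v \<rho>) (m + k) (t + s) x)))"
proof -
  have b0: "0 \<le> b" using b \<gamma> by simp
  define \<sigma> where "\<sigma> = (neg_lap ^^ m) \<rho>"
  have \<rho>m: "Ck (2 * m) \<rho>" using \<rho>(1) by (rule Ck_mono) simp
  have \<sigma>: "Ck (Suc (Suc 0)) \<sigma>" unfolding \<sigma>_def by (rule Ck_neg_lap_pow) (use \<rho>(1) in simp)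
  have s\<sigma>: "csupp \<sigma>" unfolding \<sigma>_def by (rule csupp_neg_lap_pow[OF \<rho>(2)])
  have c\<sigma>: "continuous_on UNIV \<sigma>" using \<sigma> by (rule Ck_continuous)
  have parts: "tconv ((neg_lap ^^ m) (frac_lap \<gamma> v)) \<rho> y = tconv (frac_lap \<gamma> v) \<sigma> y" for y
  proof -
    have "(LINT w|lborel. (neg_lap ^^ m) (frac_lap \<gamma> v) w * \<rho> (w + (- y))) = (LINT w|lborel. frac_lap \<gamma> v w * (neg_lap ^^ m) (\<lambda>w. \<rho> (w + (- y))) w)"
      by (rule green_pow[OF u Ck_translate[OF \<rho>m] csupp_translate[OF \<rho>(2)]])
    then show ?thesis unfolding neg_lap_pow_translate[of m \<rho> "- y"] by (simp add: tconv_def \<sigma>_def)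
  qed
  define N where "N = tconv v \<sigma>"
  have N: "wint b N" unfolding N_def by (rule wint_tconv[OF v b0 c\<sigma> s\<sigma>])
  obtain C where C: "C \<ge> 0" "\<And>x. \<bar>N x\<bar> \<le> C * (1 + norm x) powr b"
      "\<And>x z. norm z \<le> 1 \<Longrightarrow> \<bar>d2 N x z\<bar> \<le> C * (1 + norm x) powr b * norm z powr 2"
    using tconv_growth[OF v b0 \<sigma> s\<sigma>] unfolding N_def by blast
  have eq: "tconv ((neg_lap ^^ m) (frac_lap \<gamma> v)) \<rho> = (\<lambda>y. frac_const CARD('n) \<gamma> / 2 * (LINT z|lborel. d2 N y z * norm z powr (- b)))"
    using parts tconv_frac_lap[OF v b \<gamma>(1) \<eta> H cv def c\<sigma> s\<sigma>] by (simp add: N_def fun_eq_iff)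
  have cm: "hconv (\<lambda>y. a * g y) k t x = a * hconv g k t x" for a and g :: "real^'n \<Rightarrow> real"
    by (simp add: hconv_def mult.assoc)
  have hN: "hconv N k s x = hconv (tconv v \<rho>) (m + k) s x" if "s > 0" for s
    unfolding N_def \<sigma>_def by (rule hconv_tconv_neg_lap_pow[OF v b0 \<rho>m \<rho>(2) that])
  have "hconv (tconv ((neg_lap ^^ m) (frac_lap \<gamma> v)) \<rho>) k t x = frac_const CARD('n) \<gamma> / 2 * (LINT z|lborel. d2 (hconv N k t) x z * norm z powr (- b))"
  proof -
    have "hconv (\<lambda>y. LINT z|lborel. d2 N y z * norm z powr (- b)) k t x = (LINT z|lborel. d2 (hconv N k t) x z * norm z powr (- b))"
      by (rule hconv_singular_integral(1)[OF N b \<gamma> C t])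
    then show ?thesis by (simp only: eq cm)
  qed
  also have "\<dots> = \<gamma> / Gamma (1 - \<gamma>) * (LINT s|lborel. indicator {0<..} s * (s powr (- 1 - \<gamma>) * (hconv N k t x - hconv N k (t + s) x)))"
    by (rule singular_integral_marchaud[OF N b \<gamma> t hconv_singular_integral(2)[OF N b \<gamma> C t]])
  also have "(LINT s|lborel. indicator {0<..} s * (s powr (- 1 - \<gamma>) * (hconv N k t x - hconv N k (t + s) x))) =
     (LINT s|lborel. indicator {0<..} s * (s powr (- 1 - \<gamma>) * (hconv (tconv v \<rho>) (m + k) t x - hconv (tconv v \<rho>) (m + k) (t + s) x)))"
    by (intro Bochner_Integration.integral_cong refl) (use t hN in \<open>auto simp: indicator_def\<close>)
  finally show ?thesis .
qed

section \<open>From Marchaud to Weyl form\<close>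

lemma nn_integral_powr_tail:
  assumes "0 < a" "0 < (s::real)"
  shows "(\<integral>\<^sup>+x. ennreal (x powr (- 1 - a)) * indicator {s..} x \<partial>lborel) = ennreal (s powr (- a) / a)"
proof -
  have "(\<integral>\<^sup>+x. ennreal (x powr (- 1 - a)) * indicator {s..} x \<partial>lborel) = ennreal (0 - (- (s powr (- a) / a)))"
  proof (rule nn_integral_FTC_atLeast)
    show "((\<lambda>x. - (x powr (- a) / a)) has_real_derivative x powr (- 1 - a)) (at x)" if "s \<le> x" for x
    proof -
      have "((\<lambda>x. - (x powr (- a) / a)) has_real_derivative - (- a * x powr (- a - 1) / a)) (at x)"
        using that assms by (auto intro!: derivative_eq_intros)
      moreover have "- a - 1 = - 1 - a" by simp
      ultimately show ?thesis using assms by (simp only:) simp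
    qed
    have "((\<lambda>x::real. x powr (- a)) \<longlongrightarrow> 0) at_top"
      using assms by (intro tendsto_neg_powr filterlim_ident) auto
    from tendsto_minus[OF tendsto_divide[OF this tendsto_const, of a]]
    show "((\<lambda>x. - (x powr (- a) / a)) \<longlongrightarrow> 0) at_top" using assms by simp
  qed auto
  then show ?thesis by simp
qed

text \<open>Write q(t) - q(t + s) as the integral of q'(t + r) over 0 < r < s (here
  \<open>q'\<close> is minus the derivative of \<open>q\<close>) and exchange; the integral of
  s^(-1-\<gamma>) over s > r is r^(-\<gamma>)/\<gamma>.\<close>

lemma marchaud_eq_weyl:
  fixes q q' :: "real \<Rightarrow> real"
  assumes \<gamma>: "0 < \<gamma>" "\<gamma> < 1" and t: "0 < t"
    and der: "\<And>s. s \<ge> t \<Longrightarrow> (q has_real_derivative - q' s) (at s)" and cont: "\<And>s. s \<ge> t \<Longrightarrow> isCont q' s"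
    and bd: "\<And>s. s \<ge> t \<Longrightarrow> \<bar>q' s\<bar> \<le> C * s powr (\<gamma> - 2)" and [measurable]: "q' \<in> borel_measurable borel"
  shows "\<gamma> * (LINT s|lborel. indicator {0<..} s * (s powr (- 1 - \<gamma>) * (q t - q (t + s)))) =
    (LINT r|lborel. indicator {0<..} r * (r powr (- \<gamma>) * q' (t + r)))"
proof -
  define f where "f r s = indicator {0<..} r * (indicator {r..} s * (s powr (- 1 - \<gamma>) * q' (t + r)))" for r s :: real
  define B where "B r = C / \<gamma> * (indicator {0<..} r * (r powr ((1 - \<gamma>) - 1) * (t + r) powr (- (2 - \<gamma>))))" for r
  have C0: "0 \<le> C"
  proof -
    have "0 \<le> C * t powr (\<gamma> - 2)" using bd[of t] by linarith
    then show ?thesis using t by (simp add: zero_le_mult_iff)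
  qed
  have fm: "(\<lambda>(r, s). f r s) \<in> borel_measurable (borel \<Otimes>\<^sub>M borel)"
  proof -
    have "f = (\<lambda>r s. indicator {0<..} r * ((if r \<le> s then 1 else 0) * (s powr (- 1 - \<gamma>) * q' (t + r))))"
      by (auto simp: f_def fun_eq_iff indicator_def)
    then show ?thesis by simp
  qed
  have iB: "integrable lborel B" unfolding B_def using \<gamma> t by (intro integrable_mult_right integrable_powr_halfline) auto
  have B0: "0 \<le> B r" for r using C0 \<gamma> by (simp add: B_def)
  have f_nn: "(\<integral>\<^sup>+s. ennreal (indicator {r..} s * s powr (- 1 - \<gamma>)) \<partial>lborel) = ennreal (r powr (- \<gamma>) / \<gamma>)" if "r > 0" for r
  proof -
    have "(\<integral>\<^sup>+s. ennreal (indicator {r..} s * s powr (- 1 - \<gamma>)) \<partial>lborel) = (\<integral>\<^sup>+s. ennreal (s powr (- 1 - \<gamma>)) * indicator {r..} s \<partial>lborel)"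
      by (intro nn_integral_cong) (auto simp: indicator_def)
    then show ?thesis using nn_integral_powr_tail[OF \<gamma>(1) that] by simp
  qed
  have le: "(\<integral>\<^sup>+s. ennreal \<bar>f r s\<bar> \<partial>lborel) \<le> ennreal (B r)" for r
  proof (cases "r > 0")
    case True
    have "(\<integral>\<^sup>+s. ennreal \<bar>f r s\<bar> \<partial>lborel) = (\<integral>\<^sup>+s. ennreal (indicator {r..} s * s powr (- 1 - \<gamma>)) * ennreal \<bar>q' (t + r)\<bar> \<partial>lborel)"
      using True by (intro nn_integral_cong) (auto simp: f_def abs_mult ennreal_mult'[symmetric] indicator_def)
    also have "\<dots> = ennreal (r powr (- \<gamma>) / \<gamma>) * ennreal \<bar>q' (t + r)\<bar>"
      by (subst nn_integral_multc) (auto simp: f_nn[OF True])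
    also have "\<dots> = ennreal (r powr (- \<gamma>) / \<gamma> * \<bar>q' (t + r)\<bar>)" by (rule ennreal_mult''[symmetric]) simp
    also have "\<dots> \<le> ennreal (B r)"
    proof (rule ennreal_leI)
      have "r powr (- \<gamma>) / \<gamma> * \<bar>q' (t + r)\<bar> \<le> r powr (- \<gamma>) / \<gamma> * (C * (t + r) powr (\<gamma> - 2))"
        using bd[of "t + r"] True \<gamma> by (intro mult_left_mono) auto
      then show "r powr (- \<gamma>) / \<gamma> * \<bar>q' (t + r)\<bar> \<le> B r" using True by (simp add: B_def mult_ac)
    qed
    finally show ?thesis .
  qed (simp add: f_def)
  have swap: "(LINT r|lborel. LINT s|lborel. f r s) = (LINT s|lborel. LINT r|lborel. f r s)"
    by (rule fubini_swap_bound(1)[OF fm le iB B0])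
  have inner: "(LINT s|lborel. f r s) = 1 / \<gamma> * (indicator {0<..} r * (r powr (- \<gamma>) * q' (t + r)))" for r
  proof (cases "r > 0")
    case True
    have "(LINT s|lborel. indicator {r..} s * s powr (- 1 - \<gamma>)) = r powr (- \<gamma>) / \<gamma>"
      using f_nn[OF True] \<gamma> by (intro integral_eq_nn_integral[THEN trans]) auto
    moreover have "(LINT s|lborel. f r s) = (LINT s|lborel. indicator {r..} s * s powr (- 1 - \<gamma>)) * q' (t + r)"
      using True by (subst integral_mult_left_zero[symmetric]) (simp add: f_def[abs_def] mult_ac)
    ultimately show ?thesis using True by simp
  qed (simp add: f_def)
  have outer: "(LINT r|lborel. f r s) = indicator {0<..} s * (s powr (- 1 - \<gamma>) * (q t - q (t + s)))" for s
  proof (cases "s > 0")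
    case True
    have "(LINT r|lborel. q' (t + r) * indicator {0..s} r) = - q (t + s) - (- q (t + 0))"
    proof (rule integral_FTC_Icc_real)
      show "((\<lambda>r. - q (t + r)) has_real_derivative q' (t + r)) (at r)" if "0 \<le> r" for r
      proof -
        have "((\<lambda>r. q (r + t)) has_real_derivative - q' (r + t)) (at r)"
          using der[of "r + t"] DERIV_shift[of q "- q' (r + t)" r t] that by simp
        from DERIV_minus[OF this] show ?thesis by (simp add: add.commute)
      qed
      show "isCont (\<lambda>r. q' (t + r)) r" if "0 \<le> r" for r
        using isCont_o2[of r "\<lambda>r. t + r" q'] cont[of "t + r"] that by (auto intro!: continuous_intros)
    qed (use True in auto)
    moreover have "(LINT r|lborel. f r s) = (LINT r|lborel. s powr (- 1 - \<gamma>) * (q' (t + r) * indicator {0..s} r))"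
    proof (rule integral_cong_AE)
      have "AE r in lborel. r \<noteq> (0::real)" by (rule AE_lborel_singleton)
      then show "AE r in lborel. f r s = s powr (- 1 - \<gamma>) * (q' (t + r) * indicator {0..s} r)"
        by eventually_elim (auto simp: f_def indicator_def)
      show "(\<lambda>r. f r s) \<in> borel_measurable lborel" using fm by (simp add: measurable_Pair2')
    qed measurable
    ultimately show ?thesis using True by simp
  next
    case False
    then have "f r s = 0" for r by (auto simp: f_def indicator_def)
    then show ?thesis using False by simp
  qed
  have "1 / \<gamma> * (LINT r|lborel. indicator {0<..} r * (r powr (- \<gamma>) * q' (t + r))) = (LINT s|lborel. indicator {0<..} s * (s powr (- 1 - \<gamma>) * (q t - q (t + s))))"
    using swap unfolding inner outer by simp
  then show ?thesis using \<gamma>(1) by (simp add: divide_eq_eq mult.commute[of _ \<gamma>])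
qed

lemma integral_derivative_halfline:
  fixes q q' :: "real \<Rightarrow> real"
  assumes der: "\<And>s. s \<ge> t \<Longrightarrow> (q has_real_derivative - q' s) (at s)" and cont: "\<And>s. s \<ge> t \<Longrightarrow> isCont q' s"
    and int: "integrable lborel (\<lambda>r. indicator {0<..} r * q' (t + r))" and lim: "(q \<longlongrightarrow> 0) at_top"
    and [measurable]: "q' \<in> borel_measurable borel"
  shows "(LINT r|lborel. indicator {0<..} r * q' (t + r)) = q t"
proof -
  have AE0: "AE r in lborel. r \<noteq> (0::real)" by (rule AE_lborel_singleton)
  have fin: "(LINT r|lborel. indicator {..real n} r * (indicator {0<..} r * q' (t + r))) = q t - q (t + real n)" for n
  proof -
    have "(LINT r|lborel. q' (t + r) * indicator {0..real n} r) = - q (t + real n) - (- q (t + 0))"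
    proof (rule integral_FTC_Icc_real)
      show "((\<lambda>r. - q (t + r)) has_real_derivative q' (t + r)) (at r)" if "0 \<le> r" for r
      proof -
        have "((\<lambda>r. q (r + t)) has_real_derivative - q' (r + t)) (at r)"
          using der[of "r + t"] DERIV_shift[of q "- q' (r + t)" r t] that by simp
        from DERIV_minus[OF this] show ?thesis by (simp add: add.commute)
      qed
      show "isCont (\<lambda>r. q' (t + r)) r" if "0 \<le> r" for r
        using isCont_o2[of r "\<lambda>r. t + r" q'] cont[of "t + r"] that by (auto intro!: continuous_intros)
    qed auto
    moreover have "(LINT r|lborel. indicator {..real n} r * (indicator {0<..} r * q' (t + r))) = (LINT r|lborel. q' (t + r) * indicator {0..real n} r)"
    proof (rule integral_cong_AE)
      show "AE r in lborel. indicator {..real n} r * (indicator {0<..} r * q' (t + r)) = q' (t + r) * indicator {0..real n} r"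
        using AE0 by eventually_elim (auto simp: indicator_def)
    qed measurable
    ultimately show ?thesis by simp
  qed
  have "(\<lambda>n. LINT r|lborel. indicator {..real n} r * (indicator {0<..} r * q' (t + r))) \<longlonglongrightarrow> (LINT r|lborel. indicator {0<..} r * q' (t + r))"
  proof (rule integral_dominated_convergence[where w="\<lambda>r. \<bar>indicator {0<..} r * q' (t + r)\<bar>"])
    show "AE r in lborel. (\<lambda>n. indicator {..real n} r * (indicator {0<..} r * q' (t + r))) \<longlonglongrightarrow> indicator {0<..} r * q' (t + r)"
    proof (intro AE_I2)
      fix r :: real
      have "eventually (\<lambda>n. r \<le> real n) sequentially"
        using filterlim_real_sequentially unfolding filterlim_at_top by blast
      then have "eventually (\<lambda>n. indicator {..real n} r * (indicator {0<..} r * q' (t + r)) = indicator {0<..} r * q' (t + r)) sequentially"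
        by eventually_elim simp
      then show "(\<lambda>n. indicator {..real n} r * (indicator {0<..} r * q' (t + r))) \<longlonglongrightarrow> indicator {0<..} r * q' (t + r)"
        by (rule tendsto_eventually)
    qed
    show "AE r in lborel. norm (indicator {..real n} r * (indicator {0<..} r * q' (t + r))) \<le> \<bar>indicator {0<..} r * q' (t + r)\<bar>" for n
      by (intro AE_I2) (auto simp: indicator_def)
  qed (use int in auto)
  moreover have "(\<lambda>n. q t - q (t + real n)) \<longlonglongrightarrow> q t - 0"
  proof (intro tendsto_diff tendsto_const filterlim_compose[OF lim])
    show "filterlim (\<lambda>n. t + real n) at_top sequentially"
      by (rule filterlim_tendsto_add_at_top[OF tendsto_const filterlim_real_sequentially])
  qed
  ultimately show ?thesis unfolding fin by (metis LIMSEQ_unique diff_zero)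
qed

text \<open>Away from t = 0 a surplus of decay may be given up. With j = 2 the bound t^(\<gamma> -
  2), which makes the Weyl integral converge, is available for every m.\<close>

lemma hconv_decay_le:
  fixes v :: "real^'n \<Rightarrow> real"
  assumes v: "wint b v" and b: "b = real CARD('n) + 2 * \<gamma>" and \<gamma>: "0 \<le> \<gamma>" and t0: "0 < t0" and j: "j \<le> k"
  shows "\<exists>C\<ge>0. \<forall>t\<ge>t0. \<forall>x. \<bar>hconv v k t x\<bar> \<le> C * t powr (\<gamma> - real j) * (1 + norm x) powr b"
proof -
  obtain C where C: "C \<ge> 0" "\<And>t x. t \<ge> t0 \<Longrightarrow> \<bar>hconv v k t x\<bar> \<le> C * t powr (\<gamma> - real k) * (1 + norm x) powr b"
    using hconv_decay[OF v b \<gamma> t0, of k] by blast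
  have "\<bar>hconv v k t x\<bar> \<le> (C * t0 powr (real j - real k)) * t powr (\<gamma> - real j) * (1 + norm x) powr b" if t: "t \<ge> t0" for t x
  proof -
    have "t powr (\<gamma> - real k) = t powr (real j - real k) * t powr (\<gamma> - real j)" by (simp add: powr_add[symmetric])
    also have "\<dots> \<le> t0 powr (real j - real k) * t powr (\<gamma> - real j)"
      using t t0 j by (intro mult_right_mono powr_mono2') auto
    finally have "C * t powr (\<gamma> - real k) * (1 + norm x) powr b \<le> C * (t0 powr (real j - real k) * t powr (\<gamma> - real j)) * (1 + norm x) powr b"
      using C(1) by (intro mult_right_mono mult_left_mono) auto
    with C(2)[OF t, of x] show ?thesis by (simp add: mult.assoc)
  qed
  then show ?thesis using C(1) by (intro exI[of _ "C * t0 powr (real j - real k)"]) auto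
qed

lemma integrable_weyl_weight:
  assumes "0 \<le> \<gamma>" "\<gamma> < 1" "0 < (t::real)"
  shows "integrable lborel (\<lambda>r. indicator {0<..} r * (r powr (- \<gamma>) * (t + r) powr (\<gamma> - 2)))"
  using integrable_powr_halfline[of "1 - \<gamma>" "2 - \<gamma>" t] assms by simp

text \<open>The Weyl form treats \<gamma> > 0 and \<gamma> = 0 alike. In the second case there is no
  singular integral: the Laplacians become time derivatives directly, and the Weyl integral with
  weight 1 is the fundamental theorem of calculus on the half-line.\<close>

lemma hconv_equation_weyl_averaged:
  fixes v :: "real^'n \<Rightarrow> real"
  assumes v: "wint b v" and b: "b = real CARD('n) + 2 * \<gamma>" and \<gamma>: "0 \<le> \<gamma>" "\<gamma> < 1" and \<eta>: "0 < \<eta>"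
    and H: "0 < \<gamma> \<Longrightarrow> holder2 (2 * \<gamma> + \<eta>) v" and cv: "continuous_on UNIV v" and def: "\<And>x. frac_lap_defined_at \<gamma> v x"
    and u: "Ck (2 * m) (frac_lap \<gamma> v)" and \<rho>: "Ck (2 * m + 2) \<rho>" "csupp \<rho>" and t: "0 < t"
  shows "hconv (tconv ((neg_lap ^^ m) (frac_lap \<gamma> v)) \<rho>) 1 t x =
    1 / Gamma (1 - \<gamma>) * (LINT r|lborel. indicator {0<..} r * (r powr (- \<gamma>) * hconv (tconv v \<rho>) (m + 2) (t + r) x))"
proof -
  have b0: "0 \<le> b" using b \<gamma> by simp
  have c\<rho>: "continuous_on UNIV \<rho>" using \<rho>(1) by (rule Ck_continuous)
  define V where "V = tconv v \<rho>"
  have V: "wint b V" unfolding V_def by (rule wint_tconv[OF v b0 c\<rho> \<rho>(2)])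
  have Vm: "V \<in> borel_measurable borel" using V by (simp add: wint_def)
  define q where "q s = hconv V (m + 1) s x" for s
  define q' where "q' s = hconv V (m + 2) s x" for s
  have q'm[measurable]: "q' \<in> borel_measurable borel"
    unfolding q'_def[abs_def] by (intro borel_measurable_hconv Vm) auto
  have der: "(q has_real_derivative - q' s) (at s)" if "s \<ge> t" for s
    using hconv_has_derivative[OF V b0, of s "m + 1" x] that t by (simp add: q_def[abs_def] q'_def)
  have cont: "isCont q' s" if "s \<ge> t" for s
    using hconv_isCont_t[OF V b0, of s "m + 2" x] that t by (simp add: q'_def[abs_def])
  obtain C where C: "C \<ge> 0" "\<And>s. s \<ge> t \<Longrightarrow> \<bar>q' s\<bar> \<le> C * s powr (\<gamma> - 2) * (1 + norm x) powr b"
    using hconv_decay_le[OF V b \<gamma>(1) t, of 2 "m + 2"] unfolding q'_def by auto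
  have bd: "\<bar>q' s\<bar> \<le> (C * (1 + norm x) powr b) * s powr (\<gamma> - 2)" if "s \<ge> t" for s
    using C(2)[OF that] by (simp add: mult_ac)
  show ?thesis
  proof (cases "\<gamma> = 0")
    case False
    then have \<gamma>0: "0 < \<gamma>" using \<gamma> by simp
    have "hconv (tconv ((neg_lap ^^ m) (frac_lap \<gamma> v)) \<rho>) 1 t x =
       1 / Gamma (1 - \<gamma>) * (\<gamma> * (LINT s|lborel. indicator {0<..} s * (s powr (- 1 - \<gamma>) * (q t - q (t + s)))))"
      using hconv_equation_marchaud[OF v b \<gamma>0 \<gamma>(2) \<eta> H[OF \<gamma>0] cv def u \<rho> t, of 1 x] by (simp add: q_def V_def)
    also have "\<gamma> * (LINT s|lborel. indicator {0<..} s * (s powr (- 1 - \<gamma>) * (q t - q (t + s)))) =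
       (LINT r|lborel. indicator {0<..} r * (r powr (- \<gamma>) * q' (t + r)))"
      by (rule marchaud_eq_weyl[OF \<gamma>0 \<gamma>(2) t der cont bd q'm])
    finally show ?thesis by (simp add: q'_def V_def)
  next
    case True
    have \<rho>m: "Ck (2 * m) \<rho>" using \<rho>(1) by (rule Ck_mono) simp
    have fl: "frac_lap \<gamma> v = v" using True by (simp add: frac_lap_def fun_eq_iff)
    have parts: "tconv ((neg_lap ^^ m) v) \<rho> y = tconv v ((neg_lap ^^ m) \<rho>) y" for y
    proof -
      have "(LINT w|lborel. (neg_lap ^^ m) v w * \<rho> (w + (- y))) = (LINT w|lborel. v w * (neg_lap ^^ m) (\<lambda>w. \<rho> (w + (- y))) w)"
        by (rule green_pow[OF u[unfolded fl] Ck_translate[OF \<rho>m] csupp_translate[OF \<rho>(2)]])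
      then show ?thesis unfolding neg_lap_pow_translate[of m \<rho> "- y"] by (simp add: tconv_def)
    qed
    have "hconv (tconv ((neg_lap ^^ m) (frac_lap \<gamma> v)) \<rho>) 1 t x = hconv (tconv v ((neg_lap ^^ m) \<rho>)) 1 t x"
      using parts by (simp add: fl hconv_def)
    also have "\<dots> = q t"
      using hconv_tconv_neg_lap_pow[OF v b0 \<rho>m \<rho>(2) t, of 1 x] by (simp add: q_def V_def)
    also have "\<dots> = (LINT r|lborel. indicator {0<..} r * q' (t + r))"
    proof (rule integral_derivative_halfline[OF der cont _ _ q'm, symmetric])
      show "integrable lborel (\<lambda>r. indicator {0<..} r * q' (t + r))"
      proof (rule integrable_bound_real)
        show "integrable lborel (\<lambda>r. (C * (1 + norm x) powr b) * (indicator {0<..} r * (r powr (- 0) * (t + r) powr (0 - 2))))"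
          using t by (intro integrable_mult_right integrable_weyl_weight) auto
        show "\<bar>indicator {0<..} r * q' (t + r)\<bar> \<le> (C * (1 + norm x) powr b) * (indicator {0<..} r * (r powr (- 0) * (t + r) powr (0 - 2)))" for r
          using bd[of "t + r"] True by (auto simp: indicator_def)
      qed measurable
      obtain D where D: "D \<ge> 0" "\<And>s. s \<ge> t \<Longrightarrow> \<bar>q s\<bar> \<le> D * s powr (\<gamma> - 1) * (1 + norm x) powr b"
        using hconv_decay_le[OF V b \<gamma>(1) t, of 1 "m + 1"] unfolding q_def by auto
      show "(q \<longlongrightarrow> 0) at_top"
      proof (rule Lim_null_comparison)
        show "\<forall>\<^sub>F s in at_top. norm (q s) \<le> D * s powr (- 1) * (1 + norm x) powr b"
          using eventually_ge_at_top[of t] by eventually_elim (use D True in auto)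
        have "((\<lambda>s::real. s powr (- 1)) \<longlongrightarrow> 0) at_top"
          by (intro tendsto_neg_powr filterlim_ident) auto
        then show "((\<lambda>s. D * s powr (- 1) * (1 + norm x) powr b) \<longlongrightarrow> 0) at_top"
          using tendsto_mult_left_zero tendsto_mult_right_zero by blast
      qed
    qed
    also have "\<dots> = (LINT r|lborel. indicator {0<..} r * (r powr (- \<gamma>) * q' (t + r)))"
      by (intro Bochner_Integration.integral_cong refl) (auto simp: True indicator_def)
    finally show ?thesis using True by (simp add: q'_def V_def)
  qed
qed

text \<open>Both sides are continuous in \<open>x\<close>, and the averaged equation says that their
  difference \<open>A\<close> has zero average against sufficiently smooth bumps of every radius, so
  \<open>A\<close> vanishes.\<close>

lemma hconv_equation_weyl:
  fixes v F :: "real^'n \<Rightarrow> real"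
  assumes v: "wint b v" and b: "b = real CARD('n) + 2 * \<gamma>" and \<gamma>: "0 \<le> \<gamma>" "\<gamma> < 1" and \<eta>: "0 < \<eta>"
    and H: "0 < \<gamma> \<Longrightarrow> holder2 (2 * \<gamma> + \<eta>) v" and cv: "continuous_on UNIV v" and def: "\<And>x. frac_lap_defined_at \<gamma> v x"
    and u: "Ck (2 * m) (frac_lap \<gamma> v)" and F: "F = (neg_lap ^^ m) (frac_lap \<gamma> v)" "wint B F" "0 \<le> B" and t: "0 < t"
  shows "hconv F 1 t x =
    1 / Gamma (1 - \<gamma>) * (LINT r|lborel. indicator {0<..} r * (r powr (- \<gamma>) * hconv v (m + 2) (t + r) x))"
proof -
  have b0: "0 \<le> b" using b \<gamma> by simp
  have [measurable]: "v \<in> borel_measurable borel" using v by (simp add: wint_def)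
  have vm[measurable]: "v \<in> borel_measurable borel" by measurable
  define h where "h x r = indicator {0<..} r * (r powr (- \<gamma>) * hconv v (m + 2) (t + r) x)" for x r
  define A where "A x = hconv F 1 t x - 1 / Gamma (1 - \<gamma>) * (LINT r|lborel. h x r)" for x
  have hm: "(\<lambda>(x, r). h x r) \<in> borel_measurable (borel \<Otimes>\<^sub>M borel)"
    unfolding h_def using borel_measurable_hconv[OF vm, of "\<lambda>p. t + snd p" "borel \<Otimes>\<^sub>M borel" fst "m + 2"] by (simp add: split_beta')
  have hm1: "h x \<in> borel_measurable borel" for x
    unfolding h_def[abs_def] using borel_measurable_hconv[OF vm, of "\<lambda>r. t + r" borel "\<lambda>_. x" "m + 2"] by measurable
  obtain C where C: "C \<ge> 0" "\<And>s x. s \<ge> t \<Longrightarrow> \<bar>hconv v (m + 2) s x\<bar> \<le> C * s powr (\<gamma> - 2) * (1 + norm x) powr b"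
    using hconv_decay_le[OF v b \<gamma>(1) t, of 2 "m + 2"] by auto
  define W where "W r = indicator {0<..} r * (r powr (- \<gamma>) * (t + r) powr (\<gamma> - 2))" for r
  have iW: "integrable lborel W" unfolding W_def by (rule integrable_weyl_weight[OF \<gamma> t])
  have W0: "0 \<le> W r" for r by (simp add: W_def)
  have hW: "\<bar>h x r\<bar> \<le> (C * (1 + norm x) powr b) * W r" for x r
  proof (cases "r > 0")
    case True
    have "r powr (- \<gamma>) * \<bar>hconv v (m + 2) (t + r) x\<bar> \<le> r powr (- \<gamma>) * (C * (t + r) powr (\<gamma> - 2) * (1 + norm x) powr b)"
      using C(2)[of "t + r" x] True by (intro mult_left_mono) auto
    then show ?thesis using True by (simp add: h_def W_def abs_mult mult_ac)
  qed (simp add: h_def W_def)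
  have ch: "isCont (\<lambda>x. LINT r|lborel. h x r) x0" for x0
  proof (rule integral_isCont[where d=1 and w="\<lambda>r. (C * (2 + norm x0) powr b) * W r"])
    show "isCont (\<lambda>x. h x r) x0" for r
    proof (cases "r > 0")
      case True
      have "continuous_on UNIV (hconv v (m + 2) (t + r))" using True t by (intro hconv_continuous[OF v b0]) auto
      then show ?thesis unfolding h_def by (intro continuous_intros) (auto simp: continuous_on_eq_continuous_at)
    qed (simp add: h_def)
    show "\<bar>h x r\<bar> \<le> (C * (2 + norm x0) powr b) * W r" if "x \<in> ball x0 1" for x r
    proof (rule order_trans[OF hW])
      have "norm x \<le> norm x0 + 1" using that norm_triangle_ineq[of "x - x0" x0] by (simp add: dist_norm norm_minus_commute)
      then have "(1 + norm x) powr b \<le> (2 + norm x0) powr b" using b0 by (intro powr_mono2) auto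
      then show "C * (1 + norm x) powr b * W r \<le> C * (2 + norm x0) powr b * W r"
        using C(1) W0[of r] by (intro mult_right_mono mult_left_mono) auto
    qed
    show "integrable lborel (\<lambda>r. (C * (2 + norm x0) powr b) * W r)" using iW by (rule integrable_mult_right)
  qed (use hm1 in auto)
  have cA: "continuous_on UNIV A"
  proof -
    have "continuous_on UNIV (\<lambda>x. LINT r|lborel. h x r)" using ch by (simp add: continuous_at_imp_continuous_on)
    then show ?thesis unfolding A_def[abs_def]
      using hconv_continuous[OF F(2,3) t, of 1] by (intro continuous_intros) auto
  qed
  have "A x = 0"
  \<comment> \<open>The exponent 2m + 3 of the bump makes it of class C^(2m+2), as the averaged
    equation requires.\<close>
  proof (rule bump_test_zero[OF cA, where N="2 * m + 2"])
    fix e :: real assume "e > 0"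
    define \<rho> where "\<rho> = (bump (Suc (2 * m + 2)) e :: real^'n \<Rightarrow> real)"
    have \<rho>: "Ck (2 * m + 2) \<rho>" "csupp \<rho>"
      using Ck_bump[of "2 * m + 2" 0 e, where 'n='n] csupp_bump[of "2 * m + 2" e, where 'a='n] by (simp_all add: \<rho>_def)
    have c\<rho>: "continuous_on UNIV \<rho>" using \<rho>(1) by (rule Ck_continuous)
    have [measurable]: "\<rho> \<in> borel_measurable borel" using c\<rho> by (rule borel_measurable_continuous_onI)
    define k where "k w r = \<rho> w * h (x + w) r" for w r
    have km: "(\<lambda>(w, r). k w r) \<in> borel_measurable (borel \<Otimes>\<^sub>M borel)"
    proof -
      have "(\<lambda>p. (x + fst p, snd p)) \<in> borel \<Otimes>\<^sub>M borel \<rightarrow>\<^sub>M borel \<Otimes>\<^sub>M (borel :: real measure)" by measurable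
      from measurable_compose[OF this hm] have "(\<lambda>p. h (x + fst p) (snd p)) \<in> borel_measurable (borel \<Otimes>\<^sub>M borel)" by simp
      moreover have "(\<lambda>p. \<rho> (fst p)) \<in> borel_measurable (borel \<Otimes>\<^sub>M (borel :: real measure))" by measurable
      ultimately have "(\<lambda>p. \<rho> (fst p) * h (x + fst p) (snd p)) \<in> borel_measurable (borel \<Otimes>\<^sub>M borel)"
        by (rule borel_measurable_times[rotated])
      then show ?thesis by (simp add: k_def split_beta')
    qed
    have kle: "\<bar>k w r\<bar> \<le> \<bar>(C * (1 + norm (x + w)) powr b) * \<rho> w\<bar> * W r" for w r
    proof -
      have "\<bar>\<rho> w\<bar> * \<bar>h (x + w) r\<bar> \<le> \<bar>\<rho> w\<bar> * ((C * (1 + norm (x + w)) powr b) * W r)" by (intro mult_left_mono hW) auto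
      then show ?thesis using C(1) by (simp add: k_def abs_mult mult_ac)
    qed
    have iA: "integrable lborel (\<lambda>w. \<bar>(C * (1 + norm (x + w)) powr b) * \<rho> w\<bar>)"
      by (intro integrable_abs integrable_csupp csupp_mult \<rho> continuous_intros c\<rho>) (auto simp: add_nonneg_eq_0_iff)
    note fub = fubini_swap_product_bound[OF km kle iA _ iW W0]
    have inner: "(LINT r|lborel. k w r) = \<rho> w * (LINT r|lborel. h (x + w) r)" for w by (simp add: k_def)
    have outer: "(LINT w|lborel. k w r) = indicator {0<..} r * (r powr (- \<gamma>) * hconv (tconv v \<rho>) (m + 2) (t + r) x)" for r
    proof (cases "r > 0")
      case True
      then have "hconv (tconv v \<rho>) (m + 2) (t + r) x = (LINT w|lborel. \<rho> w * hconv v (m + 2) (t + r) (x + w))"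
        using t by (intro hconv_tconv[OF v b0 c\<rho> \<rho>(2)]) simp
      moreover have "(LINT w|lborel. k w r) = (LINT w|lborel. r powr (- \<gamma>) * (\<rho> w * hconv v (m + 2) (t + r) (x + w)))"
        using True by (simp add: k_def h_def mult_ac)
      ultimately show ?thesis using True by simp
    qed (simp add: k_def h_def)
    have "(LINT w|lborel. \<rho> w * hconv F 1 t (x + w)) = hconv (tconv F \<rho>) 1 t x"
      by (rule hconv_tconv[OF F(2,3) c\<rho> \<rho>(2) t, symmetric])
    also have "\<dots> = 1 / Gamma (1 - \<gamma>) * (LINT r|lborel. LINT w|lborel. k w r)"
      unfolding outer F(1) by (rule hconv_equation_weyl_averaged[OF v b \<gamma> \<eta> H cv def u \<rho> t])
    also have "\<dots> = 1 / Gamma (1 - \<gamma>) * (LINT w|lborel. \<rho> w * (LINT r|lborel. h (x + w) r))"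
      using fub(1) unfolding inner by simp
    finally have eq: "(LINT w|lborel. \<rho> w * hconv F 1 t (x + w)) = 1 / Gamma (1 - \<gamma>) * (LINT w|lborel. \<rho> w * (LINT r|lborel. h (x + w) r))" .
    have i1: "integrable lborel (\<lambda>w. \<rho> w * (LINT r|lborel. h (x + w) r))" using fub(2) unfolding inner by simp
    have i2: "integrable lborel (\<lambda>w. \<rho> w * hconv F 1 t (x + w))"
    proof -
      have "continuous_on UNIV (\<lambda>w. hconv F 1 t (x + w))"
        by (rule continuous_on_compose2[OF hconv_continuous[OF F(2,3) t]]) (auto intro!: continuous_intros)
      then have "integrable lborel (\<lambda>w. hconv F 1 t (x + w) * \<rho> w)"
        by (intro integrable_csupp csupp_mult \<rho> continuous_on_mult c\<rho>)
      then show ?thesis by (simp add: mult.commute)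
    qed
    have "(LINT w|lborel. \<rho> w * A (x + w)) = (LINT w|lborel. \<rho> w * hconv F 1 t (x + w) - 1 / Gamma (1 - \<gamma>) * (\<rho> w * (LINT r|lborel. h (x + w) r)))"
      by (intro Bochner_Integration.integral_cong refl) (simp add: A_def algebra_simps)
    also have "\<dots> = 0" using i1 i2 eq by simp
    finally show "(LINT w|lborel. bump (Suc (2 * m + 2)) e w * A (x + w)) = 0" by (simp add: \<rho>_def)
  qed
  then show ?thesis by (simp add: A_def h_def)
qed

section \<open>Inverting the Weyl integral\<close>

text \<open>The Beta integral rescaled to (0, r). The rescaled integrand and that of
  \<open>integrable_Beta\<close> are compared away from the null set {0, 1}.\<close>

lemma nn_integral_beta:
  assumes a: "0 < a" and c: "0 < c" and r: "0 < (r::real)"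
  shows "(\<integral>\<^sup>+x. ennreal (indicator {0<..<r} x * (x powr (a - 1) * (r - x) powr (c - 1))) \<partial>lborel) = ennreal (r powr (a + c - 1) * Beta a c)"
proof -
  have AE01: "AE x in lborel. x \<noteq> (0::real) \<and> x \<noteq> 1" using AE_lborel_singleton[of "0::real"] AE_lborel_singleton[of "1::real"] by eventually_elim simp
  have I: "set_integrable lborel {0..1} (\<lambda>t. t powr (a - 1) * (1 - t) powr (c - 1))" by (rule integrable_Beta[OF a c])
  have L: "(LINT x|lborel. indicator {0..1} x *\<^sub>R (x powr (a - 1) * (1 - x) powr (c - 1))) = Beta a c"
    using set_borel_integral_eq_integral(2)[OF I] integral_unique[OF has_integral_Beta_real[OF a c]] by (simp add: set_lebesgue_integral_def)
  have "(\<integral>\<^sup>+x. ennreal (indicator {0<..<r} x * (x powr (a - 1) * (r - x) powr (c - 1))) \<partial>lborel) =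
     ennreal \<bar>r\<bar> * (\<integral>\<^sup>+x. ennreal (indicator {0<..<r} (0 + r * x) * ((0 + r * x) powr (a - 1) * (r - (0 + r * x)) powr (c - 1))) \<partial>lborel)"
    by (rule nn_integral_real_affine) (use r in auto)
  also have "(\<integral>\<^sup>+x. ennreal (indicator {0<..<r} (0 + r * x) * ((0 + r * x) powr (a - 1) * (r - (0 + r * x)) powr (c - 1))) \<partial>lborel)
     = (\<integral>\<^sup>+x. ennreal (r powr (a + c - 2)) * ennreal (indicator {0..1} x *\<^sub>R (x powr (a - 1) * (1 - x) powr (c - 1))) \<partial>lborel)"
  proof (rule nn_integral_cong_AE)
    show "AE x in lborel. ennreal (indicator {0<..<r} (0 + r * x) * ((0 + r * x) powr (a - 1) * (r - (0 + r * x)) powr (c - 1))) =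
      ennreal (r powr (a + c - 2)) * ennreal (indicator {0..1} x *\<^sub>R (x powr (a - 1) * (1 - x) powr (c - 1)))"
      using AE01
    proof eventually_elim
      case (elim x)
      show ?case
      proof (cases "0 < x \<and> x < 1")
        case True
        have "r - r * x = r * (1 - x)" by (simp add: algebra_simps)
        moreover have "r powr (a - 1) * r powr (c - 1) = r powr (a + c - 2)" by (simp add: powr_add[symmetric])
        ultimately have "(r * x) powr (a - 1) * (r - r * x) powr (c - 1) = r powr (a + c - 2) * (x powr (a - 1) * (1 - x) powr (c - 1))"
          by (simp add: powr_mult mult_ac)
        then show ?thesis using True r by (simp add: ennreal_mult')
      next
        case False
        then have "0 + r * x \<notin> {0<..<r}" "x \<notin> {0..1}" using elim r by (auto simp: zero_less_mult_iff)
        then have "indicator {0<..<r} (0 + r * x) = (0::real)" "indicator {0..1} x = (0::real)" unfolding indicator_def by (simp_all only: if_False of_bool_eq)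
        then show ?thesis by (simp only:) simp
      qed
    qed
  qed
  also have "\<dots> = ennreal (r powr (a + c - 2)) * (\<integral>\<^sup>+x. ennreal (indicator {0..1} x *\<^sub>R (x powr (a - 1) * (1 - x) powr (c - 1))) \<partial>lborel)"
    by (rule nn_integral_cmult) auto
  also have "(\<integral>\<^sup>+x. ennreal (indicator {0..1} x *\<^sub>R (x powr (a - 1) * (1 - x) powr (c - 1))) \<partial>lborel) = ennreal (Beta a c)"
    using I L by (subst nn_integral_eq_integral) (auto simp: set_integrable_def)
  also have "ennreal \<bar>r\<bar> * (ennreal (r powr (a + c - 2)) * ennreal (Beta a c)) = ennreal (r powr (a + c - 1) * Beta a c)"
  proof -
    have "r * r powr (a + c - 2) = r powr (a + c - 1)" using r powr_add[of r 1 "a + c - 2"] by simp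
    then have "ennreal \<bar>r\<bar> * ennreal (r powr (a + c - 2)) = ennreal (r powr (a + c - 1))" using r by (simp add: ennreal_mult'[symmetric])
    then show ?thesis by (simp add: mult.assoc[symmetric] ennreal_mult')
  qed
  finally show ?thesis .
qed

text \<open>Weyl integrals of orders s and 1 - \<gamma> compose to one of the integer order s + 1 -
  \<gamma> = m + 1, whose kernel is r^m / m!. In \<open>f\<close> the variable \<open>r\<close> is
  the total shift, so the integral over \<open>x\<close> is a Beta integral.\<close>

lemma weyl_composition:
  fixes P :: "real \<Rightarrow> real"
  assumes s: "s = real m + \<gamma>" "0 < s" and \<gamma>: "0 \<le> \<gamma>" "\<gamma> < 1" and t: "0 < t"
    and bd: "\<And>r. r \<ge> t \<Longrightarrow> \<bar>P r\<bar> \<le> C * r powr (\<gamma> - real m - 2)" and C: "0 \<le> C" and Pm[measurable]: "P \<in> borel_measurable borel"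
  shows "(LINT x|lborel. indicator {0<..} x * (x powr (s - 1) * (LINT r|lborel. indicator {0<..} r * (r powr (- \<gamma>) * P (t + x + r)))))
    = Gamma s * Gamma (1 - \<gamma>) / fact m * (LINT r|lborel. indicator {0<..} r * (r ^ m * P (t + r)))"
proof -
  define f where "f r x = indicator {0<..} r * (indicator {0<..<r} x * (x powr (s - 1) * (r - x) powr ((1 - \<gamma>) - 1)) * P (t + r))" for r x :: real
  define Bc where "Bc = Beta s (1 - \<gamma>)"
  have Bc0: "0 \<le> Bc" unfolding Bc_def Beta_def using s \<gamma> by simp
  define B where "B r = (C * Bc) * (indicator {0<..} r * (r powr (real m + 1 - 1) * (t + r) powr (- (real m + 2 - \<gamma>))))" for r
  have fm: "(\<lambda>(r, x). f r x) \<in> borel_measurable (borel \<Otimes>\<^sub>M borel)"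
  proof -
    have "f = (\<lambda>r x. indicator {0<..} r * ((if 0 < x \<and> x < r then 1 else 0) * (x powr (s - 1) * (r - x) powr ((1 - \<gamma>) - 1)) * P (t + r)))"
      by (auto simp: f_def fun_eq_iff indicator_def)
    then show ?thesis by simp
  qed
  have iB: "integrable lborel B" unfolding B_def using \<gamma> t by (intro integrable_mult_right integrable_powr_halfline) auto
  have B0: "0 \<le> B r" for r using C Bc0 by (simp add: B_def)
  have nn: "(\<integral>\<^sup>+x. ennreal (indicator {0<..<r} x * (x powr (s - 1) * (r - x) powr ((1 - \<gamma>) - 1))) \<partial>lborel) = ennreal (r powr real m * Bc)" if "r > 0" for r
  proof -
    have "s + (1 - \<gamma>) - 1 = real m" using s by simp
    then show ?thesis using nn_integral_beta[OF s(2) _ that, of "1 - \<gamma>"] \<gamma> by (simp add: Bc_def)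
  qed
  have le: "(\<integral>\<^sup>+x. ennreal \<bar>f r x\<bar> \<partial>lborel) \<le> ennreal (B r)" for r
  proof (cases "r > 0")
    case True
    have "(\<integral>\<^sup>+x. ennreal \<bar>f r x\<bar> \<partial>lborel) = (\<integral>\<^sup>+x. ennreal (indicator {0<..<r} x * (x powr (s - 1) * (r - x) powr ((1 - \<gamma>) - 1))) * ennreal \<bar>P (t + r)\<bar> \<partial>lborel)"
      using True by (intro nn_integral_cong) (auto simp: f_def abs_mult ennreal_mult'[symmetric] indicator_def)
    also have "\<dots> = ennreal (r powr real m * Bc) * ennreal \<bar>P (t + r)\<bar>"
      by (subst nn_integral_multc) (auto simp: nn[OF True, simplified])
    also have "\<dots> = ennreal (r powr real m * Bc * \<bar>P (t + r)\<bar>)" by (rule ennreal_mult''[symmetric]) simp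
    also have "\<dots> \<le> ennreal (B r)"
    proof (rule ennreal_leI)
      have "r powr real m * Bc * \<bar>P (t + r)\<bar> \<le> r powr real m * Bc * (C * (t + r) powr (\<gamma> - real m - 2))"
        using bd[of "t + r"] True Bc0 by (intro mult_left_mono) auto
      moreover have "\<gamma> - real m - 2 = - (real m + 2 - \<gamma>)" by simp
      ultimately show "r powr real m * Bc * \<bar>P (t + r)\<bar> \<le> B r" using True by (simp add: B_def mult_ac)
    qed
    finally show ?thesis .
  qed (simp add: f_def)
  have swap: "(LINT r|lborel. LINT x|lborel. f r x) = (LINT x|lborel. LINT r|lborel. f r x)"
    by (rule fubini_swap_bound(1)[OF fm le iB B0])
  have inner: "(LINT x|lborel. f r x) = Bc * (indicator {0<..} r * (r ^ m * P (t + r)))" for r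
  proof (cases "r > 0")
    case True
    have "(LINT x|lborel. indicator {0<..<r} x * (x powr (s - 1) * (r - x) powr ((1 - \<gamma>) - 1))) = r powr real m * Bc"
      using nn[OF True] Bc0 by (intro integral_eq_nn_integral[THEN trans]) auto
    moreover have "(LINT x|lborel. f r x) = (LINT x|lborel. indicator {0<..<r} x * (x powr (s - 1) * (r - x) powr ((1 - \<gamma>) - 1))) * P (t + r)"
      unfolding f_def using True by (subst integral_mult_left_zero[symmetric]) simp
    ultimately show ?thesis using True by (simp add: powr_realpow)
  qed (simp add: f_def)
  have outer: "(LINT r|lborel. f r x) = indicator {0<..} x * (x powr (s - 1) * (LINT r|lborel. indicator {0<..} r * (r powr (- \<gamma>) * P (t + x + r))))" for x
  proof (cases "x > 0")
    case True
    \<comment> \<open>Translating by \<open>x\<close> turns the total shift back into the sum of the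
      two separate shifts.\<close>
    have "(LINT r|lborel. f r x) = (LINT r|lborel. f (x + r) x)" by (rule integral_translate[symmetric])
    also have "\<dots> = (LINT r|lborel. x powr (s - 1) * (indicator {0<..} r * (r powr (- \<gamma>) * P (t + x + r))))"
      using True by (intro Bochner_Integration.integral_cong refl) (auto simp: f_def indicator_def add.assoc)
    finally show ?thesis using True by simp
  next
    case False
    then have "f r x = 0" for r by (simp add: f_def indicator_def)
    then show ?thesis using False by simp
  qed
  have "Bc = Gamma s * Gamma (1 - \<gamma>) / fact m"
  proof -
    have "s + (1 - \<gamma>) = 1 + real m" using s by simp
    then have "Gamma (s + (1 - \<gamma>)) = fact m" by (simp only: Gamma_fact)
    then show ?thesis unfolding Bc_def Beta_def by (simp only:)
  qed
  then show ?thesis using swap unfolding inner outer by simp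
qed

text \<open>Integration by parts m times, in closed form: \<open>Q\<close> sums the boundary terms
  and its derivative telescopes to \<open>- Q'\<close>. At infinity \<open>Q\<close> vanishes
  because \<gamma> < 1, and at r = 0 only the term j = 0 survives.\<close>

lemma iterated_tail_integral:
  fixes P :: "nat \<Rightarrow> real \<Rightarrow> real"
  assumes t: "0 < t" and \<gamma>: "\<gamma> < 1"
    and der: "\<And>k s. s \<ge> t \<Longrightarrow> (P k has_real_derivative - P (Suc k) s) (at s)"
    and bd: "\<And>k. \<exists>C\<ge>0. \<forall>s\<ge>t. \<bar>P k s\<bar> \<le> C * s powr (\<gamma> - real k)" and Pm: "\<And>k. P k \<in> borel_measurable borel"
  shows "(LINT r|lborel. indicator {0<..} r * (r ^ m * P (m + 2) (t + r))) = fact m * P 1 t"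
proof -
  define Q where "Q r = (\<Sum>j\<le>m. r ^ j / fact j * P (Suc j) (t + r))" for r
  define Q' where "Q' r = r ^ m / fact m * P (m + 2) (t + r)" for r
  have sh: "((\<lambda>r. P k (t + r)) has_real_derivative - P (Suc k) (t + r)) (at r)" if "r \<ge> 0" for k r
    using der[of "r + t" k] DERIV_shift[of "P k" "- P (Suc k) (r + t)" r t] that by (simp add: add.commute)
  have dQ: "(Q has_real_derivative - Q' (0 + r)) (at r)" if r: "r \<ge> 0" for r
  proof -
    have "((\<lambda>r. \<Sum>j\<le>m. r ^ j / fact j * P (Suc j) (t + r)) has_real_derivative
       (\<Sum>j\<le>m. r ^ j / fact j * (- P (Suc (Suc j)) (t + r)) + real j * r ^ (j - 1) / fact j * P (Suc j) (t + r))) (at r)"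
      by (intro DERIV_sum DERIV_mult' sh r) (auto intro!: derivative_eq_intros)
    moreover have "(\<Sum>j\<le>k. r ^ j / fact j * (- P (Suc (Suc j)) (t + r)) + real j * r ^ (j - 1) / fact j * P (Suc j) (t + r)) = - (r ^ k / fact k * P (k + 2) (t + r))" for k
    proof (induction k)
      case (Suc k)
      have "real (Suc k) * r ^ (Suc k - 1) / fact (Suc k) = r ^ k / fact k"
        by (simp add: fact_Suc del: of_nat_Suc)
      then show ?case using Suc by simp
    qed simp
    ultimately show ?thesis unfolding Q_def[abs_def] Q'_def by simp
  qed
  have cQ: "isCont Q' r" if "r \<ge> 0" for r
    unfolding Q'_def[abs_def] using DERIV_isCont[OF sh[OF that]] by (intro continuous_intros) auto
  have Q'm: "Q' \<in> borel_measurable borel" using Pm[of "m + 2"] unfolding Q'_def[abs_def] by measurable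
  have small: "\<exists>D. \<forall>r\<ge>0. \<bar>r ^ j / fact j * P (j + k) (t + r)\<bar> \<le> D * (t + r) powr (\<gamma> - real k)" for j k
  proof -
    obtain D where D: "D \<ge> 0" "\<And>s. s \<ge> t \<Longrightarrow> \<bar>P (j + k) s\<bar> \<le> D * s powr (\<gamma> - real (j + k))"
      using bd[of "j + k"] by blast
    have "\<bar>r ^ j / fact j * P (j + k) (t + r)\<bar> \<le> D / fact j * (t + r) powr (\<gamma> - real k)" if r: "r \<ge> 0" for r
    proof -
      have "r ^ j * \<bar>P (j + k) (t + r)\<bar> \<le> (t + r) ^ j * (D * (t + r) powr (\<gamma> - real (j + k)))"
        using r t D(2)[of "t + r"] by (intro mult_mono power_mono) auto
      also have "\<dots> = D * ((t + r) powr real j * (t + r) powr (\<gamma> - real (j + k)))" using r t by (simp add: powr_realpow)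
      also have "(t + r) powr real j * (t + r) powr (\<gamma> - real (j + k)) = (t + r) powr (\<gamma> - real k)"
        by (simp add: powr_add[symmetric])
      finally show ?thesis using r by (simp add: abs_mult divide_right_mono)
    qed
    then show ?thesis by blast
  qed
  have lQ: "(Q \<longlongrightarrow> 0) at_top"
  proof -
    have "((\<lambda>r. r ^ j / fact j * P (Suc j) (t + r)) \<longlongrightarrow> 0) at_top" for j
    proof -
      obtain D where D: "\<And>r. r \<ge> 0 \<Longrightarrow> \<bar>r ^ j / fact j * P (j + 1) (t + r)\<bar> \<le> D * (t + r) powr (\<gamma> - real 1)" using small[of j 1] by blast
      show ?thesis
      proof (rule Lim_null_comparison)
        show "\<forall>\<^sub>F r in at_top. norm (r ^ j / fact j * P (Suc j) (t + r)) \<le> D * (t + r) powr (\<gamma> - 1)"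
          using eventually_ge_at_top[of 0] by eventually_elim (use D in auto)
        have "((\<lambda>r. (t + r) powr (\<gamma> - 1)) \<longlongrightarrow> 0) at_top"
          using \<gamma> by (intro tendsto_neg_powr filterlim_tendsto_add_at_top[OF tendsto_const filterlim_ident]) auto
        then show "((\<lambda>r. D * (t + r) powr (\<gamma> - 1)) \<longlongrightarrow> 0) at_top" by (rule tendsto_mult_right_zero)
      qed
    qed
    then show ?thesis unfolding Q_def[abs_def] by (intro tendsto_null_sum)
  qed
  have iQ: "integrable lborel (\<lambda>r. indicator {0<..} r * Q' (0 + r))"
  proof -
    obtain D where D: "\<And>r. r \<ge> 0 \<Longrightarrow> \<bar>Q' r\<bar> \<le> D * (t + r) powr (\<gamma> - 2)" using small[of m 2] unfolding Q'_def by auto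
    show ?thesis
    proof (rule integrable_bound_real)
      show "integrable lborel (\<lambda>r. D * (indicator {0<..} r * (r powr (1 - 1) * (t + r) powr (- (2 - \<gamma>)))))"
        using \<gamma> t by (intro integrable_mult_right integrable_powr_halfline) auto
      show "\<bar>indicator {0<..} r * Q' (0 + r)\<bar> \<le> D * (indicator {0<..} r * (r powr (1 - 1) * (t + r) powr (- (2 - \<gamma>))))" for r
        using D[of r] by (auto simp: indicator_def)
    qed (use Q'm in measurable)
  qed
  have "(LINT r|lborel. indicator {0<..} r * Q' (0 + r)) = Q 0"
    by (rule integral_derivative_halfline[OF _ cQ iQ lQ Q'm]) (use dQ in auto)
  moreover have "Q 0 = P 1 t"
  proof -
    have "Q 0 = (\<Sum>j\<le>m. if j = 0 then P 1 t else 0)" unfolding Q_def by (intro sum.cong) auto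
    then show ?thesis by simp
  qed
  moreover have "(LINT r|lborel. indicator {0<..} r * Q' (0 + r)) = 1 / fact m * (LINT r|lborel. indicator {0<..} r * (r ^ m * P (m + 2) (t + r)))"
    by (subst integral_mult_right_zero[symmetric]) (simp add: Q'_def mult_ac)
  ultimately show ?thesis by simp
qed

section \<open>Heat extensions of integrable powers\<close>

text \<open>Plays the part of Hoelder's inequality: with a free threshold \<open>l\<close> it splits
  a function in L^p into a bounded and an integrable part, and a suitable \<open>l\<close> gives the
  sharp power of t in \<open>hconv_powr_decay\<close>.\<close>

lemma powr_split_bound:
  fixes a l p :: real
  assumes "0 \<le> a" "0 < l" "1 \<le> p"
  shows "a \<le> l + l powr (1 - p) * a powr p"
proof (cases "a \<le> l")
  case True
  then show ?thesis by (simp add: add_increasing2)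
next
  case False
  have "a / l = (a / l) powr 1" using False assms by simp
  also have "\<dots> \<le> (a / l) powr p" using False assms by (intro powr_mono) auto
  finally have "l * (a / l) \<le> l * (a / l) powr p" using assms by (intro mult_left_mono) auto
  also have "l * (a / l) powr p = l powr 1 * (a powr p / l powr p)" using assms by (simp add: powr_divide)
  also have "\<dots> = l powr (1 - p) * a powr p" by (simp add: powr_diff)
  finally show ?thesis using assms by simp
qed

lemma wint_of_integrable_powr:
  fixes F :: "real^'n \<Rightarrow> real"
  assumes Fm[measurable]: "F \<in> borel_measurable borel" and F0: "\<And>x. 0 \<le> F x" and p: "1 \<le> p"
    and int: "integrable lborel (\<lambda>x. F x powr p)"
  shows "wint (real CARD('n) + 1) F"
proof -
  let ?W = "\<lambda>y::real^'n. (1 + norm y) powr (- (real CARD('n) + 1))"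
  have "integrable lborel (\<lambda>y. \<bar>F y\<bar> * ?W y)"
  proof (rule integrable_bound_real)
    show "integrable lborel (\<lambda>y. ?W y + F y powr p)"
      by (intro Bochner_Integration.integrable_add integrable_weight int) simp
    show "\<bar>\<bar>F y\<bar> * ?W y\<bar> \<le> ?W y + F y powr p" for y
    proof -
      have "?W y \<le> 1 powr (- (real CARD('n) + 1))" by (intro powr_mono2') auto
      then have W1: "?W y \<le> 1" by (simp only: powr_one_eq_one)
      have "F y * ?W y \<le> (1 + F y powr p) * ?W y"
        using powr_split_bound[OF F0[of y], of 1 p] p by (intro mult_right_mono) auto
      also have "\<dots> \<le> ?W y + F y powr p" using W1 mult_left_le[of "?W y" "F y powr p"] by (simp add: distrib_right)
      finally show ?thesis using F0[of y] by simp
    qed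
  qed measurable
  then show ?thesis by (simp add: wint_def)
qed

text \<open>By scaling, the kernel at time t is t^(-n/2) times the kernel at time 1 evaluated at z /
  sqrt(t); the weighted bound is needed at time 1 only. This leaves a single power of
  \<open>t\<close>, which disappears for B = n.\<close>

lemma heat_far_bound:
  assumes B: "0 \<le> B"
  shows "\<exists>C>0. \<forall>t>0. \<forall>z::real^'n. z \<noteq> 0 \<longrightarrow> heat t z \<le> C * t powr ((B - real CARD('n)) / 2) * norm z powr (- B)"
proof -
  let ?n = "real CARD('n)"
  obtain C where C: "C > 0" "\<And>t z. t > 0 \<Longrightarrow> heat t (z::real^'n) \<le> C * (t powr (- (?n / 2)) + t powr ((B - ?n) / 2)) * (1 + norm z) powr (- B)"
    using heat_weight_bound[OF B] by blast
  have "heat t z \<le> (2 * C) * t powr ((B - ?n) / 2) * norm z powr (- B)" if t: "t > 0" and z: "z \<noteq> 0" for t and z :: "real^'n"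
  proof -
    define w where "w = (1 / sqrt t) *\<^sub>R z"
    have nw: "norm w = norm z / sqrt t" using t by (simp add: w_def)
    have "(norm w)\<^sup>2 / (4 * 1) = (norm z)\<^sup>2 / (4 * t)" using t by (simp add: nw power_divide)
    then have "heat t z = t powr (- (?n / 2)) * heat 1 w"
      by (simp add: heat_def powr_mult mult_ac)
    also have "\<dots> \<le> t powr (- (?n / 2)) * (2 * C * norm w powr (- B))"
    proof (intro mult_left_mono)
      have "heat 1 w \<le> 2 * C * (1 + norm w) powr (- B)" using C(2)[of 1 w] by simp
      also have "\<dots> \<le> 2 * C * norm w powr (- B)"
        using C(1) B z t by (intro mult_left_mono powr_mono2') (auto simp: nw)
      finally show "heat 1 w \<le> 2 * C * norm w powr (- B)" .
    qed simp
    also have "norm w powr (- B) = norm z powr (- B) * t powr (B / 2)"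
      using t z by (simp add: nw powr_divide powr_half_sqrt[symmetric] powr_powr powr_minus divide_simps)
    also have "t powr (- (?n / 2)) * (2 * C * (norm z powr (- B) * t powr (B / 2))) = (2 * C) * (t powr (- (?n / 2)) * t powr (B / 2)) * norm z powr (- B)"
      by (simp add: mult_ac)
    also have "t powr (- (?n / 2)) * t powr (B / 2) = t powr ((B - ?n) / 2)"
      by (simp add: powr_add[symmetric] diff_divide_distrib)
    finally show ?thesis .
  qed
  then show ?thesis using C(1) by (intro exI[of _ "2 * C"]) auto
qed

lemma hconv_powr_decay:
  fixes F :: "real^'n \<Rightarrow> real"
  assumes F: "wint B F" "0 \<le> B" and F0: "\<And>x. 0 \<le> F x" and p: "1 \<le> p"
    and int: "integrable lborel (\<lambda>x. F x powr p)"
  shows "\<exists>C\<ge>0. \<forall>t>0. \<forall>x. hconv F 0 t x \<le> C * t powr (- (real CARD('n) / (2 * p)))"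
proof -
  let ?n = "real CARD('n)"
  define A where "A = (LINT x|lborel. F x powr p)"
  have A0: "0 \<le> A" unfolding A_def by (intro integral_nonneg_AE) auto
  have "hconv F 0 t x \<le> (1 + (4 * pi) powr (- (?n / 2)) * A) * t powr (- (?n / (2 * p)))" if t: "t > 0" for t x
  proof -
    \<comment> \<open>The threshold for which the two parts balance: l^(1-p) t^(-n/2) = l.\<close>
    define l where "l = t powr (- (?n / (2 * p)))"
    have l: "l > 0" using t by (simp add: l_def)
    define K where "K = (4 * pi * t) powr (- (?n / 2))"
    have ih: "integrable lborel (\<lambda>y. heat t (x - y))" "(LINT y|lborel. heat t (x - y)) = 1"
      using integrable_reflect[of "heat t" x] integral_reflect[of "heat t" x] integral_heat[OF t, where 'n='n] by auto
    have "hconv F 0 t x \<le> (LINT y|lborel. l * heat t (x - y) + l powr (1 - p) * K * F y powr p)"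
      unfolding hconv_def hk_0
    proof (rule integral_mono)
      show "integrable lborel (\<lambda>y. F y * heat t (x - y))" using hconv_integrable[OF F t, of 0 x] by (simp add: hk_0)
      show "integrable lborel (\<lambda>y. l * heat t (x - y) + l powr (1 - p) * K * F y powr p)"
        using ih(1) int by (intro Bochner_Integration.integrable_add integrable_mult_right)
      show "F y * heat t (x - y) \<le> l * heat t (x - y) + l powr (1 - p) * K * F y powr p" for y
      proof -
        have "F y * heat t (x - y) \<le> (l + l powr (1 - p) * F y powr p) * heat t (x - y)"
          by (intro mult_right_mono powr_split_bound F0 l p) simp
        also have "\<dots> = l * heat t (x - y) + l powr (1 - p) * F y powr p * heat t (x - y)" by (simp add: distrib_right)
        also have "\<dots> \<le> l * heat t (x - y) + l powr (1 - p) * F y powr p * K"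
          unfolding K_def by (intro add_left_mono mult_left_mono heat_le t) auto
        finally show ?thesis by (simp add: mult_ac)
      qed
    qed
    also have "\<dots> = l + l powr (1 - p) * K * A" using ih int by (simp add: A_def)
    also have "l powr (1 - p) * K = (4 * pi) powr (- (?n / 2)) * l"
    proof -
      have "l powr (1 - p) * t powr (- (?n / 2)) = l"
      proof -
        have e: "- (?n / (2 * p)) * (1 - p) + - (?n / 2) = - (?n / (2 * p))" using p by (simp add: field_simps)
        have "l powr (1 - p) * t powr (- (?n / 2)) = t powr (- (?n / (2 * p)) * (1 - p) + - (?n / 2))"
          by (simp only: l_def powr_powr powr_add)
        then show ?thesis unfolding e by (simp add: l_def)
      qed
      then show ?thesis by (simp add: K_def powr_mult mult_ac)
    qed
    finally show ?thesis by (simp add: l_def algebra_simps)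
  qed
  moreover have "0 \<le> 1 + (4 * pi) powr (- (?n / 2)) * A" using A0 by simp
  ultimately show ?thesis by blast
qed

lemma continuous_le_on_cball:
  fixes F :: "real^'n \<Rightarrow> real"
  assumes "continuous_on UNIV F"
  shows "\<exists>M>0. \<forall>y\<in>cball x r. F y \<le> M"
proof -
  have "bounded (F ` cball x r)"
    by (intro compact_imp_bounded compact_continuous_image continuous_on_subset[OF assms]) auto
  then obtain M where "M > 0" "\<forall>z\<in>F ` cball x r. norm z \<le> M" unfolding bounded_pos by blast
  then show ?thesis by (intro exI[of _ M]) auto
qed

text \<open>Complements the decay estimate, which blows up as t tends to 0. On the unit ball around
  \<open>x\<close> the continuous function \<open>F\<close> is bounded; outside it the kernel is
  bounded uniformly in \<open>t\<close>, by \<open>heat_far_bound\<close> with B = n.\<close>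

lemma hconv_powr_bounded:
  fixes F :: "real^'n \<Rightarrow> real"
  assumes F: "wint B F" "0 \<le> B" and F0: "\<And>x. 0 \<le> F x" and p: "1 \<le> p"
    and int: "integrable lborel (\<lambda>x. F x powr p)" and c: "continuous_on UNIV F"
  shows "\<exists>M\<ge>0. \<forall>t>0. hconv F 0 t x \<le> M"
proof -
  let ?n = "real CARD('n)"
  define A where "A = (LINT x|lborel. F x powr p)"
  have A0: "0 \<le> A" unfolding A_def by (intro integral_nonneg_AE) auto
  obtain C where C: "C > 0" "\<And>t z. t > 0 \<Longrightarrow> z \<noteq> 0 \<Longrightarrow> heat t (z::real^'n) \<le> C * t powr ((?n - ?n) / 2) * norm z powr (- ?n)"
    using heat_far_bound[of ?n, where 'n='n] by auto
  obtain M where M: "M > 0" "\<And>y. y \<in> cball x 1 \<Longrightarrow> F y \<le> M" using continuous_le_on_cball[OF c] by blast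
  have "hconv F 0 t x \<le> (M + 1) + C * A" if t: "t > 0" for t
  proof -
    have ih: "integrable lborel (\<lambda>y. heat t (x - y))" "(LINT y|lborel. heat t (x - y)) = 1"
      using integrable_reflect[of "heat t" x] integral_reflect[of "heat t" x] integral_heat[OF t, where 'n='n] by auto
    have "hconv F 0 t x \<le> (LINT y|lborel. (M + 1) * heat t (x - y) + C * F y powr p)"
      unfolding hconv_def hk_0
    proof (rule integral_mono)
      show "integrable lborel (\<lambda>y. F y * heat t (x - y))" using hconv_integrable[OF F t, of 0 x] by (simp add: hk_0)
      show "integrable lborel (\<lambda>y. (M + 1) * heat t (x - y) + C * F y powr p)"
        using ih(1) int by (intro Bochner_Integration.integrable_add integrable_mult_right)
      show "F y * heat t (x - y) \<le> (M + 1) * heat t (x - y) + C * F y powr p" for y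
      proof (cases "y \<in> cball x 1")
        case True
        have "F y * heat t (x - y) \<le> (M + 1) * heat t (x - y)" using M(2)[OF True] by (intro mult_right_mono) auto
        moreover have "0 \<le> C * F y powr p" using C by simp
        ultimately show ?thesis by linarith
      next
        case False
        then have n1: "norm (x - y) > 1" by (simp add: dist_norm)
        then have "norm (x - y) powr (- ?n) \<le> 1 powr (- ?n)" by (intro powr_mono2') auto
        then have "norm (x - y) powr (- ?n) \<le> 1" by simp
        then have "C * norm (x - y) powr (- ?n) \<le> C * 1" using C(1) by (intro mult_left_mono) auto
        then have hC: "heat t (x - y) \<le> C" using C(2)[OF t, of "x - y"] n1 t by fastforce
        have "F y \<le> 1 + F y powr p" using powr_split_bound[OF F0[of y], of 1 p] p by simp
        then have "F y * heat t (x - y) \<le> (1 + F y powr p) * heat t (x - y)" by (intro mult_right_mono) auto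
        also have "\<dots> \<le> (M + 1) * heat t (x - y) + F y powr p * C"
          unfolding distrib_right[of 1] using M(1) hC by (intro add_mono mult_left_mono mult_right_mono) auto
        finally show ?thesis by (simp add: mult.commute)
      qed
    qed
    also have "\<dots> = (M + 1) + C * A" using ih int by (simp add: A_def)
    finally show ?thesis .
  qed
  moreover have "0 \<le> (M + 1) + C * A" using A0 C M by simp
  ultimately show ?thesis by blast
qed

text \<open>Since \<open>F\<close> is nonnegative, the bound of the differentiated kernel by K/t
  times the kernel at time 2t compares the time derivative with the heat extension itself at time
  2t.\<close>

lemma hconv_1_bound:
  fixes F :: "real^'n \<Rightarrow> real"
  assumes F: "wint B F" "0 \<le> B" and F0: "\<And>x. 0 \<le> F x" and a: "0 \<le> a" and C: "0 \<le> C"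
    and bd: "\<And>t. t > 0 \<Longrightarrow> hconv F 0 t x \<le> C * t powr (- a)"
  shows "\<exists>D\<ge>0. \<forall>t>0. \<bar>hconv F 1 t x\<bar> \<le> D * t powr (- (1 + a))"
proof -
  obtain K where K: "K > 0" "\<And>t z. t > 0 \<Longrightarrow> \<bar>hk 1 t (z::real^'n)\<bar> \<le> K * inverse (t ^ 1) * heat (2 * t) z"
    using hk_bound[of 1, where 'n='n] by blast
  have "\<bar>hconv F 1 t x\<bar> \<le> (K * C) * t powr (- (1 + a))" if t: "t > 0" for t
  proof -
    have i2: "integrable lborel (\<lambda>y. F y * hk 0 (2 * t) (x - y))" using t by (intro hconv_integrable[OF F]) simp
    have "\<bar>hconv F 1 t x\<bar> \<le> (LINT y|lborel. K * inverse t * (F y * hk 0 (2 * t) (x - y)))"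
      unfolding hconv_def
    proof (rule integral_abs_bound[THEN order_trans], rule integral_mono)
      show "integrable lborel (\<lambda>y. \<bar>F y * hk 1 t (x - y)\<bar>)" by (intro integrable_abs hconv_integrable[OF F t])
      show "integrable lborel (\<lambda>y. K * inverse t * (F y * hk 0 (2 * t) (x - y)))" using i2 by (rule integrable_mult_right)
      show "\<bar>F y * hk 1 t (x - y)\<bar> \<le> K * inverse t * (F y * hk 0 (2 * t) (x - y))" for y
        using mult_left_mono[OF K(2)[OF t, of "x - y"] F0[of y]] F0[of y] by (simp add: abs_mult hk_0 mult_ac)
    qed
    also have "\<dots> = K * inverse t * hconv F 0 (2 * t) x" by (simp add: hconv_def)
    also have "\<dots> \<le> K * inverse t * (C * t powr (- a))"
    proof (intro mult_left_mono)
      have "(2 * t) powr (- a) \<le> t powr (- a)" using t a by (intro powr_mono2') auto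
      then have "C * (2 * t) powr (- a) \<le> C * t powr (- a)" using C by (intro mult_left_mono)
      then show "hconv F 0 (2 * t) x \<le> C * t powr (- a)" using bd[of "2 * t"] t by simp
    qed (use K t in auto)
    also have "\<dots> = (K * C) * (inverse t * t powr (- a))" by (simp add: mult_ac)
    also have "inverse t * t powr (- a) = t powr (- (1 + a))"
    proof -
      have "t powr (- (1 + a)) = t powr (- 1) * t powr (- a)" by (subst powr_add[symmetric]) simp
      moreover have "t powr (- 1) = inverse t" using t powr_minus[of t 1] by simp
      ultimately show ?thesis by (simp only:)
    qed
    finally show ?thesis .
  qed
  then show ?thesis using K C by (intro exI[of _ "K * C"]) auto
qed

lemma hconv_nonneg: "(\<And>y. 0 \<le> v y) \<Longrightarrow> 0 \<le> hconv v 0 t x"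
  unfolding hconv_def hk_0 by (intro integral_nonneg_AE) auto

text \<open>Near \<open>x\<close> continuity of \<open>v\<close> suffices. Away from
  \<open>x\<close> the heat kernel is a positive power of \<open>t\<close> times a weight that
  integrates both \<open>v\<close> and constants.\<close>

lemma hconv_tendsto_initial:
  fixes v :: "real^'n \<Rightarrow> real"
  assumes v: "wint b v" and b: "b \<ge> real CARD('n)" and c: "continuous_on UNIV v"
  shows "((\<lambda>t. hconv v 0 t x) \<longlongrightarrow> v x) (at_right 0)"
proof (rule tendstoI)
  fix e :: real assume e: "e > 0"
  have b0: "0 \<le> b" using b by linarith
  let ?n = "real CARD('n)"
  have [measurable]: "v \<in> borel_measurable borel" using v by (simp add: wint_def)
  have "isCont v x" using c by (simp add: continuous_on_eq_continuous_at)
  then obtain d where d: "d > 0" "\<And>y. dist y x < d \<Longrightarrow> dist (v y) (v x) < e / 2"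
    unfolding continuous_at_eps_delta using e by (metis half_gt_zero)
  \<comment> \<open>The exponent is b + 1 instead of b so that the power of \<open>t\<close> is
    positive even for b = n, the case \<gamma> = 0.\<close>
  obtain C where C: "C > 0" "\<And>t z. t > 0 \<Longrightarrow> z \<noteq> 0 \<Longrightarrow> heat t (z::real^'n) \<le> C * t powr (((b + 1) - ?n) / 2) * norm z powr (- (b + 1))"
    using heat_far_bound[of "b + 1", where 'n='n] b0 by auto
  define D where "D = C * (1 + 1 / d) powr (b + 1)"
  have D0: "D \<ge> 0" using C by (simp add: D_def)
  let ?W = "\<lambda>z::real^'n. (1 + norm z) powr (- (b + 1))"
  have far: "heat t z \<le> D * t powr (((b + 1) - ?n) / 2) * ?W z" if t: "t > 0" and z: "norm z \<ge> d" for t and z :: "real^'n"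
  proof -
    have z0: "norm z > 0" using z d by linarith
    have "1 + norm z \<le> (1 + 1 / d) * norm z" using z d by (simp add: field_simps)
    then have "((1 + 1 / d) * norm z) powr (- (b + 1)) \<le> ?W z"
      using b0 by (intro powr_mono2') (auto simp: add_pos_nonneg)
    then have "(1 + 1 / d) powr (b + 1) * ((1 + 1 / d) * norm z) powr (- (b + 1)) \<le> (1 + 1 / d) powr (b + 1) * ?W z"
      by (intro mult_left_mono) auto
    then have "norm z powr (- (b + 1)) \<le> (1 + 1 / d) powr (b + 1) * ?W z"
      using powr_scale[of "1 + 1 / d" "norm z" "b + 1"] z0 d by (simp add: add_pos_pos)
    then have "C * t powr (((b + 1) - ?n) / 2) * norm z powr (- (b + 1)) \<le> C * t powr (((b + 1) - ?n) / 2) * ((1 + 1 / d) powr (b + 1) * ?W z)"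
      using C(1) by (intro mult_left_mono) auto
    then show ?thesis using C(2)[OF t, of z] z0 by (simp add: D_def mult_ac)
  qed
  have iv: "integrable lborel (\<lambda>y. v y * ?W (x - y))"
  proof (rule wint_kernel_bound(2)[OF v b0])
    show "\<bar>?W (x - y)\<bar> \<le> 1 * (1 + norm (y - x)) powr (- b)" for y
      unfolding norm_minus_weight[of x y] by (simp add: powr_mono)
  qed auto
  have iW: "integrable lborel (\<lambda>y. ?W (x - y))"
    using integrable_reflect[of ?W x] integrable_weight[of "b + 1", where 'n='n] b by simp
  define S where "S y = (\<bar>v y\<bar> + \<bar>v x\<bar>) * ?W (x - y)" for y
  have iS: "integrable lborel S"
  proof -
    have "integrable lborel (\<lambda>y. \<bar>v y * ?W (x - y)\<bar> + \<bar>v x\<bar> * ?W (x - y))"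
      using iv iW by (intro Bochner_Integration.integrable_add integrable_abs integrable_mult_right)
    then show ?thesis by (simp add: S_def[abs_def] abs_mult distrib_right)
  qed
  define J where "J = (LINT y|lborel. S y)"
  have est: "\<bar>hconv v 0 t x - v x\<bar> \<le> e / 2 + D * J * t powr (((b + 1) - ?n) / 2)" if t: "t > 0" for t
  proof -
    have ih: "integrable lborel (\<lambda>y. heat t (x - y))" "(LINT y|lborel. heat t (x - y)) = 1"
      using integrable_reflect[of "heat t" x] integral_reflect[of "heat t" x] integral_heat[OF t, where 'n='n] by auto
    have ivh: "integrable lborel (\<lambda>y. v y * heat t (x - y))" using hconv_integrable[OF v b0 t, of 0 x] by (simp add: hk_0)
    have "hconv v 0 t x - v x = (LINT y|lborel. v y * heat t (x - y) - v x * heat t (x - y))"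
      using ih ivh by (simp add: hconv_def hk_0)
    also have "\<bar>\<dots>\<bar> \<le> (LINT y|lborel. e / 2 * heat t (x - y) + D * t powr (((b + 1) - ?n) / 2) * S y)"
    proof (rule integral_abs_bound[THEN order_trans], rule integral_mono)
      show "integrable lborel (\<lambda>y. \<bar>v y * heat t (x - y) - v x * heat t (x - y)\<bar>)"
        using ih ivh by (intro integrable_abs Bochner_Integration.integrable_diff integrable_mult_right)
      show "integrable lborel (\<lambda>y. e / 2 * heat t (x - y) + D * t powr (((b + 1) - ?n) / 2) * S y)"
        using ih iS by (intro Bochner_Integration.integrable_add integrable_mult_right)
      show "\<bar>v y * heat t (x - y) - v x * heat t (x - y)\<bar> \<le> e / 2 * heat t (x - y) + D * t powr (((b + 1) - ?n) / 2) * S y" for y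
      proof -
        have eq: "\<bar>v y * heat t (x - y) - v x * heat t (x - y)\<bar> = \<bar>v y - v x\<bar> * heat t (x - y)"
          by (simp add: left_diff_distrib[symmetric] abs_mult)
        have S0: "0 \<le> D * t powr (((b + 1) - ?n) / 2) * S y" using D0 by (simp add: S_def)
        show ?thesis
        proof (cases "dist y x < d")
          case True
          then have "\<bar>v y - v x\<bar> * heat t (x - y) \<le> e / 2 * heat t (x - y)"
            using d(2)[OF True] by (intro mult_right_mono) (auto simp: dist_real_def)
          then show ?thesis using S0 eq by linarith
        next
          case False
          then have "norm (x - y) \<ge> d" by (simp add: dist_norm norm_minus_commute)
          from far[OF t this] have "\<bar>v y - v x\<bar> * heat t (x - y) \<le> (\<bar>v y\<bar> + \<bar>v x\<bar>) * (D * t powr (((b + 1) - ?n) / 2) * ?W (x - y))"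
            by (intro mult_mono) auto
          also have "\<dots> = D * t powr (((b + 1) - ?n) / 2) * S y" by (simp add: S_def mult_ac)
          finally show ?thesis using eq e heat_nonneg[of t "x - y"] by (simp add: add_increasing)
        qed
      qed
    qed
    also have "\<dots> = e / 2 + D * t powr (((b + 1) - ?n) / 2) * J" using ih iS by (simp add: J_def)
    finally show ?thesis by (simp add: mult_ac)
  qed
  have "((\<lambda>t. D * J * t powr (((b + 1) - ?n) / 2)) \<longlongrightarrow> D * J * 0) (at_right 0)"
  proof (intro tendsto_mult_left)
    have "((\<lambda>t. t powr (((b + 1) - ?n) / 2)) \<longlongrightarrow> 0 powr (((b + 1) - ?n) / 2)) (at_right 0)"
    proof (rule tendsto_powr')
      show "((\<lambda>t::real. t) \<longlongrightarrow> 0) (at_right 0)" by (simp add: tendsto_ident_at)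
      show "(0::real) \<noteq> 0 \<or> 0 < ((b + 1) - ?n) / 2 \<and> (\<forall>\<^sub>F t in at_right (0::real). 0 \<le> t)"
      proof -
        have "\<forall>\<^sub>F t in at_right (0::real). 0 \<le> t" using eventually_at_right_less[of "0::real"] by eventually_elim simp
        then show ?thesis using b by simp
      qed
    qed auto
    then show "((\<lambda>t. t powr (((b + 1) - ?n) / 2)) \<longlongrightarrow> 0) (at_right 0)" by simp
  qed
  then have "\<forall>\<^sub>F t in at_right 0. D * J * t powr (((b + 1) - ?n) / 2) < e / 2"
    using e by (intro order_tendstoD(2)) auto
  then show "\<forall>\<^sub>F t in at_right 0. dist (hconv v 0 t x) (v x) < e"
    using eventually_at_right_less[of 0]
  proof eventually_elim
    case (elim t)
    then show ?case using est[of t] by (simp add: dist_real_def)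
  qed
qed

section \<open>The representation up to a constant\<close>

text \<open>R/\<Gamma>(s) is the Weyl integral of order s of the heat extension of \<open>F\<close>.
  By \<open>key\<close> it has the same time derivative as the heat extension of \<open>v\<close>,
  so the two differ by a constant \<open>c\<close> in time. As t tends to infinity \<open>R\<close>
  vanishes because a > s, which identifies \<open>c\<close>; as t tends to 0 the formula for v(x)
  appears.\<close>

lemma hconv_representation:
  fixes v F :: "real^'n \<Rightarrow> real"
  assumes v: "wint b v" and b: "b = real CARD('n) + 2 * \<gamma>" and \<gamma>: "0 \<le> \<gamma>" "\<gamma> < 1" and cv: "continuous_on UNIV v"
    and F: "wint B F" "0 \<le> B" "\<And>y. 0 \<le> F y" and s: "s = real m + \<gamma>" "0 < s" and a: "s < a"
    and weyl: "\<And>t. t > 0 \<Longrightarrow> hconv F 1 t x = 1 / Gamma (1 - \<gamma>) * (LINT r|lborel. indicator {0<..} r * (r powr (- \<gamma>) * hconv v (m + 2) (t + r) x))"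
    and decay: "0 \<le> C" "\<And>t. t > 0 \<Longrightarrow> hconv F 0 t x \<le> C * t powr (- a)" and bounded: "0 \<le> M" "\<And>t. t > 0 \<Longrightarrow> hconv F 0 t x \<le> M"
  shows "\<exists>c. ((\<lambda>t. hconv v 0 t x) \<longlongrightarrow> c) at_top \<and>
     integrable lborel (\<lambda>r. indicator {0<..} r * (r powr (s - 1) * hconv F 0 r x)) \<and>
     v x = 1 / Gamma s * (LINT r|lborel. indicator {0<..} r * (r powr (s - 1) * hconv F 0 r x)) + c"
proof -
  have b0: "0 \<le> b" using b \<gamma> by simp
  have vm: "v \<in> borel_measurable borel" and Fm: "F \<in> borel_measurable borel" using v F by (auto simp: wint_def)
  have a0: "0 \<le> a" using a s by simp
  have Gs: "Gamma s > 0" using s by simp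
  have G\<gamma>: "Gamma (1 - \<gamma>) > 0" using \<gamma> by simp
  define g where "g r = hconv F 0 r x" for r
  have gm[measurable]: "g \<in> borel_measurable borel" unfolding g_def[abs_def] by (intro borel_measurable_hconv Fm) auto
  have g0: "0 \<le> g r" for r unfolding g_def by (rule hconv_nonneg[OF F(3)])
  obtain D where D: "D \<ge> 0" "\<And>t. t > 0 \<Longrightarrow> \<bar>hconv F 1 t x\<bar> \<le> D * t powr (- (1 + a))"
    using hconv_1_bound[OF F a0 decay] by blast
  define R where "R t = (LINT r|lborel. indicator {0<..} r * (r powr (s - 1) * g (t + r)))" for t
  have int: "integrable lborel (\<lambda>r. indicator {0<..} r * (r powr (s - 1) * g (t + r)))" if t: "t > 0" for t
  proof (rule integrable_bound_real)
    show "integrable lborel (\<lambda>r. C * (indicator {0<..} r * (r powr (s - 1) * (t + r) powr (- a))))"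
      using s a t by (intro integrable_mult_right integrable_powr_halfline) auto
    show "\<bar>indicator {0<..} r * (r powr (s - 1) * g (t + r))\<bar> \<le> C * (indicator {0<..} r * (r powr (s - 1) * (t + r) powr (- a)))" for r
    proof (cases "r > 0")
      case True
      have "r powr (s - 1) * g (t + r) \<le> r powr (s - 1) * (C * (t + r) powr (- a))"
        unfolding g_def using decay(2)[of "t + r"] t True by (intro mult_left_mono) auto
      then show ?thesis using True g0[of "t + r"] by (simp add: mult_ac)
    qed simp
  qed measurable
  have dR: "(R has_real_derivative - (LINT r|lborel. indicator {0<..} r * (r powr (s - 1) * hconv F 1 (t + r) x))) (at t)" if t: "t > 0" for t
  proof -
    have tt: "t' > t / 2" if "t' \<in> ball t (t / 2)" for t' using that unfolding mem_ball dist_real_def by arith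
    have "((\<lambda>t. LINT r|lborel. indicator {0<..} r * (r powr (s - 1) * g (t + r))) has_real_derivative
       (LINT r|lborel. indicator {0<..} r * (r powr (s - 1) * - hconv F 1 (t + r) x))) (at t)"
    proof (rule integral_has_real_derivative[where d="t / 2" and w="\<lambda>r. D * (indicator {0<..} r * (r powr (s - 1) * (t / 2 + r) powr (- (1 + a))))"])
      show "integrable lborel (\<lambda>r. D * (indicator {0<..} r * (r powr (s - 1) * (t / 2 + r) powr (- (1 + a)))))"
        using s a t by (intro integrable_mult_right integrable_powr_halfline) auto
      fix t' r assume t': "t' \<in> ball t (t / 2)"
      show "((\<lambda>t. indicator {0<..} r * (r powr (s - 1) * g (t + r))) has_real_derivative indicator {0<..} r * (r powr (s - 1) * - hconv F 1 (t' + r) x)) (at t')"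
      proof (cases "r > 0")
        case True
        have "(g has_real_derivative - hconv F 1 (t' + r) x) (at (t' + r))"
          using hconv_has_derivative[OF F(1,2), of "t' + r" 0 x] tt[OF t'] t True by (simp add: g_def[abs_def])
        then have "((\<lambda>t. g (t + r)) has_real_derivative - hconv F 1 (t' + r) x) (at t')" by (simp add: DERIV_shift)
        then show ?thesis by (intro DERIV_cmult)
      qed simp
      show "\<bar>indicator {0<..} r * (r powr (s - 1) * - hconv F 1 (t' + r) x)\<bar> \<le> D * (indicator {0<..} r * (r powr (s - 1) * (t / 2 + r) powr (- (1 + a))))"
      proof (cases "r > 0")
        case True
        have "\<bar>hconv F 1 (t' + r) x\<bar> \<le> D * (t' + r) powr (- (1 + a))" using D(2)[of "t' + r"] tt[OF t'] t True by simp
        also have "\<dots> \<le> D * (t / 2 + r) powr (- (1 + a))"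
          using D(1) tt[OF t'] t True a0 by (intro mult_left_mono powr_mono2') auto
        finally have "r powr (s - 1) * \<bar>hconv F 1 (t' + r) x\<bar> \<le> r powr (s - 1) * (D * (t / 2 + r) powr (- (1 + a)))"
          by (intro mult_left_mono) auto
        then show ?thesis using True by (simp add: abs_mult mult_ac)
      qed simp
    next
      fix t' assume t': "t' \<in> ball t (t / 2)"
      show "integrable lborel (\<lambda>r. indicator {0<..} r * (r powr (s - 1) * g (t' + r)))"
        using tt[OF t'] t by (intro int) simp
    qed (use t in auto)
    then show ?thesis unfolding R_def[abs_def] by simp
  qed
  \<comment> \<open>The Weyl integral of order s is applied to the equation:
    \<open>weyl_composition\<close> makes the total order an integer, and
    \<open>iterated_tail_integral\<close> undoes that many derivatives of the extension of
    \<open>v\<close>, from index m + 2 down to index 1.\<close>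
  have key: "(LINT r|lborel. indicator {0<..} r * (r powr (s - 1) * hconv F 1 (t + r) x)) = Gamma s * hconv v 1 t x" if t: "t > 0" for t
  proof -
    obtain K where K: "K \<ge> 0" "\<And>r. r \<ge> t \<Longrightarrow> \<bar>hconv v (m + 2) r x\<bar> \<le> K * r powr (\<gamma> - real (m + 2)) * (1 + norm x) powr b"
      using hconv_decay[OF v b \<gamma>(1) t, of "m + 2"] by blast
    have comp: "(LINT r'|lborel. indicator {0<..} r' * (r' powr (s - 1) * (LINT r|lborel. indicator {0<..} r * (r powr (- \<gamma>) * hconv v (m + 2) (t + r' + r) x))))
      = Gamma s * Gamma (1 - \<gamma>) / fact m * (LINT r|lborel. indicator {0<..} r * (r ^ m * hconv v (m + 2) (t + r) x))"
    proof (rule weyl_composition[OF s \<gamma> t])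
      show "\<bar>hconv v (m + 2) r x\<bar> \<le> (K * (1 + norm x) powr b) * r powr (\<gamma> - real m - 2)" if "r \<ge> t" for r
      proof -
        have "\<gamma> - real (m + 2) = \<gamma> - real m - 2" by simp
        then show ?thesis using K(2)[OF that] by (simp only: mult_ac)
      qed
      show "0 \<le> K * (1 + norm x) powr b" using K by simp
      show "(\<lambda>r. hconv v (m + 2) r x) \<in> borel_measurable borel" by (intro borel_measurable_hconv vm) auto
    qed
    have tail: "(LINT r|lborel. indicator {0<..} r * (r ^ m * hconv v (m + 2) (t + r) x)) = fact m * hconv v 1 t x"
    proof (rule iterated_tail_integral[of t \<gamma> "\<lambda>k r. hconv v k r x", OF t \<gamma>(2)])
      show "((\<lambda>r. hconv v k r x) has_real_derivative - hconv v (Suc k) r x) (at r)" if "r \<ge> t" for k r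
        using that t by (intro hconv_has_derivative[OF v b0]) simp
      show "\<exists>C\<ge>0. \<forall>r\<ge>t. \<bar>hconv v k r x\<bar> \<le> C * r powr (\<gamma> - real k)" for k
      proof -
        obtain K where K: "K \<ge> 0" "\<And>r. r \<ge> t \<Longrightarrow> \<bar>hconv v k r x\<bar> \<le> K * r powr (\<gamma> - real k) * (1 + norm x) powr b"
          using hconv_decay[OF v b \<gamma>(1) t, of k] by blast
        then have "\<bar>hconv v k r x\<bar> \<le> (K * (1 + norm x) powr b) * r powr (\<gamma> - real k)" if "r \<ge> t" for r
          using K(2)[OF that] by (simp add: mult_ac)
        then show ?thesis using K(1) by (intro exI[of _ "K * (1 + norm x) powr b"]) auto
      qed
      show "(\<lambda>r. hconv v k r x) \<in> borel_measurable borel" for k by (intro borel_measurable_hconv vm) auto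
    qed
    have "(LINT r|lborel. indicator {0<..} r * (r powr (s - 1) * hconv F 1 (t + r) x)) =
      (LINT r'|lborel. 1 / Gamma (1 - \<gamma>) * (indicator {0<..} r' * (r' powr (s - 1) * (LINT r|lborel. indicator {0<..} r * (r powr (- \<gamma>) * hconv v (m + 2) (t + r' + r) x)))))"
    proof (intro Bochner_Integration.integral_cong refl)
      fix r' :: real
      show "indicator {0<..} r' * (r' powr (s - 1) * hconv F 1 (t + r') x) = 1 / Gamma (1 - \<gamma>) * (indicator {0<..} r' * (r' powr (s - 1) * (LINT r|lborel. indicator {0<..} r * (r powr (- \<gamma>) * hconv v (m + 2) (t + r' + r) x))))"
        using weyl[of "t + r'"] t by (cases "r' > 0") auto
    qed
    also have "\<dots> = 1 / Gamma (1 - \<gamma>) * (Gamma s * Gamma (1 - \<gamma>) / fact m * (fact m * hconv v 1 t x))"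
      by (simp only: integral_mult_right_zero comp tail)
    also have "\<dots> = Gamma s * hconv v 1 t x" using G\<gamma> by simp
    finally show ?thesis .
  qed
  have "\<exists>c. \<forall>t\<in>{0<..}. hconv v 0 t x - 1 / Gamma s * R t = c"
  proof (rule has_field_derivative_zero_constant)
    fix t :: real assume "t \<in> {0<..}"
    then have t: "t > 0" by simp
    have "((\<lambda>t. hconv v 0 t x - 1 / Gamma s * R t) has_real_derivative - hconv v 1 t x - 1 / Gamma s * - (Gamma s * hconv v 1 t x)) (at t)"
      using hconv_has_derivative[OF v b0 t, of 0 x] dR[OF t, unfolded key[OF t]] by (intro DERIV_diff DERIV_cmult) auto
    then show "((\<lambda>t. hconv v 0 t x - 1 / Gamma s * R t) has_real_derivative 0) (at t within {0<..})"
      using Gs by (simp add: has_field_derivative_at_within)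
  qed simp
  then obtain c where c: "\<And>t. t > 0 \<Longrightarrow> hconv v 0 t x = 1 / Gamma s * R t + c" by (metis add.commute diff_add_cancel greaterThan_iff)
  have R0: "0 \<le> R t" for t unfolding R_def using g0 by (intro integral_nonneg_AE) auto
  have Rinf: "(R \<longlongrightarrow> 0) at_top"
  proof -
    \<comment> \<open>Half of the gap between a and s is spent on decay in \<open>t\<close>; the
      other half keeps the integral over \<open>r\<close> convergent.\<close>
    define d where "d = (a - s) / 2"
    have d: "d > 0" "s < a - d" using a by (auto simp: d_def field_simps)
    define J where "J = (LINT r|lborel. indicator {0<..} r * (r powr (s - 1) * (1 + r) powr (- (a - d))))"
    have iJ: "integrable lborel (\<lambda>r. indicator {0<..} r * (r powr (s - 1) * (1 + r) powr (- (a - d))))"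
      using s d by (intro integrable_powr_halfline) auto
    have Rle: "R t \<le> C * t powr (- d) * J" if t: "t \<ge> 1" for t
    proof -
      have "R t \<le> (LINT r|lborel. C * t powr (- d) * (indicator {0<..} r * (r powr (s - 1) * (1 + r) powr (- (a - d)))))"
        unfolding R_def
      proof (rule integral_mono)
        show "integrable lborel (\<lambda>r. indicator {0<..} r * (r powr (s - 1) * g (t + r)))" using t by (intro int) simp
        show "integrable lborel (\<lambda>r. C * t powr (- d) * (indicator {0<..} r * (r powr (s - 1) * (1 + r) powr (- (a - d)))))"
          using iJ by (rule integrable_mult_right)
        show "indicator {0<..} r * (r powr (s - 1) * g (t + r)) \<le> C * t powr (- d) * (indicator {0<..} r * (r powr (s - 1) * (1 + r) powr (- (a - d))))" for r
        proof (cases "r > 0")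
          case True
          have "g (t + r) \<le> C * (t + r) powr (- a)" unfolding g_def using decay(2)[of "t + r"] t True by simp
          also have "(t + r) powr (- a) = (t + r) powr (- d) * (t + r) powr (- (a - d))" by (simp add: powr_add[symmetric])
          also have "C * ((t + r) powr (- d) * (t + r) powr (- (a - d))) \<le> C * (t powr (- d) * (1 + r) powr (- (a - d)))"
            using decay(1) t True d s by (intro mult_left_mono mult_mono powr_mono2') auto
          finally have "r powr (s - 1) * g (t + r) \<le> r powr (s - 1) * (C * (t powr (- d) * (1 + r) powr (- (a - d))))"
            by (intro mult_left_mono) auto
          then show ?thesis using True by (simp add: mult_ac)
        qed simp
      qed
      then show ?thesis by (simp add: J_def)
    qed
    have "\<forall>\<^sub>F t in at_top. norm (R t) \<le> C * t powr (- d) * J"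
      using eventually_ge_at_top[of 1] by eventually_elim (use Rle R0 in simp)
    moreover have "((\<lambda>t. C * t powr (- d) * J) \<longlongrightarrow> 0) at_top"
    proof -
      have "((\<lambda>t::real. t powr (- d)) \<longlongrightarrow> 0) at_top" using d by (intro tendsto_neg_powr filterlim_ident) auto
      then show ?thesis by (intro tendsto_mult_left_zero tendsto_mult_right_zero)
    qed
    ultimately show ?thesis by (rule Lim_null_comparison)
  qed
  have lim: "((\<lambda>t. hconv v 0 t x) \<longlongrightarrow> c) at_top"
  proof -
    have "((\<lambda>t. 1 / Gamma s * R t + c) \<longlongrightarrow> 1 / Gamma s * 0 + c) at_top" by (intro tendsto_intros Rinf)
    then have "((\<lambda>t. 1 / Gamma s * R t + c) \<longlongrightarrow> c) at_top" by simp
    then show ?thesis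
    proof (rule Lim_transform_eventually)
      show "\<forall>\<^sub>F t in at_top. 1 / Gamma s * R t + c = hconv v 0 t x"
        using eventually_gt_at_top[of 0] by eventually_elim (simp add: c)
    qed
  qed
  \<comment> \<open>One majorant for all t \<ge> 0: the bound \<open>M\<close> serves r < 1 and the
    decay C r^(-a) serves r \<ge> 1. The factor 2^a converts both into powers of 1 + r.\<close>
  define w where "w r = ((C + M) * 2 powr a) * (indicator {0<..} r * (r powr (s - 1) * (1 + r) powr (- a)))" for r
  have iw: "integrable lborel w" unfolding w_def using s a by (intro integrable_mult_right integrable_powr_halfline) auto
  have dom: "\<bar>indicator {0<..} r * (r powr (s - 1) * g (t + r))\<bar> \<le> w r" if t: "t \<ge> 0" for t r
  proof (cases "r > 0")
    case True
    have "g (t + r) \<le> (C + M) * (2 powr a * (1 + r) powr (- a))"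
    proof (cases "r \<ge> 1")
      case r1: True
      have "g (t + r) \<le> C * (t + r) powr (- a)" unfolding g_def using decay(2)[of "t + r"] t True by simp
      also have "\<dots> \<le> C * r powr (- a)" using decay(1) t True a0 by (intro mult_left_mono powr_mono2') auto
      also have "\<dots> \<le> (C + M) * (2 powr a * (1 + r) powr (- a))"
        using decay(1) bounded(1) powr_far_bound[OF a0 r1] by (intro mult_mono) auto
      finally show ?thesis .
    next
      case False
      have "2 powr (- a) \<le> (1 + r) powr (- a)" using False True a0 by (intro powr_mono2') auto
      then have "2 powr a * 2 powr (- a) \<le> 2 powr a * (1 + r) powr (- a)" by (intro mult_left_mono) auto
      then have "1 \<le> 2 powr a * (1 + r) powr (- a)" by (simp add: powr_add[symmetric])
      moreover have "g (t + r) \<le> M" unfolding g_def using bounded(2)[of "t + r"] t True by simp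
      ultimately have "g (t + r) * 1 \<le> (C + M) * (2 powr a * (1 + r) powr (- a))"
        using decay(1) bounded(1) by (intro mult_mono) auto
      then show ?thesis by simp
    qed
    then have "r powr (s - 1) * g (t + r) \<le> r powr (s - 1) * ((C + M) * (2 powr a * (1 + r) powr (- a)))" by (intro mult_left_mono) auto
    then show ?thesis using True g0[of "t + r"] by (simp add: w_def mult_ac)
  qed (simp add: w_def)
  have i0: "integrable lborel (\<lambda>r. indicator {0<..} r * (r powr (s - 1) * g r))"
    by (rule integrable_bound_real[OF iw]) (use dom[of 0] in auto)
  have "(\<lambda>n. R (1 / real (Suc n))) \<longlonglongrightarrow> (LINT r|lborel. indicator {0<..} r * (r powr (s - 1) * g r))"
    unfolding R_def
  proof (rule integral_dominated_convergence[OF _ _ iw])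
    show "AE r in lborel. (\<lambda>n. indicator {0<..} r * (r powr (s - 1) * g (1 / real (Suc n) + r))) \<longlonglongrightarrow> indicator {0<..} r * (r powr (s - 1) * g r)"
    proof (intro AE_I2)
      fix r :: real
      show "(\<lambda>n. indicator {0<..} r * (r powr (s - 1) * g (1 / real (Suc n) + r))) \<longlonglongrightarrow> indicator {0<..} r * (r powr (s - 1) * g r)"
      proof (cases "r > 0")
        case True
        have "isCont g r" unfolding g_def[abs_def] by (rule hconv_isCont_t[OF F(1,2) True])
        moreover have "(\<lambda>n. 1 / real (Suc n) + r) \<longlonglongrightarrow> 0 + r"
          by (intro tendsto_add LIMSEQ_Suc[OF lim_1_over_n] tendsto_const)
        ultimately have "(\<lambda>n. g (1 / real (Suc n) + r)) \<longlonglongrightarrow> g r"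
          using isCont_tendsto_compose[of r g] by simp
        then show ?thesis by (intro tendsto_mult_left)
      qed simp
    qed
    show "AE r in lborel. norm (indicator {0<..} r * (r powr (s - 1) * g (1 / real (Suc n) + r))) \<le> w r" for n
      using dom[of "1 / real (Suc n)"] by (intro AE_I2) simp
  qed measurable
  then have l1: "(\<lambda>n. 1 / Gamma s * R (1 / real (Suc n)) + c) \<longlonglongrightarrow> 1 / Gamma s * (LINT r|lborel. indicator {0<..} r * (r powr (s - 1) * g r)) + c"
    by (intro tendsto_intros)
  have "(\<lambda>n. hconv v 0 (1 / real (Suc n)) x) \<longlonglongrightarrow> v x"
  proof -
    have "filterlim (\<lambda>n. 1 / real (Suc n)) (at_right 0) sequentially"
      unfolding filterlim_at using LIMSEQ_Suc[OF lim_1_over_n] by auto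
    then show ?thesis using filterlim_compose[OF hconv_tendsto_initial[OF v _ cv, of x]] b \<gamma> by simp
  qed
  then have "(\<lambda>n. 1 / Gamma s * R (1 / real (Suc n)) + c) \<longlonglongrightarrow> v x" by (simp add: c)
  with l1 have "v x = 1 / Gamma s * (LINT r|lborel. indicator {0<..} r * (r powr (s - 1) * g r)) + c"
    using LIMSEQ_unique by blast
  then show ?thesis using lim i0 unfolding g_def by blast
qed

text \<open>By Tonelli the time integral is taken first; by subordination with a = -s it gives the
  Riesz kernel, and s < n/2 is the positivity of n/2 + a required there. Everything is done in
  \<open>ennreal\<close>, so the finiteness of the left side yields integrability of the
  potential.\<close>

lemma riesz_potential:
  fixes F :: "real^'n \<Rightarrow> real"
  assumes F: "wint B F" "0 \<le> B" "\<And>y. 0 \<le> F y" and s: "0 < s" "s < real CARD('n) / 2"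
    and int: "integrable lborel (\<lambda>r. indicator {0<..} r * (r powr (s - 1) * hconv F 0 r x))"
  shows "integrable lborel (\<lambda>y. F y / norm (x - y) powr (real CARD('n) - 2 * s))"
    and "1 / Gamma s * (LINT r|lborel. indicator {0<..} r * (r powr (s - 1) * hconv F 0 r x)) =
      riesz_const CARD('n) s * (LINT y|lborel. F y / norm (x - y) powr (real CARD('n) - 2 * s))"
proof -
  let ?n = "real CARD('n)"
  have [measurable]: "F \<in> borel_measurable borel" using F by (simp add: wint_def)
  define K where "K = Gamma s * riesz_const CARD('n) s"
  have Gs: "Gamma s > 0" "Gamma (?n / 2 - s) > 0" using s by simp_all
  have K: "K > 0" unfolding K_def riesz_const_def using Gs by (intro mult_pos_pos divide_pos_pos) auto
  have Keq: "K = 4 powr (- s) * Gamma (?n / 2 + - s) / pi powr (?n / 2)"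
  proof -
    have "(4::real) powr (- s) = 1 / 2 powr (2 * s)"
      by (simp add: powr_minus_divide powr_powr[symmetric])
    then show ?thesis using Gs(1) by (simp add: K_def riesz_const_def)
  qed
  define I where "I = (LINT r|lborel. indicator {0<..} r * (r powr (s - 1) * hconv F 0 r x))"
  have hn: "0 \<le> hconv F 0 r x" for r by (rule hconv_nonneg[of F, OF F(3)])
  have I0: "0 \<le> I" unfolding I_def using hn by (intro integral_nonneg_AE) auto
  have "ennreal I = (\<integral>\<^sup>+r. ennreal (indicator {0<..} r * (r powr (s - 1) * hconv F 0 r x)) \<partial>lborel)"
    unfolding I_def using int hn by (intro nn_integral_eq_integral[symmetric]) auto
  also have "\<dots> = (\<integral>\<^sup>+r. \<integral>\<^sup>+y. ennreal (indicator {0<..} r * (r powr (s - 1) * (F y * heat r (x - y)))) \<partial>lborel \<partial>lborel)"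
  proof (rule nn_integral_cong)
    fix r :: real
    show "ennreal (indicator {0<..} r * (r powr (s - 1) * hconv F 0 r x)) = (\<integral>\<^sup>+y. ennreal (indicator {0<..} r * (r powr (s - 1) * (F y * heat r (x - y)))) \<partial>lborel)"
    proof (cases "r > 0")
      case True
      have "integrable lborel (\<lambda>y. r powr (s - 1) * (F y * heat r (x - y)))"
        using hconv_integrable[OF F(1,2) True, of 0 x] by (intro integrable_mult_right) (simp add: hk_0)
      then have "(\<integral>\<^sup>+y. ennreal (r powr (s - 1) * (F y * heat r (x - y))) \<partial>lborel) = ennreal (LINT y|lborel. r powr (s - 1) * (F y * heat r (x - y)))"
        using F(3) by (intro nn_integral_eq_integral) auto
      then show ?thesis using True by (simp add: hconv_def hk_0)
    qed simp
  qed
  also have "\<dots> = (\<integral>\<^sup>+y. \<integral>\<^sup>+r. ennreal (indicator {0<..} r * (r powr (s - 1) * (F y * heat r (x - y)))) \<partial>lborel \<partial>lborel)"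
    by (rule lborel_pair.Fubini') measurable
  also have "\<dots> = (\<integral>\<^sup>+y. ennreal (K * (F y / norm (x - y) powr (?n - 2 * s))) \<partial>lborel)"
  proof (rule nn_integral_cong_AE)
    have "AE y in lborel. y \<noteq> x" by (rule AE_lborel_singleton)
    then show "AE y in lborel. (\<integral>\<^sup>+r. ennreal (indicator {0<..} r * (r powr (s - 1) * (F y * heat r (x - y)))) \<partial>lborel) = ennreal (K * (F y / norm (x - y) powr (?n - 2 * s)))"
    proof eventually_elim
      case (elim y)
      have nz: "x - y \<noteq> 0" and pos: "?n / 2 + - s > 0" using elim s by auto
      note sub = heat_subordination[OF pos nz]
      have e: "indicator {0<..} r * (r powr (s - 1) * (F y * heat r (x - y))) = F y * (indicator {0<..} r * (r powr (- 1 - - s) * heat r (x - y)))" for r :: real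
        by (simp add: mult_ac)
      have "(\<integral>\<^sup>+r. ennreal (indicator {0<..} r * (r powr (s - 1) * (F y * heat r (x - y)))) \<partial>lborel) = ennreal (LINT r|lborel. F y * (indicator {0<..} r * (r powr (- 1 - - s) * heat r (x - y))))"
        unfolding e using F(3)[of y] by (intro nn_integral_eq_integral integrable_mult_right sub) auto
      also have "(LINT r|lborel. F y * (indicator {0<..} r * (r powr (- 1 - - s) * heat r (x - y)))) = F y * (K * norm (x - y) powr (- (?n + 2 * - s)))"
        unfolding integral_mult_right_zero sub(2) Keq ..
      also have "norm (x - y) powr (- (?n + 2 * - s)) = 1 / norm (x - y) powr (?n - 2 * s)"
        by (subst powr_minus_divide) simp
      finally show ?case by (simp add: mult_ac)
    qed
  qed
  finally have eq: "(\<integral>\<^sup>+y. ennreal (K * (F y / norm (x - y) powr (?n - 2 * s))) \<partial>lborel) = ennreal I" by simp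
  have m: "(\<lambda>y. K * (F y / norm (x - y) powr (?n - 2 * s))) \<in> borel_measurable lborel" by measurable
  have "integrable lborel (\<lambda>y. K * (F y / norm (x - y) powr (?n - 2 * s))) \<and> (LINT y|lborel. K * (F y / norm (x - y) powr (?n - 2 * s))) = I"
    using nn_integral_eq_integrable[OF m _ I0] eq F(3) K by auto
  then have i: "integrable lborel (\<lambda>y. K * (F y / norm (x - y) powr (?n - 2 * s)))" and v: "K * (LINT y|lborel. F y / norm (x - y) powr (?n - 2 * s)) = I"
    using integral_mult_right_zero[of lborel K "\<lambda>y. F y / norm (x - y) powr (?n - 2 * s)"] by simp_all
  from integrable_mult_right[OF i, of "1 / K"] show "integrable lborel (\<lambda>y. F y / norm (x - y) powr (?n - 2 * s))"
    using K by simp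
  show "1 / Gamma s * (LINT r|lborel. indicator {0<..} r * (r powr (s - 1) * hconv F 0 r x)) =
      riesz_const CARD('n) s * (LINT y|lborel. F y / norm (x - y) powr (?n - 2 * s))"
    using v Gs(1) unfolding I_def[symmetric] K_def by auto
qed

section \<open>Vanishing of the constant\<close>

text \<open>Outside a large ball \<open>v\<close> is below e/2 and the kernel has mass 1; on the
  ball \<open>v\<close> is bounded and the kernel is uniformly of order t^(-n/2).\<close>

lemma hconv_at_top_zero:
  fixes v :: "real^'n \<Rightarrow> real"
  assumes v: "wint b v" "0 \<le> b" and v0: "\<And>y. 0 \<le> v y" and cv: "continuous_on UNIV v" and lim: "(v \<longlongrightarrow> 0) at_infinity"
  shows "((\<lambda>t. hconv v 0 t x) \<longlongrightarrow> 0) at_top"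
proof (rule tendstoI)
  fix e :: real assume e: "e > 0"
  let ?n = "real CARD('n)"
  from tendstoD[OF lim, of "e / 2"] e obtain R where R: "\<And>y. R \<le> norm y \<Longrightarrow> v y < e / 2"
    unfolding eventually_at_infinity using v0 by (auto simp: dist_real_def)
  obtain M where M: "M > 0" "\<And>y. y \<in> cball 0 R \<Longrightarrow> v y \<le> M" using continuous_le_on_cball[OF cv] by blast
  define J where "J = (LINT y|lborel. M * indicator (cball (0::real^'n) R) y)"
  have est: "hconv v 0 t x \<le> e / 2 + (4 * pi) powr (- (?n / 2)) * t powr (- (?n / 2)) * J" if t: "t > 0" for t
  proof -
    have ih: "integrable lborel (\<lambda>y. heat t (x - y))" "(LINT y|lborel. heat t (x - y)) = 1"
      using integrable_reflect[of "heat t" x] integral_reflect[of "heat t" x] integral_heat[OF t, where 'n='n] by auto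
    have iJ: "integrable lborel (\<lambda>y. M * indicator (cball (0::real^'n) R) y)" by (rule integrable_indicator_cball)
    have "hconv v 0 t x \<le> (LINT y|lborel. e / 2 * heat t (x - y) + (4 * pi * t) powr (- (?n / 2)) * (M * indicator (cball 0 R) y))"
      unfolding hconv_def hk_0
    proof (rule integral_mono)
      show "integrable lborel (\<lambda>y. v y * heat t (x - y))" using hconv_integrable[OF v t, of 0 x] by (simp add: hk_0)
      show "integrable lborel (\<lambda>y. e / 2 * heat t (x - y) + (4 * pi * t) powr (- (?n / 2)) * (M * indicator (cball 0 R) y))"
        by (intro Bochner_Integration.integrable_add integrable_mult_right ih iJ)
      show "v y * heat t (x - y) \<le> e / 2 * heat t (x - y) + (4 * pi * t) powr (- (?n / 2)) * (M * indicator (cball 0 R) y)" for y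
      proof (cases "y \<in> cball 0 R")
        case True
        have "v y * heat t (x - y) \<le> M * (4 * pi * t) powr (- (?n / 2))"
          using M True v0 by (intro mult_mono heat_le t) auto
        moreover have "0 \<le> e / 2 * heat t (x - y)" using e by simp
        ultimately show ?thesis using True by (simp add: mult.commute)
      next
        case False
        then have "v y * heat t (x - y) \<le> e / 2 * heat t (x - y)" using R[of y] by (intro mult_right_mono) auto
        then show ?thesis using False by simp
      qed
    qed
    also have "\<dots> = e / 2 + (4 * pi * t) powr (- (?n / 2)) * J" unfolding J_def using ih iJ
      by (subst Bochner_Integration.integral_add) (auto intro!: integrable_mult_right simp del: integral_mult_right_zero simp: integral_mult_right)
    finally show ?thesis by (simp add: powr_mult)
  qed
  have "((\<lambda>t. (4 * pi) powr (- (?n / 2)) * t powr (- (?n / 2)) * J) \<longlongrightarrow> 0) at_top"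
  proof -
    have "((\<lambda>t::real. t powr (- (?n / 2))) \<longlongrightarrow> 0) at_top" by (intro tendsto_neg_powr filterlim_ident) auto
    then show ?thesis by (intro tendsto_mult_left_zero tendsto_mult_right_zero)
  qed
  then have "\<forall>\<^sub>F t in at_top. (4 * pi) powr (- (?n / 2)) * t powr (- (?n / 2)) * J < e / 2"
    using e by (intro order_tendstoD(2)) auto
  then show "\<forall>\<^sub>F t in at_top. dist (hconv v 0 t x) 0 < e"
    using eventually_gt_at_top[of 0]
  proof eventually_elim
    case (elim t)
    then show ?case using est[of t] hconv_nonneg[of v t x, OF v0] by (simp add: dist_real_def)
  qed
qed

text \<open>From |y - z|^2 \<le> 2|x - y|^2 + 2|x - z|^2: doubling the time at \<open>y\<close>
  compensates the factor 2 in front of |x - z|^2. The power of 2 comes from the normalisation of the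
  kernel at time 2t.\<close>

lemma hconv_harnack:
  fixes v :: "real^'n \<Rightarrow> real"
  assumes v: "wint b v" "0 \<le> b" and v0: "\<And>y. 0 \<le> v y" and t: "0 < t"
  shows "hconv v 0 t x \<le> 2 powr (real CARD('n) / 2) * exp ((norm (x - y))\<^sup>2 / (4 * t)) * hconv v 0 (2 * t) y"
proof -
  let ?K = "2 powr (real CARD('n) / 2) * exp ((norm (x - y))\<^sup>2 / (4 * t))"
  have pt: "heat t (x - z) \<le> ?K * heat (2 * t) (y - z)" for z
  proof -
    have "(norm (y - z))\<^sup>2 \<le> 2 * (norm (x - y))\<^sup>2 + 2 * (norm (x - z))\<^sup>2"
    proof -
      have "norm (y - z) \<le> norm (x - y) + norm (x - z)" using norm_triangle_ineq[of "y - x" "x - z"] by (simp add: norm_minus_commute)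
      then have "(norm (y - z))\<^sup>2 \<le> (norm (x - y) + norm (x - z))\<^sup>2" by (intro power_mono) auto
      also have "\<dots> \<le> 2 * (norm (x - y))\<^sup>2 + 2 * (norm (x - z))\<^sup>2"
        using sum_squares_bound[of "norm (x - y)" "norm (x - z)"] by (simp add: power2_sum)
      finally show ?thesis .
    qed
    then have "(norm (y - z))\<^sup>2 / (4 * (2 * t)) \<le> (2 * (norm (x - y))\<^sup>2 + 2 * (norm (x - z))\<^sup>2) / (4 * (2 * t))"
      using t by (intro divide_right_mono) auto
    also have "\<dots> = (norm (x - y))\<^sup>2 / (4 * t) + (norm (x - z))\<^sup>2 / (4 * t)" using t by (simp add: field_simps)
    finally have "exp (- ((norm (x - z))\<^sup>2 / (4 * t))) \<le> exp ((norm (x - y))\<^sup>2 / (4 * t)) * exp (- ((norm (y - z))\<^sup>2 / (4 * (2 * t))))"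
      by (simp add: mult_exp_exp)
    then have "(4 * pi * t) powr (- (real CARD('n) / 2)) * exp (- ((norm (x - z))\<^sup>2 / (4 * t))) \<le> (4 * pi * t) powr (- (real CARD('n) / 2)) * (exp ((norm (x - y))\<^sup>2 / (4 * t)) * exp (- ((norm (y - z))\<^sup>2 / (4 * (2 * t)))))"
      by (intro mult_left_mono) auto
    moreover have "2 powr (real CARD('n) / 2) * (4 * pi * (2 * t)) powr (- (real CARD('n) / 2)) = (4 * pi * t) powr (- (real CARD('n) / 2))"
      using powr_scale[of 2 "4 * pi * t" "real CARD('n) / 2"] t by (simp add: mult_ac)
    ultimately have "(4 * pi * t) powr (- (real CARD('n) / 2)) * exp (- ((norm (x - z))\<^sup>2 / (4 * t))) \<le> (2 powr (real CARD('n) / 2) * (4 * pi * (2 * t)) powr (- (real CARD('n) / 2))) * (exp ((norm (x - y))\<^sup>2 / (4 * t)) * exp (- ((norm (y - z))\<^sup>2 / (4 * (2 * t)))))"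
      by (simp only:)
    then show ?thesis unfolding heat_def by (simp only: mult_ac minus_divide_left)
  qed
  have "hconv v 0 t x \<le> (LINT z|lborel. ?K * (v z * hk 0 (2 * t) (y - z)))"
    unfolding hconv_def
  proof (rule integral_mono)
    show "integrable lborel (\<lambda>z. v z * hk 0 t (x - z))" by (rule hconv_integrable[OF v t])
    show "integrable lborel (\<lambda>z. ?K * (v z * hk 0 (2 * t) (y - z)))" using t by (intro integrable_mult_right hconv_integrable[OF v]) simp
    show "v z * hk 0 t (x - z) \<le> ?K * (v z * hk 0 (2 * t) (y - z))" for z
      using mult_left_mono[OF pt[of z] v0[of z]] by (simp add: hk_0 mult_ac)
  qed
  then show ?thesis by (simp add: hconv_def)
qed

text \<open>As t grows the exponential factor in \<open>hconv_harnack\<close> tends to 1, and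
  doubling the time does not affect the limit.\<close>

lemma hconv_limit_harnack:
  fixes v :: "real^'n \<Rightarrow> real"
  assumes v: "wint b v" "0 \<le> b" and v0: "\<And>y. 0 \<le> v y"
    and lx: "((\<lambda>t. hconv v 0 t x) \<longlongrightarrow> c) at_top" and ly: "((\<lambda>t. hconv v 0 t y) \<longlongrightarrow> c') at_top"
  shows "c \<le> 2 powr (real CARD('n) / 2) * c'"
proof (rule tendsto_le[OF _ _ lx])
  have f2: "filterlim (\<lambda>t::real. 2 * t) at_top at_top"
    by (rule filterlim_tendsto_pos_mult_at_top[OF tendsto_const _ filterlim_ident]) simp
  have f4: "filterlim (\<lambda>t::real. 4 * t) at_infinity at_top"
    by (rule filterlim_at_top_imp_at_infinity, rule filterlim_tendsto_pos_mult_at_top[OF tendsto_const _ filterlim_ident]) simp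
  have "((\<lambda>t. (norm (x - y))\<^sup>2 / (4 * t)) \<longlongrightarrow> 0) at_top"
    by (rule tendsto_divide_0[OF tendsto_const f4])
  then have "((\<lambda>t. exp ((norm (x - y))\<^sup>2 / (4 * t))) \<longlongrightarrow> exp 0) at_top" by (rule tendsto_exp)
  then have "((\<lambda>t. 2 powr (real CARD('n) / 2) * exp ((norm (x - y))\<^sup>2 / (4 * t)) * hconv v 0 (2 * t) y) \<longlongrightarrow> 2 powr (real CARD('n) / 2) * exp 0 * c') at_top"
    by (intro tendsto_mult tendsto_const filterlim_compose[OF ly f2])
  then show "((\<lambda>t. 2 powr (real CARD('n) / 2) * exp ((norm (x - y))\<^sup>2 / (4 * t)) * hconv v 0 (2 * t) y) \<longlongrightarrow> 2 powr (real CARD('n) / 2) * c') at_top"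
    by simp
  show "\<forall>\<^sub>F t in at_top. hconv v 0 t x \<le> 2 powr (real CARD('n) / 2) * exp ((norm (x - y))\<^sup>2 / (4 * t)) * hconv v 0 (2 * t) y"
    using eventually_gt_at_top[of 0] by eventually_elim (rule hconv_harnack[OF v v0])
qed simp

lemma not_integrable_const_lborel:
  assumes "c > (0::real)"
  shows "\<not> integrable lborel (\<lambda>x::real^'n. c)"
proof
  assume "integrable lborel (\<lambda>x::real^'n. c)"
  then have "(\<integral>\<^sup>+(x::real^'n). ennreal (norm c) \<partial>lborel) < \<infinity>" unfolding integrable_iff_bounded by blast
  then show False using assms by (simp add: ennreal_mult_less_top)
qed

theorem theorem3p1:
  fixes s p :: real and f :: "real^'n \<Rightarrow> real \<Rightarrow> real" and v :: "real^'n \<Rightarrow> real"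
  assumes s_pos: "0 < s" and s_lt: "s < real CARD('n) / 2"
    and f_cont: "continuous_on (UNIV \<times> {0..}) (\<lambda>(x, t). f x t)"
    and f_nonneg: "\<And>x t. t \<ge> 0 \<Longrightarrow> f x t \<ge> 0"
    and v_nonneg: "\<And>x. v x \<ge> 0"
    and sol: "strong_solution s v (\<lambda>x. f x (v x))"
    and p_gt: "1 < p" and p_lt: "p < real CARD('n) / (2 * s)"
    and f_Lp: "integrable lborel (\<lambda>x. \<bar>f x (v x)\<bar> powr p)"
    and ab: "((\<forall>x. mono_on {0<..} (f x)) \<and> (\<forall>t>0. (INF x. f x t) > 0))
             \<or> (v \<longlongrightarrow> 0) at_infinity"
  shows "\<forall>x. v x \<ge> 0 \<and>
           integrable lborel (\<lambda>y. f y (v y) / norm (x - y) powr (real CARD('n) - 2 * s)) \<and>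
           v x = riesz_const CARD('n) s *
             (LINT y|lborel. f y (v y) / norm (x - y) powr (real CARD('n) - 2 * s))"
proof -
  let ?n = "real CARD('n)"
  define m where "m = nat \<lfloor>s\<rfloor>"
  define \<gamma> where "\<gamma> = s - of_int \<lfloor>s\<rfloor>"
  define b where "b = ?n + 2 * \<gamma>"
  have \<gamma>: "0 \<le> \<gamma>" "\<gamma> < 1" unfolding \<gamma>_def by linarith+
  have s: "s = real m + \<gamma>" using s_pos by (simp add: m_def \<gamma>_def)
  have b0: "0 \<le> b" using \<gamma> by (simp add: b_def)
  have vL: "v \<in> L_s \<gamma>" and reg: "\<exists>\<epsilon>>0. Ck_alpha_loc (2 * m + nat \<lfloor>2 * \<gamma>\<rfloor>) (2 * \<gamma> - of_int \<lfloor>2 * \<gamma>\<rfloor> + \<epsilon>) v"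
    and def: "\<And>x. frac_lap_defined_at \<gamma> v x" and contF: "continuous_on UNIV (neg_lap_pow m (frac_lap \<gamma> v))"
    and eqF: "\<And>x. neg_lap_pow m (frac_lap \<gamma> v) x = f x (v x)"
    using sol unfolding strong_solution_def Let_def m_def[symmetric] \<gamma>_def[symmetric] by auto
  define F where "F x = f x (v x)" for x
  have FL: "F = (neg_lap ^^ m) (frac_lap \<gamma> v)" using eqF by (simp add: F_def fun_eq_iff neg_lap_pow_def)
  have cF: "continuous_on UNIV F" using contF by (simp add: FL neg_lap_pow_def)
  have Fm: "F \<in> borel_measurable borel" using cF by (rule borel_measurable_continuous_onI)
  have F0: "0 \<le> F x" for x unfolding F_def by (rule f_nonneg[OF v_nonneg])
  have FLp: "integrable lborel (\<lambda>x. F x powr p)" using f_Lp F0 by (simp add: F_def)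
  have p1: "1 \<le> p" using p_gt by simp
  have Fw: "wint (?n + 1) F" by (rule wint_of_integrable_powr[OF Fm F0 p1 FLp])
  have v: "wint b v" unfolding b_def by (rule L_s_wint[OF vL \<gamma>(1)])
  obtain \<epsilon> where \<epsilon>: "\<epsilon> > 0" "Ck_alpha_loc (2 * m + nat \<lfloor>2 * \<gamma>\<rfloor>) (2 * \<gamma> - of_int \<lfloor>2 * \<gamma>\<rfloor> + \<epsilon>) v" using reg by blast
  have Cv: "Ck (2 * m) v" using \<epsilon>(2) unfolding Ck_alpha_loc_def by (auto intro: Ck_mono)
  have cv: "continuous_on UNIV v" using Cv by (rule Ck_continuous)
  have "\<exists>\<eta>>0. (0 < \<gamma> \<longrightarrow> holder2 (2 * \<gamma> + \<eta>) v) \<and> Ck (2 * m) (frac_lap \<gamma> v)"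
  proof (cases "\<gamma> = 0")
    case True
    then have "frac_lap \<gamma> v = v" by (simp add: frac_lap_def fun_eq_iff)
    \<comment> \<open>For \<gamma> = 0 the Hoelder claim is vacuous, and any positive \<eta> will
      do.\<close>
    then show ?thesis using True Cv by (intro exI[of _ 1]) auto
  next
    case False
    then have \<gamma>0: "0 < \<gamma>" using \<gamma> by simp
    obtain \<eta> where \<eta>: "0 < \<eta>" "\<And>is. length is \<le> 2 * m \<Longrightarrow> holder2 (2 * \<gamma> + \<eta>) (pderivs is v)"
      using Ck_alpha_holder2[OF \<epsilon>(2) \<gamma>0 \<gamma>(2) \<epsilon>(1)] by blast
    have "holder2 (2 * \<gamma> + \<eta>) v" using \<eta>(2)[of "[]"] by simp
    moreover have "Ck (2 * m) (frac_lap \<gamma> v)" by (rule Ck_frac_lap[OF v b_def \<gamma>0 \<eta>(1) def Cv \<eta>(2)])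
    ultimately show ?thesis using \<eta>(1) by blast
  qed
  then obtain \<eta> where \<eta>: "\<eta> > 0" and H: "0 < \<gamma> \<Longrightarrow> holder2 (2 * \<gamma> + \<eta>) v" and Cu: "Ck (2 * m) (frac_lap \<gamma> v)" by blast
  have n1: "0 \<le> ?n + 1" by simp
  have weyl: "hconv F 1 t x = 1 / Gamma (1 - \<gamma>) * (LINT r|lborel. indicator {0<..} r * (r powr (- \<gamma>) * hconv v (m + 2) (t + r) x))" if "t > 0" for t x
    by (rule hconv_equation_weyl[OF v b_def \<gamma> \<eta> H cv def Cu FL Fw n1 that])
  define a where "a = ?n / (2 * p)"
  \<comment> \<open>The hypothesis p < n/(2s), rearranged: it says exactly that the decay rate
    n/(2p) of the extension of \<open>F\<close> exceeds \<open>s\<close>.\<close>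
  have a: "s < a" unfolding a_def using p_lt p_gt s_pos by (simp add: field_simps)
  obtain C where C: "0 \<le> C" "\<And>t x. t > 0 \<Longrightarrow> hconv F 0 t x \<le> C * t powr (- a)"
    using hconv_powr_decay[OF Fw n1 F0 p1 FLp] unfolding a_def by blast
  have "\<exists>c. ((\<lambda>t. hconv v 0 t x) \<longlongrightarrow> c) at_top \<and>
       integrable lborel (\<lambda>y. F y / norm (x - y) powr (?n - 2 * s)) \<and>
       v x = riesz_const CARD('n) s * (LINT y|lborel. F y / norm (x - y) powr (?n - 2 * s)) + c" for x
  proof -
    obtain M where M: "0 \<le> M" "\<And>t. t > 0 \<Longrightarrow> hconv F 0 t x \<le> M"
      using hconv_powr_bounded[OF Fw n1 F0 p1 FLp cF] by blast
    obtain c where c: "((\<lambda>t. hconv v 0 t x) \<longlongrightarrow> c) at_top"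
      "integrable lborel (\<lambda>r. indicator {0<..} r * (r powr (s - 1) * hconv F 0 r x))"
      "v x = 1 / Gamma s * (LINT r|lborel. indicator {0<..} r * (r powr (s - 1) * hconv F 0 r x)) + c"
      using hconv_representation[OF v b_def \<gamma> cv Fw n1 F0 s s_pos a weyl C(1) C(2) M] by blast
    show ?thesis using c riesz_potential[OF Fw n1 F0 s_pos s_lt c(2)] by auto
  qed
  then have "\<exists>c. \<forall>x. ((\<lambda>t. hconv v 0 t x) \<longlongrightarrow> c x) at_top \<and>
       integrable lborel (\<lambda>y. F y / norm (x - y) powr (?n - 2 * s)) \<and>
       v x = riesz_const CARD('n) s * (LINT y|lborel. F y / norm (x - y) powr (?n - 2 * s)) + c x"
    by (intro choice) blast
  then obtain c where c: "\<And>x. ((\<lambda>t. hconv v 0 t x) \<longlongrightarrow> c x) at_top"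
    and int: "\<And>x. integrable lborel (\<lambda>y. F y / norm (x - y) powr (?n - 2 * s))"
    and rep: "\<And>x. v x = riesz_const CARD('n) s * (LINT y|lborel. F y / norm (x - y) powr (?n - 2 * s)) + c x"
    by blast
  have c0: "0 \<le> c x" for x
    by (rule tendsto_lowerbound[OF c]) (auto simp: hconv_nonneg v_nonneg)
  have "c x = 0" for x
    using ab
  proof
    assume "(v \<longlongrightarrow> 0) at_infinity"
    from hconv_at_top_zero[OF v b0 v_nonneg cv this, of x] show "c x = 0"
      using tendsto_unique[OF _ c[of x]] by simp
  next
    assume A: "(\<forall>x. mono_on {0<..} (f x)) \<and> (\<forall>t>0. (INF x. f x t) > 0)"
    show "c x = 0"
    proof (rule ccontr)
      assume "c x \<noteq> 0"
      then have cx: "c x > 0" using c0[of x] by simp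
      \<comment> \<open>The lower bound for \<open>c\<close> at every point that the Harnack factor
        2^(n/2) leaves. Since the potential is nonnegative, it is also a lower bound for
        \<open>v\<close>.\<close>
      define \<delta> where "\<delta> = c x / 2 powr (?n / 2)"
      have \<delta>: "\<delta> > 0" using cx by (simp add: \<delta>_def)
      define k where "k = (INF y. f y \<delta>)"
      have k: "k > 0" using A \<delta> by (simp add: k_def)
      have "k \<le> F y" for y
      proof -
        have "c x \<le> 2 powr (?n / 2) * c y" by (rule hconv_limit_harnack[OF v b0 v_nonneg c c])
        then have "\<delta> \<le> c y" by (simp add: \<delta>_def field_simps)
        also have "c y \<le> v y"
        proof -
          have "0 \<le> riesz_const CARD('n) s * (LINT z|lborel. F z / norm (y - z) powr (?n - 2 * s))"
            using s_pos s_lt F0 by (intro mult_nonneg_nonneg integral_nonneg_AE) (auto simp: riesz_const_def)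
          then show ?thesis using rep[of y] by linarith
        qed
        finally have "\<delta> \<le> v y" .
        then have "f y \<delta> \<le> f y (v y)" using A \<delta> by (auto intro: mono_onD)
        \<comment> \<open>An infimum of reals lies below the values only if these are bounded below;
          nonnegativity of \<open>f\<close> provides the bound 0.\<close>
        moreover have "k \<le> f y \<delta>" unfolding k_def
          by (rule cINF_lower) (use f_nonneg[of \<delta>] \<delta> in \<open>auto intro!: bdd_belowI[of _ 0]\<close>)
        ultimately show ?thesis by (simp add: F_def)
      qed
      then have "k powr p \<le> F y powr p" for y using k p_gt by (intro powr_mono2) auto
      then have "integrable lborel (\<lambda>y::real^'n. k powr p)"
        by (intro integrable_bound_real[OF FLp]) auto
      then show False using not_integrable_const_lborel[of "k powr p", where 'n='n] k by simp
    qed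
  qed
  then have "v x = riesz_const CARD('n) s * (LINT y|lborel. F y / norm (x - y) powr (?n - 2 * s))" for x
    using rep[of x] by (metis add.right_neutral)
  then show ?thesis using v_nonneg int unfolding F_def by blast
qed

end
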